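(* Suppose Assumption A (stated in the context) holds and write $\theta:=e^{-2\pi^2/\beta}$. For each integer $b\ge2$ there exists $\epsilon>0$ and, for all $\beta>0$ with $1<b\theta<1+\epsilon$, there exist $\eta>0$, $C>0$ and a sequence $\{\lambda_\star(q)\}_{q\in\mathbb Z}$ with $\lambda_\star(0)=1$, $\lambda_\star(q)\le\theta^{q^2}$ for $q\in\mathbb Z$ and $$0<\lambda_\star(q)=\lambda_\star(-q)\le\bigl(2b^{1/2}\sqrt{b\theta-1}\bigr)^{|q|},\quad q\in\mathbb Z,$$ for which the following is true: For all initial $\nu$ subject to Assumption B (stated in the context) there exists $k_0\ge0$ such that for all integers $n$ and $k$ with $\min\{k,n-k\}\ge k_0$ and all $q\in\mathbb Z$, $$a_k(q)\le a_k(0)\bigl(2b^{1/2}\sqrt{b\theta-1}\bigr)^{|q|}$$ and $$\Bigl|\frac{a_k(q)}{a_k(0)}-\lambda_\star(q)\Bigr|\le C^{|q|}\Bigl[e^{-\eta k}+\sum_{j=0}^ke^{-\eta(k-j)}\mathfrak d_{\min\{j,n-j\}}\Bigr]$$ hold, with $\{\mathfrak d_j\}_{j\ge0}$ denoting the sequence from Assumption A. Moreover, each $v_k$ is a $C^\infty$ function with $\{v_k'\}_{k\ge0}$ and $\{v_k''\}_{k\ge0}$ uniformly bounded and, defining $v_\star\colon\mathbb R\to\mathbb R$ by $$e^{-v_\star(z)}:=\Bigl(\sum_{\substack{q_1,\dots,q_b\in\mathbb Z \\ {q_1+\dots+q_b=0}}}\prod_{i=1}^b\lambda_\star(q_i)\Bigr)^{-\frac1{b-1}}\sum_{q\in\mathbb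 Z}\lambda_\star(q)e^{2\pi iqz},$$ we have $v_k(z)-b\,v_{k-1}(z')\to v_\star(z)-b\,v_\star(z')$ and $v_k'(z)\to v_\star'(z)$ as $\min\{k,n-k\}\to\infty$, uniformly in $z,z'\in\mathbb R$. In addition, assuming $\{\mathfrak d_k\}_{k\ge0}$ decays exponentially fast, there exist $\eta'>0$ and $C'>0$ such that $$\sup_{z,z'\in\mathbb R}\Bigl|v_{k+1}(z)-b\,v_k(z')-\bigl[v_\star(z)-b\,v_\star(z')\bigr]\Bigr|\le C'e^{-\eta'\min\{k,n-k\}}$$ for all $n>k\ge0$ and $$\sup_{z\in\mathbb R}\bigl|v_k'(z)-v_\star'(z)\bigr|\le C'e^{-\eta'\min\{k,n-k\}}$$ for all $n\ge k\ge0$.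
   Context: Let $b\ge2$ be an integer and $\beta>0$. Assumption A. $\{\mathfrak d_j\}_{j\ge0}$ is a positive sequence with $\sum_{j\ge0}\mathfrak d_j<\infty$ and, for each $n\ge1$, $\{\sigma_k^2\}_{k=0}^n$ is a strictly positive sequence (which may depend on $n$) with $|\sigma_k^2-1|\le\mathfrak d_{\min\{k,n-k\}}$ for $k=0,\dots,n$. Moreover $\inf_{n\ge k\ge0}\sigma_k^2>0$. Assumption B. $\nu$ is a $1$-periodic (positive) Radon measure on $\mathbb R$ whose Fourier coefficients $a(q):=\int_{[0,1)}e^{-2\pi iqz}\nu(dz)$, $q\in\mathbb Z$, are real-valued and strictly positive, with $a(-q)=a(q)$ for all $q$ and $\sup_{q\ge0}a(q+1)/a(q)<\infty$. Write $\mu_{s}$ for the normal law $\mathcal N(0,s)$. For each $n\ge1$ define functions $v_0,\dots,v_n\colon\mathbb R\to\mathbb R$ by $$e^{-v_0(z)}:=\int_{\mathbb R}e^{-\frac12\beta\sigma_0^{-2}(z-\zeta)^2}\nu(d\zeta),\qquad e^{-v_{k+1}(z)}:=\int_{\mathbb R}e^{-b\,v_k(z+\zeta)}\mu_{\sigma_{k+1}^2/\beta}(d\zeta),\quad k=0,\dots,n-1.$$ These are $1$-periodic. Set $a_k(q):=\int_0^1e^{-v_k(z)-2\pi iqz}\,dz$ for $q\in\mathbb Z$, $k=0,\dots,n$. The dependence of $\sigma_k^2,v_k,a_k$ on $n$ is suppressed; the constants $\eta,C,\eta',C'$ and the bounds on $v_k',v_k''$ do not depend on $n$ or $k$. *)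

theory Defs
  imports "HOL-Probability.Probability"
begin

text \<open>The entry \<open>sigma2 n k\<close> is the variance $\sigma_k^2$ at level \<open>n\<close>; only \<open>1 \<le> n\<close>, \<open>k \<le> n\<close> matter.\<close>

definition assumption_A :: "(nat \<Rightarrow> real) \<Rightarrow> (nat \<Rightarrow> nat \<Rightarrow> real) \<Rightarrow> bool" where
  "assumption_A d sigma2 \<longleftrightarrow>
     (\<forall>j. 0 < d j) \<and> summable d \<and>
     (\<forall>n\<ge>1. \<forall>k\<le>n. 0 < sigma2 n k \<and> \<bar>sigma2 n k - 1\<bar> \<le> d (min k (n - k))) \<and>
     0 < (INF (n, k) \<in> {(n, k). 1 \<le> n \<and> k \<le> n}. sigma2 n k)"

definition radon_measure :: "real measure \<Rightarrow> bool" where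
  "radon_measure \<nu> \<longleftrightarrow>
     sets \<nu> = sets borel \<and>
     (\<forall>K. compact K \<longrightarrow> emeasure \<nu> K < \<infinity>) \<and>
     (\<forall>A\<in>sets borel. emeasure \<nu> A = (SUP K \<in> {K. compact K \<and> K \<subseteq> A}. emeasure \<nu> K))"

definition one_periodic_measure :: "real measure \<Rightarrow> bool" where
  "one_periodic_measure \<nu> \<longleftrightarrow> distr \<nu> borel (\<lambda>x. x + 1) = \<nu>"

definition measure_fourier_coeff :: "real measure \<Rightarrow> int \<Rightarrow> complex" where
  "measure_fourier_coeff \<nu> q =
     (LINT z:{0..<1}|\<nu>. exp (- (2 * of_real pi * \<i> * of_int q * of_real z)))"

definition assumption_B :: "real measure \<Rightarrow> bool" where
  "assumption_B \<nu> \<longleftrightarrow>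
     radon_measure \<nu> \<and> one_periodic_measure \<nu> \<and>
     (\<forall>q. measure_fourier_coeff \<nu> q \<in> \<real> \<and> 0 < Re (measure_fourier_coeff \<nu> q)) \<and>
     (\<forall>q. measure_fourier_coeff \<nu> (- q) = measure_fourier_coeff \<nu> q) \<and>
     bdd_above ((\<lambda>q. Re (measure_fourier_coeff \<nu> (q + 1)) / Re (measure_fourier_coeff \<nu> q)) ` {0..})"

definition centered_normal :: "real \<Rightarrow> real measure" where
  "centered_normal s = density lborel (\<lambda>x. ennreal (normal_density 0 (sqrt s) x))"

text \<open>The argument \<open>s\<close> is the variance sequence $(\sigma_k^2)_k$ of one fixed level $n$. The defining
  relations prescribe $e^{-v_k}$; under the two assumptions above the integrals are finite and
  strictly positive, so taking \<open>- ln\<close> is the same thing.\<close>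

primrec potential :: "nat \<Rightarrow> real \<Rightarrow> real measure \<Rightarrow> (nat \<Rightarrow> real) \<Rightarrow> nat \<Rightarrow> real \<Rightarrow> real" where
  "potential b \<beta> \<nu> s 0 =
     (\<lambda>z. - ln (LINT \<zeta>|\<nu>. exp (- (1/2 * \<beta> * inverse (s 0) * (z - \<zeta>)\<^sup>2))))"
| "potential b \<beta> \<nu> s (Suc k) =
     (\<lambda>z. - ln (LINT \<zeta>|centered_normal (s (Suc k) / \<beta>). exp (- (real b * potential b \<beta> \<nu> s k (z + \<zeta>)))))"

definition activity :: "(real \<Rightarrow> real) \<Rightarrow> int \<Rightarrow> complex" where
  "activity v q =
     (LINT z:{0..1}|lborel. exp (of_real (- v z) - 2 * of_real pi * \<i> * of_int q * of_real z))"

definition smooth_real :: "(real \<Rightarrow> real) \<Rightarrow> bool" where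
  "smooth_real f \<longleftrightarrow> (\<forall>m x. (deriv ^^ m) f differentiable (at x))"

definition theta :: "real \<Rightarrow> real" where
  "theta \<beta> = exp (- (2 * pi\<^sup>2 / \<beta>))"

definition zero_sum_tuples :: "nat \<Rightarrow> (nat \<Rightarrow> int) set" where
  "zero_sum_tuples b = {q \<in> {1..b} \<rightarrow>\<^sub>E UNIV. (\<Sum>i=1..b. q i) = 0}"

text \<open>At most one \<open>v\<close> satisfies this, and the equation itself forces the sum on the right to be real and
  strictly positive (a divergent \<open>infsum\<close> would be \<open>0\<close>, which the left-hand side excludes).\<close>

definition is_limit_potential :: "nat \<Rightarrow> (int \<Rightarrow> real) \<Rightarrow> (real \<Rightarrow> real) \<Rightarrow> bool" where
  "is_limit_potential b lam v \<longleftrightarrow>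
     (\<forall>z. complex_of_real (exp (- v z)) =
        complex_of_real ((\<Sum>\<^sub>\<infinity>q\<in>zero_sum_tuples b. \<Prod>i=1..b. lam (q i)) powr (- (1 / (real b - 1)))) *
        (\<Sum>\<^sub>\<infinity>q. complex_of_real (lam q) * exp (2 * of_real pi * \<i> * of_int q * of_real z)))"

definition decays_exponentially :: "(nat \<Rightarrow> real) \<Rightarrow> bool" where
  "decays_exponentially d \<longleftrightarrow> (\<exists>c>0. \<exists>K. \<forall>j. \<bar>d j\<bar> \<le> K * exp (- (c * real j)))"

end

(* The normalized coefficients lambda_k(q) = a_k(q) / a_k(0) evolve by
   lambda_{k+1}(q) = theta_k^(q^2) S_q / S_0, where S_q is the b-fold convolution power of lambda_k at q
   and theta_k = exp (- 2 pi^2 sigma_{k+1}^2 / beta). Ratio bounds lambda(q+1) <= c lambda(q) for q >= 0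
   are propagated with c replaced by at most b theta_k c, and since nonzero zero-sum tuples have negative
   entries, the bound on lambda(1) improves by a definite factor as long as lambda(1) is large compared
   with sqrt (b theta - 1). As S_0 = 1 + b (b-1) lambda(1)^2 + ..., small lambda(1) grows. Hence every
   orbit enters a region where lambda(1) is comparable to sqrt (b theta - 1) and lambda(2) is controlled
   by lambda(1)^2. On that region the expansion of the map to third order shows that it contracts a
   weighted l^1 distance by a factor 1 - (b theta - 1) / 5, which yields the fixed point lambda_star;
   fluctuating variances add a summable perturbation. Gaussian decay of the coefficients turns closeness
   of coefficients into closeness of generating functions and of their derivatives, and writing
   exp (- v_k) as a convolution with a periodized Gaussian keeps it away from 0 uniformly. *)

theory Submission
  imports Defs
begin

text \<open>The obstacle is that the trivial fixed point is almost marginal: near it the map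
  multiplies lambda(1) by b \<theta> = 1 + \<delta>, and the nonlinear terms change this slope by an
  amount of the same order \<delta>. In the direction of lambda(1) the margin for a contraction is
  therefore only of order \<delta>, and it becomes visible only once the leading terms are known
  with their exact constants. As \<delta> is of order X^2, with X the scale of lambda(1), the errors
  at q = 1 must be of order X^3; this is why the cubic term and the interaction of lambda(1) with
  lambda(2) are kept there, while errors of order X^2 suffice for q \<ge> 2, where the Gaussian
  factor already contracts. The scale itself comes from balancing b \<theta> - 1 against S_0 - 1.

  Coefficients do not show that exp (- v_k) is positive, yet positivity is needed both to bound
  lambda(q) by a Gaussian and to take logarithms. Hence functions and coefficients are carried in
  parallel, linked by uniqueness of Fourier coefficients and Poisson summation.\<close>

section \<open>Convolution powers of nonnegative symmetric summable sequences\<close>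

definition nnsym :: "(int \<Rightarrow> real) \<Rightarrow> bool" where
  "nnsym f \<longleftrightarrow> (\<forall>q. 0 \<le> f q) \<and> f summable_on UNIV \<and> (\<forall>q. f (- q) = f q)"

definition conv :: "(int \<Rightarrow> real) \<Rightarrow> (int \<Rightarrow> real) \<Rightarrow> int \<Rightarrow> real" where
  "conv f g q = (\<Sum>\<^sub>\<infinity>i. f i * g (q - i))"

primrec cpow :: "(int \<Rightarrow> real) \<Rightarrow> nat \<Rightarrow> int \<Rightarrow> real" where
  "cpow f 0 = (\<lambda>q. if q = 0 then 1 else 0)"
| "cpow f (Suc j) = conv f (cpow f j)"

definition cexpo :: "int \<Rightarrow> real \<Rightarrow> complex" where
  "cexpo q z = cis (2 * pi * of_int q * z)"

text \<open>Two forms of one generating function: the complex form turns convolution into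
  multiplication by the character identity, the real form \<open>rser\<close> is what equals exp (-
  v). Symmetry of the coefficients makes them agree (\<open>cser_eq_rser\<close>).\<close>

definition cser :: "(int \<Rightarrow> real) \<Rightarrow> real \<Rightarrow> complex" where
  "cser f z = (\<Sum>\<^sub>\<infinity>q. of_real (f q) * cexpo q z)"

definition rser :: "(int \<Rightarrow> real) \<Rightarrow> real \<Rightarrow> real" where
  "rser f z = (\<Sum>\<^sub>\<infinity>q. f q * cos (2 * pi * of_int q * z))"

lemma nnsymD: assumes "nnsym f" shows "0 \<le> f q" "f summable_on A" "f (- q) = f q"
  using assms summable_on_subset_banach[of f UNIV A] by (auto simp: nnsym_def)

lemma summable_on_Times:
  fixes f :: "'a \<Rightarrow> real" and g :: "'b \<Rightarrow> real"
  assumes "f summable_on A" "g summable_on B" "\<And>x. 0 \<le> f x" "\<And>x. 0 \<le> g x"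
  shows "(\<lambda>(x, y). f x * g y) summable_on A \<times> B"
proof (rule summable_on_SigmaI)
  show "((\<lambda>y. case (x, y) of (x, y) \<Rightarrow> f x * g y) has_sum f x * infsum g B) B" for x
    using assms by (auto intro!: has_sum_cmult_right)
  show "(\<lambda>x. f x * infsum g B) summable_on A"
    using assms(1) by (rule summable_on_cmult_left)
qed (use assms in auto)

lemma conv_summable_pair:
  assumes "nnsym f" "nnsym g"
  shows "(\<lambda>(i, q). f i * g (q - i)) summable_on UNIV"
proof -
  have "(\<lambda>(i, j). f i * g j) summable_on UNIV \<times> UNIV"
    using assms by (intro summable_on_Times) (auto simp: nnsym_def)
  also have "?this \<longleftrightarrow> (\<lambda>(i, q). f i * g (q - i)) summable_on UNIV \<times> UNIV"
    by (rule summable_on_reindex_bij_witness[of _ "\<lambda>(i,q). (i, q - i)" "\<lambda>(i,j). (i, i + j)"]) auto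
  finally show ?thesis by simp
qed

lemma conv_summable_pair':
  assumes "nnsym f" "nnsym g"
  shows "(\<lambda>(q, i). f i * g (q - i)) summable_on UNIV \<times> UNIV"
proof -
  have "(\<lambda>(i, q). f i * g (q - i)) summable_on UNIV \<times> UNIV"
    using conv_summable_pair[OF assms] by simp
  from this[THEN summable_on_swap[THEN iffD1]] show ?thesis by simp
qed

lemma conv_summand_summable:
  assumes "nnsym f" "nnsym g" shows "(\<lambda>i. f i * g (q - i)) summable_on A"
proof -
  have "(\<lambda>i. f i * g (q - i)) summable_on UNIV"
    by (rule summable_on_SigmaD1[OF conv_summable_pair'[OF assms]]) simp
  then show ?thesis using summable_on_subset_banach by blast
qed

lemma nnsym_conv: assumes "nnsym f" "nnsym g" shows "nnsym (conv f g)"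
proof -
  have "conv f g summable_on UNIV"
    unfolding conv_def by (rule summable_on_Sigma_banach[OF conv_summable_pair'[OF assms]])
  moreover have "conv f g (- q) = conv f g q" for q
    unfolding conv_def
  proof (rule infsum_reindex_bij_witness[of _ uminus uminus])
    fix a show "f (- a) * g (q - - a) = f a * g (- q - a)"
      using nnsymD(3)[OF assms(1), of a] nnsymD(3)[OF assms(2), of "- q - a"] by (simp add: add.commute)
  qed auto
  ultimately show ?thesis
    using assms by (auto simp: nnsym_def conv_def intro!: infsum_nonneg)
qed

lemma nnsym_finite_supp:
  "nnsym (\<lambda>q. if q = 0 then 1 else 0)"
  unfolding nnsym_def
  by (auto intro!: finite_nonzero_values_imp_summable_on)

lemma nnsym_cpow: "nnsym f \<Longrightarrow> nnsym (cpow f j)"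
  by (induction j) (auto simp: nnsym_finite_supp nnsym_conv)

lemma cexpo_add: "cexpo (p + q) z = cexpo p z * cexpo q z"
  by (simp add: cexpo_def cis_mult algebra_simps)

lemma norm_cexpo [simp]: "cmod (cexpo q z) = 1"
  by (simp add: cexpo_def)

lemma cser_summable:
  assumes "nnsym f" shows "(\<lambda>q. complex_of_real (f q) * cexpo q z) summable_on A"
proof (rule abs_summable_summable)
  show "(\<lambda>q. norm (complex_of_real (f q) * cexpo q z)) summable_on A"
    using nnsymD[OF assms] by (simp add: norm_mult)
qed

text \<open>Characters have modulus one, so the nonnegative summable array f i * g (q - i) dominates
  the double series and allows the two sums to be exchanged.\<close>

lemma cser_conv:
  assumes "nnsym f" "nnsym g"
  shows "cser (conv f g) z = cser f z * cser g z"
proof -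
  define h where "h = (\<lambda>i q. complex_of_real (f i * g (q - i)) * cexpo q z)"
  have sumpair: "(\<lambda>(i, q). h i q) summable_on UNIV \<times> UNIV"
  proof (rule abs_summable_summable)
    have "(\<lambda>x. norm (case x of (i, q) \<Rightarrow> h i q)) = (\<lambda>(i, q). f i * g (q - i))"
      using nnsymD(1)[OF assms(1)] nnsymD(1)[OF assms(2)]
      by (auto simp: h_def norm_mult fun_eq_iff)
    then show "(\<lambda>x. norm (case x of (i, q) \<Rightarrow> h i q)) summable_on UNIV \<times> UNIV"
      using conv_summable_pair[OF assms] by simp
  qed
  have "cser f z * cser g z = (\<Sum>\<^sub>\<infinity>i. complex_of_real (f i) * cexpo i z * cser g z)"
    unfolding cser_def by (subst infsum_cmult_left') simp
  also have "\<dots> = (\<Sum>\<^sub>\<infinity>i. \<Sum>\<^sub>\<infinity>q. h i q)"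
  proof (rule infsum_cong)
    fix i
    have "complex_of_real (f i) * cexpo i z * cser g z
        = (\<Sum>\<^sub>\<infinity>j. complex_of_real (f i) * cexpo i z * (complex_of_real (g j) * cexpo j z))"
      unfolding cser_def by (subst infsum_cmult_right') simp
    also have "\<dots> = (\<Sum>\<^sub>\<infinity>q. h i q)"
      by (rule infsum_reindex_bij_witness[of _ "\<lambda>q. q - i" "\<lambda>j. i + j"])
        (auto simp: h_def cexpo_add)
    finally show "complex_of_real (f i) * cexpo i z * cser g z = (\<Sum>\<^sub>\<infinity>q. h i q)" .
  qed
  also have "\<dots> = (\<Sum>\<^sub>\<infinity>q. \<Sum>\<^sub>\<infinity>i. h i q)"
    using sumpair by (intro infsum_swap_banach) simp
  also have "\<dots> = (\<Sum>\<^sub>\<infinity>q. complex_of_real (conv f g q) * cexpo q z)"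
  proof (rule infsum_cong)
    fix q
    have "(\<Sum>\<^sub>\<infinity>i. h i q) = (\<Sum>\<^sub>\<infinity>i. complex_of_real (f i * g (q - i))) * cexpo q z"
      unfolding h_def by (rule infsum_cmult_left')
    also have "(\<Sum>\<^sub>\<infinity>i. complex_of_real (f i * g (q - i))) = complex_of_real (conv f g q)"
      unfolding conv_def
      by (intro infsumI has_sum_of_real has_sum_infsum conv_summand_summable assms)
    finally show "(\<Sum>\<^sub>\<infinity>i. h i q) = complex_of_real (conv f g q) * cexpo q z" .
  qed
  finally show ?thesis unfolding cser_def by simp
qed

lemma infsum_single:
  fixes f :: "'a \<Rightarrow> 'b::{topological_comm_monoid_add, t2_space}"
  assumes "\<And>y. y \<noteq> x \<Longrightarrow> f y = 0" shows "infsum f UNIV = f x"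
proof -
  have "infsum f UNIV = infsum f {x}" by (rule infsum_cong_neutral) (use assms in auto)
  then show ?thesis by simp
qed

lemma cser_cpow: "nnsym f \<Longrightarrow> cser (cpow f j) z = cser f z ^ j"
proof (induction j)
  case 0
  have "cser (cpow f 0) z = of_real (cpow f 0 0) * cexpo 0 z"
    unfolding cser_def by (rule infsum_single) auto
  then show ?case by (simp add: cexpo_def)
qed (simp add: cser_conv nnsym_cpow)

lemma cser_eq_rser: assumes "nnsym f" shows "cser f z = of_real (rser f z)"
proof -
  have s: "(\<lambda>q. complex_of_real (f q) * cexpo q z) summable_on UNIV" by (rule cser_summable[OF assms])
  have "Re (cser f z) = rser f z"
    unfolding cser_def rser_def
    by (subst infsum_Re[OF s, symmetric]) (auto simp: cexpo_def intro!: infsum_cong)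
  moreover have "Im (cser f z) = (\<Sum>\<^sub>\<infinity>q. f q * sin (2 * pi * of_int q * z))"
    unfolding cser_def
    by (subst infsum_Im[OF s, symmetric]) (auto simp: cexpo_def intro!: infsum_cong)
  moreover have "(\<Sum>\<^sub>\<infinity>q. f q * sin (2 * pi * of_int q * z)) = (\<Sum>\<^sub>\<infinity>q. - (f q * sin (2 * pi * of_int q * z)))"
    by (rule infsum_reindex_bij_witness[of _ uminus uminus]) (use assms in \<open>auto simp: nnsym_def\<close>)
  moreover have "\<dots> = - (\<Sum>\<^sub>\<infinity>q. f q * sin (2 * pi * of_int q * z))"
    by (rule infsum_uminus)
  ultimately have "Re (cser f z) = rser f z" "Im (cser f z) = 0" by linarith+
  then show ?thesis by (simp add: complex_eq_iff)
qed

lemma rser_cpow: assumes "nnsym f" shows "rser (cpow f j) z = rser f z ^ j"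
proof -
  have "complex_of_real (rser (cpow f j) z) = complex_of_real (rser f z ^ j)"
    using cser_cpow[OF assms] cser_eq_rser[OF assms] cser_eq_rser[OF nnsym_cpow[OF assms]] by simp
  then show ?thesis using of_real_eq_iff by blast
qed

lemma rser_summable:
  assumes "nnsym f" shows "(\<lambda>q. f q * cos (2 * pi * of_int q * z)) summable_on A"
proof (rule abs_summable_summable, rule Infinite_Sum.abs_summable_on_comparison_test'[of f])
  show "f summable_on A" by (rule nnsymD(2)[OF assms])
  show "norm (f q * cos (2 * pi * of_int q * z)) \<le> f q" for q
    using nnsymD(1)[OF assms, of q] by (simp add: abs_mult mult_left_le)
qed

lemma conv_cong_mono:
  assumes "nnsym f" "nnsym g" "finite A"
  shows "(\<Sum>i\<in>A. f i * g (q - i)) \<le> conv f g q"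
  unfolding conv_def using assms
  by (intro finite_sum_le_infsum) (auto intro: conv_summand_summable simp: nnsym_def)

lemma conv_split:
  assumes "nnsym f" "nnsym g"
  shows "conv f g q = (\<Sum>\<^sub>\<infinity>i\<in>{1..}. f i * g (q - i)) + f 0 * g q + (\<Sum>\<^sub>\<infinity>i\<in>{..-1}. f i * g (q - i))"
proof -
  have U: "(UNIV::int set) = ({1..} \<union> {0}) \<union> {..-1}" by auto
  show ?thesis unfolding conv_def
    by (subst U, subst infsum_Un_disjoint, (auto intro!: conv_summand_summable assms)[3],
      subst infsum_Un_disjoint) (auto intro!: conv_summand_summable assms)
qed

subsection \<open>Ratio bounds\<close>

lemma infsum_shift_ge1:
  fixes F :: "int \<Rightarrow> real"
  shows "(\<Sum>\<^sub>\<infinity>i\<in>{1..}. F (i - 1)) = (\<Sum>\<^sub>\<infinity>i\<in>{0..}. F i)"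
  by (rule infsum_reindex_bij_witness[of _ "\<lambda>i. i + 1" "\<lambda>i. i - 1"]) auto

text \<open>For i \<ge> 1 the extra unit is removed from the entry i itself: f i \<le> c f (i - 1)
  and q + 1 - i = q - (i - 1), so the sum shifts to the one starting at 0.\<close>

lemma conv_ratio_pos_part:
  assumes f: "nnsym f" and g: "nnsym g" and c: "\<And>q. 0 \<le> q \<Longrightarrow> f (q + 1) \<le> c * f q"
  shows "(\<Sum>\<^sub>\<infinity>i\<in>{1..}. f i * g (q + 1 - i)) \<le> c * (\<Sum>\<^sub>\<infinity>i\<in>{0..}. f i * g (q - i))"
proof -
  have s: "(\<lambda>i. f (i - 1) * g (q - (i - 1))) summable_on {1..}"
    using conv_summand_summable[OF f g, of q "{0..}"]
    by (subst summable_on_reindex_bij_witness[of "{1..}" "\<lambda>i. i + 1" "\<lambda>i. i - 1" "{0..}" "\<lambda>i. f i * g (q - i)"]) auto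
  have "(\<Sum>\<^sub>\<infinity>i\<in>{1..}. f i * g (q + 1 - i)) \<le> (\<Sum>\<^sub>\<infinity>i\<in>{1..}. c * (f (i - 1) * g (q - (i - 1))))"
  proof (rule infsum_mono)
    fix i :: int assume "i \<in> {1..}"
    then have "f i \<le> c * f (i - 1)" using c[of "i - 1"] by simp
    moreover have "0 \<le> g (q + 1 - i)" using nnsymD(1)[OF g] .
    moreover have "q - (i - 1) = q + 1 - i" by simp
    ultimately show "f i * g (q + 1 - i) \<le> c * (f (i - 1) * g (q - (i - 1)))"
      by (metis mult.assoc mult_right_mono)
  qed (auto intro!: conv_summand_summable f g summable_on_cmult_right s)
  also have "\<dots> = c * (\<Sum>\<^sub>\<infinity>i\<in>{1..}. f (i - 1) * g (q - (i - 1)))"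
    by (rule infsum_cmult_right')
  also have "(\<Sum>\<^sub>\<infinity>i\<in>{1..}. f (i - 1) * g (q - (i - 1))) = (\<Sum>\<^sub>\<infinity>i\<in>{0..}. f i * g (q - i))"
    by (rule infsum_shift_ge1[of "\<lambda>i. f i * g (q - i)"])
  finally show ?thesis .
qed

lemma conv_split0:
  assumes "nnsym f" "nnsym g"
  shows "(\<Sum>\<^sub>\<infinity>i\<in>{0..}. f i * g (q - i)) = f 0 * g q + (\<Sum>\<^sub>\<infinity>i\<in>{1..}. f i * g (q - i))"
proof -
  have U: "{0..} = {0} \<union> {1::int..}" by auto
  show ?thesis
    by (subst U, subst infsum_Un_disjoint) (auto intro!: conv_summand_summable assms)
qed

text \<open>If the first entry is positive, lowering it costs a factor c. If it is negative or zero,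
  the remaining entries have sum at least q and the induction hypothesis costs j c. Only the entry 0
  is charged for both, which gives the factor j + 1.\<close>

lemma cpow_ratio:
  assumes f: "nnsym f" and c: "\<And>q. 0 \<le> q \<Longrightarrow> f (q + 1) \<le> c * f q" and q: "0 \<le> q" and c0: "0 \<le> c"
  shows "cpow f j (q + 1) \<le> real j * c * cpow f j q"
  using q
proof (induction j arbitrary: q)
  case (Suc j)
  note g = nnsym_cpow[OF f, of j]
  let ?g = "cpow f j"
  have "(\<Sum>\<^sub>\<infinity>i\<in>{..-1}. f i * ?g (q + 1 - i)) \<le> (\<Sum>\<^sub>\<infinity>i\<in>{..-1}. real j * c * (f i * ?g (q - i)))"
  proof (rule infsum_mono)
    fix i :: int assume "i \<in> {..-1}"
    then have "?g (q + 1 - i) \<le> real j * c * ?g (q - i)" using Suc.IH[of "q - i"] Suc.prems by (simp add: algebra_simps)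
    then show "f i * ?g (q + 1 - i) \<le> real j * c * (f i * ?g (q - i))"
      using mult_left_mono[OF _ nnsymD(1)[OF f], of _ _ i] by (metis mult.left_commute)
  qed (auto intro!: conv_summand_summable f g summable_on_cmult_right)
  then have neg: "(\<Sum>\<^sub>\<infinity>i\<in>{..-1}. f i * ?g (q + 1 - i)) \<le> real j * c * (\<Sum>\<^sub>\<infinity>i\<in>{..-1}. f i * ?g (q - i))"
    by (simp add: infsum_cmult_right')
  have mid: "f 0 * ?g (q + 1) \<le> real j * c * (f 0 * ?g q)"
    using mult_left_mono[OF Suc.IH[OF Suc.prems] nnsymD(1)[OF f]] by (metis mult.left_commute)
  have pos: "(\<Sum>\<^sub>\<infinity>i\<in>{1..}. f i * ?g (q + 1 - i)) \<le> c * (f 0 * ?g q + (\<Sum>\<^sub>\<infinity>i\<in>{1..}. f i * ?g (q - i)))"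
    using conv_ratio_pos_part[OF f g c] by (simp add: conv_split0[OF f g])
  have nn: "0 \<le> (\<Sum>\<^sub>\<infinity>i\<in>{..-1}. f i * ?g (q - i))" "0 \<le> (\<Sum>\<^sub>\<infinity>i\<in>{1..}. f i * ?g (q - i))"
    using nnsymD(1)[OF f] nnsymD(1)[OF g] by (auto intro!: infsum_nonneg)
  have "cpow f (Suc j) (q + 1) \<le> c * (f 0 * ?g q + (\<Sum>\<^sub>\<infinity>i\<in>{1..}. f i * ?g (q - i)))
      + real j * c * (f 0 * ?g q) + real j * c * (\<Sum>\<^sub>\<infinity>i\<in>{..-1}. f i * ?g (q - i))"
    using pos mid neg by (simp add: conv_split[OF f g])
  also have "\<dots> \<le> real (Suc j) * c * conv f ?g q"
    using nn c0 by (simp add: conv_split[OF f g] algebra_simps mult_nonneg_nonneg)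
  finally show ?case by simp
qed simp

text \<open>The gain over \<open>cpow_ratio\<close>: every nonzero zero-sum tuple has a negative entry, which cannot be
  the one that is raised by one.\<close>

lemma cpow_ratio_zero:
  assumes f: "nnsym f" and c: "\<And>q. 0 \<le> q \<Longrightarrow> f (q + 1) \<le> c * f q" and c0: "0 \<le> c" and f0: "f 0 = 1"
  shows "cpow f (Suc j) 1 \<le> c * (real j * cpow f (Suc j) 0 + 1)"
proof (induction j)
  case 0
  have "conv f (cpow f 0) q = f q" for q
    unfolding conv_def by (subst infsum_single[of q]) auto
  then show ?case using c[of 0] f0 by (simp add: mult.commute)
next
  case (Suc j)
  define g where "g = cpow f (Suc j)"
  have g: "nnsym g" unfolding g_def by (rule nnsym_cpow[OF f])
  have "(\<Sum>\<^sub>\<infinity>i\<in>{..-1}. f i * g (0 + 1 - i)) \<le> (\<Sum>\<^sub>\<infinity>i\<in>{..-1}. real (Suc j) * c * (f i * g (0 - i)))"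
  proof (rule infsum_mono)
    fix i :: int assume "i \<in> {..-1}"
    then have "g (0 - i + 1) \<le> real (Suc j) * c * g (0 - i)" unfolding g_def
      by (intro cpow_ratio[OF f c _ c0]) auto
    then have "g (0 + 1 - i) \<le> real (Suc j) * c * g (0 - i)" by (simp add: algebra_simps)
    then show "f i * g (0 + 1 - i) \<le> real (Suc j) * c * (f i * g (0 - i))"
      using mult_left_mono[OF _ nnsymD(1)[OF f], of _ _ i] by (metis mult.left_commute)
  qed (intro conv_summand_summable f g summable_on_cmult_right)+
  then have neg: "(\<Sum>\<^sub>\<infinity>i\<in>{..-1}. f i * g (0 + 1 - i)) \<le> real (Suc j) * c * (\<Sum>\<^sub>\<infinity>i\<in>{..-1}. f i * g (0 - i))"
    by (simp add: infsum_cmult_right')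
  have pos: "(\<Sum>\<^sub>\<infinity>i\<in>{1..}. f i * g (0 + 1 - i)) \<le> c * (f 0 * g 0 + (\<Sum>\<^sub>\<infinity>i\<in>{1..}. f i * g (0 - i)))"
    using conv_ratio_pos_part[OF f g c] by (simp only: conv_split0[OF f g])
  define N where "N = (\<Sum>\<^sub>\<infinity>i\<in>{..-1}. f i * g (0 - i))"
  have sym: "(\<Sum>\<^sub>\<infinity>i\<in>{1..}. f i * g (0 - i)) = N" unfolding N_def
    by (rule infsum_reindex_bij_witness[of _ uminus uminus]) (use nnsymD(3)[OF f] nnsymD(3)[OF g] in auto)
  have N0: "0 \<le> N"
    unfolding N_def using nnsymD(1)[OF f] nnsymD(1)[OF g] by (auto intro!: infsum_nonneg)
  have IH: "g 1 \<le> c * (real j * g 0 + 1)" using Suc.IH by (simp add: g_def)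
  have "conv f g 1 \<le> c * (g 0 + N) + c * (real j * g 0 + 1) + real (Suc j) * c * N"
    using conv_split[OF f g, of "0 + 1"] pos neg IH unfolding N_def[symmetric] sym f0 by simp
  also have "\<dots> \<le> c * (real (Suc j) * conv f g 0 + 1)"
  proof -
    \<comment> \<open>At 0 the positive and the negative part coincide, so N is counted twice here.
      The left-hand side contains only (j + 2) N against (2 j + 2) N on the right; the surplus is j
      N.\<close>
    have "conv f g 0 = 2 * N + g 0" using conv_split[OF f g, of 0] f0 unfolding N_def[symmetric] sym by simp
    moreover have "0 \<le> c * real j * N" using c0 N0 by simp
    ultimately show ?thesis by (simp add: algebra_simps)
  qed
  finally show ?case by (simp add: g_def)
qed

lemma cpow_mono_Suc: assumes "nnsym f" "f 0 = 1" shows "cpow f j (q::int) \<le> cpow f (Suc j) q"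
  using conv_cong_mono[OF assms(1) nnsym_cpow[OF assms(1)], of "{0}" j q] assms(2) by simp

lemma cpow_zero_ge_one: assumes "nnsym f" "f 0 = 1" shows "1 \<le> cpow f j 0"
  by (induction j) (use cpow_mono_Suc[OF assms] in \<open>auto intro: order_trans\<close>)

lemma cpow_ge_linear: assumes f: "nnsym f" and f0: "f 0 = 1" and q: "q \<noteq> 0" shows "real j * f q \<le> cpow f j q"
proof (induction j)
  case (Suc j)
  have "f 0 * cpow f j q + f q * cpow f j 0 \<le> cpow f (Suc j) q"
    using conv_cong_mono[OF f nnsym_cpow[OF f], of "{0, q}" j q] q by simp
  moreover have "f q \<le> f q * cpow f j 0" using cpow_zero_ge_one[OF f f0] nnsymD(1)[OF f]
    by (metis mult_left_mono mult.right_neutral)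
  ultimately show ?case using Suc f0 by (simp add: algebra_simps)
qed (use nnsymD(1)[OF nnsym_cpow[OF f]] in auto)

text \<open>The quadratic term counts the tuples with one entry 1, one entry -1 and zeros
  elsewhere.\<close>

lemma cpow_zero_ge: assumes f: "nnsym f" and f0: "f 0 = 1"
  shows "1 + real j * (real j - 1) * (f 1)\<^sup>2 \<le> cpow f j 0"
proof (induction j)
  case (Suc j)
  let ?g = "cpow f j"
  have "f 0 * ?g 0 + f 1 * ?g (-1) + f (-1) * ?g 1 \<le> cpow f (Suc j) 0"
    using conv_cong_mono[OF f nnsym_cpow[OF f], of "{0, 1, -1}" j 0] by simp
  moreover have "?g (-1) = ?g 1" "f (-1) = f 1" using nnsymD(3)[OF f] nnsymD(3)[OF nnsym_cpow[OF f]] by auto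
  moreover have "f 1 * (real j * f 1) \<le> f 1 * ?g 1"
    by (intro mult_left_mono cpow_ge_linear f f0 nnsymD(1)[OF f]) auto
  ultimately show ?case using Suc f0 by (simp add: algebra_simps power2_eq_square)
qed simp

text \<open>Serves to pass strict positivity of a fixed point from q - 1 to q.\<close>

lemma cpow_two_ge: assumes f: "nnsym f" and f0: "f 0 = 1" and j: "2 \<le> j"
  shows "f 1 * f (q - 1) \<le> cpow f j q"
proof -
  have c1: "cpow f 1 q = f q" for q
    unfolding One_nat_def cpow.simps conv_def by (subst infsum_single[of q]) auto
  have "f 1 * f (q - 1) \<le> cpow f 2 q"
    using conv_cong_mono[OF f nnsym_cpow[OF f], of "{1}" 1 q] unfolding c1 by (simp add: numeral_2_eq_2 flip: c1)
  also have "\<dots> \<le> cpow f j q"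
    using j by (induction rule: dec_induct) (use cpow_mono_Suc[OF f f0] in \<open>auto intro: order_trans\<close>)
  finally show ?thesis .
qed

section \<open>Exchange of sums over the integers with integrals, limits and derivatives\<close>

text \<open>Enumerating the integers by \<open>int_decode\<close> makes the theorems on absolutely
  convergent series over \<open>nat\<close> applicable.\<close>

lemma infsum_int_eq_suminf:
  fixes f :: "int \<Rightarrow> 'b::banach"
  assumes "(\<lambda>q. norm (f q)) summable_on UNIV"
  shows "infsum f UNIV = (\<Sum>n. f (int_decode n))" "summable (\<lambda>n. norm (f (int_decode n)))"
proof -
  have "(\<lambda>n. norm (f (int_decode n))) summable_on UNIV"
    using summable_on_reindex_bij_betw[OF bij_int_decode, of "\<lambda>q. norm (f q)"] assms by simp
  then show s: "summable (\<lambda>n. norm (f (int_decode n)))"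
    by (rule summable_on_imp_summable)
  have "infsum f UNIV = (\<Sum>\<^sub>\<infinity>n. f (int_decode n))"
    using infsum_reindex_bij_betw[OF bij_int_decode, of f] by simp
  also have "\<dots> = (\<Sum>n. f (int_decode n))"
    using norm_summable_imp_has_sum[OF s summable_sums[OF summable_norm_cancel[OF s]]] infsumI by blast
  finally show "infsum f UNIV = (\<Sum>n. f (int_decode n))" .
qed

lemma summable_on_norm_bound:
  assumes "B summable_on A" "\<And>q. q \<in> A \<Longrightarrow> norm (f q :: 'b::banach) \<le> B q"
  shows "(\<lambda>q. norm (f q)) summable_on A" "f summable_on A"
proof -
  show "(\<lambda>q. norm (f q)) summable_on A"
    using assms by (rule Infinite_Sum.abs_summable_on_comparison_test')
  then show "f summable_on A" by (rule abs_summable_summable)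
qed

lemma integral_infsum_int:
  fixes g :: "int \<Rightarrow> 'a \<Rightarrow> 'b::{banach, second_countable_topology}"
  assumes M: "finite_measure M" and meas: "\<And>q. g q \<in> borel_measurable M"
    and bound: "\<And>q x. norm (g q x) \<le> B q" and B: "B summable_on UNIV"
  shows "(LINT x|M. (\<Sum>\<^sub>\<infinity>q. g q x)) = (\<Sum>\<^sub>\<infinity>q. (LINT x|M. g q x))"
proof -
  interpret finite_measure M by (rule M)
  define m where "m = measure M (space M)"
  have int: "integrable M (g q)" for q
    by (rule integrable_const_bound[of _ "B q"]) (use meas bound in auto)
  have *: "(\<Sum>\<^sub>\<infinity>q. g q x) = (\<Sum>n. g (int_decode n) x)" "summable (\<lambda>n. norm (g (int_decode n) x))" for x
    using infsum_int_eq_suminf[OF summable_on_norm_bound(1)[OF B bound]] by auto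
  have nb: "(LINT x|M. norm (g q x)) \<le> m * B q" for q
  proof -
    have "(LINT x|M. norm (g q x)) \<le> (LINT x|M. B q)"
      using int bound by (intro integral_mono) auto
    then show ?thesis by (simp add: m_def mult.commute)
  qed
  have mB: "(\<lambda>q. m * B q) summable_on UNIV" by (rule summable_on_cmult_right[OF B])
  have s: "summable (\<lambda>n. LINT x|M. norm (g (int_decode n) x))"
    using infsum_int_eq_suminf(2)[OF summable_on_norm_bound(1)[OF mB, of "\<lambda>q. LINT x|M. norm (g q x)"]] nb
    by simp
  have *: "(\<lambda>x. \<Sum>\<^sub>\<infinity>q. g q x) = (\<lambda>x. \<Sum>n. g (int_decode n) x)" "\<And>x. summable (\<lambda>n. norm (g (int_decode n) x))"
    using * by auto
  have "(LINT x|M. (\<Sum>\<^sub>\<infinity>q. g q x)) = (\<Sum>n. LINT x|M. g (int_decode n) x)"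
    unfolding * by (rule integral_suminf[OF int]) (use * s in auto)
  also have "\<dots> = (\<Sum>\<^sub>\<infinity>q. (LINT x|M. g q x))"
  proof (rule infsum_int_eq_suminf(1)[symmetric], rule summable_on_norm_bound(1)[OF mB])
    show "norm (LINT x|M. g q x) \<le> m * B q" for q
      using integral_norm_bound[of M "g q"] nb[of q] by linarith
  qed
  finally show "(LINT x|M. (\<Sum>\<^sub>\<infinity>q. g q x)) = (\<Sum>\<^sub>\<infinity>q. (LINT x|M. g q x))" .
qed

lemma continuous_on_infsum:
  fixes g :: "'i \<Rightarrow> 'a::topological_space \<Rightarrow> 'b::banach"
  assumes cont: "\<And>q. continuous_on S (g q)"
    and bound: "\<And>q x. x \<in> S \<Longrightarrow> norm (g q x) \<le> B q" and B: "B summable_on UNIV"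
  shows "continuous_on S (\<lambda>x. \<Sum>\<^sub>\<infinity>q. g q x)"
  by (rule uniform_limit_theorem[OF _ Weierstrass_m_test_general[OF _ B]])
    (use cont bound in \<open>auto intro!: always_eventually continuous_on_sum\<close>)

lemma infsum_int_has_derivative:
  fixes f f' :: "int \<Rightarrow> real \<Rightarrow> real"
  assumes der: "\<And>q x. (f q has_real_derivative f' q x) (at x)"
    and bound': "\<And>q x. \<bar>f' q x\<bar> \<le> B' q" and B': "B' summable_on UNIV"
    and bound: "\<And>q x. \<bar>f q x\<bar> \<le> B q" and B: "B summable_on UNIV"
  shows "((\<lambda>x. \<Sum>\<^sub>\<infinity>q. f q x) has_real_derivative (\<Sum>\<^sub>\<infinity>q. f' q x)) (at x)"
proof -
  have f: "(\<Sum>\<^sub>\<infinity>q. f q x) = (\<Sum>n. f (int_decode n) x)" "summable (\<lambda>n. f (int_decode n) x)" for x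
    using infsum_int_eq_suminf[OF summable_on_norm_bound(1)[OF B, of "\<lambda>q. f q x"]] bound summable_norm_cancel[of "\<lambda>n. f (int_decode n) x"] by auto
  have f': "(\<Sum>\<^sub>\<infinity>q. f' q x) = (\<Sum>n. f' (int_decode n) x)" for x
    using infsum_int_eq_suminf[OF summable_on_norm_bound(1)[OF B', of "\<lambda>q. f' q x"]] bound' by auto
  have sB: "summable (\<lambda>n. B' (int_decode n))"
    using summable_on_imp_summable summable_on_reindex_bij_betw[OF bij_int_decode, of B'] B' by simp
  have "((\<lambda>x. \<Sum>n. f (int_decode n) x) has_real_derivative (\<Sum>n. f' (int_decode n) x)) (at x)"
  proof (rule has_field_derivative_series'(2)[of UNIV])
    show "uniformly_convergent_on UNIV (\<lambda>n x. \<Sum>i<n. f' (int_decode i) x)"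
      by (rule Weierstrass_m_test'[OF _ sB]) (use bound' in auto)
  qed (use der f in auto)
  then show ?thesis by (simp add: f f')
qed

subsection \<open>Gaussian decay\<close>

lemma power_le_fact_exp: assumes "0 \<le> (x::real)" shows "x ^ n \<le> fact n * exp x"
proof -
  have "x ^ n /\<^sub>R fact n \<le> (\<Sum>k. x ^ k /\<^sub>R fact k)"
    using sum_le_suminf[OF summable_exp_generic[of x], of "{n}"] assms by simp
  then show ?thesis by (simp add: exp_def field_simps)
qed

lemma summable_on_int_nat_abs:
  fixes g :: "nat \<Rightarrow> real"
  assumes "summable g" "\<And>n. 0 \<le> g n"
  shows "(\<lambda>q::int. g (nat \<bar>q\<bar>)) summable_on UNIV"
proof -
  have g: "g summable_on UNIV" using assms summable_nonneg_imp_summable_on by blast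
  have 1: "(\<lambda>q::int. g (nat \<bar>q\<bar>)) summable_on {0..}"
    using g by (subst summable_on_reindex_bij_witness[of _ int nat UNIV g]) auto
  have 2: "(\<lambda>q::int. g (nat \<bar>q\<bar>)) summable_on {..0}"
    using g by (subst summable_on_reindex_bij_witness[of _ "\<lambda>n. - int n" "\<lambda>q. nat (- q)" UNIV g]) auto
  have "(UNIV::int set) = {0..} \<union> {..0}" by auto
  then show ?thesis using summable_on_union[OF 1 2] by simp
qed

text \<open>Since |q| \<le> q^2, the Gaussian is at most exp (- c |q|); one half of this exponent
  absorbs the polynomial, the other half leaves a geometric series.\<close>

lemma gauss_poly_summable:
  fixes c :: real assumes "0 < c"
  shows "(\<lambda>q::int. \<bar>of_int q\<bar> ^ m * exp (- (c * (of_int q)\<^sup>2))) summable_on UNIV"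
proof -
  define K where "K = fact m * (2 / c) ^ m"
  have "summable (\<lambda>n. K * exp (- (c / 2)) ^ n)"
    using assms by (intro summable_mult summable_geometric) auto
  then have s: "(\<lambda>q::int. K * exp (- (c / 2)) ^ nat \<bar>q\<bar>) summable_on UNIV"
    by (intro summable_on_int_nat_abs) (auto simp: K_def assms less_imp_le)
  have "norm (\<bar>of_int q\<bar> ^ m * exp (- (c * (of_int q)\<^sup>2))) \<le> K * exp (- (c / 2)) ^ nat \<bar>q\<bar>" for q :: int
  proof -
    define n where "n = real_of_int \<bar>q\<bar>"
    have n: "0 \<le> n" "n \<le> n\<^sup>2" unfolding n_def of_int_power[symmetric] of_int_le_iff
      by (auto simp: power2_eq_square) (metis abs_ge_zero abs_mult_self_eq int_one_le_iff_zero_less linorder_not_less mult_left_mono nle_le mult.right_neutral order.order_iff_strict zero_le_mult_iff)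
    have "(c / 2 * n) ^ m \<le> fact m * exp (c / 2 * n)"
      using n assms by (intro power_le_fact_exp) auto
    then have "n ^ m \<le> K * exp (c / 2 * n)"
      using assms by (simp add: K_def power_mult_distrib power_divide field_simps)
    then have "n ^ m * exp (- (c * n\<^sup>2)) \<le> K * exp (c / 2 * n) * exp (- (c * n\<^sup>2))"
      by (intro mult_right_mono) auto
    also have "\<dots> \<le> K * exp (c / 2 * n) * exp (- (c * n))"
      using n assms by (intro mult_left_mono) (auto simp: K_def less_imp_le)
    also have "\<dots> = K * exp (- (c / 2) * n)"
      by (simp flip: exp_add add: algebra_simps)
    also have "exp (- (c / 2) * n) = exp (- (c / 2)) ^ nat \<bar>q\<bar>"
      by (simp add: n_def flip: exp_of_nat_mult) 
    finally show ?thesis by (simp add: n_def abs_mult power_abs)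
  qed
  from summable_on_norm_bound(2)[OF s this] show ?thesis by simp
qed

lemmas gauss_summable = gauss_poly_summable[where m = 0, simplified]

subsection \<open>Fourier coefficients\<close>

lemma cexpo_continuous [continuous_intros]: "continuous_on S (cexpo q)"
  unfolding cexpo_def cis_conv_exp by (intro continuous_intros)

lemma cexpo_measurable [measurable]: "cexpo q \<in> borel_measurable borel"
  by (intro borel_measurable_continuous_onI continuous_intros)

lemma cexpo_int: "cexpo q (of_int m) = 1"
  using cis_multiple_2pi[of "of_int (q * m)"] by (simp add: cexpo_def mult.assoc)

lemma cexpo_add_arg: "cexpo q (x + y) = cexpo q x * cexpo q y"
  by (simp add: cexpo_def cis_mult algebra_simps)

lemma cexpo_periodic: "cexpo q (x + of_int m) = cexpo q x"
  by (simp add: cexpo_add_arg cexpo_int)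

lemma integral_cexpo: "integral {0..1} (cexpo q) = (if q = 0 then 1 else 0)"
proof (cases "q = 0")
  case False
  define w where "w = 2 * pi * of_int q * \<i>"
  have w: "w \<noteq> 0" using False by (simp add: w_def)
  have e: "cexpo q z = exp (w * of_real z)" for z
    by (simp add: cexpo_def cis_conv_exp w_def algebra_simps)
  have "(cexpo q has_integral exp (w * of_real 1) / w - exp (w * of_real 0) / w) {0..1}"
    unfolding e[abs_def]
  proof (rule fundamental_theorem_of_calculus)
    fix x :: real
    have "((\<lambda>u. exp (w * u) / w) has_field_derivative exp (w * of_real x)) (at (of_real x))"
      using w by (auto intro!: derivative_eq_intros)
    then show "((\<lambda>x. exp (w * of_real x) / w) has_vector_derivative exp (w * of_real x)) (at x within {0..1})"
      by (rule has_vector_derivative_real_field)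
  qed simp
  moreover have "exp (w * of_real 1) = 1" using cexpo_int[of q 1] e[of 1] by simp
  ultimately show ?thesis using False by (simp add: integral_unique)
qed (simp add: cexpo_def[abs_def])

lemma integral_infsum_01:
  fixes g :: "int \<Rightarrow> real \<Rightarrow> 'b::euclidean_space"
  assumes cont: "\<And>q. continuous_on UNIV (g q)"
    and bound: "\<And>q x. norm (g q x) \<le> B q" and B: "B summable_on UNIV"
  shows "integral {0..1} (\<lambda>x. \<Sum>\<^sub>\<infinity>q. g q x) = (\<Sum>\<^sub>\<infinity>q. integral {0..1} (g q))"
proof -
  define M where "M = restrict_space lborel {0..1::real}"
  have M: "finite_measure M" unfolding M_def
    by (intro finite_measureI) (simp add: emeasure_restrict_space space_restrict_space)
  have m: "g q \<in> borel_measurable M" for q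
    using borel_measurable_continuous_onI[OF cont, of q] by (simp add: M_def measurable_restrict_space1)
  have c: "(LINT x|M. f x) = integral {0..1} f" if "continuous_on UNIV f" for f :: "real \<Rightarrow> 'b"
  proof -
    have "set_integrable lborel {0..1} f"
      using that continuous_on_subset[OF that] by (intro borel_integrable_atLeastAtMost') auto
    from set_borel_integral_eq_integral(2)[OF this] show ?thesis
      unfolding M_def by (subst integral_restrict_space) (auto simp: set_lebesgue_integral_def)
  qed
  have "continuous_on UNIV (\<lambda>x. \<Sum>\<^sub>\<infinity>q. g q x)"
    by (rule continuous_on_infsum[OF cont _ B]) (use bound in auto)
  then show ?thesis
    using integral_infsum_int[OF M m bound B] c[OF cont] c by simp
qed

lemma cser_continuous: assumes "nnsym f" shows "continuous_on S (cser f)"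
proof -
  have "norm (complex_of_real (f q) * cexpo q x) \<le> f q" for q x
    using nnsymD(1)[OF assms, of q] by (simp add: norm_mult)
  then show ?thesis unfolding cser_def[abs_def]
    by (intro continuous_on_infsum[OF _ _ nnsymD(2)[OF assms]] continuous_intros) auto
qed

lemma rser_continuous: assumes "nnsym f" shows "continuous_on S (rser f)"
proof -
  have "continuous_on S (\<lambda>x. Re (cser f x))" by (intro continuous_intros cser_continuous assms)
  then show ?thesis by (simp add: cser_eq_rser[OF assms])
qed

lemma cser_coeff: assumes "nnsym f"
  shows "integral {0..1} (\<lambda>z. cser f z * cexpo (- p) z) = of_real (f p)"
proof -
  have "integral {0..1} (\<lambda>z. cser f z * cexpo (- p) z)
      = integral {0..1} (\<lambda>z. \<Sum>\<^sub>\<infinity>q. of_real (f q) * cexpo (q - p) z)"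
    unfolding cser_def diff_conv_add_uminus cexpo_add
    by (simp add: infsum_cmult_left' flip: mult.assoc)
  also have "\<dots> = (\<Sum>\<^sub>\<infinity>q. integral {0..1} (\<lambda>z. of_real (f q) * cexpo (q - p) z))"
    by (rule integral_infsum_01[OF _ _ nnsymD(2)[OF assms]])
      (use nnsymD(1)[OF assms] in \<open>auto intro!: continuous_intros simp: norm_mult\<close>)
  also have "\<dots> = (\<Sum>\<^sub>\<infinity>q. if q = p then of_real (f p) else 0)"
    by (intro infsum_cong) (auto simp: integral_cexpo)
  also have "\<dots> = of_real (f p)" by (subst infsum_single[of p]) auto
  finally show ?thesis .
qed

lemma rser_coeff: assumes "nnsym f"
  shows "integral {0..1} (\<lambda>z. rser f z * cos (2 * pi * of_int p * z)) = f p"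
proof -
  have "((\<lambda>z. cser f z * cexpo (- p) z) has_integral of_real (f p)) {0..1}"
    unfolding cser_coeff[OF assms, symmetric]
    by (intro integrable_integral integrable_continuous_interval continuous_intros cser_continuous assms)
  from has_integral_Re[OF this] show ?thesis
    by (intro integral_unique) (simp add: cser_eq_rser[OF assms] cexpo_def)
qed

lemma rser_periodic: "rser f (z + of_int m) = rser f z"
proof -
  have "cos (2 * pi * of_int q * (z + of_int m)) = cos (2 * pi * of_int q * z)" for q
    using arg_cong[OF cexpo_periodic[of q z m], of Re] by (simp add: cexpo_def)
  then show ?thesis by (simp add: rser_def)
qed

lemma rser_abs_le: assumes "nnsym f" shows "\<bar>rser f z\<bar> \<le> infsum f UNIV"
proof -
  have "norm (f q * cos (2 * pi * of_int q * z)) \<le> f q" for q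
    using nnsymD(1)[OF assms, of q] by (simp add: abs_mult mult_left_le)
  then have "norm (rser f z) \<le> infsum f UNIV" unfolding rser_def
    by (rule norm_infsum_le[OF has_sum_infsum[OF rser_summable[OF assms]] has_sum_infsum[OF nnsymD(2)[OF assms]]])
  then show ?thesis by simp
qed

lemma cexpo_conv_bump:
  "complex_of_real (1 + cos (2 * pi * (z - z0)))
     = 1 + (cexpo 1 z * cexpo (-1) z0 + cexpo (-1) z * cexpo 1 z0) / 2"
proof -
  have "cexpo 1 z * cexpo (-1) z0 = cis (2 * pi * (z - z0))" "cexpo (-1) z * cexpo 1 z0 = cis (- (2 * pi * (z - z0)))"
    by (simp_all add: cexpo_def cis_mult algebra_simps)
  then show ?thesis by (simp add: complex_eq_iff)
qed

text \<open>The powers \<open>(1 + cos (2\<pi>(z - z0)))^n\<close> concentrate at \<open>z0\<close> and are trigonometric polynomials.\<close>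

lemma fourier_unique_aux:
  fixes h :: "real \<Rightarrow> real"
  assumes cont: "continuous_on UNIV h"
    and zero: "\<And>q. integral {0..1} (\<lambda>z. of_real (h z) * cexpo q z) = 0"
  shows "integral {0..1} (\<lambda>z. of_real (h z * (1 + cos (2 * pi * (z - z0))) ^ n) * cexpo q z) = 0"
proof (induction n arbitrary: q)
  case (Suc n)
  define g where "g = (\<lambda>z. complex_of_real (h z * (1 + cos (2 * pi * (z - z0))) ^ n))"
  have c: "continuous_on {0..1} (\<lambda>z. g z * cexpo q z)" for q
    unfolding g_def by (intro continuous_intros continuous_on_subset[OF cont]) auto
  have i: "((\<lambda>z. g z * cexpo q z) has_integral 0) {0..1}" for q
    using integrable_integral[OF integrable_continuous_interval[OF c[of q]]] Suc.IH[of q] unfolding g_def by metis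
  have "((\<lambda>z. g z * cexpo q z + (g z * cexpo (q + 1) z) * (cexpo (-1) z0 / 2) + (g z * cexpo (q - 1) z) * (cexpo 1 z0 / 2))
      has_integral (0 + 0 * (cexpo (-1) z0 / 2) + 0 * (cexpo 1 z0 / 2))) {0..1}"
    by (intro has_integral_add has_integral_mult_left i)
  moreover have "g z * cexpo q z + (g z * cexpo (q + 1) z) * (cexpo (-1) z0 / 2) + (g z * cexpo (q - 1) z) * (cexpo 1 z0 / 2)
      = of_real (h z * (1 + cos (2 * pi * (z - z0))) ^ Suc n) * cexpo q z" for z
    unfolding power_Suc mult.left_commute[of "h z"] of_real_mult[of "1 + _"] cexpo_conv_bump g_def
    by (simp add: cexpo_add diff_conv_add_uminus algebra_simps del: add_uminus_conv_diff)
  ultimately show ?case by (simp add: integral_unique)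
qed (use zero in simp)

text \<open>If h z0 were positive, the integral of h w^n would grow like k2^n from the neighbourhood
  of z0, while the rest is of order k1^n with k1 < k2; but w^n is a trigonometric polynomial, so the
  integral vanishes.\<close>

lemma fourier_unique_pos:
  fixes h :: "real \<Rightarrow> real"
  assumes cont: "continuous_on UNIV h"
    and zero: "\<And>q. integral {0..1} (\<lambda>z. of_real (h z) * cexpo q z) = 0"
    and z0: "0 < z0" "z0 < 1"
  shows "h z0 \<le> 0"
proof (rule ccontr)
  assume "\<not> h z0 \<le> 0"
  then have h0: "0 < h z0" by simp
  have "\<forall>e>0. \<exists>d>0. \<forall>x. dist x z0 < d \<longrightarrow> dist (h x) (h z0) < e"
    using cont unfolding continuous_on_iff by auto
  then obtain r' where r': "0 < r'" "\<And>x. \<bar>x - z0\<bar> < r' \<Longrightarrow> \<bar>h x - h z0\<bar> < h z0 / 2"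
    using h0 unfolding dist_real_def by (metis half_gt_zero)
  \<comment> \<open>The radius keeps the neighbourhood inside the period, keeps h above half of h z0
    on it, and makes 2 pi r at most pi / 2, so that k1 is positive.\<close>
  define r where "r = min (min (z0 / 2) ((1 - z0) / 2)) (min (r' / 2) (1 / 4))"
  have r: "0 < r" "r \<le> z0 / 2" "r \<le> 1/4" using z0 r'(1) by (auto simp: r_def)
  have "r \<le> (1 - z0) / 2" "r \<le> r' / 2" unfolding r_def by (meson min.cobounded1 min.cobounded2 order_trans)+
  with r r'(1) have r: "0 < r" "r < r'" "r \<le> z0 / 2" "r \<le> (1 - z0) / 2" "r \<le> 1/4" by auto
  have "bounded (h ` {0..1})"
    by (intro compact_imp_bounded compact_continuous_image continuous_on_subset[OF cont]) auto
  then obtain B where B: "\<And>x. x \<in> {0..1} \<Longrightarrow> \<bar>h x\<bar> \<le> B" unfolding bounded_iff real_norm_def by blast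
  define B' where "B' = max B 1"
  have B': "0 < B'" "\<And>x. x \<in> {0..1} \<Longrightarrow> \<bar>h x\<bar> \<le> B'" using B by (auto simp: B'_def intro: le_max_iff_disj[THEN iffD2])
  define w where "w = (\<lambda>z. 1 + cos (2 * pi * (z - z0)))"
  have w0: "0 \<le> w z" for z by (simp add: w_def) (metis add.commute add_diff_cancel cos_ge_minus_one diff_ge_0_iff_ge minus_add_cancel uminus_add_conv_diff)
  \<comment> \<open>Two radii are needed for a strict gap: w is at most k1 beyond distance r and at
    least k2 within distance r / 2.\<close>
  define k1 k2 where "k1 = 1 + cos (2 * pi * r)" and "k2 = 1 + cos (pi * r)"
  have rpi: "0 < pi * r" "pi * r < 2 * pi * r" "2 * pi * r \<le> pi / 2" using r by auto
  have k: "0 < k1" "k1 < k2"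
  proof -
    have "0 \<le> cos (2 * pi * r)" by (rule cos_ge_zero; use rpi pi_gt_zero in linarith)
    then show "0 < k1" by (simp add: k1_def)
    show "k1 < k2" unfolding k1_def k2_def using rpi by (intro add_strict_left_mono cos_monotone_0_pi) auto
  qed
  have cosabs: "w z = 1 + cos (2 * pi * \<bar>z - z0\<bar>)" for z
    by (cases "z0 \<le> z") (simp_all add: w_def, metis cos_minus minus_diff_eq mult_minus_right)
  have far: "w z \<le> k1" if "z \<in> {0..1}" "r \<le> \<bar>z - z0\<bar>" for z
  proof -
    have l: "\<bar>z - z0\<bar> \<le> 1 - r" using that(1) r by auto
    have "cos (2 * pi * \<bar>z - z0\<bar>) \<le> cos (2 * pi * r)"
    proof (cases "\<bar>z - z0\<bar> \<le> 1/2")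
      case True
      then show ?thesis using that(2) r by (intro cos_monotone_0_pi_le) auto
    next
      case False
      have "cos (2 * pi * \<bar>z - z0\<bar>) = cos (2 * pi * (1 - \<bar>z - z0\<bar>))"
        by (simp add: right_diff_distrib)
      also have "\<dots> \<le> cos (2 * pi * r)" using False l r by (intro cos_monotone_0_pi_le) auto
      finally show ?thesis .
    qed
    then show ?thesis by (simp add: cosabs k1_def)
  qed
  have near: "k2 \<le> w z" if "\<bar>z - z0\<bar> \<le> r / 2" for z
    unfolding cosabs k2_def using that r by (intro add_left_mono cos_monotone_0_pi_le) auto
  have hnear: "h z0 / 2 \<le> h z" if "\<bar>z - z0\<bar> < r" for z
  proof -
    have "\<bar>h z - h z0\<bar> < h z0 / 2" using r'(2)[of z] that r by auto
    then show ?thesis by linarith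
  qed
  have key: "r * (h z0 / 2 * k2 ^ n) \<le> B' * k1 ^ n" for n
  proof -
    \<comment> \<open>Adding the bound for the far part makes the integrand nonnegative on the whole
      period, so that its integral dominates the one over the small interval.\<close>
    define f where "f = (\<lambda>z. h z * w z ^ n + B' * k1 ^ n)"
    have cf: "continuous_on S f" for S unfolding f_def w_def
      by (intro continuous_intros continuous_on_subset[OF cont]) auto
    have f0: "0 \<le> f z" if "z \<in> {0..1}" for z
    proof (cases "\<bar>z - z0\<bar> < r")
      case True
      then have "0 \<le> h z" using hnear h0 by force
      then show ?thesis using w0 B' k by (auto simp: f_def)
    next
      case False
      have "\<bar>h z * w z ^ n\<bar> \<le> B' * k1 ^ n"
        unfolding abs_mult using B' that far[OF that] False w0 by (intro mult_mono) (auto simp: power_abs intro!: power_mono)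
      then show ?thesis by (simp add: f_def)
    qed
    let ?I = "{z0 - r/2..z0 + r/2}"
    have sub: "?I \<subseteq> {0..1}" using r by auto
    have "integral ?I (\<lambda>z. h z0 / 2 * k2 ^ n) \<le> integral ?I f"
    proof (intro integral_le integrable_continuous_interval cf continuous_intros)
      fix z assume "z \<in> ?I"
      then have "\<bar>z - z0\<bar> \<le> r / 2" by (auto simp: abs_if field_simps)
      then have "h z0 / 2 * k2 ^ n \<le> h z * w z ^ n"
        using hnear[of z] near[of z] k h0 r by (intro mult_mono power_mono) auto
      then show "h z0 / 2 * k2 ^ n \<le> f z" using B' k by (auto simp: f_def intro: order_trans)
    qed
    also have "\<dots> \<le> integral {0..1} f"
      by (intro integral_subset_le sub integrable_continuous_interval cf ballI f0)
    also have "\<dots> = integral {0..1} (\<lambda>z. h z * w z ^ n) + integral {0..1} (\<lambda>z::real. B' * k1 ^ n)"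
    proof -
      have "continuous_on {0..1} (\<lambda>z. h z * w z ^ n)"
        unfolding w_def by (intro continuous_intros continuous_on_subset[OF cont]) auto
      then have "(\<lambda>z. h z * w z ^ n) integrable_on {0..1}" by (rule integrable_continuous_interval)
      moreover have "(\<lambda>z::real. B' * k1 ^ n) integrable_on {0..1}" by (rule integrable_continuous_interval, rule continuous_on_const)
      ultimately show ?thesis unfolding f_def by (rule Henstock_Kurzweil_Integration.integral_add)
    qed
    also have "integral {0..1} (\<lambda>z. h z * w z ^ n) = 0"
    proof -
      have "((\<lambda>z. complex_of_real (h z * w z ^ n)) has_integral 0) {0..1}"
        using fourier_unique_aux[OF cont zero, of z0 n 0]
        by (subst has_integral_iff) (auto simp: w_def cexpo_def intro!: integrable_continuous_interval continuous_intros continuous_on_subset[OF cont])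
      from has_integral_Re[OF this] show ?thesis by (intro integral_unique) simp
    qed
    finally show ?thesis using r by (simp add: mult.commute mult.left_commute)
  qed
  define t where "t = k2 / k1"
  have t: "1 < t" using k by (simp add: t_def)
  obtain n where n: "B' / (r * (h z0 / 2)) < t ^ n" using real_arch_pow[OF t] by blast
  have "B' * k1 ^ n < r * (h z0 / 2) * t ^ n * k1 ^ n"
    using n r h0 k by (intro mult_strict_right_mono) (auto simp: field_simps)
  also have "\<dots> = r * (h z0 / 2 * k2 ^ n)" using k by (simp add: t_def power_divide)
  finally show False using key[of n] by simp
qed

text \<open>Applying \<open>fourier_unique_pos\<close> to h and to - h settles the open period; the
  endpoints follow by continuity and the rest by periodicity.\<close>

lemma fourier_unique:
  fixes h :: "real \<Rightarrow> real"
  assumes cont: "continuous_on UNIV h" and per: "\<And>z m. h (z + of_int m) = h z"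
    and zero: "\<And>q. integral {0..1} (\<lambda>z. of_real (h z) * cexpo q z) = 0"
  shows "h z = 0"
proof -
  have neg: "integral {0..1} (\<lambda>z. of_real (- h z) * cexpo q z) = 0" for q
    using zero[of q] by simp
  have inner: "h x = 0" if "x \<in> {0<..<1}" for x
    using fourier_unique_pos[OF cont zero, of x] fourier_unique_pos[OF _ neg, of x] that
    by (auto intro!: continuous_intros cont)
  have "h x = 0" if "x \<in> {0..1}" for x
  proof -
    have "h constant_on closure {0<..<1}"
      by (rule constant_on_closureI) (use inner continuous_on_subset[OF cont] in \<open>auto simp: constant_on_def\<close>)
    then have "h x = h (1/2)" using that by (auto simp: constant_on_def)
    then show ?thesis using inner[of "1/2"] by simp
  qed
  moreover have "h z = h (frac z)" using per[of z "- \<lfloor>z\<rfloor>"] by (simp add: frac_def)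
  ultimately show ?thesis using frac_lt_1[of z] frac_ge_0[of z] by (simp add: less_imp_le)
qed

subsection \<open>Gaussian integrals\<close>

lemma integral_normal_cexpo:
  assumes "0 < s"
  shows "(LINT x|lborel. normal_density 0 (sqrt s) x *\<^sub>R cexpo q x) = of_real (exp (- (2 * pi\<^sup>2 * (of_int q)\<^sup>2 * s)))"
proof -
  define r where "r = sqrt s"
  have r: "0 < r" "r\<^sup>2 = s" using assms by (auto simp: r_def)
  have "(LINT x|lborel. normal_density 0 r x *\<^sub>R cexpo q x)
      = \<bar>r\<bar> *\<^sub>R (LINT x|lborel. normal_density 0 r (0 + r * x) *\<^sub>R cexpo q (0 + r * x))"
    using r by (intro lborel_integral_real_affine) auto
  also have "\<dots> = (LINT x|lborel. std_normal_density x *\<^sub>R iexp (2 * pi * of_int q * r * x))"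
    unfolding integral_scaleR_right[symmetric]
  proof (intro Bochner_Integration.integral_cong refl)
    fix x
    have "r * normal_density 0 r (r * x) = std_normal_density x"
      using r(1) by (simp add: normal_density_def real_sqrt_mult power_mult_distrib)
    moreover have "cexpo q (r * x) = iexp (2 * pi * of_int q * r * x)"
      by (simp add: cexpo_def cis_conv_exp algebra_simps)
    ultimately show "\<bar>r\<bar> *\<^sub>R normal_density 0 r (0 + r * x) *\<^sub>R cexpo q (0 + r * x) = std_normal_density x *\<^sub>R iexp (2 * pi * of_int q * r * x)"
      using r by simp
  qed
  also have "\<dots> = char std_normal_distribution (2 * pi * of_int q * r)"
    unfolding char_def by (subst integral_density) (auto simp: normal_density_nonneg)
  also have "\<dots> = of_real (exp (- (2 * pi\<^sup>2 * (of_int q)\<^sup>2 * s)))"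
    by (simp add: char_std_normal_distribution power_mult_distrib r(2))
  finally show ?thesis by (simp add: r_def)
qed

lemma integral_centered_normal_cexpo:
  assumes "0 < s"
  shows "(LINT x|centered_normal s. cexpo q x) = of_real (exp (- (2 * pi\<^sup>2 * (of_int q)\<^sup>2 * s)))"
  unfolding centered_normal_def integral_normal_cexpo[OF assms, symmetric]
  using assms by (subst integral_density) (auto simp: normal_density_nonneg)

lemma prob_space_centered_normal: "0 < s \<Longrightarrow> prob_space (centered_normal s)"
  unfolding centered_normal_def by (rule prob_space_normal_density) simp

lemma sets_centered_normal [measurable_cong]: "sets (centered_normal s) = sets borel"
  by (simp add: centered_normal_def)

lemma summable_gauss_shift_bound:
  fixes c u R :: real
  assumes c: "0 < c" and u: "\<bar>u\<bar> \<le> R"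
  shows "exp (- (c * (u + of_int m)\<^sup>2)) \<le> exp (c * R\<^sup>2) * exp (- ((c / 2) * (of_int m)\<^sup>2))"
proof -
  have "(of_int m)\<^sup>2 \<le> 2 * (u + of_int m)\<^sup>2 + 2 * u\<^sup>2"
    using zero_le_power2[of "2 * u + of_int m"] by (simp add: power2_eq_square algebra_simps)
  moreover have "u\<^sup>2 \<le> R\<^sup>2" using u by (simp add: abs_le_square_iff[symmetric])
  ultimately have "(of_int m)\<^sup>2 / 2 - R\<^sup>2 \<le> (u + of_int m)\<^sup>2" by simp
  then have "c * ((of_int m)\<^sup>2 / 2 - R\<^sup>2) \<le> c * (u + of_int m)\<^sup>2" using c by (intro mult_left_mono) auto
  then show ?thesis by (simp flip: exp_add add: algebra_simps)
qed

section \<open>Periodized Gaussians and Poisson summation\<close>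

text \<open>A theta function. In this form a uniform positive lower bound is evident; in the Fourier
  form supplied by \<open>poisson_gauss\<close> the coefficients are.\<close>

definition wrapped_gauss :: "real \<Rightarrow> real \<Rightarrow> real" where
  "wrapped_gauss c u = (\<Sum>\<^sub>\<infinity>m::int. exp (- (c * (u + of_int m)\<^sup>2)))"

lemma wrapped_gauss_summable:
  fixes c u :: real
  assumes "0 < c" shows "(\<lambda>m::int. exp (- (c * (u + of_int m)\<^sup>2))) summable_on UNIV"
  by (rule summable_on_norm_bound(2)[OF summable_on_cmult_right[OF gauss_summable[of "c / 2"]]])
    (use assms summable_gauss_shift_bound[OF assms order_refl] in auto)

lemma wrapped_gauss_continuous:
  assumes c: "0 < c" shows "continuous_on UNIV (wrapped_gauss c)"
proof -
  have "continuous_on {-R<..<R} (wrapped_gauss c)" for R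
    unfolding wrapped_gauss_def[abs_def]
    by (rule continuous_on_infsum[OF _ _ summable_on_cmult_right[OF gauss_summable[of "c / 2"]], of _ _ "exp (c * R\<^sup>2)"])
      (use assms summable_gauss_shift_bound[OF assms] in \<open>auto intro!: continuous_intros\<close>)
  then have "continuous_on (\<Union>R\<in>UNIV. {-R<..<R}) (wrapped_gauss c)"
    by (intro continuous_on_open_UN) auto
  moreover have "(\<Union>R\<in>UNIV. {-R<..<R}) = (UNIV::real set)"
  proof -
    have "x \<in> {-(\<bar>x\<bar> + 1)<..<\<bar>x\<bar> + 1}" for x :: real by (auto simp: abs_if)
    then show ?thesis by blast
  qed
  ultimately show ?thesis by simp
qed

lemma wrapped_gauss_periodic: "wrapped_gauss c (u + of_int k) = wrapped_gauss c u"
  unfolding wrapped_gauss_def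
  by (rule infsum_reindex_bij_witness[of _ "\<lambda>m. m - k" "\<lambda>m. m + k"]) (auto simp: algebra_simps)

lemma wrapped_gauss_ge: assumes c: "0 < c" shows "exp (- c) \<le> wrapped_gauss c u"
proof -
  define m where "m = - \<lfloor>u\<rfloor>"
  have "(u + of_int m)\<^sup>2 \<le> 1" using frac_ge_0[of u] frac_lt_1[of u]
    by (simp add: m_def frac_def abs_square_le_1)
  then have "exp (- c) \<le> exp (- (c * (u + of_int m)\<^sup>2))" using c by simp
  also have "\<dots> \<le> wrapped_gauss c u"
    using finite_sum_le_infsum[OF wrapped_gauss_summable[OF c, of u], of "{m}"] by (simp add: wrapped_gauss_def)
  finally show ?thesis .
qed

lemma UN_int_intervals: "(\<Union>n. {of_int (int_decode n)..<of_int (int_decode n) + 1}) = (UNIV :: real set)"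
proof -
  have "x \<in> {of_int (int_decode n)..<of_int (int_decode n) + 1}" if "n = int_encode \<lfloor>x\<rfloor>" for x :: real and n
    by (simp add: that)
  then show ?thesis by blast
qed

lemma disjoint_int_intervals:
  "disjoint_family (\<lambda>n. {of_int (int_decode n)..<of_int (int_decode n) + 1 :: real})"
proof (unfold disjoint_family_on_def, safe)
  fix m n :: nat and x :: real assume mn: "m \<noteq> n"
    and "x \<in> {of_int (int_decode m)..<of_int (int_decode m) + 1}" "x \<in> {of_int (int_decode n)..<of_int (int_decode n) + 1}"
  then have "int_decode m = \<lfloor>x\<rfloor>" "int_decode n = \<lfloor>x\<rfloor>" by (auto intro!: floor_unique[symmetric])
  then show "x \<in> {}" using mn by (metis int_decode_inverse)
qed

lemma integral_01_half_open:
  fixes f :: "real \<Rightarrow> 'b::euclidean_space"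
  assumes "continuous_on UNIV f"
  shows "(LINT x:{0..<1}|lborel. f x) = integral {0..1} f"
proof -
  have "set_integrable lborel {0..1} f"
    using continuous_on_subset[OF assms] by (intro borel_integrable_atLeastAtMost') auto
  then have "set_integrable lborel {0..<1} f" by (rule set_integrable_subset) auto
  then have "(LINT x:{0..<1}|lborel. f x) = integral {0..<1} f"
    by (rule set_borel_integral_eq_integral)
  also have "\<dots> = integral {0..1} f"
    by (rule integral_spike_set; rule negligible_subset[of "{1}"]) auto
  finally show ?thesis .
qed

lemma integral_unfold_periods:
  fixes f :: "real \<Rightarrow> 'b::euclidean_space"
  assumes f: "integrable lborel f"
  shows "integral\<^sup>L lborel f = (\<Sum>n. (LINT x:{0..<1}|lborel. f (x + of_int (int_decode n))))"
proof -
  let ?A = "\<lambda>n. {of_int (int_decode n)..<of_int (int_decode n) + 1 :: real}"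
  have "integral\<^sup>L lborel f = (LINT x:(\<Union>n. ?A n)|lborel. f x)"
    by (simp add: UN_int_intervals set_lebesgue_integral_def)
  also have "\<dots> = (\<Sum>n. (LINT x:?A n|lborel. f x))"
    by (rule lebesgue_integral_countable_add)
      (use disjoint_int_intervals f in \<open>auto simp: UN_int_intervals set_integrable_def disjoint_family_on_def\<close>)
  also have "\<dots> = (\<Sum>n. (LINT x:{0..<1}|lborel. f (x + of_int (int_decode n))))"
  proof (rule suminf_cong)
    fix n
    have "(LINT x:?A n|lborel. f x) = (LINT x|lborel. indicator (?A n) (of_int (int_decode n) + 1 * x) *\<^sub>R f (of_int (int_decode n) + 1 * x))"
      unfolding set_lebesgue_integral_def by (subst lborel_integral_real_affine[of 1 _ "of_int (int_decode n)"]) simp_all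
    also have "\<dots> = (LINT x:{0..<1}|lborel. f (x + of_int (int_decode n)))"
      unfolding set_lebesgue_integral_def by (intro Bochner_Integration.integral_cong) (auto simp: indicator_def add.commute)
    finally show "(LINT x:?A n|lborel. f x) = (LINT x:{0..<1}|lborel. f (x + of_int (int_decode n)))" .
  qed
  finally show ?thesis .
qed

lemma gauss_normal_density:
  assumes "0 < c"
  shows "exp (- (c * x\<^sup>2)) = sqrt (pi / c) * normal_density 0 (sqrt (1 / (2 * c))) x"
  using assms by (simp add: normal_density_def real_sqrt_divide field_simps)

lemma gauss_fourier:
  assumes c: "0 < c"
  shows "(LINT x|lborel. of_real (exp (- (c * x\<^sup>2))) * cexpo q x)
     = of_real (sqrt (pi / c) * exp (- (pi\<^sup>2 / c * (of_int q)\<^sup>2)))"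
    and "integrable lborel (\<lambda>x. of_real (exp (- (c * x\<^sup>2))) * cexpo q x)"
proof -
  let ?n = "normal_density 0 (sqrt (1 / (2 * c)))"
  have e: "complex_of_real (exp (- (c * x\<^sup>2))) * cexpo q x = of_real (sqrt (pi / c)) * (?n x *\<^sub>R cexpo q x)" for x
    unfolding gauss_normal_density[OF c] by (simp add: scaleR_conv_of_real)
  have "integrable lborel (\<lambda>x. ?n x *\<^sub>R cexpo q x)"
    by (rule Bochner_Integration.integrable_bound[OF integrable_normal_density[of "sqrt (1 / (2 * c))" 0]])
      (use c in \<open>auto simp: normal_density_nonneg\<close>)
  then show "integrable lborel (\<lambda>x. of_real (exp (- (c * x\<^sup>2))) * cexpo q x)" unfolding e by (rule integrable_mult_right)
  show "(LINT x|lborel. of_real (exp (- (c * x\<^sup>2))) * cexpo q x)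
     = of_real (sqrt (pi / c) * exp (- (pi\<^sup>2 / c * (of_int q)\<^sup>2)))"
    unfolding e integral_mult_right_zero using c by (subst integral_normal_cexpo) auto
qed

text \<open>Integrating a periodized function over one period is integrating the function over the
  line, because the character does not change under integer shifts.\<close>

lemma wrapped_gauss_coeff:
  assumes c: "0 < c"
  shows "integral {0..1} (\<lambda>z. of_real (wrapped_gauss c z) * cexpo q z)
      = of_real (sqrt (pi / c) * exp (- (pi\<^sup>2 / c * (of_int q)\<^sup>2)))"
proof -
  define g where "g = (\<lambda>m z. complex_of_real (exp (- (c * (z + of_int m)\<^sup>2))) * cexpo q z)"
  define B where "B = (\<lambda>m::int. exp (c * 1\<^sup>2) * exp (- ((c / 2) * (of_int m)\<^sup>2)))"
  have B: "B summable_on UNIV" unfolding B_def using c by (intro summable_on_cmult_right gauss_summable) auto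
  define M where "M = restrict_space lborel {0..<1::real}"
  have M: "finite_measure M" unfolding M_def
    by (intro finite_measureI) (simp add: emeasure_restrict_space space_restrict_space)
  \<comment> \<open>The majorant B holds only for |z| \<le> 1, whereas
    \<open>integral_infsum_int\<close> asks for a bound at every point; hence the truncation to the
    period.\<close>
  define g' where "g' = (\<lambda>m z. if z \<in> {0..<1} then g m z else 0)"
  have cg: "continuous_on UNIV (g m)" for m unfolding g_def by (intro continuous_intros)
  have meas: "g' m \<in> borel_measurable M" for m
  proof -
    have [measurable]: "g m \<in> borel_measurable borel" by (intro borel_measurable_continuous_onI cg)
    show ?thesis unfolding g'_def M_def by (intro measurable_restrict_space1) measurable
  qed
  have bd: "norm (g' m z) \<le> B m" for m z
    using summable_gauss_shift_bound[OF c, of z 1 m] by (auto simp: g'_def g_def B_def norm_mult)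
  have toM: "(LINT z|M. f z) = (LINT z:{0..<1}|lborel. f z)" for f :: "real \<Rightarrow> complex"
    unfolding M_def by (subst integral_restrict_space) (auto simp: set_lebesgue_integral_def)
  have g'g: "(LINT z:{0..<1}|lborel. g' m z) = (LINT z:{0..<1}|lborel. g m z)" for m
    unfolding set_lebesgue_integral_def by (intro Bochner_Integration.integral_cong) (auto simp: g'_def indicator_def)
  have "integral {0..1} (\<lambda>z. of_real (wrapped_gauss c z) * cexpo q z)
      = (LINT z:{0..<1}|lborel. of_real (wrapped_gauss c z) * cexpo q z)"
    by (intro integral_01_half_open[symmetric] continuous_intros wrapped_gauss_continuous c)
  also have "\<dots> = (LINT z|M. (\<Sum>\<^sub>\<infinity>m. g' m z))"
    unfolding toM set_lebesgue_integral_def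
  proof (intro Bochner_Integration.integral_cong refl)
    fix z :: real
    have "(\<Sum>\<^sub>\<infinity>m. g m z) = of_real (wrapped_gauss c z) * cexpo q z"
      unfolding g_def wrapped_gauss_def
      by (subst infsum_cmult_left', subst infsumI[OF has_sum_of_real[OF has_sum_infsum[OF wrapped_gauss_summable[OF c]]]]) simp
    then show "indicator {0..<1} z *\<^sub>R (complex_of_real (wrapped_gauss c z) * cexpo q z) = indicator {0..<1} z *\<^sub>R (\<Sum>\<^sub>\<infinity>m. g' m z)"
      by (auto simp: indicator_def g'_def)
  qed
  also have "\<dots> = (\<Sum>\<^sub>\<infinity>m. (LINT z|M. g' m z))"
    by (rule integral_infsum_int[OF M meas bd B])
  also have "\<dots> = (\<Sum>\<^sub>\<infinity>m. (LINT z:{0..<1}|lborel. g m z))" by (simp add: toM g'g)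
  also have "\<dots> = (\<Sum>n. (LINT z:{0..<1}|lborel. g (int_decode n) z))"
  proof (rule infsum_int_eq_suminf(1), rule summable_on_norm_bound(1)[OF B])
    fix m
    interpret finite_measure M by (rule M)
    have "norm (LINT z|M. g' m z) \<le> (LINT z|M. norm (g' m z))" by (rule integral_norm_bound)
    also have "\<dots> \<le> (LINT z|M. B m)"
      by (rule integral_mono[OF integrable_norm[OF integrable_const_bound[of _ "B m"]]]) (use meas bd in auto)
    also have "\<dots> = B m" by (simp add: M_def measure_restrict_space space_restrict_space)
    finally show "norm (LINT z:{0..<1}|lborel. g m z) \<le> B m" by (simp add: toM g'g)
  qed
  also have "\<dots> = (LINT x|lborel. of_real (exp (- (c * x\<^sup>2))) * cexpo q x)"
    unfolding integral_unfold_periods[OF gauss_fourier(2)[OF c]] by (simp add: g_def cexpo_periodic)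
  finally show ?thesis using gauss_fourier(1)[OF c] by simp
qed

definition gauss_seq :: "real \<Rightarrow> int \<Rightarrow> real" where
  "gauss_seq c q = exp (- (c * (of_int q)\<^sup>2))"

lemma nnsym_gauss_seq: "0 < c \<Longrightarrow> nnsym (gauss_seq c)"
  unfolding nnsym_def gauss_seq_def using gauss_summable by auto

lemma nnsym_scale: assumes "nnsym f" "0 \<le> k" shows "nnsym (\<lambda>q. k * f q)"
  using assms by (auto simp: nnsym_def intro!: summable_on_cmult_right)

lemma rser_scale: "rser (\<lambda>q. k * f q) z = k * rser f z"
  unfolding rser_def by (simp add: infsum_cmult_right' mult.assoc)

text \<open>Both sides are continuous and periodic with the same Fourier coefficients, so their
  difference vanishes by \<open>fourier_unique\<close>.\<close>

lemma poisson_gauss: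
  assumes c: "0 < c"
  shows "wrapped_gauss c u = sqrt (pi / c) * rser (gauss_seq (pi\<^sup>2 / c)) u"
proof -
  define f where "f = (\<lambda>q. sqrt (pi / c) * gauss_seq (pi\<^sup>2 / c) q)"
  have f: "nnsym f" unfolding f_def using c by (intro nnsym_scale nnsym_gauss_seq) auto
  have "wrapped_gauss c u - rser f u = 0"
  proof (rule fourier_unique[where h = "\<lambda>u. wrapped_gauss c u - rser f u" and z = u])
    show "continuous_on UNIV (\<lambda>u. wrapped_gauss c u - rser f u)"
      by (intro continuous_intros wrapped_gauss_continuous c rser_continuous f)
    show "wrapped_gauss c (z + of_int m) - rser f (z + of_int m) = wrapped_gauss c z - rser f z" for z m
      by (simp add: wrapped_gauss_periodic rser_periodic)
    show "integral {0..1} (\<lambda>z. of_real (wrapped_gauss c z - rser f z) * cexpo q z) = 0" for q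
    proof -
      have "integral {0..1} (\<lambda>z. of_real (wrapped_gauss c z - rser f z) * cexpo q z)
        = integral {0..1} (\<lambda>z. of_real (wrapped_gauss c z) * cexpo q z) - integral {0..1} (\<lambda>z. cser f z * cexpo (- (- q)) z)"
        by (subst Henstock_Kurzweil_Integration.integral_diff[symmetric])
          (auto simp: cser_eq_rser[OF f] algebra_simps intro!: integrable_continuous_interval continuous_intros
            continuous_on_subset[OF wrapped_gauss_continuous[OF c]] rser_continuous f)
      then show ?thesis
        unfolding wrapped_gauss_coeff[OF c] cser_coeff[OF f] by (simp add: f_def gauss_seq_def)
    qed
  qed
  then show ?thesis by (simp add: f_def rser_scale)
qed

lemma nnsym_mult_bounded:
  assumes g: "nnsym g" and f: "\<And>q. 0 \<le> f q" "\<And>q. f q \<le> K" "\<And>q. f (- q) = f q"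
  shows "nnsym (\<lambda>q. g q * f q)"
  unfolding nnsym_def
proof (intro conjI allI)
  show "(\<lambda>q. g q * f q) summable_on UNIV"
    by (rule summable_on_norm_bound(2)[OF summable_on_cmult_left[OF nnsymD(2)[OF g], of K]])
      (use f nnsymD(1)[OF g] in \<open>auto intro!: mult_left_mono\<close>)
qed (use g f in \<open>auto simp: nnsym_def\<close>)

lemma nnsym_le_infsum: assumes "nnsym f" shows "f q \<le> infsum f UNIV"
  using finite_sum_le_infsum[OF nnsymD(2)[OF assms], of "{q}" ] nnsymD(1)[OF assms] by simp

lemma nnsym_mult: assumes "nnsym g" "nnsym f" shows "nnsym (\<lambda>q. g q * f q)"
  by (rule nnsym_mult_bounded[where K = "infsum f UNIV"])
    (use assms nnsymD[OF assms(2)] nnsym_le_infsum[OF assms(2)] in auto)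

lemma nnsym_le_zero_coeff:
  assumes f: "nnsym f" and pos: "\<And>z. 0 \<le> rser f z"
  shows "f q \<le> f 0"
proof -
  have i: "(\<lambda>z. rser f z * cos (2 * pi * of_int q * z)) integrable_on {0..1}" for q
    by (intro integrable_continuous_interval continuous_intros rser_continuous f)
  have "f q = integral {0..1} (\<lambda>z. rser f z * cos (2 * pi * of_int q * z))" by (rule rser_coeff[OF f, symmetric])
  also have "\<dots> \<le> integral {0..1} (\<lambda>z. rser f z * cos (2 * pi * of_int 0 * z))"
    by (intro integral_le i) (use pos in \<open>auto intro!: mult_left_le\<close>)
  also have "\<dots> = f 0" by (rule rser_coeff[OF f])
  finally show ?thesis .
qed

lemma cpow_le_zero_coeff:
  assumes f: "nnsym f" and pos: "\<And>z. 0 \<le> rser f z"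
  shows "cpow f j q \<le> cpow f j 0"
  by (rule nnsym_le_zero_coeff[OF nnsym_cpow[OF f]]) (simp add: rser_cpow[OF f] pos)

lemma rser_mult_convolution:
  assumes g: "nnsym g" and f: "nnsym f"
  shows "integral {0..1} (\<lambda>u. rser g (z - u) * rser f u) = rser (\<lambda>q. g q * f q) z"
proof -
  have gf: "nnsym (\<lambda>q. g q * f q)"
    by (rule nnsym_mult[OF g f])
  have "integral {0..1} (\<lambda>u. cser g (z - u) * cser f u)
      = integral {0..1} (\<lambda>u. \<Sum>\<^sub>\<infinity>q. of_real (g q) * cexpo q z * (cser f u * cexpo (- q) u))"
  proof (rule Henstock_Kurzweil_Integration.integral_cong)
    fix u
    have "cexpo q (z - u) = cexpo q z * cexpo (- q) u" for q
      by (simp add: cexpo_def cis_mult algebra_simps)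
    then show "cser g (z - u) * cser f u = (\<Sum>\<^sub>\<infinity>q. of_real (g q) * cexpo q z * (cser f u * cexpo (- q) u))"
      unfolding cser_def[of g] by (subst infsum_cmult_left'[symmetric]) (auto intro!: infsum_cong)
  qed
  also have "\<dots> = (\<Sum>\<^sub>\<infinity>q. integral {0..1} (\<lambda>u. of_real (g q) * cexpo q z * (cser f u * cexpo (- q) u)))"
  proof (rule integral_infsum_01[OF _ _ summable_on_cmult_left[OF nnsymD(2)[OF g], of "infsum f UNIV"]])
    show "continuous_on UNIV (\<lambda>u. of_real (g q) * cexpo q z * (cser f u * cexpo (- q) u))" for q
      by (intro continuous_intros cser_continuous f)
    show "norm (of_real (g q) * cexpo q z * (cser f u * cexpo (- q) u)) \<le> g q * infsum f UNIV" for q u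
      using nnsymD(1)[OF g, of q] rser_abs_le[OF f, of u]
      by (simp add: norm_mult cser_eq_rser[OF f] mult_left_mono)
  qed
  also have "\<dots> = (\<Sum>\<^sub>\<infinity>q. of_real (g q * f q) * cexpo q z)"
    by (intro infsum_cong) (simp add: cser_coeff[OF f])
  also have "\<dots> = of_real (rser (\<lambda>q. g q * f q) z)"
    using cser_eq_rser[OF gf] by (simp add: cser_def)
  finally have "integral {0..1} (\<lambda>u. complex_of_real (rser g (z - u) * rser f u)) = of_real (rser (\<lambda>q. g q * f q) z)"
    by (simp add: cser_eq_rser g f)
  moreover have c: "continuous_on {0..1} (\<lambda>u. rser g (z - u) * rser f u)"
    by (intro continuous_intros rser_continuous f continuous_on_compose2[OF rser_continuous[OF g, of UNIV]]) auto
  ultimately have "((\<lambda>u. complex_of_real (rser g (z - u) * rser f u)) has_integral of_real (rser (\<lambda>q. g q * f q) z)) {0..1}"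
    by (subst has_integral_iff) (auto simp del: of_real_mult intro!: integrable_continuous_interval continuous_on_of_real c)
  from has_integral_Re[OF this] show ?thesis by (intro integral_unique) simp
qed

text \<open>Multiplying coefficients is convolving functions, and the convolution is at least the
  minimum of the kernel times the mass f 0. Applied with a Gaussian kernel this yields a lower bound
  that does not deteriorate with the number of steps.\<close>

lemma rser_mult_ge:
  assumes g: "nnsym g" and f: "nnsym f" and pos: "\<And>u. 0 \<le> rser f u" and m: "\<And>u. m \<le> rser g u"
  shows "m * f 0 \<le> rser (\<lambda>q. g q * f q) z"
proof -
  have c: "continuous_on {0..1} (\<lambda>u. rser g (z - u) * rser f u)"
    by (intro continuous_intros rser_continuous f continuous_on_compose2[OF rser_continuous[OF g, of UNIV]]) auto
  have "m * f 0 = integral {0..1} (\<lambda>u. m * rser f u)"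
    using rser_coeff[OF f, of 0] by simp
  also have "\<dots> \<le> integral {0..1} (\<lambda>u. rser g (z - u) * rser f u)"
    by (intro integral_le integrable_continuous_interval c)
      (auto intro!: continuous_intros rser_continuous f mult_right_mono m pos)
  finally show ?thesis by (simp add: rser_mult_convolution[OF g f])
qed

text \<open>With c = pi^2 / \<kappa>, some image in the periodized Gaussian lies within distance 1
  and contributes at least exp (- c); the square root is the inverse of the factor in Poisson's
  formula.\<close>

definition gauss_min :: "real \<Rightarrow> real" where
  "gauss_min \<kappa> = sqrt (pi / \<kappa>) * exp (- (pi\<^sup>2 / \<kappa>))"

lemma rser_gauss_ge: assumes "0 < \<kappa>" shows "gauss_min \<kappa> \<le> rser (gauss_seq \<kappa>) u"
proof -
  have k: "0 < pi\<^sup>2 / \<kappa>" "pi\<^sup>2 / (pi\<^sup>2 / \<kappa>) = \<kappa>" "pi / (pi\<^sup>2 / \<kappa>) = \<kappa> / pi"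
    using assms by (auto simp: field_simps power2_eq_square)
  have "exp (- (pi\<^sup>2 / \<kappa>)) \<le> sqrt (\<kappa> / pi) * rser (gauss_seq \<kappa>) u"
    using wrapped_gauss_ge[OF k(1), of u] poisson_gauss[OF k(1), of u] unfolding k by simp
  then have "sqrt (pi / \<kappa>) * exp (- (pi\<^sup>2 / \<kappa>)) \<le> sqrt (pi / \<kappa>) * (sqrt (\<kappa> / pi) * rser (gauss_seq \<kappa>) u)"
    by (intro mult_left_mono) (use assms in auto)
  also have "sqrt (pi / \<kappa>) * (sqrt (\<kappa> / pi) * rser (gauss_seq \<kappa>) u) = rser (gauss_seq \<kappa>) u"
    using assms by (simp add: real_sqrt_mult[symmetric] flip: mult.assoc)
  finally show ?thesis by (simp add: gauss_min_def)
qed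

subsection \<open>Integrals against periodic measures\<close>

lemma periodic_shift:
  assumes per: "one_periodic_measure \<nu>" and sets: "sets \<nu> = sets borel"
  shows "distr \<nu> borel (\<lambda>x. x + of_int m) = \<nu>"
proof -
  have d1: "distr \<nu> borel (\<lambda>x. x + 1) = \<nu>" using per by (simp add: one_periodic_measure_def)
  have nat: "distr \<nu> borel (\<lambda>x. x + real n) = \<nu>" for n
  proof (induction n)
    case 0
    have "distr \<nu> borel (\<lambda>x. x) = \<nu>" by (rule distr_id2) (simp add: sets)
    then show ?case by simp
  next
    case (Suc n)
    have [measurable_cong]: "sets \<nu> = sets borel" by (rule sets)
    have "distr \<nu> borel (\<lambda>x. x + real (Suc n)) = distr (distr \<nu> borel (\<lambda>x. x + real n)) borel (\<lambda>x. x + 1)"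
      by (subst distr_distr) (auto simp: o_def add_ac)
    then show ?case by (simp add: Suc d1)
  qed
  have [measurable_cong]: "sets \<nu> = sets borel" by (rule sets)
  show ?thesis
  proof (cases "0 \<le> m")
    case True
    then show ?thesis using nat[of "nat m"] by simp
  next
    case False
    \<comment> \<open>For a negative shift the measure is first replaced by its own image under the
      opposite shift, so that the two shifts cancel.\<close>
    have "distr \<nu> borel (\<lambda>x. x + of_int m) = distr (distr \<nu> borel (\<lambda>x. x + real (nat (- m)))) borel (\<lambda>x. x + of_int m)"
      by (simp only: nat)
    also have "\<dots> = distr \<nu> borel (\<lambda>x. x)" using False
      by (subst distr_distr) (auto simp: o_def)
    also have "\<dots> = \<nu>" by (rule distr_id2) (simp add: sets)
    finally show ?thesis .
  qed
qed

lemma nn_integral_unfold_periods: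
  assumes per: "one_periodic_measure \<nu>" and sets: "sets \<nu> = sets borel"
    and f[measurable]: "f \<in> borel_measurable borel"
  shows "(\<integral>\<^sup>+x. f x \<partial>\<nu>) = (\<integral>\<^sup>+x\<in>{0..<1}. (\<Sum>n. f (x + of_int (int_decode n))) \<partial>\<nu>)"
proof -
  have [measurable_cong]: "sets \<nu> = sets borel" by (rule sets)
  let ?A = "\<lambda>n. {of_int (int_decode n)..<of_int (int_decode n) + 1 :: real}"
  have "(\<integral>\<^sup>+x. f x \<partial>\<nu>) = (\<integral>\<^sup>+x\<in>(\<Union>n. ?A n). f x \<partial>\<nu>)"
    by (simp add: UN_int_intervals)
  also have "\<dots> = (\<Sum>n. \<integral>\<^sup>+x\<in>?A n. f x \<partial>\<nu>)"
    by (rule nn_integral_disjoint_family) (auto simp: disjoint_int_intervals)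
  also have "\<dots> = (\<Sum>n. \<integral>\<^sup>+x\<in>{0..<1}. f (x + of_int (int_decode n)) \<partial>\<nu>)"
  proof (rule suminf_cong)
    fix n
    have "(\<integral>\<^sup>+x\<in>?A n. f x \<partial>\<nu>) = (\<integral>\<^sup>+x. f x * indicator (?A n) x \<partial>distr \<nu> borel (\<lambda>x. x + of_int (int_decode n)))"
      by (simp only: periodic_shift[OF per sets])
    also have "\<dots> = (\<integral>\<^sup>+x. f (x + of_int (int_decode n)) * indicator (?A n) (x + of_int (int_decode n)) \<partial>\<nu>)"
      by (rule nn_integral_distr) auto
    also have "\<dots> = (\<integral>\<^sup>+x\<in>{0..<1}. f (x + of_int (int_decode n)) \<partial>\<nu>)"
      by (intro nn_integral_cong) (auto simp: indicator_def)
    finally show "(\<integral>\<^sup>+x\<in>?A n. f x \<partial>\<nu>) = (\<integral>\<^sup>+x\<in>{0..<1}. f (x + of_int (int_decode n)) \<partial>\<nu>)" .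
  qed
  also have "\<dots> = (\<integral>\<^sup>+x. (\<Sum>n. f (x + of_int (int_decode n)) * indicator {0..<1} x) \<partial>\<nu>)"
    by (rule nn_integral_suminf[symmetric]) auto
  also have "\<dots> = (\<integral>\<^sup>+x\<in>{0..<1}. (\<Sum>n. f (x + of_int (int_decode n))) \<partial>\<nu>)"
    by (simp add: ennreal_suminf_multc)
  finally show ?thesis .
qed

definition mcoeff :: "real measure \<Rightarrow> int \<Rightarrow> real" where
  "mcoeff \<nu> q = Re (measure_fourier_coeff \<nu> q)"

lemma assumption_B_coeff:
  assumes "assumption_B \<nu>"
  shows "measure_fourier_coeff \<nu> q = of_real (mcoeff \<nu> q)" "0 < mcoeff \<nu> q" "mcoeff \<nu> (- q) = mcoeff \<nu> q"
    "sets \<nu> = sets borel" "one_periodic_measure \<nu>"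
  using assms by (auto simp: assumption_B_def mcoeff_def radon_measure_def complex_is_Real_iff complex_eq_iff)

lemma assumption_B_restrict:
  assumes B: "assumption_B \<nu>"
  defines "\<nu>0 \<equiv> restrict_space \<nu> {0..<1}"
  shows "finite_measure \<nu>0" "(LINT x|\<nu>0. cexpo q x) = of_real (mcoeff \<nu> q)" "mcoeff \<nu> q \<le> mcoeff \<nu> 0"
    "measure \<nu>0 (space \<nu>0) = mcoeff \<nu> 0"
proof -
  note sets = assumption_B_coeff(4)[OF B]
  have [measurable_cong]: "sets \<nu> = sets borel" by (rule sets)
  have sp: "space \<nu> = UNIV" using sets_eq_imp_space_eq[OF sets] by simp
  have "emeasure \<nu> {0..<1} \<le> emeasure \<nu> {0..1}" by (rule emeasure_mono) (auto simp: sets)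
  also have "\<dots> < \<infinity>" using B by (auto simp: assumption_B_def radon_measure_def)
  finally show fin: "finite_measure \<nu>0" unfolding \<nu>0_def
    by (intro finite_measureI) (simp add: emeasure_restrict_space space_restrict_space sets sp)
  have e: "exp (- (2 * of_real pi * \<i> * of_int q * of_real z)) = cexpo (- q) z" for q z
    by (simp add: cexpo_def cis_conv_exp algebra_simps)
  have L: "(LINT x|\<nu>0. cexpo q x) = of_real (mcoeff \<nu> q)" for q
  proof -
    have "(LINT x|\<nu>0. cexpo q x) = (LINT x:{0..<1}|\<nu>. cexpo (- (- q)) x)"
      unfolding \<nu>0_def by (subst integral_restrict_space) (auto simp: sets sp set_lebesgue_integral_def)
    also have "\<dots> = measure_fourier_coeff \<nu> (- q)"
      unfolding measure_fourier_coeff_def e ..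
    finally show ?thesis by (simp add: assumption_B_coeff[OF B])
  qed
  show "(LINT x|\<nu>0. cexpo q x) = of_real (mcoeff \<nu> q)" by (rule L)
  have "complex_of_real (measure \<nu>0 (space \<nu>0)) = of_real (mcoeff \<nu> 0)"
    using L[of 0] by (simp add: cexpo_def scaleR_conv_of_real)
  then show m: "measure \<nu>0 (space \<nu>0) = mcoeff \<nu> 0" using of_real_eq_iff by blast
  interpret finite_measure \<nu>0 by (rule fin)
  have "norm (LINT x|\<nu>0. cexpo q x) \<le> (LINT x|\<nu>0. norm (cexpo q x))" by (rule integral_norm_bound)
  also have "\<dots> = mcoeff \<nu> 0" by (simp add: m)
  finally show "mcoeff \<nu> q \<le> mcoeff \<nu> 0" using assumption_B_coeff(2)[OF B, of q] unfolding L by simp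
qed

text \<open>The line is folded onto one period for nonnegative integrals, where integrability
  against \<nu> need not be known beforehand.\<close>

lemma gauss_integral_periodic:
  assumes B: "assumption_B \<nu>" and c: "0 < c"
  shows "(LINT x|\<nu>. exp (- (c * (z - x)\<^sup>2))) = (LINT x|restrict_space \<nu> {0..<1}. wrapped_gauss c (x - z))"
proof -
  note sets = assumption_B_coeff(4)[OF B]
  have [measurable_cong]: "sets \<nu> = sets borel" by (rule sets)
  have sp: "space \<nu> = UNIV" using sets_eq_imp_space_eq[OF sets] by simp
  have [measurable]: "wrapped_gauss c \<in> borel_measurable borel"
    by (intro borel_measurable_continuous_onI wrapped_gauss_continuous c)
  have wg0: "0 \<le> wrapped_gauss c u" for u using wrapped_gauss_ge[OF c, of u] exp_ge_zero order_trans by blast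
  have s: "(\<Sum>n. ennreal (exp (- (c * (z - (x + of_int (int_decode n)))\<^sup>2)))) = ennreal (wrapped_gauss c (x - z))" for x
  proof -
    have sq: "(z - (x + of_int m))\<^sup>2 = ((x - z) + of_int m)\<^sup>2" for m by (simp add: power2_eq_square algebra_simps)
    have n: "(\<lambda>m::int. norm (exp (- (c * ((x - z) + of_int m)\<^sup>2)))) summable_on UNIV"
      using wrapped_gauss_summable[OF c, of "x - z"] by simp
    show ?thesis unfolding sq wrapped_gauss_def infsum_int_eq_suminf(1)[OF n]
      using infsum_int_eq_suminf(2)[OF n] by (intro suminf_ennreal2) auto
  qed
  have "(\<integral>\<^sup>+x. ennreal (exp (- (c * (z - x)\<^sup>2))) \<partial>\<nu>) = (\<integral>\<^sup>+x\<in>{0..<1}. ennreal (wrapped_gauss c (x - z)) \<partial>\<nu>)"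
    by (subst nn_integral_unfold_periods[OF assumption_B_coeff(5)[OF B] sets]) (auto simp: s)
  also have "\<dots> = (\<integral>\<^sup>+x. ennreal (wrapped_gauss c (x - z)) \<partial>restrict_space \<nu> {0..<1})"
    by (subst nn_integral_restrict_space) (auto simp: sets sp)
  finally have e: "(\<integral>\<^sup>+x. ennreal (exp (- (c * (z - x)\<^sup>2))) \<partial>\<nu>)
     = (\<integral>\<^sup>+x. ennreal (wrapped_gauss c (x - z)) \<partial>restrict_space \<nu> {0..<1})" .
  have "(LINT x|\<nu>. exp (- (c * (z - x)\<^sup>2))) = enn2real (\<integral>\<^sup>+x. ennreal (exp (- (c * (z - x)\<^sup>2))) \<partial>\<nu>)"
    by (rule integral_eq_nn_integral) auto
  moreover have "(LINT x|restrict_space \<nu> {0..<1}. wrapped_gauss c (x - z))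
      = enn2real (\<integral>\<^sup>+x. ennreal (wrapped_gauss c (x - z)) \<partial>restrict_space \<nu> {0..<1})"
    by (rule integral_eq_nn_integral) (auto intro!: measurable_restrict_space1 simp: wg0)
  ultimately show ?thesis using e by simp
qed

text \<open>After folding, Poisson's formula expands the kernel, and integrating it term by term
  against \<nu> produces the coefficients of \<nu>. The lower bound is that of the periodized
  Gaussian times the mass of one period.\<close>

lemma potential_base:
  assumes B: "assumption_B \<nu>" and c: "0 < c"
  defines "f \<equiv> \<lambda>q. sqrt (pi / c) * (gauss_seq (pi\<^sup>2 / c) q * mcoeff \<nu> q)"
  shows "nnsym f" "(LINT x|\<nu>. exp (- (c * (z - x)\<^sup>2))) = rser f z" "exp (- c) * mcoeff \<nu> 0 \<le> rser f z"
proof -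
  define \<nu>0 where "\<nu>0 = restrict_space \<nu> {0..<1}"
  note R = assumption_B_restrict[OF B, folded \<nu>0_def]
  note sets = assumption_B_coeff(4)[OF B]
  have [measurable_cong]: "sets \<nu> = sets borel" by (rule sets)
  interpret finite_measure \<nu>0 by (rule R)
  have g: "nnsym (gauss_seq (pi\<^sup>2 / c))" using c by (intro nnsym_gauss_seq) auto
  show f: "nnsym f" unfolding f_def
    by (intro nnsym_scale nnsym_mult_bounded[OF g _ R(3)]) (use c assumption_B_coeff[OF B] in \<open>auto intro: less_imp_le\<close>)
  have m1: "h \<in> borel_measurable \<nu>0" if "h \<in> borel_measurable borel" for h :: "real \<Rightarrow> 'c::topological_space"
    unfolding \<nu>0_def using that by (intro measurable_restrict_space1) (simp cong: measurable_cong_sets add: sets)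
  have wm: "(\<lambda>x. wrapped_gauss c (x - z)) \<in> borel_measurable \<nu>0"
  proof (rule m1)
    have [measurable]: "wrapped_gauss c \<in> borel_measurable borel"
      by (intro borel_measurable_continuous_onI wrapped_gauss_continuous c)
    show "(\<lambda>x. wrapped_gauss c (x - z)) \<in> borel_measurable borel" by measurable
  qed
  let ?G = "gauss_seq (pi\<^sup>2 / c)"
  have "complex_of_real (LINT x|\<nu>0. wrapped_gauss c (x - z)) = (LINT x|\<nu>0. complex_of_real (wrapped_gauss c (x - z)))"
    by simp
  also have "\<dots> = (LINT x|\<nu>0. (\<Sum>\<^sub>\<infinity>q. of_real (sqrt (pi / c) * ?G q) * cexpo (- q) z * cexpo q x))"
  proof (intro Bochner_Integration.integral_cong refl)
    fix x
    have "complex_of_real (wrapped_gauss c (x - z)) = of_real (sqrt (pi / c)) * cser ?G (x - z)"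
      by (simp add: poisson_gauss[OF c] cser_eq_rser[OF g])
    also have "\<dots> = (\<Sum>\<^sub>\<infinity>q. of_real (sqrt (pi / c)) * (of_real (?G q) * cexpo q (x - z)))"
      unfolding cser_def by (rule infsum_cmult_right'[symmetric])
    also have "\<dots> = (\<Sum>\<^sub>\<infinity>q. of_real (sqrt (pi / c) * ?G q) * cexpo (- q) z * cexpo q x)"
      by (intro infsum_cong) (simp add: cexpo_def cis_mult algebra_simps)
    finally show "complex_of_real (wrapped_gauss c (x - z)) = (\<Sum>\<^sub>\<infinity>q. of_real (sqrt (pi / c) * ?G q) * cexpo (- q) z * cexpo q x)" .
  qed
  also have "\<dots> = (\<Sum>\<^sub>\<infinity>q. (LINT x|\<nu>0. of_real (sqrt (pi / c) * ?G q) * cexpo (- q) z * cexpo q x))"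
  proof (rule integral_infsum_int[OF R(1)])
    show "(\<lambda>q. sqrt (pi / c) * ?G q) summable_on UNIV" by (rule summable_on_cmult_right[OF nnsymD(2)[OF g]])
    show "norm (of_real (sqrt (pi / c) * ?G q) * cexpo (- q) z * cexpo q x) \<le> sqrt (pi / c) * ?G q" for q x
      using c nnsymD(1)[OF g, of q] by (simp add: norm_mult)
    show "(\<lambda>x. of_real (sqrt (pi / c) * ?G q) * cexpo (- q) z * cexpo q x) \<in> borel_measurable \<nu>0" for q
      by (intro borel_measurable_times borel_measurable_const m1 cexpo_measurable)
  qed
  also have "\<dots> = (\<Sum>\<^sub>\<infinity>q. of_real (f q) * cexpo (- q) z)"
    by (intro infsum_cong) (simp add: R(2) f_def mult_ac)
  also have "\<dots> = cser f z" unfolding cser_def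
    by (rule infsum_reindex_bij_witness[of _ uminus uminus]) (auto simp: nnsymD(3)[OF f])
  finally have eq: "(LINT x|\<nu>0. wrapped_gauss c (x - z)) = rser f z"
    unfolding cser_eq_rser[OF f] of_real_eq_iff .
  show "(LINT x|\<nu>. exp (- (c * (z - x)\<^sup>2))) = rser f z"
    unfolding gauss_integral_periodic[OF B c] \<nu>0_def[symmetric] eq ..
  have "\<bar>wrapped_gauss c u\<bar> \<le> sqrt (pi / c) * infsum ?G UNIV" for u
    unfolding poisson_gauss[OF c] abs_mult using rser_abs_le[OF g, of u] c by (simp add: mult_left_mono)
  then have wi: "integrable \<nu>0 (\<lambda>x. wrapped_gauss c (x - z))"
    by (intro integrable_const_bound[of _ "sqrt (pi / c) * infsum ?G UNIV"] wm) auto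
  have "exp (- c) * mcoeff \<nu> 0 = (LINT x|\<nu>0. exp (- c))" by (simp add: R(4))
  also have "\<dots> \<le> (LINT x|\<nu>0. wrapped_gauss c (x - z))"
    by (intro integral_mono wi wrapped_gauss_ge c) simp
  finally show "exp (- c) * mcoeff \<nu> 0 \<le> rser f z" by (simp only: eq)
qed

lemma gauss_smoothing:
  assumes f: "nnsym f" and s: "0 < s"
  shows "(LINT x|centered_normal s. rser f (z + x)) = rser (\<lambda>q. gauss_seq (2 * pi\<^sup>2 * s) q * f q) z"
proof -
  interpret prob_space "centered_normal s" by (rule prob_space_centered_normal[OF s])
  have [measurable_cong]: "sets (centered_normal s) = sets borel" by (rule sets_centered_normal)
  have gf: "nnsym (\<lambda>q. gauss_seq (2 * pi\<^sup>2 * s) q * f q)"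
    using s by (intro nnsym_mult nnsym_gauss_seq f) auto
  have "complex_of_real (LINT x|centered_normal s. rser f (z + x)) = (LINT x|centered_normal s. cser f (z + x))"
    by (simp add: cser_eq_rser[OF f])
  also have "\<dots> = (LINT x|centered_normal s. (\<Sum>\<^sub>\<infinity>q. of_real (f q) * cexpo q z * cexpo q x))"
    by (simp add: cser_def cexpo_add_arg mult.assoc)
  also have "\<dots> = (\<Sum>\<^sub>\<infinity>q. (LINT x|centered_normal s. of_real (f q) * cexpo q z * cexpo q x))"
    by (rule integral_infsum_int[OF finite_measure_axioms _ _ nnsymD(2)[OF f]])
      (auto simp: norm_mult nnsymD(1)[OF f])
  also have "\<dots> = (\<Sum>\<^sub>\<infinity>q. of_real (gauss_seq (2 * pi\<^sup>2 * s) q * f q) * cexpo q z)"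
    by (intro infsum_cong) (simp add: integral_centered_normal_cexpo[OF s] gauss_seq_def mult_ac)
  also have "\<dots> = of_real (rser (\<lambda>q. gauss_seq (2 * pi\<^sup>2 * s) q * f q) z)"
    using cser_eq_rser[OF gf, of z] by (simp add: cser_def)
  finally show ?thesis using of_real_eq_iff by blast
qed

section \<open>Fourier coefficients of the potentials\<close>

text \<open>Normalized so that exp (- kap \<beta> 1) is \<open>theta \<beta>\<close>. The second
  argument is the variance, not the standard deviation.\<close>

definition kap :: "real \<Rightarrow> real \<Rightarrow> real" where
  "kap \<beta> \<sigma> = 2 * pi\<^sup>2 * (\<sigma> / \<beta>)"

text \<open>\<open>act b \<beta> \<nu> s k q\<close> is the Fourier coefficient $a_k(q)$: raising to the power \<open>b\<close> becomes a convolution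
  power, and averaging over a centred normal law of variance $\sigma^2/\beta$ multiplies the coefficient
  at \<open>q\<close> by \<open>exp (- kap \<beta> \<sigma>\<^sup>2 * q\<^sup>2)\<close>.\<close>

primrec act :: "nat \<Rightarrow> real \<Rightarrow> real measure \<Rightarrow> (nat \<Rightarrow> real) \<Rightarrow> nat \<Rightarrow> int \<Rightarrow> real" where
  "act b \<beta> \<nu> s 0 = (\<lambda>q. sqrt (2 * pi * s 0 / \<beta>) * (gauss_seq (kap \<beta> (s 0)) q * mcoeff \<nu> q))"
| "act b \<beta> \<nu> s (Suc k) = (\<lambda>q. gauss_seq (kap \<beta> (s (Suc k))) q * cpow (act b \<beta> \<nu> s k) b q)"

lemma cpow_pos:
  assumes f: "nnsym f" and pos: "\<And>q. 0 < f q" and j: "0 < j"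
  shows "0 < cpow f j q"
proof -
  have st: "0 < cpow f (Suc j) q" if "0 < cpow f j 0" for j q
  proof -
    have "f q * cpow f j 0 \<le> cpow f (Suc j) q"
      using conv_cong_mono[OF f nnsym_cpow[OF f], of "{q}" j q] by simp
    moreover have "0 < f q * cpow f j 0" using that pos by simp
    ultimately show ?thesis by linarith
  qed
  have "0 < cpow f j 0" for j by (induction j) (use st in auto)
  then show ?thesis using j st by (metis gr0_conv_Suc)
qed

lemma gauss_seq_pos: "0 < gauss_seq c q" by (simp add: gauss_seq_def)

lemma gauss_seq_0 [simp]: "gauss_seq c 0 = 1" by (simp add: gauss_seq_def)

lemma gauss_min_pos: "0 < c \<Longrightarrow> 0 < gauss_min c" by (simp add: gauss_min_def)

text \<open>The claims support each other: the lower bound makes the integral positive, so that exp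
  undoes - ln; the resulting representation makes the next function nonnegative; and nonnegativity
  bounds every coefficient of the convolution power by the one at 0. The last two claims involve
  only the latest variance, because each step convolves afresh with a Gaussian.\<close>

lemma act_properties:
  assumes B: "assumption_B \<nu>" and \<beta>: "0 < \<beta>" and b: "2 \<le> b" and s: "\<And>j. j \<le> k \<Longrightarrow> 0 < s j"
  shows "nnsym (act b \<beta> \<nu> s k) \<and> (\<forall>q. 0 < act b \<beta> \<nu> s k q) \<and>
    (\<forall>z. exp (- potential b \<beta> \<nu> s k z) = rser (act b \<beta> \<nu> s k) z) \<and>
    (\<forall>z. gauss_min (kap \<beta> (s k)) * act b \<beta> \<nu> s k 0 \<le> rser (act b \<beta> \<nu> s k) z) \<and>
    (\<forall>q. act b \<beta> \<nu> s k q \<le> gauss_seq (kap \<beta> (s k)) q * act b \<beta> \<nu> s k 0)"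
  using s
proof (induction k)
  case 0
  define c where "c = \<beta> / (2 * s 0)"
  have s0: "0 < s 0" using 0 by simp
  have c: "0 < c" using s0 \<beta> by (simp add: c_def)
  have k: "pi\<^sup>2 / c = kap \<beta> (s 0)" "sqrt (pi / c) = sqrt (2 * pi * s 0 / \<beta>)"
    using s0 \<beta> by (simp_all add: c_def kap_def field_simps)
  note P = potential_base[OF B c, unfolded k]
  note m = assumption_B_coeff[OF B]
  have pe: "- (1 / 2 * \<beta> * inverse (s 0) * (z - x)\<^sup>2) = - (c * (z - x)\<^sup>2)" for z x
    by (simp add: c_def field_simps)
  have lower: "gauss_min (kap \<beta> (s 0)) * act b \<beta> \<nu> s 0 0 = exp (- c) * mcoeff \<nu> 0"
  proof -
    have "pi\<^sup>2 / kap \<beta> (s 0) = c" "sqrt (pi / kap \<beta> (s 0)) * sqrt (2 * pi * s 0 / \<beta>) = 1"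
      using s0 \<beta> by (simp_all add: c_def kap_def field_simps power2_eq_square flip: real_sqrt_mult)
    then show ?thesis by (simp add: gauss_min_def)
  qed
  have pos: "0 < rser (act b \<beta> \<nu> s 0) z" for z
  proof -
    have "0 < exp (- c) * mcoeff \<nu> 0" using m(2) by simp
    also have "\<dots> \<le> rser (act b \<beta> \<nu> s 0) z" using P(3) by simp
    finally show ?thesis .
  qed
  have "exp (- potential b \<beta> \<nu> s 0 z) = rser (act b \<beta> \<nu> s 0) z" for z
    using pos[of z] P(2)[of z] unfolding potential.simps pe by simp
  moreover have "gauss_min (kap \<beta> (s 0)) * act b \<beta> \<nu> s 0 0 \<le> rser (act b \<beta> \<nu> s 0) z" for z
    using P(3) unfolding lower by simp
  moreover have "0 < act b \<beta> \<nu> s 0 q" for q using m(2) s0 \<beta> gauss_seq_pos by simp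
  moreover have "act b \<beta> \<nu> s 0 q \<le> gauss_seq (kap \<beta> (s 0)) q * act b \<beta> \<nu> s 0 0" for q
    using assumption_B_restrict(3)[OF B, of q] s0 \<beta> gauss_seq_pos[of "kap \<beta> (s 0)" q]
    by (simp add: mult_left_mono mult.left_commute less_imp_le divide_right_mono)
  ultimately show ?case using P(1) by simp
next
  case (Suc k)
  let ?f = "act b \<beta> \<nu> s k" and ?F = "act b \<beta> \<nu> s (Suc k)"
  have sk: "0 < s (Suc k)" "0 < s k" using Suc.prems by auto
  have \<kappa>: "0 < kap \<beta> (s (Suc k))" "0 < kap \<beta> (s k)" using sk \<beta> by (auto simp: kap_def)
  have IH: "nnsym ?f" "\<And>q. 0 < ?f q" "\<And>z. exp (- potential b \<beta> \<nu> s k z) = rser ?f z"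
    using Suc by auto
  have pos: "0 \<le> rser ?f z" for z unfolding IH(3)[symmetric] by simp
  have c: "nnsym (cpow ?f b)" by (rule nnsym_cpow[OF IH(1)])
  have c0: "0 < cpow ?f b q" for q by (rule cpow_pos[OF IH(1,2)]) (use b in auto)
  have F: "nnsym ?F" using nnsym_mult[OF nnsym_gauss_seq[OF \<kappa>(1)] c] by simp
  have Fpos: "0 < ?F q" for q using c0 gauss_seq_pos by simp
  have low: "gauss_min (kap \<beta> (s (Suc k))) * ?F 0 \<le> rser ?F z" for z
    using rser_mult_ge[OF nnsym_gauss_seq[OF \<kappa>(1)] c _ rser_gauss_ge[OF \<kappa>(1)], of z] pos
    by (simp add: rser_cpow[OF IH(1)])
  have pe: "exp (- (real b * potential b \<beta> \<nu> s k x)) = rser (cpow ?f b) x" for x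
    unfolding rser_cpow[OF IH(1)] IH(3)[symmetric] by (simp flip: exp_of_nat_mult)
  have "(LINT \<zeta>|centered_normal (s (Suc k) / \<beta>). exp (- (real b * potential b \<beta> \<nu> s k (z + \<zeta>)))) = rser ?F z" for z
    unfolding pe using sk \<beta> by (subst gauss_smoothing[OF c]) (simp_all add: kap_def mult.assoc)
  moreover have "0 < rser ?F z" for z
    using low[of z] mult_pos_pos[OF gauss_min_pos[OF \<kappa>(1)] Fpos[of 0]] by linarith
  ultimately have "exp (- potential b \<beta> \<nu> s (Suc k) z) = rser ?F z" for z by simp
  moreover have "?F q \<le> gauss_seq (kap \<beta> (s (Suc k))) q * ?F 0" for q
    using cpow_le_zero_coeff[OF IH(1) pos] gauss_seq_pos[of "kap \<beta> (s (Suc k))" q] by (simp add: mult_left_mono)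
  ultimately show ?case using F Fpos low by blast
qed

lemma activity_eq:
  assumes f: "nnsym f" and e: "\<And>z. exp (- v z) = rser f z"
  shows "activity v q = of_real (f q)"
proof -
  have x: "exp (of_real (- v z) - 2 * of_real pi * \<i> * of_int q * of_real z) = cser f z * cexpo (- q) z" for z
  proof -
    have "exp (of_real (- v z) - 2 * of_real pi * \<i> * of_int q * of_real z)
        = exp (complex_of_real (- v z)) * exp (- (2 * of_real pi * \<i> * of_int q * of_real z))"
      by (simp add: exp_diff exp_minus divide_inverse)
    also have "exp (complex_of_real (- v z)) = cser f z"
      unfolding exp_of_real cser_eq_rser[OF f] e ..
    also have "exp (- (2 * of_real pi * \<i> * of_int q * of_real z)) = cexpo (- q) z"
      by (simp add: cexpo_def cis_conv_exp algebra_simps)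
    finally show ?thesis .
  qed
  have "set_integrable lborel {0..1} (\<lambda>z. cser f z * cexpo (- q) z)"
    by (intro borel_integrable_atLeastAtMost' continuous_intros cser_continuous f)
  from set_borel_integral_eq_integral(2)[OF this] show ?thesis
    unfolding activity_def x cser_coeff[OF f] by simp
qed

subsection \<open>Derivatives\<close>

text \<open>The m-th derivative of \<open>rser f\<close>; the phase m pi / 2 avoids distinguishing m
  modulo 4.\<close>

definition dser :: "nat \<Rightarrow> (int \<Rightarrow> real) \<Rightarrow> real \<Rightarrow> real" where
  "dser m f z = (\<Sum>\<^sub>\<infinity>q. f q * (2 * pi * of_int q) ^ m * cos (2 * pi * of_int q * z + real m * (pi / 2)))"

definition gmom :: "real \<Rightarrow> nat \<Rightarrow> real" where
  "gmom \<kappa> m = (\<Sum>\<^sub>\<infinity>q::int. gauss_seq \<kappa> q * \<bar>2 * pi * of_int q\<bar> ^ m)"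

lemma gmom_summable: assumes "0 < \<kappa>"
  shows "(\<lambda>q::int. gauss_seq \<kappa> q * \<bar>2 * pi * of_int q\<bar> ^ m) summable_on UNIV"
  using summable_on_cmult_right[OF gauss_poly_summable[OF assms, of m], of "(2 * pi) ^ m"]
  by (simp add: gauss_seq_def power_mult_distrib abs_mult mult_ac)

lemma gmom_nonneg: "0 \<le> gmom \<kappa> m"
  unfolding gmom_def by (intro infsum_nonneg) (simp add: gauss_seq_def)

lemma dser_term_bound:
  assumes "\<bar>f q\<bar> \<le> A * gauss_seq \<kappa> q"
  shows "\<bar>f q * (2 * pi * of_int q) ^ m * cos u\<bar> \<le> A * (gauss_seq \<kappa> q * \<bar>2 * pi * of_int q\<bar> ^ m)"
proof -
  have "\<bar>f q * (2 * pi * of_int q) ^ m * cos u\<bar> \<le> \<bar>f q\<bar> * \<bar>2 * pi * of_int q\<bar> ^ m * 1"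
    unfolding abs_mult power_abs by (intro mult_left_mono) (auto simp: abs_mult)
  also have "\<dots> \<le> A * gauss_seq \<kappa> q * \<bar>2 * pi * of_int q\<bar> ^ m"
    using assms by (simp add: mult_right_mono)
  finally show ?thesis by (simp add: mult.assoc)
qed

lemma dser_bound:
  assumes k: "0 < \<kappa>" and f: "\<And>q. \<bar>f q\<bar> \<le> A * gauss_seq \<kappa> q"
  shows "\<bar>dser m f z\<bar> \<le> A * gmom \<kappa> m"
    "(\<lambda>q. f q * (2 * pi * of_int q) ^ m * cos (2 * pi * of_int q * z + real m * (pi / 2))) summable_on UNIV"
proof -
  have s: "(\<lambda>q. A * (gauss_seq \<kappa> q * \<bar>2 * pi * of_int q\<bar> ^ m)) summable_on UNIV"
    by (rule summable_on_cmult_right[OF gmom_summable[OF k]])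
  have b: "norm (f q * (2 * pi * of_int q) ^ m * cos (2 * pi * of_int q * z + real m * (pi / 2)))
      \<le> A * (gauss_seq \<kappa> q * \<bar>2 * pi * of_int q\<bar> ^ m)" for q
    using dser_term_bound[where f = f and q = q, OF f] by simp
  show s': "(\<lambda>q. f q * (2 * pi * of_int q) ^ m * cos (2 * pi * of_int q * z + real m * (pi / 2))) summable_on UNIV"
    by (rule summable_on_norm_bound(2)[OF s b])
  have "norm (dser m f z) \<le> infsum (\<lambda>q. A * (gauss_seq \<kappa> q * \<bar>2 * pi * of_int q\<bar> ^ m)) UNIV"
    unfolding dser_def by (rule norm_infsum_le[OF has_sum_infsum[OF s'] has_sum_infsum[OF s] b])
  then show "\<bar>dser m f z\<bar> \<le> A * gmom \<kappa> m" by (simp add: gmom_def infsum_cmult_right')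
qed

lemma dser_deriv:
  assumes k: "0 < \<kappa>" and f: "\<And>q. \<bar>f q\<bar> \<le> A * gauss_seq \<kappa> q"
  shows "(dser m f has_real_derivative dser (Suc m) f z) (at z)"
  unfolding dser_def[abs_def]
proof (rule infsum_int_has_derivative[where B = "\<lambda>q. A * (gauss_seq \<kappa> q * \<bar>2 * pi * of_int q\<bar> ^ m)"
      and B' = "\<lambda>q. A * (gauss_seq \<kappa> q * \<bar>2 * pi * of_int q\<bar> ^ Suc m)"])
  show "((\<lambda>z. f q * (2 * pi * of_int q) ^ m * cos (2 * pi * of_int q * z + real m * (pi / 2))) has_real_derivative
       f q * (2 * pi * of_int q) ^ Suc m * cos (2 * pi * of_int q * x + real (Suc m) * (pi / 2))) (at x)" for q x
  proof -
    have "cos (2 * pi * of_int q * x + real (Suc m) * (pi / 2)) = - sin (2 * pi * of_int q * x + real m * (pi / 2))"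
    proof -
      have e: "real (Suc m) * (pi / 2) = real m * (pi / 2) + pi / 2" by (simp add: algebra_simps)
      show ?thesis unfolding e add.assoc[symmetric] by (simp add: minus_sin_cos_eq add_ac)
    qed
    then show ?thesis by (auto intro!: derivative_eq_intros)
  qed
qed (rule dser_term_bound[OF f] summable_on_cmult_right[OF gmom_summable[OF k]])+

lemma rser_eq_dser: "rser f = dser 0 f"
  by (simp add: rser_def dser_def fun_eq_iff)

text \<open>The algebra generated by the \<open>D m\<close> and \<open>1 / D 0\<close> is closed under differentiation, so \<open>- ln (D 0)\<close> is smooth.\<close>

inductive dalg :: "(nat \<Rightarrow> real \<Rightarrow> real) \<Rightarrow> (real \<Rightarrow> real) \<Rightarrow> bool" for D where
  gen: "dalg D (D m)"
| inv: "dalg D (\<lambda>z. inverse (D 0 z))"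
| add: "dalg D f \<Longrightarrow> dalg D g \<Longrightarrow> dalg D (\<lambda>z. f z + g z)"
| mult: "dalg D f \<Longrightarrow> dalg D g \<Longrightarrow> dalg D (\<lambda>z. f z * g z)"
| neg: "dalg D f \<Longrightarrow> dalg D (\<lambda>z. - f z)"

lemma dalg_deriv:
  assumes "dalg D f" and D: "\<And>m z. (D m has_real_derivative D (Suc m) z) (at z)" and pos: "\<And>z. D 0 z \<noteq> 0"
  shows "\<exists>f'. dalg D f' \<and> (\<forall>z. (f has_real_derivative f' z) (at z))"
  using assms(1)
proof induction
  case (gen m)
  then show ?case using D dalg.gen by blast
next
  case inv
  have "dalg D (\<lambda>z. - (inverse (D 0 z) * D 1 z * inverse (D 0 z)))"
    by (intro dalg.intros)
  moreover have "((\<lambda>z. inverse (D 0 z)) has_real_derivative - (inverse (D 0 z) * D 1 z * inverse (D 0 z))) (at z)" for z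
    using pos D[of 0 z] by (auto intro!: derivative_eq_intros)
  ultimately show ?case by blast
next
  case (add f g)
  then obtain f' g' where "dalg D f'" "dalg D g'"
    "\<And>z. (f has_real_derivative f' z) (at z)" "\<And>z. (g has_real_derivative g' z) (at z)" by blast
  then show ?case by (intro exI[of _ "\<lambda>z. f' z + g' z"]) (auto intro!: dalg.intros derivative_eq_intros)
next
  case (mult f g)
  then obtain f' g' where "dalg D f'" "dalg D g'"
    "\<And>z. (f has_real_derivative f' z) (at z)" "\<And>z. (g has_real_derivative g' z) (at z)" by blast
  then show ?case using mult.hyps
    by (intro exI[of _ "\<lambda>z. f' z * g z + g' z * f z"]) (auto intro!: dalg.intros derivative_eq_intros)
next
  case (neg f)
  then obtain f' where "dalg D f'" "\<And>z. (f has_real_derivative f' z) (at z)" by blast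
  then show ?case by (intro exI[of _ "\<lambda>z. - f' z"]) (auto intro!: dalg.intros derivative_eq_intros)
qed

lemma smooth_neg_ln:
  assumes D: "\<And>m z. (D m has_real_derivative D (Suc m) z) (at z)" and pos: "\<And>z. 0 < D 0 z"
  defines "v \<equiv> \<lambda>z. - ln (D 0 z)"
  shows "smooth_real v" "deriv v = (\<lambda>z. - (D 1 z / D 0 z))"
    "deriv (deriv v) = (\<lambda>z. (D 1 z / D 0 z)\<^sup>2 - D 2 z / D 0 z)"
    "(v has_real_derivative - (D 1 z / D 0 z)) (at z)"
proof -
  have d: "(v has_real_derivative - (D 1 z / D 0 z)) (at z)" for z
    unfolding v_def using pos[of z] D[of 0 z] by (auto intro!: derivative_eq_intros)
  then show "(v has_real_derivative - (D 1 z / D 0 z)) (at z)" .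
  show dv: "deriv v = (\<lambda>z. - (D 1 z / D 0 z))" using d DERIV_imp_deriv by blast
  have "((\<lambda>z. - (D 1 z / D 0 z)) has_real_derivative (D 1 z / D 0 z)\<^sup>2 - D 2 z / D 0 z) (at z)" for z
    using pos[of z] D[of 0 z] D[of 1 z] unfolding numeral_2_eq_2
    by (auto intro!: derivative_eq_intros simp: field_simps power2_eq_square)
  then show "deriv (deriv v) = (\<lambda>z. (D 1 z / D 0 z)\<^sup>2 - D 2 z / D 0 z)"
    unfolding dv using DERIV_imp_deriv by blast
  have nz: "D 0 z \<noteq> 0" for z using pos[of z] by simp
  have alg: "dalg D ((deriv ^^ m) f) \<and> (\<forall>x. (deriv ^^ m) f differentiable (at x))" if "dalg D f" for m f
    using that
  proof (induction m arbitrary: f)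
    case 0
    then show ?case using dalg_deriv[OF 0 D nz] real_differentiable_def by auto
  next
    case (Suc m)
    obtain f' where f': "dalg D f'" "\<And>z. (f has_real_derivative f' z) (at z)" using dalg_deriv[OF Suc.prems D nz] by auto
    then have "deriv f = f'" using DERIV_imp_deriv by blast
    then show ?case using Suc.IH[OF f'(1)] by (simp add: funpow_swap1)
  qed
  have "dalg D (deriv v)" unfolding dv divide_inverse by (intro dalg.intros)
  then have "(deriv ^^ m) v differentiable (at x)" for m x
  proof (cases m)
    case 0
    then show ?thesis using d real_differentiable_def by auto
  next
    case (Suc k)
    then show ?thesis using alg[OF \<open>dalg D (deriv v)\<close>, of k] by (simp add: funpow_swap1)
  qed
  then show "smooth_real v" by (simp add: smooth_real_def)
qed

text \<open>The scale f 0 cancels in the quotients of derivatives by the function, so the bounds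
  depend on \<kappa> and c alone and are uniform along a trajectory.\<close>

lemma potential_derivatives:
  assumes k: "0 < \<kappa>" and f: "\<And>q. \<bar>f q\<bar> \<le> f 0 * gauss_seq \<kappa> q" and f0: "0 < f 0"
    and c: "0 < c" and low: "\<And>z. c * f 0 \<le> rser f z" and v: "\<And>z. exp (- v z) = rser f z"
  shows "smooth_real v" "deriv v z = - (dser 1 f z / rser f z)" "\<bar>deriv v z\<bar> \<le> gmom \<kappa> 1 / c"
    "\<bar>deriv (deriv v) z\<bar> \<le> (gmom \<kappa> 1 / c)\<^sup>2 + gmom \<kappa> 2 / c" "v differentiable (at z)"
proof -
  have pos: "0 < dser 0 f z" for z
    using low[of z] mult_pos_pos[OF c f0] unfolding rser_eq_dser by linarith
  have ve: "v = (\<lambda>z. - ln (dser 0 f z))" using v unfolding rser_eq_dser by (metis ln_exp minus_minus)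
  note S = smooth_neg_ln[where D = "\<lambda>m. dser m f", OF dser_deriv[OF k f] pos, folded ve]
  show "smooth_real v" by (rule S(1))
  show "v differentiable (at z)" using S(4) real_differentiable_def by blast
  show "deriv v z = - (dser 1 f z / rser f z)" by (simp add: S(2) rser_eq_dser)
  have r: "\<bar>dser m f z / dser 0 f z\<bar> \<le> gmom \<kappa> m / c" for m
  proof -
    have "\<bar>dser m f z / dser 0 f z\<bar> \<le> (f 0 * gmom \<kappa> m) / (c * f 0)"
      unfolding abs_divide using dser_bound(1)[OF k f, of m z] pos[of z] low[of z] c f0 gmom_nonneg
      by (intro frac_le) (auto simp: rser_eq_dser)
    then show ?thesis using f0 by simp
  qed
  show "\<bar>deriv v z\<bar> \<le> gmom \<kappa> 1 / c" using r[of 1] by (simp add: S(2))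
  have "\<bar>deriv (deriv v) z\<bar> \<le> \<bar>dser 1 f z / dser 0 f z\<bar>\<^sup>2 + \<bar>dser 2 f z / dser 0 f z\<bar>"
    unfolding S(3) power2_abs by (rule order_trans[OF abs_triangle_ineq4]) simp
  also have "\<dots> \<le> (gmom \<kappa> 1 / c)\<^sup>2 + gmom \<kappa> 2 / c" by (intro add_mono power_mono r) auto
  finally show "\<bar>deriv (deriv v) z\<bar> \<le> (gmom \<kappa> 1 / c)\<^sup>2 + gmom \<kappa> 2 / c" .
qed

section \<open>Normalized sequences and integrals known up to an error\<close>

definition unit_seq :: "(int \<Rightarrow> real) \<Rightarrow> bool" where
  "unit_seq f \<longleftrightarrow> nnsym f \<and> f 0 = 1"

lemma infsum_sym_split:
  fixes d :: "int \<Rightarrow> real"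
  assumes s: "d summable_on UNIV" and sym: "\<And>q. d (- q) = d q"
  shows "infsum d UNIV = d 0 + 2 * d 1 + 2 * (\<Sum>\<^sub>\<infinity>q\<in>{2..}. d q)"
proof -
  have sa: "d summable_on A" for A using s summable_on_subset_banach by blast
  have U: "(UNIV::int set) = ({-1, 0, 1} \<union> {2..}) \<union> {..-2}" by auto
  have "infsum d UNIV = infsum d {-1, 0, 1} + infsum d {2..} + infsum d {..-2}"
    by (subst U, subst infsum_Un_disjoint, (auto intro!: sa)[3], subst infsum_Un_disjoint) (auto intro!: sa)
  moreover have "infsum d {..-2} = infsum d {2..}"
    by (rule infsum_reindex_bij_witness[of _ uminus uminus]) (auto simp: sym)
  moreover have "infsum d {-1, 0, 1} = d 0 + 2 * d 1" using sym[of 1] by (simp add: infsum_finite)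
  ultimately show ?thesis by linarith
qed

text \<open>Continuity is bundled with the approximate value, so that integrability is carried along
  when main terms and errors are added up.\<close>

definition approx_int :: "(real \<Rightarrow> real) \<Rightarrow> real \<Rightarrow> real \<Rightarrow> bool" where
  "approx_int \<phi> a e \<longleftrightarrow> continuous_on UNIV \<phi> \<and> \<bar>integral {0..1} \<phi> - a\<bar> \<le> e"

lemma cont_integrable_01: "continuous_on UNIV \<phi> \<Longrightarrow> (\<phi> :: real \<Rightarrow> real) integrable_on {0..1}"
  by (rule integrable_continuous_interval, rule continuous_on_subset[of UNIV]) auto

lemma approx_int_add:
  assumes "approx_int \<phi> a e" "approx_int \<psi> a' e'"
  shows "approx_int (\<lambda>z. \<phi> z + \<psi> z) (a + a') (e + e')"
  using assms unfolding approx_int_def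
  by (auto simp: Henstock_Kurzweil_Integration.integral_add[OF cont_integrable_01 cont_integrable_01] intro!: continuous_intros)

lemma approx_int_scale:
  assumes "approx_int \<phi> a e"
  shows "approx_int (\<lambda>z. c * \<phi> z) (c * a) (\<bar>c\<bar> * e)"
  using assms unfolding approx_int_def
  by (auto simp: abs_mult mult_left_mono simp flip: right_diff_distrib intro!: continuous_intros)

lemma approx_int_bound:
  assumes "continuous_on UNIV \<phi>" "\<And>z. \<bar>\<phi> z\<bar> \<le> e"
  shows "approx_int \<phi> 0 e"
proof -
  have "norm (integral {0..1} \<phi>) \<le> e * (1 - 0)"
    by (rule integral_bound) (use assms continuous_on_subset[OF assms(1)] in auto)
  then show ?thesis using assms by (simp add: approx_int_def)
qed

lemma approx_int_exact: "continuous_on UNIV \<phi> \<Longrightarrow> integral {0..1} \<phi> = a \<Longrightarrow> approx_int \<phi> a 0"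
  by (simp add: approx_int_def)

lemma approx_int_weaken: "approx_int \<phi> a e \<Longrightarrow> a = a' \<Longrightarrow> e \<le> e' \<Longrightarrow> (\<And>z. \<phi> z = \<psi> z) \<Longrightarrow> approx_int \<psi> a' e'"
  unfolding approx_int_def by (metis (no_types, lifting) ext order_trans)

lemma integral_cos: "integral {0..1} (\<lambda>z. cos (2 * pi * of_int q * z)) = (if q = 0 then 1 else 0)"
proof -
  have "(cexpo q has_integral (if q = 0 then 1 else 0)) {0..1}"
    unfolding integral_cexpo[symmetric]
    by (intro integrable_integral integrable_continuous_interval continuous_intros)
  from has_integral_Re[OF this] show ?thesis
    by (intro integral_unique) (simp add: cexpo_def if_distrib cong: if_cong)
qed

abbreviation cosq :: "int \<Rightarrow> real \<Rightarrow> real" where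
  "cosq q z \<equiv> cos (2 * pi * of_int q * z)"

lemma approx_cos: "approx_int (cosq q) (if q = 0 then 1 else 0) 0"
  by (rule approx_int_exact) (auto intro!: continuous_intros simp: integral_cos)

lemma cosq_mult: "cosq p z * cosq q z = (cosq (p + q) z + cosq (p - q) z) / 2"
  by (simp add: cos_times_cos algebra_simps)

lemma approx_cos_mult: "approx_int (\<lambda>z. cosq p z * cosq q z) ((if p + q = 0 then 1/2 else 0) + (if p = q then 1/2 else 0)) 0"
  by (rule approx_int_weaken[OF approx_int_add[OF approx_int_scale[OF approx_cos[of "p + q"], of "1/2"] approx_int_scale[OF approx_cos[of "p - q"], of "1/2"]]])
    (auto simp: cosq_mult)

lemma cos1_sq: "(cosq 1 z)\<^sup>2 = 1/2 + cosq 2 z / 2"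
  using cosq_mult[of 1 z 1] by (simp add: power2_eq_square)

lemma approx_cos1_sq_cos:
  assumes "0 \<le> q" shows "approx_int (\<lambda>z. (cosq 1 z)\<^sup>2 * cosq q z) (if q = 0 then 1/2 else if q = 2 then 1/4 else 0) 0"
proof (rule approx_int_weaken[OF approx_int_add[OF approx_int_scale[OF approx_cos[of q], of "1/2"] approx_int_scale[OF approx_cos_mult[of 2 q], of "1/2"]]])
  show "1 / 2 * cosq q z + 1 / 2 * (cosq 2 z * cosq q z) = (cosq 1 z)\<^sup>2 * cosq q z" for z
    unfolding cos1_sq by (simp add: algebra_simps)
qed (use assms in auto)

lemma approx_cos1_pow4: "approx_int (\<lambda>z. (cosq 1 z) ^ 3 * cosq 1 z) (3/8) 0"
proof (rule approx_int_weaken[OF approx_int_add[OF approx_int_scale[OF approx_cos1_sq_cos[of 0], of "1/2"] approx_int_scale[OF approx_cos1_sq_cos[of 2], of "1/2"]]])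
  fix z
  have "(cosq 1 z) ^ 3 * cosq 1 z = (cosq 1 z)\<^sup>2 * (cosq 1 z)\<^sup>2" by (simp add: power2_eq_square power3_eq_cube)
  also have "\<dots> = (cosq 1 z)\<^sup>2 * (1/2 + cosq 2 z / 2)" by (simp only: cos1_sq[of z])
  finally show "1 / 2 * ((cosq 1 z)\<^sup>2 * cosq 0 z) + 1 / 2 * ((cosq 1 z)\<^sup>2 * cosq 2 z) = cosq 1 z ^ 3 * cosq 1 z"
    by (simp add: algebra_simps)
qed auto

subsection \<open>Binomial expansion to third order\<close>

definition binom2 :: "nat \<Rightarrow> real" where "binom2 b = real b * (real b - 1) / 2"
definition binom3 :: "nat \<Rightarrow> real" where "binom3 b = real b * (real b - 1) * (real b - 2) / 6"

definition expansion_rest :: "nat \<Rightarrow> real \<Rightarrow> real" where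
  "expansion_rest b u = (1 + u) ^ b - 1 - real b * u - binom2 b * u\<^sup>2 - binom3 b * u ^ 3"

text \<open>The remainder starts at order four, so its increments carry a factor t^3. A Lipschitz
  estimate is what comparing two sequences requires, not a bound on each remainder
  separately.\<close>

lemma expansion_rest_lipschitz:
  "\<exists>K\<ge>0. \<forall>t u v. t \<le> 1 \<longrightarrow> \<bar>u\<bar> \<le> t \<longrightarrow> \<bar>v\<bar> \<le> t \<longrightarrow>
     \<bar>expansion_rest b u - expansion_rest b v\<bar> \<le> K * t ^ 3 * \<bar>u - v\<bar>"
proof (induction b)
  case 0
  show ?case by (intro exI[of _ 0]) (simp add: expansion_rest_def binom2_def binom3_def)
next
  case (Suc b)
  then obtain K where K: "0 \<le> K" "\<And>t u v. t \<le> 1 \<Longrightarrow> \<bar>u\<bar> \<le> t \<Longrightarrow> \<bar>v\<bar> \<le> t \<Longrightarrow>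
     \<bar>expansion_rest b u - expansion_rest b v\<bar> \<le> K * t ^ 3 * \<bar>u - v\<bar>" by blast
  let ?R = "expansion_rest b"
  \<comment> \<open>Multiplying the expansion by 1 + u shifts only the cubic term across the cut,
    which turns the statement into an induction on b.\<close>
  have rec: "expansion_rest (Suc b) u = (1 + u) * ?R u + binom3 b * u ^ 4" for u
    by (simp add: expansion_rest_def binom2_def binom3_def field_simps power2_eq_square power3_eq_cube power4_eq_xxxx)
  have "\<bar>expansion_rest (Suc b) u - expansion_rest (Suc b) v\<bar> \<le> (3 * K + 4 * \<bar>binom3 b\<bar>) * t ^ 3 * \<bar>u - v\<bar>"
    if t: "t \<le> 1" "\<bar>u\<bar> \<le> t" "\<bar>v\<bar> \<le> t" for t u v
  proof -
    have t0: "0 \<le> t" using t by linarith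
    have e: "expansion_rest (Suc b) u - expansion_rest (Suc b) v
        = (1 + u) * (?R u - ?R v) + (u - v) * ?R v + binom3 b * (u ^ 4 - v ^ 4)"
      unfolding rec by (simp add: algebra_simps)
    have 1: "\<bar>(1 + u) * (?R u - ?R v)\<bar> \<le> 2 * (K * t ^ 3 * \<bar>u - v\<bar>)"
      unfolding abs_mult using t K by (intro mult_mono K(2)) auto
    have R0: "?R 0 = 0" by (simp add: expansion_rest_def)
    have "\<bar>?R v\<bar> \<le> K * t ^ 3 * \<bar>v\<bar>" using K(2)[of t v 0] t t0 R0 by simp
    also have "\<dots> \<le> K * t ^ 3 * 1" using t t0 K by (intro mult_left_mono) auto
    finally have 2: "\<bar>(u - v) * ?R v\<bar> \<le> K * t ^ 3 * \<bar>u - v\<bar>"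
      unfolding abs_mult using mult_left_mono[of "\<bar>?R v\<bar>" "K * t ^ 3" "\<bar>u - v\<bar>"] by (simp add: mult.commute)
    have "u ^ 4 - v ^ 4 = (u ^ 3 + u\<^sup>2 * v + u * v\<^sup>2 + v ^ 3) * (u - v)"
      by (simp add: algebra_simps power2_eq_square power3_eq_cube power4_eq_xxxx)
    moreover have "\<bar>u ^ 3 + u\<^sup>2 * v + u * v\<^sup>2 + v ^ 3\<bar> \<le> 4 * t ^ 3"
    proof -
      have p: "\<bar>u ^ i * v ^ j\<bar> \<le> t ^ i * t ^ j" for i j
        unfolding abs_mult power_abs using t t0 by (intro mult_mono power_mono) auto
      have "\<bar>u ^ 3\<bar> \<le> t ^ 3" "\<bar>v ^ 3\<bar> \<le> t ^ 3" "\<bar>u\<^sup>2 * v\<bar> \<le> t ^ 3" "\<bar>u * v\<^sup>2\<bar> \<le> t ^ 3"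
        using p[of 3 0] p[of 0 3] p[of 2 1] p[of 1 2] by (simp_all add: power2_eq_square power3_eq_cube mult.assoc)
      then show ?thesis by linarith
    qed
    ultimately have "\<bar>u ^ 4 - v ^ 4\<bar> \<le> 4 * t ^ 3 * \<bar>u - v\<bar>"
      by (simp add: abs_mult mult_right_mono)
    then have "\<bar>binom3 b * (u ^ 4 - v ^ 4)\<bar> \<le> \<bar>binom3 b\<bar> * (4 * t ^ 3 * \<bar>u - v\<bar>)"
      unfolding abs_mult by (intro mult_left_mono) auto
    then show ?thesis using 1 2 unfolding e by (simp add: algebra_simps abs_le_iff)
  qed
  then show ?case using K(1) by (intro exI[of _ "3 * K + 4 * \<bar>binom3 b\<bar>"]) auto
qed

subsection \<open>First-order comparison of two convolution powers\<close>

lemma geometric_tail: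
  fixes X :: real
  assumes X: "0 \<le> X" "X \<le> 1/8"
  shows "(\<lambda>q. X ^ nat \<bar>q\<bar>) summable_on A" "(\<Sum>\<^sub>\<infinity>q\<in>{2::int..}. X ^ nat \<bar>q\<bar>) \<le> 3/2 * X\<^sup>2"
proof -
  have "summable (\<lambda>n. X ^ n)" using X by (intro summable_geometric) auto
  then have "(\<lambda>q::int. X ^ nat \<bar>q\<bar>) summable_on UNIV" using X by (intro summable_on_int_nat_abs) auto
  then show "(\<lambda>q. X ^ nat \<bar>q\<bar>) summable_on A" using summable_on_subset_banach by blast
  have "(\<Sum>\<^sub>\<infinity>q\<in>{2::int..}. X ^ nat \<bar>q\<bar>) = (\<Sum>\<^sub>\<infinity>n. X\<^sup>2 * X ^ n)"
  proof (rule infsum_reindex_bij_witness[of _ "\<lambda>n. int n + 2" "\<lambda>q. nat (q - 2)"])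
    fix a :: int assume "a \<in> {2..}"
    then have "nat \<bar>a\<bar> = 2 + nat (a - 2)" by auto
    then show "X\<^sup>2 * X ^ nat (a - 2) = X ^ nat \<bar>a\<bar>" by (simp only: power_add)
  qed auto
  also have "\<dots> = X\<^sup>2 * (\<Sum>\<^sub>\<infinity>n. X ^ n)" by (rule infsum_cmult_right')
  also have "(\<Sum>\<^sub>\<infinity>n. X ^ n) = 1 / (1 - X)"
    using X by (intro infsumI sums_nonneg_imp_has_sum geometric_sums) auto
  also have "X\<^sup>2 * (1 / (1 - X)) \<le> X\<^sup>2 * (3/2)" using X by (intro mult_left_mono) (auto simp: field_simps)
  finally show "(\<Sum>\<^sub>\<infinity>q\<in>{2::int..}. X ^ nat \<bar>q\<bar>) \<le> 3/2 * X\<^sup>2" by simp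
qed

lemma rser_tail_bound:
  fixes d :: "int \<Rightarrow> real"
  assumes s: "(\<lambda>q. \<bar>d q\<bar>) summable_on UNIV" and sym: "\<And>q. d (- q) = d q" and d0: "d 0 = 0"
  shows "\<bar>rser d z - 2 * d 1 * cosq 1 z\<bar> \<le> 2 * (\<Sum>\<^sub>\<infinity>q\<in>{2..}. \<bar>d q\<bar>)"
proof -
  have b: "norm (d q * cosq q z) \<le> \<bar>d q\<bar>" for q by (simp add: abs_mult mult_left_le)
  have sA: "(\<lambda>q. \<bar>d q\<bar>) summable_on A" for A using s summable_on_subset_banach by blast
  have s': "(\<lambda>q. d q * cosq q z) summable_on A" for A by (rule summable_on_norm_bound(2)[OF sA b])
  have "rser d z = d 0 * cosq 0 z + 2 * (d 1 * cosq 1 z) + 2 * (\<Sum>\<^sub>\<infinity>q\<in>{2..}. d q * cosq q z)"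
    unfolding rser_def by (rule infsum_sym_split[OF s']) (simp add: sym)
  moreover have "norm (\<Sum>\<^sub>\<infinity>q\<in>{2..}. d q * cosq q z) \<le> (\<Sum>\<^sub>\<infinity>q\<in>{2..}. \<bar>d q\<bar>)"
    by (rule norm_infsum_le[OF has_sum_infsum[OF s'] has_sum_infsum[OF sA] b])
  ultimately show ?thesis using d0 by simp
qed

lemma abs_mult_le: "\<bar>a\<bar> \<le> A \<Longrightarrow> \<bar>b\<bar> \<le> B \<Longrightarrow> \<bar>a * b\<bar> \<le> A * (B::real)"
  unfolding abs_mult by (intro mult_mono) auto

lemma mult_cos_le: "\<bar>a\<bar> \<le> A \<Longrightarrow> \<bar>a * cos u\<bar> \<le> (A::real)"
  using abs_mult_le[of a A "cos u" 1] by simp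

lemma unit_seq_tail:
  assumes f: "unit_seq f" and fX: "\<And>q. f q \<le> X ^ nat \<bar>q\<bar>" and X: "0 \<le> X" "X \<le> 1/8"
  shows "\<bar>rser f z - 1 - 2 * f 1 * cosq 1 z\<bar> \<le> 3 * X\<^sup>2" "\<bar>rser f z - 1\<bar> \<le> 3 * X"
proof -
  have fn: "nnsym f" and f0: "f 0 = 1" using f by (auto simp: unit_seq_def)
  define d where "d = (\<lambda>q. if q = 0 then 0 else f q)"
  have ad: "\<bar>d q\<bar> \<le> f q" for q using nnsymD(1)[OF fn, of q] by (auto simp: d_def f0)
  have s: "(\<lambda>q. \<bar>d q\<bar>) summable_on UNIV"
    using summable_on_norm_bound(1)[OF nnsymD(2)[OF fn], of UNIV d] ad by simp
  have "rser f z = rser (\<lambda>q. d q + (if q = 0 then 1 else 0)) z"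
    by (intro arg_cong[where f = "\<lambda>f. rser f z"]) (auto simp: d_def f0)
  also have "\<dots> = (\<Sum>\<^sub>\<infinity>q. d q * cosq q z + (if q = 0 then 1 else 0))"
    unfolding rser_def by (intro infsum_cong) auto
  also have "\<dots> = rser d z + (\<Sum>\<^sub>\<infinity>q::int. (if q = 0 then 1 else 0))"
    unfolding rser_def
  proof (rule infsum_add)
    show "(\<lambda>q. d q * cosq q z) summable_on UNIV"
      by (rule summable_on_norm_bound(2)[OF s]) (simp add: abs_mult mult_left_le)
  qed (auto intro!: finite_nonzero_values_imp_summable_on)
  also have "(\<Sum>\<^sub>\<infinity>q::int. (if q = 0 then 1 else 0)) = (1::real)" by (subst infsum_single[of 0]) auto
  finally have r: "rser f z = rser d z + 1" .
  have "(\<Sum>\<^sub>\<infinity>q\<in>{2..}. \<bar>d q\<bar>) \<le> (\<Sum>\<^sub>\<infinity>q\<in>{2::int..}. X ^ nat \<bar>q\<bar>)"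
  proof (intro infsum_mono geometric_tail X)
    show "(\<lambda>q. \<bar>d q\<bar>) summable_on {2..}" using s summable_on_subset_banach by blast
    show "\<bar>d q\<bar> \<le> X ^ nat \<bar>q\<bar>" for q using ad[of q] fX[of q] by linarith
  qed
  then have "(\<Sum>\<^sub>\<infinity>q\<in>{2..}. \<bar>d q\<bar>) \<le> 3/2 * X\<^sup>2" using geometric_tail(2)[OF X] by linarith
  moreover have "\<bar>rser d z - 2 * d 1 * cosq 1 z\<bar> \<le> 2 * (\<Sum>\<^sub>\<infinity>q\<in>{2..}. \<bar>d q\<bar>)"
    by (rule rser_tail_bound[OF s]) (auto simp: d_def nnsymD(3)[OF fn])
  ultimately show 1: "\<bar>rser f z - 1 - 2 * f 1 * cosq 1 z\<bar> \<le> 3 * X\<^sup>2"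
    by (simp add: r d_def)
  have "\<bar>f 1 * cosq 1 z\<bar> \<le> X"
    using fX[of 1] nnsymD(1)[OF fn, of 1] by (intro mult_cos_le) simp
  moreover have "X\<^sup>2 \<le> X * (1/8)" using X unfolding power2_eq_square by (intro mult_left_mono) auto
  ultimately show "\<bar>rser f z - 1\<bar> \<le> 3 * X" using 1 X by linarith
qed

lemma cpow_coeff:
  assumes "nnsym f" shows "integral {0..1} (\<lambda>z. rser f z ^ b * cosq q z) = cpow f b q"
  using rser_coeff[OF nnsym_cpow[OF assms], of b q] by (simp add: rser_cpow[OF assms])

text \<open>M measures the distance of the two sequences. The tail of the difference is required to
  be smaller by a factor of order X, just as the tails themselves are of order X^2; all comparison
  estimates then become linear in M.\<close>

locale seq_pair =
  fixes f g :: "int \<Rightarrow> real" and X M :: real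
  assumes f: "unit_seq f" and g: "unit_seq g"
    and fX: "\<And>q. f q \<le> X ^ nat \<bar>q\<bar>" and gX: "\<And>q. g q \<le> X ^ nat \<bar>q\<bar>"
    and X: "0 \<le> X" "X \<le> 1/8"
    and D1: "\<bar>f 1 - g 1\<bar> \<le> M" and tail: "(\<Sum>\<^sub>\<infinity>q\<in>{2..}. \<bar>f q - g q\<bar>) \<le> 2 * X * M"
begin

lemma fn: "nnsym f" and gn: "nnsym g" and f0: "f 0 = 1" and g0: "g 0 = 1"
  using f g by (auto simp: unit_seq_def)

lemma M0: "0 \<le> M" using D1 by linarith

text \<open>U and V are of size X. Without their first harmonics they become \<open>hf\<close> and
  \<open>hg\<close> of size X^2, and the difference U - V becomes \<open>H\<close> of size X
  M.\<close>

definition "U z = rser f z - 1"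
definition "V z = rser g z - 1"
definition "hf z = U z - 2 * f 1 * cosq 1 z"
definition "hg z = V z - 2 * g 1 * cosq 1 z"
definition "H z = U z - V z - 2 * (f 1 - g 1) * cosq 1 z"

lemma cont: "continuous_on UNIV U" "continuous_on UNIV V" "continuous_on UNIV hf" "continuous_on UNIV hg" "continuous_on UNIV H"
  unfolding U_def hf_def hg_def V_def H_def by (intro continuous_intros rser_continuous fn gn)+

lemma bounds: "\<bar>U z\<bar> \<le> 3 * X" "\<bar>V z\<bar> \<le> 3 * X" "\<bar>hf z\<bar> \<le> 3 * X\<^sup>2" "\<bar>hg z\<bar> \<le> 3 * X\<^sup>2"
  unfolding U_def V_def hf_def hg_def using unit_seq_tail[OF f fX X] unit_seq_tail[OF g gX X] by auto

lemma x_bounds: "0 \<le> f 1" "f 1 \<le> X" "0 \<le> g 1" "g 1 \<le> X"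
  using fX[of 1] gX[of 1] nnsymD(1)[OF fn] nnsymD(1)[OF gn] by auto

lemma H_bound: "\<bar>H z\<bar> \<le> 4 * X * M"
proof -
  have sd: "(\<lambda>q. \<bar>f q - g q\<bar>) summable_on UNIV"
    using summable_on_norm_bound(1)[OF summable_on_add[OF nnsymD(2)[OF fn, of UNIV] nnsymD(2)[OF gn]], of "\<lambda>q. f q - g q"]
      nnsymD(1)[OF fn] nnsymD(1)[OF gn] by (auto simp: abs_le_iff add_increasing add_increasing2)
  have "rser (\<lambda>q. f q - g q) z = rser f z - rser g z"
  proof -
    have "(\<Sum>\<^sub>\<infinity>q. f q * cosq q z + - (g q * cosq q z)) = (\<Sum>\<^sub>\<infinity>q. f q * cosq q z) + (\<Sum>\<^sub>\<infinity>q. - (g q * cosq q z))"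
      by (rule infsum_add) (simp_all add: rser_summable fn gn summable_on_uminus)
    then show ?thesis by (simp add: rser_def infsum_uminus left_diff_distrib)
  qed
  then have "\<bar>H z\<bar> \<le> 2 * (\<Sum>\<^sub>\<infinity>q\<in>{2..}. \<bar>f q - g q\<bar>)"
    using rser_tail_bound[OF sd, of z] by (simp add: H_def U_def V_def nnsymD(3)[OF fn] nnsymD(3)[OF gn] f0 g0)
  then show ?thesis using tail by linarith
qed

lemma UV_bound: "\<bar>U z - V z\<bar> \<le> 3 * M"
proof -
  have "\<bar>(f 1 - g 1) * cosq 1 z\<bar> \<le> M"
    by (rule mult_cos_le[OF D1])
  moreover have "4 * X * M \<le> 4 * (1/8) * M" using X M0 by (intro mult_right_mono mult_left_mono) auto
  moreover have "U z - V z = H z + 2 * ((f 1 - g 1) * cosq 1 z)" by (simp add: H_def)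
  ultimately show ?thesis using H_bound[of z] M0 by linarith
qed

lemma linear_coeff:
  "approx_int (\<lambda>z. (U z - V z) * cosq q z) (f q - g q) 0"
proof (rule approx_int_exact)
  show "continuous_on UNIV (\<lambda>z. (U z - V z) * cosq q z)" by (intro continuous_intros cont)
  have i: "(\<lambda>z. rser f z * cosq q z) integrable_on {0..1}" "(\<lambda>z. rser g z * cosq q z) integrable_on {0..1}"
    by (intro integrable_continuous_interval continuous_intros rser_continuous fn gn)+
  have "(\<lambda>z. (U z - V z) * cosq q z) = (\<lambda>z. rser f z * cosq q z - rser g z * cosq q z)"
    by (auto simp: U_def V_def algebra_simps)
  then show "integral {0..1} (\<lambda>z. (U z - V z) * cosq q z) = f q - g q"
    by (simp add: Henstock_Kurzweil_Integration.integral_diff[OF i] rser_coeff fn gn)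
qed

lemma quad_identity:
  "(U z)\<^sup>2 - (V z)\<^sup>2 = 4 * (f 1 - g 1) * (f 1 + g 1) * (cosq 1 z)\<^sup>2
     + (2 * (f 1 - g 1) * cosq 1 z * (hf z + hg z) + 2 * (f 1 + g 1) * cosq 1 z * H z + H z * (hf z + hg z))"
  unfolding hf_def hg_def H_def by (simp add: algebra_simps power2_eq_square)

lemma quad_error:
  "\<bar>2 * (f 1 - g 1) * cosq 1 z * (hf z + hg z)\<bar> \<le> 12 * X\<^sup>2 * M"
  "\<bar>2 * (f 1 + g 1) * cosq 1 z * H z\<bar> \<le> 16 * X\<^sup>2 * M"
  "\<bar>H z * (hf z + hg z)\<bar> \<le> 24 * X ^ 3 * M"
proof -
  have h: "\<bar>hf z + hg z\<bar> \<le> 6 * X\<^sup>2" using bounds[of z] by linarith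
  have 1: "\<bar>2 * (f 1 - g 1) * cosq 1 z\<bar> \<le> 2 * M" using D1 by (intro mult_cos_le) auto
  show "\<bar>2 * (f 1 - g 1) * cosq 1 z * (hf z + hg z)\<bar> \<le> 12 * X\<^sup>2 * M"
    using abs_mult_le[OF 1 h] by (simp add: mult_ac)
  have 2: "\<bar>2 * (f 1 + g 1) * cosq 1 z\<bar> \<le> 4 * X" using x_bounds by (intro mult_cos_le) auto
  show "\<bar>2 * (f 1 + g 1) * cosq 1 z * H z\<bar> \<le> 16 * X\<^sup>2 * M"
    using abs_mult_le[OF 2 H_bound[of z]] by (simp add: power2_eq_square mult_ac)
  show "\<bar>H z * (hf z + hg z)\<bar> \<le> 24 * X ^ 3 * M"
    using abs_mult_le[OF H_bound[of z] h] by (simp add: power2_eq_square power3_eq_cube mult_ac)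
qed

lemma X3: "X ^ 3 \<le> X\<^sup>2 / 8"
  using X mult_left_mono[of X "1/8" "X\<^sup>2"] by (simp add: power2_eq_square power3_eq_cube mult_ac)

lemma X3M: "X ^ 3 * M \<le> X\<^sup>2 * M / 8"
  using mult_right_mono[OF X3 M0] by simp

lemma quad_coeff:
  assumes q: "0 \<le> q"
  shows "approx_int (\<lambda>z. ((U z)\<^sup>2 - (V z)\<^sup>2) * cosq q z)
    (4 * (f 1 - g 1) * (f 1 + g 1) * (if q = 0 then 1/2 else if q = 2 then 1/4 else 0)) (31 * X\<^sup>2 * M)"
proof (rule approx_int_weaken[OF approx_int_add[OF approx_int_scale[OF approx_cos1_sq_cos[OF q], of "4 * (f 1 - g 1) * (f 1 + g 1)"]
      approx_int_bound[of "\<lambda>z. (2 * (f 1 - g 1) * cosq 1 z * (hf z + hg z) + 2 * (f 1 + g 1) * cosq 1 z * H z + H z * (hf z + hg z)) * cosq q z" "31 * X\<^sup>2 * M"]]])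
  fix z
  \<comment> \<open>31 is 12 + 16 + 24 / 8, the last term using X \<le> 1/8.\<close>
  have "\<bar>2 * (f 1 - g 1) * cosq 1 z * (hf z + hg z) + 2 * (f 1 + g 1) * cosq 1 z * H z + H z * (hf z + hg z)\<bar> \<le> 31 * X\<^sup>2 * M"
    using quad_error[of z] X3M by linarith
  then show "\<bar>(2 * (f 1 - g 1) * cosq 1 z * (hf z + hg z) + 2 * (f 1 + g 1) * cosq 1 z * H z + H z * (hf z + hg z)) * cosq q z\<bar> \<le> 31 * X\<^sup>2 * M"
    by (rule mult_cos_le)
  show "4 * (f 1 - g 1) * (f 1 + g 1) * ((cosq 1 z)\<^sup>2 * cosq q z) +
      (2 * (f 1 - g 1) * cosq 1 z * (hf z + hg z) + 2 * (f 1 + g 1) * cosq 1 z * H z + H z * (hf z + hg z)) * cosq q z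
      = ((U z)\<^sup>2 - (V z)\<^sup>2) * cosq q z"
    unfolding quad_identity by (simp add: algebra_simps)
qed (auto intro!: continuous_intros cont)

lemma zero_coeffs: "approx_int U 0 0" "approx_int V 0 0"
  "approx_int (\<lambda>z. U z * cosq 2 z) (f 2) 0" "approx_int (\<lambda>z. V z * cosq 2 z) (g 2) 0"
proof -
  have *: "approx_int (\<lambda>z. (rser k z + - 1) * cosq q z) (k q + - 1 * (if q = 0 then 1 else 0)) 0" if k: "nnsym k" for k q
    by (rule approx_int_weaken[OF approx_int_add[OF approx_int_exact[OF _ rser_coeff[OF k]] approx_int_scale[OF approx_cos[of q], of "-1"]]])
      (auto intro!: continuous_intros rser_continuous k simp: algebra_simps)
  show "approx_int U 0 0" "approx_int V 0 0"
    using *[OF fn, of 0] *[OF gn, of 0] by (simp_all add: U_def[abs_def] V_def[abs_def] f0 g0)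
  show "approx_int (\<lambda>z. U z * cosq 2 z) (f 2) 0" "approx_int (\<lambda>z. V z * cosq 2 z) (g 2) 0"
    using *[OF fn, of 2] *[OF gn, of 2] by (simp_all add: U_def[abs_def] V_def[abs_def])
qed

lemma approx_cos1_sq_mult:
  assumes "approx_int \<phi> a 0" "approx_int (\<lambda>z. \<phi> z * cosq 2 z) c 0"
  shows "approx_int (\<lambda>z. (cosq 1 z)\<^sup>2 * \<phi> z) ((a + c) / 2) 0"
proof (rule approx_int_weaken[OF approx_int_add[OF approx_int_scale[OF assms(1), of "1/2"] approx_int_scale[OF assms(2), of "1/2"]]])
  show "1 / 2 * \<phi> z + 1 / 2 * (\<phi> z * cosq 2 z) = (cosq 1 z)\<^sup>2 * \<phi> z" for z
    unfolding cos1_sq by (simp add: algebra_simps)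
qed auto

lemma approx_cos1_cubed: "approx_int (\<lambda>z. (cosq 1 z)\<^sup>2 * cosq 1 z) 0 0"
  using approx_cos1_sq_cos[of 1] by simp

lemma h_coeffs:
  "approx_int (\<lambda>z. (cosq 1 z)\<^sup>2 * (hf z + hg z)) ((f 2 + g 2) / 2) 0"
  "approx_int (\<lambda>z. (cosq 1 z)\<^sup>2 * H z) ((f 2 - g 2) / 2) 0"
proof -
  note UV = approx_cos1_sq_mult[OF zero_coeffs(1,3)] approx_cos1_sq_mult[OF zero_coeffs(2,4)]
  show "approx_int (\<lambda>z. (cosq 1 z)\<^sup>2 * (hf z + hg z)) ((f 2 + g 2) / 2) 0"
    by (rule approx_int_weaken[OF approx_int_add[OF approx_int_add[OF UV] approx_int_scale[OF approx_cos1_cubed, of "- (2 * (f 1 + g 1))"]]])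
      (auto simp: hf_def hg_def algebra_simps simp del: of_int_1)
  show "approx_int (\<lambda>z. (cosq 1 z)\<^sup>2 * H z) ((f 2 - g 2) / 2) 0"
    by (rule approx_int_weaken[OF approx_int_add[OF approx_int_add[OF UV(1) approx_int_scale[OF UV(2), of "-1"]] approx_int_scale[OF approx_cos1_cubed, of "- (2 * (f 1 - g 1))"]]])
      (auto simp: H_def algebra_simps diff_divide_distrib simp del: of_int_1)
qed

text \<open>The third power of the cosine has mean zero, so the leading quadratic term drops out at
  q = 1. This brings out the interaction with f 2 and g 2 and leaves an error one order smaller than
  in \<open>quad_coeff\<close>.\<close>

lemma quad_coeff_one:
  "approx_int (\<lambda>z. ((U z)\<^sup>2 - (V z)\<^sup>2) * cosq 1 z) ((f 1 - g 1) * (f 2 + g 2) + (f 1 + g 1) * (f 2 - g 2)) (24 * X ^ 3 * M)"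
proof (rule approx_int_weaken[OF approx_int_add[OF approx_int_add[OF
      approx_int_scale[OF approx_cos1_cubed, of "4 * (f 1 - g 1) * (f 1 + g 1)"]
      approx_int_add[OF approx_int_scale[OF h_coeffs(1), of "2 * (f 1 - g 1)"] approx_int_scale[OF h_coeffs(2), of "2 * (f 1 + g 1)"]]]
      approx_int_bound[of "\<lambda>z. H z * (hf z + hg z) * cosq 1 z" "24 * X ^ 3 * M"]]])
  fix z
  show "\<bar>H z * (hf z + hg z) * cosq 1 z\<bar> \<le> 24 * X ^ 3 * M" by (rule mult_cos_le[OF quad_error(3)])
  show "4 * (f 1 - g 1) * (f 1 + g 1) * ((cosq 1 z)\<^sup>2 * cosq 1 z) +
      (2 * (f 1 - g 1) * ((cosq 1 z)\<^sup>2 * (hf z + hg z)) + 2 * (f 1 + g 1) * ((cosq 1 z)\<^sup>2 * H z)) + H z * (hf z + hg z) * cosq 1 z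
      = ((U z)\<^sup>2 - (V z)\<^sup>2) * cosq 1 z"
    unfolding quad_identity power2_eq_square[of "cosq 1 z"] by (simp add: algebra_simps del: of_int_1)
qed (auto intro!: continuous_intros cont simp: field_simps)

lemma cube_bound: "\<bar>(U z) ^ 3 - (V z) ^ 3\<bar> \<le> 81 * X\<^sup>2 * M"
proof -
  have "(U z) ^ 3 - (V z) ^ 3 = (U z - V z) * (U z * U z + U z * V z + V z * V z)"
    by (simp add: algebra_simps power3_eq_cube)
  moreover have "\<bar>U z * U z + U z * V z + V z * V z\<bar> \<le> 27 * X\<^sup>2"
    using abs_mult_le[OF bounds(1) bounds(1), of z z] abs_mult_le[OF bounds(1) bounds(2), of z z] abs_mult_le[OF bounds(2) bounds(2), of z z]
    unfolding power2_eq_square by linarith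
  then have "\<bar>(U z - V z) * (U z * U z + U z * V z + V z * V z)\<bar> \<le> 3 * M * (27 * X\<^sup>2)"
    by (rule abs_mult_le[OF UV_bound])
  ultimately show ?thesis by (simp add: mult_ac)
qed

lemma cube_coeff_one:
  "approx_int (\<lambda>z. ((U z) ^ 3 - (V z) ^ 3) * cosq 1 z)
     (3 * (f 1 - g 1) * ((f 1)\<^sup>2 + f 1 * g 1 + (g 1)\<^sup>2)) (198 * X ^ 3 * M)"
proof -
  define S where "S = (f 1)\<^sup>2 + f 1 * g 1 + (g 1)\<^sup>2"
  define e where "e = (\<lambda>z. (U z)\<^sup>2 + U z * V z + (V z)\<^sup>2 - 4 * S * (cosq 1 z)\<^sup>2)"
  have ce: "continuous_on UNIV e" unfolding e_def by (intro continuous_intros cont)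
  \<comment> \<open>The pieces of the identity below contribute 15 + (9 + 6) + 15.\<close>
  have eb: "\<bar>e z\<bar> \<le> 45 * X ^ 3" for z
  proof -
    let ?c = "cosq 1 z"
    have xc: "\<bar>2 * f 1 * ?c\<bar> \<le> 2 * X" "\<bar>2 * g 1 * ?c\<bar> \<le> 2 * X" using x_bounds by (auto intro!: mult_cos_le)
    have e: "e z = hf z * (U z + 2 * f 1 * ?c) + (hf z * V z + 2 * f 1 * ?c * hg z) + hg z * (V z + 2 * g 1 * ?c)"
      unfolding e_def S_def hf_def hg_def by (simp add: algebra_simps power2_eq_square)
    have "\<bar>U z + 2 * f 1 * ?c\<bar> \<le> 5 * X" "\<bar>V z + 2 * g 1 * ?c\<bar> \<le> 5 * X" using bounds(1,2)[of z] xc by linarith+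
    then show ?thesis unfolding e
      using abs_mult_le[OF bounds(3)[of z], of "U z + 2 * f 1 * ?c" "5 * X"] abs_mult_le[OF bounds(4)[of z], of "V z + 2 * g 1 * ?c" "5 * X"]
        abs_mult_le[OF bounds(3)[of z] bounds(2)[of z]] abs_mult_le[OF xc(1) bounds(4)[of z]]
      by (simp add: power2_eq_square power3_eq_cube mult_ac)
  qed
  have id: "((U z) ^ 3 - (V z) ^ 3) * cosq 1 z = 8 * (f 1 - g 1) * S * (cosq 1 z ^ 3 * cosq 1 z)
     + (2 * (f 1 - g 1) * cosq 1 z * e z + H z * ((U z)\<^sup>2 + U z * V z + (V z)\<^sup>2)) * cosq 1 z" for z
    unfolding e_def H_def by (simp add: algebra_simps power2_eq_square power3_eq_cube del: of_int_1)
  \<comment> \<open>198 is 2 * 45 from the term with e and 4 * 27 from the term with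
    \<open>H\<close>.\<close>
  have err: "\<bar>(2 * (f 1 - g 1) * cosq 1 z * e z + H z * ((U z)\<^sup>2 + U z * V z + (V z)\<^sup>2)) * cosq 1 z\<bar> \<le> 198 * X ^ 3 * M" for z
  proof (rule mult_cos_le)
    have 1: "\<bar>2 * (f 1 - g 1) * cosq 1 z\<bar> \<le> 2 * M" using D1 by (intro mult_cos_le) auto
    have "\<bar>U z * U z + U z * V z + V z * V z\<bar> \<le> 27 * X\<^sup>2"
      using abs_mult_le[OF bounds(1) bounds(1), of z z] abs_mult_le[OF bounds(1) bounds(2), of z z] abs_mult_le[OF bounds(2) bounds(2), of z z]
      unfolding power2_eq_square by linarith
    then have "\<bar>H z * ((U z)\<^sup>2 + U z * V z + (V z)\<^sup>2)\<bar> \<le> 4 * X * M * (27 * X\<^sup>2)"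
      by (intro abs_mult_le H_bound) (simp add: power2_eq_square)
    then show "\<bar>2 * (f 1 - g 1) * cosq 1 z * e z + H z * ((U z)\<^sup>2 + U z * V z + (V z)\<^sup>2)\<bar> \<le> 198 * X ^ 3 * M"
      using abs_triangle_ineq[of "2 * (f 1 - g 1) * cosq 1 z * e z" "H z * ((U z)\<^sup>2 + U z * V z + (V z)\<^sup>2)"]
        add_mono[OF abs_mult_le[OF 1 eb[of z]]] by (fastforce simp: power2_eq_square power3_eq_cube algebra_simps intro: order_trans)
  qed
  show ?thesis
    by (rule approx_int_weaken[OF approx_int_add[OF approx_int_scale[OF approx_cos1_pow4, of "8 * (f 1 - g 1) * S"] approx_int_bound[OF _ err]]])
      (use id in \<open>auto intro!: continuous_intros cont ce simp: S_def\<close>)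
qed

lemma cpow_diff_approx:
  assumes q2: "approx_int (\<lambda>z. ((U z)\<^sup>2 - (V z)\<^sup>2) * cosq q z) a2 e2"
    and q3: "approx_int (\<lambda>z. ((U z) ^ 3 - (V z) ^ 3) * cosq q z) a3 e3"
    and K: "\<And>u v. \<bar>u\<bar> \<le> 3 * X \<Longrightarrow> \<bar>v\<bar> \<le> 3 * X \<Longrightarrow> \<bar>expansion_rest b u - expansion_rest b v\<bar> \<le> K * (3 * X) ^ 3 * \<bar>u - v\<bar>"
      "0 \<le> K"
  shows "\<bar>cpow f b q - cpow g b q - (real b * (f q - g q) + binom2 b * a2 + binom3 b * a3)\<bar>
     \<le> \<bar>binom2 b\<bar> * e2 + \<bar>binom3 b\<bar> * e3 + 81 * K * X ^ 3 * M"
proof -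
  \<comment> \<open>81 is the product of 3^3 from the size of U and V and 3 from the bound on U -
    V.\<close>
  have r: "\<bar>(expansion_rest b (U z) - expansion_rest b (V z)) * cosq q z\<bar> \<le> 81 * K * X ^ 3 * M" for z
  proof (rule mult_cos_le)
    have "\<bar>expansion_rest b (U z) - expansion_rest b (V z)\<bar> \<le> K * (3 * X) ^ 3 * \<bar>U z - V z\<bar>"
      by (rule K(1)[OF bounds(1,2)])
    also have "\<dots> \<le> K * (3 * X) ^ 3 * (3 * M)" using K(2) X UV_bound by (intro mult_left_mono) auto
    finally show "\<bar>expansion_rest b (U z) - expansion_rest b (V z)\<bar> \<le> 81 * K * X ^ 3 * M"
      by (simp add: power_mult_distrib mult_ac)
  qed
  have cr: "continuous_on UNIV (\<lambda>z. (expansion_rest b (U z) - expansion_rest b (V z)) * cosq q z)"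
    unfolding expansion_rest_def by (intro continuous_intros cont)
  have "approx_int (\<lambda>z. (rser f z ^ b - rser g z ^ b) * cosq q z)
     (real b * (f q - g q) + binom2 b * a2 + binom3 b * a3 + 0) (\<bar>real b\<bar> * 0 + \<bar>binom2 b\<bar> * e2 + \<bar>binom3 b\<bar> * e3 + 81 * K * X ^ 3 * M)"
  proof (rule approx_int_weaken[OF approx_int_add[OF approx_int_add[OF approx_int_add[OF
        approx_int_scale[OF linear_coeff, of "real b"] approx_int_scale[OF q2, of "binom2 b"]] approx_int_scale[OF q3, of "binom3 b"]] approx_int_bound[OF cr r]] refl order_refl])
    fix z
    have "rser f z = 1 + U z" "rser g z = 1 + V z" by (auto simp: U_def V_def)
    then show "real b * ((U z - V z) * cosq q z) + binom2 b * (((U z)\<^sup>2 - (V z)\<^sup>2) * cosq q z) + binom3 b * ((U z ^ 3 - V z ^ 3) * cosq q z)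
        + (expansion_rest b (U z) - expansion_rest b (V z)) * cosq q z = (rser f z ^ b - rser g z ^ b) * cosq q z"
      by (simp add: expansion_rest_def algebra_simps)
  qed
  moreover have "integral {0..1} (\<lambda>z. (rser f z ^ b - rser g z ^ b) * cosq q z) = cpow f b q - cpow g b q"
  proof -
    have i: "(\<lambda>z. rser f z ^ b * cosq q z) integrable_on {0..1}" "(\<lambda>z. rser g z ^ b * cosq q z) integrable_on {0..1}"
      by (intro integrable_continuous_interval continuous_intros rser_continuous fn gn)+
    show ?thesis unfolding left_diff_distrib
      by (simp add: Henstock_Kurzweil_Integration.integral_diff[OF i] cpow_coeff fn gn)
  qed
  ultimately show ?thesis by (simp add: approx_int_def)
qed

end

text \<open>One constant, depending on b only, serves all pairs of sequences. The error at q = 1 is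
  smaller by a factor X than the others, since at q = 1 it must be negligible against \<delta> M,
  which is of order X^2 M.\<close>

lemma cpow_diff:
  "\<exists>K\<ge>0. \<forall>f g X M. seq_pair f g X M \<longrightarrow>
    \<bar>cpow f b 0 - cpow g b 0 - 4 * binom2 b * (f 1 - g 1) * (f 1 + g 1) / 2\<bar> \<le> K * X\<^sup>2 * M \<and>
    \<bar>cpow f b 1 - cpow g b 1 - (real b * (f 1 - g 1) + binom2 b * ((f 1 - g 1) * (f 2 + g 2) + (f 1 + g 1) * (f 2 - g 2))
       + binom3 b * (3 * (f 1 - g 1) * ((f 1)\<^sup>2 + f 1 * g 1 + (g 1)\<^sup>2)))\<bar> \<le> K * X ^ 3 * M \<and>
    \<bar>cpow f b 2 - cpow g b 2 - (real b * (f 2 - g 2) + binom2 b * (f 1 - g 1) * (f 1 + g 1))\<bar> \<le> K * X\<^sup>2 * M \<and>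
    (\<forall>q\<ge>3. \<bar>cpow f b q - cpow g b q - real b * (f q - g q)\<bar> \<le> K * X\<^sup>2 * M)"
proof -
  obtain K where K: "0 \<le> K" "\<And>t u v. t \<le> 1 \<Longrightarrow> \<bar>u\<bar> \<le> t \<Longrightarrow> \<bar>v\<bar> \<le> t \<Longrightarrow>
     \<bar>expansion_rest b u - expansion_rest b v\<bar> \<le> K * t ^ 3 * \<bar>u - v\<bar>" using expansion_rest_lipschitz[of b] by blast
  define K' where "K' = 31 * \<bar>binom2 b\<bar> + 198 * \<bar>binom3 b\<bar> + 81 * K"
  show ?thesis
  proof (intro exI[of _ K'] conjI allI impI)
    show "0 \<le> K'" using K(1) by (simp add: K'_def)
    fix f g :: "int \<Rightarrow> real" and X M :: real assume "seq_pair f g X M"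
    then interpret seq_pair f g X M .
    have Kr: "\<bar>expansion_rest b u - expansion_rest b v\<bar> \<le> K * (3 * X) ^ 3 * \<bar>u - v\<bar>" if "\<bar>u\<bar> \<le> 3 * X" "\<bar>v\<bar> \<le> 3 * X" for u v
      using K(2)[of "3 * X" u v] X that by simp
    have XM: "0 \<le> X\<^sup>2 * M" "0 \<le> X ^ 3 * M" using X M0 by auto
    have q3: "approx_int (\<lambda>z. ((U z) ^ 3 - (V z) ^ 3) * cosq q z) 0 (81 * X\<^sup>2 * M)" for q
      by (rule approx_int_bound) (auto intro!: continuous_intros cont mult_cos_le cube_bound)
    have KX: "K * (X ^ 3 * M) \<le> K * (X\<^sup>2 * M)" using X3M XM K(1) by (intro mult_left_mono) auto
    have err: "\<bar>binom2 b\<bar> * (31 * X\<^sup>2 * M) + \<bar>binom3 b\<bar> * (81 * X\<^sup>2 * M) + 81 * K * X ^ 3 * M \<le> K' * X\<^sup>2 * M"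
      using KX mult_nonneg_nonneg[OF abs_ge_zero[of "binom3 b"] XM(1)] by (simp add: K'_def algebra_simps)
    have C: "\<bar>cpow f b q - cpow g b q - t\<bar> \<le> K' * X\<^sup>2 * M"
      if "0 \<le> q" "t = real b * (f q - g q) + binom2 b * (4 * (f 1 - g 1) * (f 1 + g 1) * (if q = 0 then 1/2 else if q = 2 then 1/4 else 0)) + binom3 b * 0" for q t
      unfolding that(2) by (rule order_trans[OF cpow_diff_approx[OF quad_coeff[OF that(1)] q3 Kr K(1)] err])
    show "\<bar>cpow f b 0 - cpow g b 0 - 4 * binom2 b * (f 1 - g 1) * (f 1 + g 1) / 2\<bar> \<le> K' * X\<^sup>2 * M"
      by (rule C) (simp_all add: f0 g0)
    show "\<bar>cpow f b 2 - cpow g b 2 - (real b * (f 2 - g 2) + binom2 b * (f 1 - g 1) * (f 1 + g 1))\<bar> \<le> K' * X\<^sup>2 * M"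
      by (rule C) (simp_all add: algebra_simps)
    show "\<bar>cpow f b q - cpow g b q - real b * (f q - g q)\<bar> \<le> K' * X\<^sup>2 * M" if "3 \<le> q" for q
      by (rule C) (use that in simp_all)
    have "\<bar>binom2 b\<bar> * (24 * X ^ 3 * M) + \<bar>binom3 b\<bar> * (198 * X ^ 3 * M) + 81 * K * X ^ 3 * M \<le> K' * X ^ 3 * M"
      using mult_nonneg_nonneg[OF abs_ge_zero[of "binom2 b"] XM(2)] by (simp add: K'_def algebra_simps)
    then show "\<bar>cpow f b 1 - cpow g b 1 - (real b * (f 1 - g 1) + binom2 b * ((f 1 - g 1) * (f 2 + g 2) + (f 1 + g 1) * (f 2 - g 2))
       + binom3 b * (3 * (f 1 - g 1) * ((f 1)\<^sup>2 + f 1 * g 1 + (g 1)\<^sup>2)))\<bar> \<le> K' * X ^ 3 * M"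
      using cpow_diff_approx[OF quad_coeff_one cube_coeff_one Kr K(1)] by linarith
  qed
qed

section \<open>The renormalization map on normalized sequences\<close>

abbreviation delta_seq :: "int \<Rightarrow> real" where
  "delta_seq \<equiv> \<lambda>q. if q = 0 then 1 else 0"

definition renorm :: "nat \<Rightarrow> real \<Rightarrow> (int \<Rightarrow> real) \<Rightarrow> int \<Rightarrow> real" where
  "renorm b \<kappa> f q = gauss_seq \<kappa> q * (cpow f b q / cpow f b 0)"

definition ratio_le :: "(int \<Rightarrow> real) \<Rightarrow> real \<Rightarrow> bool" where
  "ratio_le f c \<longleftrightarrow> (\<forall>q\<ge>0. f (q + 1) \<le> c * f q)"

lemma unit_seqD: assumes "unit_seq f" shows "nnsym f" "f 0 = 1" "0 \<le> f q" "f (- q) = f q"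
  using assms nnsymD by (auto simp: unit_seq_def)

lemma conv_delta: "conv f delta_seq q = f q"
  unfolding conv_def by (subst infsum_single[of q]) auto

lemma cpow_delta: "cpow delta_seq j = delta_seq"
proof (induction j)
  case (Suc j)
  show ?case unfolding cpow.simps Suc.IH by (rule ext) (rule conv_delta)
qed simp

lemma unit_delta: "unit_seq delta_seq" by (simp add: unit_seq_def nnsym_finite_supp)

lemma gauss_seq_mono: "0 \<le> c \<Longrightarrow> c \<le> c' \<Longrightarrow> gauss_seq c' q \<le> gauss_seq c q"
  by (simp add: gauss_seq_def mult_right_mono)

lemma gauss_seq_Suc: "gauss_seq c (q + 1) = gauss_seq c q * exp (- c * (2 * of_int q + 1))"
  by (simp add: gauss_seq_def algebra_simps power2_eq_square flip: exp_add)

lemma gauss_seq_step: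
  assumes "0 < c" "0 \<le> q"
  shows "gauss_seq c (q + 1) \<le> gauss_seq c q * exp (- c)" "1 \<le> q \<Longrightarrow> gauss_seq c (q + 1) \<le> gauss_seq c q * exp (- c) ^ 3"
proof -
  show "gauss_seq c (q + 1) \<le> gauss_seq c q * exp (- c)"
    unfolding gauss_seq_Suc using assms gauss_seq_pos[of c q] by (intro mult_left_mono) (auto simp: less_imp_le)
  assume "1 \<le> q"
  then have "exp (- c * (2 * of_int q + 1)) \<le> exp (3 * (- c))" using assms by simp
  also have "\<dots> = exp (- c) ^ 3" by (simp flip: exp_of_nat_mult)
  finally show "gauss_seq c (q + 1) \<le> gauss_seq c q * exp (- c) ^ 3"
    unfolding gauss_seq_Suc using gauss_seq_pos[of c q] by (intro mult_left_mono) auto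
qed

lemma renorm_unit: assumes f: "unit_seq f" and k: "0 < \<kappa>" shows "unit_seq (renorm b \<kappa> f)"
proof -
  note fD = unit_seqD[OF f]
  have c: "1 \<le> cpow f b 0" by (rule cpow_zero_ge_one[OF fD(1,2)])
  have "nnsym (\<lambda>q. 1 / cpow f b 0 * (gauss_seq \<kappa> q * cpow f b q))"
    using c by (intro nnsym_scale nnsym_mult nnsym_gauss_seq k nnsym_cpow fD) auto
  then show ?thesis using c by (simp add: unit_seq_def renorm_def[abs_def])
qed

lemma ratio_le_power:
  assumes f: "unit_seq f" and r: "ratio_le f c" and c: "0 \<le> c" shows "f q \<le> c ^ nat \<bar>q\<bar>"
proof -
  have n: "f (int n) \<le> c ^ n" for n
  proof (induction n)
    case (Suc n)
    have "f (int n + 1) \<le> c * f (int n)" using r by (simp add: ratio_le_def)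
    also have "\<dots> \<le> c * c ^ n" using Suc c by (rule mult_left_mono)
    finally show ?case by (simp add: add.commute)
  qed (use unit_seqD[OF f] in auto)
  show ?thesis
    using n[of "nat \<bar>q\<bar>"] unit_seqD(4)[OF f, of q] by (cases "0 \<le> q") auto
qed

text \<open>The ratio of consecutive Gaussian factors is the exponential of - \<kappa> (2 q + 1):
  for q \<ge> 1 this is a third power. All ratios beyond the first thereby contract by a fixed
  factor, and only the first is critical.\<close>

lemma renorm_ratio:
  assumes f: "unit_seq f" and r: "ratio_le f c" and c: "0 \<le> c" and k: "0 < \<kappa>" and q: "0 \<le> q"
  shows "renorm b \<kappa> f (q + 1) \<le> exp (- \<kappa>) * real b * c * renorm b \<kappa> f q"
    "1 \<le> q \<Longrightarrow> renorm b \<kappa> f (q + 1) \<le> exp (- \<kappa>) ^ 3 * real b * c * renorm b \<kappa> f q"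
proof -
  note fD = unit_seqD[OF f]
  have S0: "1 \<le> cpow f b 0" by (rule cpow_zero_ge_one[OF fD(1,2)])
  have R: "cpow f b (q + 1) / cpow f b 0 \<le> real b * c * (cpow f b q / cpow f b 0)"
    using divide_right_mono[OF cpow_ratio[OF fD(1) _ q c, of b], of "cpow f b 0"] r S0 by (simp add: ratio_le_def)
  have nn: "0 \<le> cpow f b q" for q using nnsymD(1)[OF nnsym_cpow[OF fD(1)]] .
  have gen: "renorm b \<kappa> f (q + 1) \<le> e * real b * c * renorm b \<kappa> f q" if "gauss_seq \<kappa> (q + 1) \<le> gauss_seq \<kappa> q * e" "0 \<le> e" for e
  proof -
    have "renorm b \<kappa> f (q + 1) \<le> (gauss_seq \<kappa> q * e) * (real b * c * (cpow f b q / cpow f b 0))"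
      unfolding renorm_def using that R S0 nn gauss_seq_pos[of \<kappa>] by (intro mult_mono) (auto simp: less_imp_le)
    then show ?thesis by (simp add: renorm_def mult_ac)
  qed
  show "renorm b \<kappa> f (q + 1) \<le> exp (- \<kappa>) * real b * c * renorm b \<kappa> f q" by (rule gen[OF gauss_seq_step(1)[OF k q]]) simp
  show "1 \<le> q \<Longrightarrow> renorm b \<kappa> f (q + 1) \<le> exp (- \<kappa>) ^ 3 * real b * c * renorm b \<kappa> f q"
    by (rule gen[OF gauss_seq_step(2)[OF k q]]) auto
qed

lemma gauss_seq_1: "gauss_seq \<kappa> 1 = exp (- \<kappa>)" by (simp add: gauss_seq_def)

lemma renorm_one_ge:
  assumes f: "unit_seq f" shows "exp (- \<kappa>) * real b * f 1 / cpow f b 0 \<le> renorm b \<kappa> f 1"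
proof -
  note fD = unit_seqD[OF f]
  have S0: "1 \<le> cpow f b 0" by (rule cpow_zero_ge_one[OF fD(1,2)])
  have "real b * f 1 \<le> cpow f b 1" by (rule cpow_ge_linear[OF fD(1,2)]) simp
  then have "exp (- \<kappa>) * (real b * f 1 / cpow f b 0) \<le> exp (- \<kappa>) * (cpow f b 1 / cpow f b 0)"
    using S0 by (intro mult_left_mono divide_right_mono) auto
  then show ?thesis by (simp add: renorm_def gauss_seq_1 mult.assoc)
qed

lemma renorm_one_le:
  assumes f: "unit_seq f" and r: "ratio_le f c" and c: "0 \<le> c" and b: "1 \<le> b"
  shows "renorm b \<kappa> f 1 \<le> exp (- \<kappa>) * c * (real b - 1 + 1 / cpow f b 0)"
proof -
  note fD = unit_seqD[OF f]
  have S0: "1 \<le> cpow f b 0" by (rule cpow_zero_ge_one[OF fD(1,2)])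
  obtain j where j: "b = Suc j" using b by (metis Suc_le_D One_nat_def)
  have "cpow f b 1 \<le> c * (real j * cpow f b 0 + 1)"
    unfolding j using r by (intro cpow_ratio_zero[OF fD(1) _ c fD(2)]) (auto simp: ratio_le_def)
  then have "exp (- \<kappa>) * (cpow f b 1 / cpow f b 0) \<le> exp (- \<kappa>) * (c * (real j * cpow f b 0 + 1) / cpow f b 0)"
    using S0 by (intro mult_left_mono divide_right_mono) auto
  also have "\<dots> = exp (- \<kappa>) * c * (real b - 1 + 1 / cpow f b 0)" using S0 by (simp add: j field_simps)
  finally show ?thesis by (simp add: renorm_def gauss_seq_1)
qed

lemma renorm_le_gauss:
  assumes f: "unit_seq f" and pos: "\<And>z. 0 \<le> rser f z" shows "renorm b \<kappa> f q \<le> gauss_seq \<kappa> q"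
proof -
  have "1 \<le> cpow f b 0" by (rule cpow_zero_ge_one[OF unit_seqD(1,2)[OF f]])
  then have "cpow f b q / cpow f b 0 \<le> 1"
    using cpow_le_zero_coeff[OF unit_seqD(1)[OF f] pos, of b q] by (simp add: field_simps)
  then have "gauss_seq \<kappa> q * (cpow f b q / cpow f b 0) \<le> gauss_seq \<kappa> q * 1"
    using gauss_seq_pos[of \<kappa> q] by (intro mult_left_mono) auto
  then show ?thesis by (simp add: renorm_def)
qed

text \<open>\<open>delta_seq\<close> is its own convolution power, so comparing with it turns the
  estimates on differences into expansions of \<open>cpow f b\<close> itself.\<close>

lemma seq_pair_delta:
  assumes f: "unit_seq f" and r: "ratio_le f c" and c: "0 \<le> c" "c \<le> 1/8"
  shows "seq_pair f delta_seq c c"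
proof
  show "f q \<le> c ^ nat \<bar>q\<bar>" for q by (rule ratio_le_power[OF f r c(1)])
  show "(if q = 0 then 1 else 0) \<le> c ^ nat \<bar>q\<bar>" for q :: int using c by auto
  show "\<bar>f 1 - (if (1::int) = 0 then 1 else 0)\<bar> \<le> c" using ratio_le_power[OF f r c(1), of 1] unit_seqD(3)[OF f, of 1] by simp
  have "(\<Sum>\<^sub>\<infinity>q\<in>{2..}. \<bar>f q - (if q = 0 then 1 else 0)\<bar>) = (\<Sum>\<^sub>\<infinity>q\<in>{2..}. f q)"
    by (intro infsum_cong) (use unit_seqD(3)[OF f] in auto)
  also have "\<dots> \<le> (\<Sum>\<^sub>\<infinity>q\<in>{2::int..}. c ^ nat \<bar>q\<bar>)"
    by (intro infsum_mono geometric_tail c nnsymD(2)[OF unit_seqD(1)[OF f]] ratio_le_power[OF f r])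
  also have "\<dots> \<le> 2 * c * c" using geometric_tail(2)[OF c] zero_le_power2[of c] unfolding power2_eq_square by linarith
  finally show "(\<Sum>\<^sub>\<infinity>q\<in>{2..}. \<bar>f q - (if q = 0 then 1 else 0)\<bar>) \<le> 2 * c * c" .
qed (use f unit_delta c in auto)

text \<open>The differences of convolution powers are read off from $(1+U)^b-(1+V)^b$, expanded to third order in the
  zero-mean parts $U$, $V$ of the two Fourier series, which are of size \<open>X\<close>.\<close>

definition cpow_diff_const :: "nat \<Rightarrow> real \<Rightarrow> bool" where
  "cpow_diff_const b K \<longleftrightarrow> 0 \<le> K \<and> (\<forall>f g X M. seq_pair f g X M \<longrightarrow>
    \<bar>cpow f b 0 - cpow g b 0 - 4 * binom2 b * (f 1 - g 1) * (f 1 + g 1) / 2\<bar> \<le> K * X\<^sup>2 * M \<and>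
    \<bar>cpow f b 1 - cpow g b 1 - (real b * (f 1 - g 1) + binom2 b * ((f 1 - g 1) * (f 2 + g 2) + (f 1 + g 1) * (f 2 - g 2))
       + binom3 b * (3 * (f 1 - g 1) * ((f 1)\<^sup>2 + f 1 * g 1 + (g 1)\<^sup>2)))\<bar> \<le> K * X ^ 3 * M \<and>
    \<bar>cpow f b 2 - cpow g b 2 - (real b * (f 2 - g 2) + binom2 b * (f 1 - g 1) * (f 1 + g 1))\<bar> \<le> K * X\<^sup>2 * M \<and>
    (\<forall>q\<ge>3. \<bar>cpow f b q - cpow g b q - real b * (f q - g q)\<bar> \<le> K * X\<^sup>2 * M))"

lemma cpow_diff_const_exists: "\<exists>K. cpow_diff_const b K"
  using cpow_diff[of b] unfolding cpow_diff_const_def by blast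

text \<open>\<open>X\<close> is the scale of \<open>\<lambda>(1)\<close>. It is tied to $\theta$ by $b\theta-1=\delta=(b-1)X^2/2$; the slack in \<open>window\<close>
  admits variances that are close to one.\<close>

locale dyn =
  fixes b :: nat and K X :: real
  assumes b2: "2 \<le> b" and K: "cpow_diff_const b K" and X0: "0 < X"
    and small: "((K + 1) * real b ^ 3) ^ 3 * X \<le> 1 / 1000"
begin

definition "\<delta> = (real b - 1) * X\<^sup>2 / 2"
text \<open>Chosen so that b (b - 1) xlo^2 is 9/10 \<delta>: for f 1 up to slightly above this value
  S_0 stays below b exp (- \<kappa>), so the first coefficient grows.\<close>

definition "xlo = X * sqrt (9 / (20 * real b))"

definition window :: "real \<Rightarrow> bool" where
  "window \<kappa> \<longleftrightarrow> 1 + 99/100 * \<delta> \<le> real b * exp (- \<kappa>) \<and> real b * exp (- \<kappa>) \<le> 1 + 101/100 * \<delta>"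

lemma rb: "2 \<le> real b" using b2 by simp

lemma K0: "0 \<le> K" using K by (simp add: cpow_diff_const_def)

text \<open>A single constant that dominates K, b^3 and sums such as b^2 + K; the assumption
  \<open>small\<close> says N^3 X \<le> 1/1000.\<close>

definition "N = (K + 1) * real b ^ 3"

lemma N_ge: "8 \<le> N" "real b ^ 3 \<le> N" "K \<le> N" "real b \<le> N" "real b ^ 2 \<le> N"
proof -
  have b3: "2 ^ 3 \<le> real b ^ 3" by (intro power_mono rb) auto
  then show "real b ^ 3 \<le> N" using K0 by (simp add: N_def algebra_simps)
  then show "8 \<le> N" using b3 by simp
  have "K * 1 \<le> K * real b ^ 3" using b3 K0 by (intro mult_left_mono) auto
  then show "K \<le> N" using b3 by (simp add: N_def algebra_simps)
  have "real b ^ 1 \<le> real b ^ 3" "real b ^ 2 \<le> real b ^ 3" using rb by (intro power_increasing; simp)+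
  then show "real b \<le> N" "real b ^ 2 \<le> N" using \<open>real b ^ 3 \<le> N\<close> unfolding power_one_right by linarith+
qed

lemma NX: "N ^ 2 * X \<le> 1 / 8000" "N * X \<le> 1 / 64000" "X \<le> 1 / 512000"
proof -
  have 1: "8 * (N ^ 2 * X) \<le> N * (N ^ 2 * X)" using N_ge X0 by (intro mult_right_mono) auto
  then show a: "N ^ 2 * X \<le> 1 / 8000" using small unfolding N_def[symmetric] by (simp add: power2_eq_square power3_eq_cube mult.assoc)
  have 2: "8 * (N * X) \<le> N * (N * X)" using N_ge X0 by (intro mult_right_mono) auto
  then show c: "N * X \<le> 1 / 64000" using a by (simp add: power2_eq_square mult.assoc)
  have 3: "8 * X \<le> N * X" using N_ge X0 by (intro mult_right_mono) auto
  then show "X \<le> 1 / 512000" using c by simp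
qed

lemma bX: "real b * X \<le> 1 / 64000" and KX: "K * X \<le> 1 / 64000"
proof -
  have "real b * X \<le> N * X" "K * X \<le> N * X" using N_ge X0 by (intro mult_right_mono; simp)+
  then show "real b * X \<le> 1 / 64000" "K * X \<le> 1 / 64000" using NX(2) by linarith+
qed

lemma \<delta>0: "0 < \<delta>" using rb X0 by (simp add: \<delta>_def)

lemma beta_X: "real b * (real b - 1) * X\<^sup>2 = 2 * real b * \<delta>" by (simp add: \<delta>_def)

lemma b\<delta>: "real b * \<delta> \<le> 1 / 1000000" "\<delta> \<le> 1 / 2000000"
proof -
  have "real b * \<delta> \<le> (real b * X) * (real b * X) / 2"
    using rb X0 by (simp add: \<delta>_def power2_eq_square algebra_simps)
  also have "\<dots> \<le> (1 / 64000) * (1 / 64000) / 2" using bX rb X0 by (intro divide_right_mono mult_mono) auto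
  finally show 1: "real b * \<delta> \<le> 1 / 1000000" by simp
  have "2 * \<delta> \<le> real b * \<delta>" using rb \<delta>0 by (intro mult_right_mono) auto
  then show "\<delta> \<le> 1 / 2000000" using 1 by simp
qed

lemma X2\<delta>: "X\<^sup>2 \<le> 2 * \<delta>"
  using mult_right_mono[of 1 "real b - 1" "X\<^sup>2"] rb by (simp add: \<delta>_def)

lemma window_bounds:
  assumes "window \<kappa>"
  shows "1 + 99/100 * \<delta> \<le> exp (- \<kappa>) * real b" "exp (- \<kappa>) * real b \<le> 1 + 101/100 * \<delta>"
    "exp (- \<kappa>) * real b \<le> 101/100" "exp (- \<kappa>) ^ 3 * real b \<le> 26/100" "0 < \<kappa>" "exp (- \<kappa>) \<le> 51/100"
    "exp (- \<kappa>) ^ 3 * real b \<le> 101/100 / (real b)\<^sup>2"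
proof -
  show 1: "1 + 99/100 * \<delta> \<le> exp (- \<kappa>) * real b" and 2: "exp (- \<kappa>) * real b \<le> 1 + 101/100 * \<delta>"
    using assms by (auto simp: window_def mult.commute)
  then have 3: "exp (- \<kappa>) * real b \<le> 1001/1000" using b\<delta> by simp
  then show "exp (- \<kappa>) * real b \<le> 101/100" by simp
  have "exp (- \<kappa>) * 2 \<le> exp (- \<kappa>) * real b" by (rule mult_left_mono[OF rb]) simp
  then show t: "exp (- \<kappa>) \<le> 51/100" using 3 by linarith
  then have "exp (- \<kappa>) < 1" by linarith
  then show "0 < \<kappa>" by simp
  have "(exp (- \<kappa>) * real b) ^ 3 \<le> (1001/1000) ^ 3" by (rule power_mono[OF 3]) simp
  also have "\<dots> \<le> 101/100" by (simp add: power3_eq_cube)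
  finally have "(exp (- \<kappa>) ^ 3 * real b) * (real b)\<^sup>2 \<le> 101/100"
    by (simp add: power_mult_distrib power2_eq_square power3_eq_cube mult_ac)
  then show c: "exp (- \<kappa>) ^ 3 * real b \<le> 101/100 / (real b)\<^sup>2" using rb by (simp add: field_simps)
  have "101/100 / (real b)\<^sup>2 \<le> 101/100 / 2\<^sup>2" using rb by (intro divide_left_mono power_mono) auto
  then show "exp (- \<kappa>) ^ 3 * real b \<le> 26/100" using c by simp
qed

lemma S0_lower: "unit_seq f \<Longrightarrow> 1 + real b * (real b - 1) * (f 1)\<^sup>2 \<le> cpow f b 0"
  by (rule cpow_zero_ge[OF unit_seqD(1,2)])

lemma S0_ge1: "unit_seq f \<Longrightarrow> 1 \<le> cpow f b 0"
  by (rule cpow_zero_ge_one[OF unit_seqD(1,2)])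

lemma S0_upper:
  assumes "unit_seq f" "ratio_le f c" "0 \<le> c" "c \<le> 1/8"
  shows "cpow f b 0 \<le> 1 + real b * (real b - 1) * (f 1)\<^sup>2 + K * c ^ 3"
proof -
  have "\<bar>cpow f b 0 - cpow delta_seq b 0 - 4 * binom2 b * (f 1 - delta_seq 1) * (f 1 + delta_seq 1) / 2\<bar> \<le> K * c\<^sup>2 * c"
    using K seq_pair_delta[OF assms] unfolding cpow_diff_const_def by blast
  moreover have "4 * binom2 b * (f 1 - delta_seq 1) * (f 1 + delta_seq 1) / 2 = real b * (real b - 1) * (f 1)\<^sup>2"
    by (simp add: binom2_def power2_eq_square)
  moreover have "K * c\<^sup>2 * c = K * c ^ 3" by (simp add: power2_eq_square power3_eq_cube)
  ultimately show ?thesis by (simp add: cpow_delta)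
qed

lemma S0_upper_X:
  assumes f: "unit_seq f" "ratio_le f c" "0 \<le> c" "c \<le> X"
  shows "cpow f b 0 \<le> 1001/1000"
proof -
  have x: "0 \<le> f 1" "f 1 \<le> X" using ratio_le_power[OF f(1-3), of 1] unit_seqD(3)[OF f(1)] f(4) by auto
  have "real b * (real b - 1) * (f 1)\<^sup>2 \<le> real b * (real b - 1) * X\<^sup>2"
    using x rb by (intro mult_left_mono power_mono) auto
  moreover have "K * c ^ 3 \<le> K * X ^ 3" using K0 f by (intro mult_left_mono power_mono) auto
  moreover have "K * X ^ 3 \<le> 1/64000 * X\<^sup>2" using mult_right_mono[OF KX, of "X\<^sup>2"] by (simp add: power2_eq_square power3_eq_cube mult.assoc)
  ultimately show ?thesis
    using S0_upper[OF f(1-3)] f(4) NX(3) beta_X b\<delta> X2\<delta> by simp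
qed

subsection \<open>Absorption into a small region\<close>

text \<open>The ratios beyond the first are held lower by the factor 3/4, which they can afford
  because of their stronger contraction. It guarantees that f 1 is the largest ratio whenever f 1 is
  close to M.\<close>

definition upper_bd :: "(int \<Rightarrow> real) \<Rightarrow> real \<Rightarrow> bool" where
  "upper_bd f M \<longleftrightarrow> f 1 \<le> M \<and> (\<forall>q\<ge>1. f (q + 1) \<le> 3/4 * M * f q)"

lemma upper_bd_mono:
  assumes f: "unit_seq f" and "upper_bd f M" "M \<le> M'" shows "upper_bd f M'"
proof -
  have "3/4 * M * f q \<le> 3/4 * M' * f q" for q using assms(3) unit_seqD(3)[OF f, of q] by (intro mult_right_mono) auto
  then show ?thesis using assms unfolding upper_bd_def by (meson order_trans)
qed

lemma upper_bd_ratio: assumes f: "unit_seq f" and u: "upper_bd f M" shows "ratio_le f (max (f 1) (3/4 * M))"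
  unfolding ratio_le_def
proof (intro allI impI)
  fix q :: int assume q: "0 \<le> q"
  show "f (q + 1) \<le> max (f 1) (3/4 * M) * f q"
  proof (cases "q = 0")
    case True then show ?thesis using unit_seqD(2)[OF f] by simp
  next
    case False
    then have "f (q + 1) \<le> 3/4 * M * f q" using u q by (auto simp: upper_bd_def)
    also have "\<dots> \<le> max (f 1) (3/4 * M) * f q" using unit_seqD(3)[OF f, of q] by (intro mult_right_mono) auto
    finally show ?thesis .
  qed
qed

text \<open>Well below X the growth of at most one percent cannot lead past X. Otherwise S_0 exceeds
  1 by more than 8/5 b \<delta>, and b - 1 + 1 / S_0 in place of b outweighs the factor 1 +
  \<delta>.\<close>

lemma renorm_one_upper:
  assumes f: "unit_seq f" and r: "ratio_le f (f 1)" and w: "window \<kappa>"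
  shows "renorm b \<kappa> f 1 \<le> max X ((1 - \<delta> / 5) * f 1)"
proof -
  define x where "x = f 1"
  have x0: "0 \<le> x" using unit_seqD(3)[OF f] by (simp add: x_def)
  note W = window_bounds[OF w]
  let ?t = "exp (- \<kappa>)" and ?S = "cpow f b 0"
  have S1: "1 \<le> ?S" by (rule S0_ge1[OF f])
  have le: "renorm b \<kappa> f 1 \<le> ?t * x * (real b - 1 + 1 / ?S)"
    using renorm_one_le[OF f r _ , of b \<kappa>] x0 b2 by (simp add: x_def)
  show ?thesis
  proof (cases "x \<le> 9/10 * X")
    case True
    have "?t * x * (real b - 1 + 1 / ?S) \<le> ?t * x * real b" using S1 x0 by (intro mult_left_mono) auto
    also have "\<dots> = (?t * real b) * x" by simp
    also have "\<dots> \<le> 101/100 * x" using W(3) x0 by (intro mult_right_mono)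
    finally show ?thesis using le True X0 by (simp add: x_def le_max_iff_disj)
  next
    case False
    \<comment> \<open>The lower bound for S_0 - 1 at x = 9/10 X, where b (b - 1) X^2 = 2 b \<delta>
      and 81/50 is 2 * 81/100.\<close>
    define u where "u = 81/50 * real b * \<delta>"
    have u: "0 \<le> u" "u \<le> 1/1000" using b\<delta> rb \<delta>0 by (auto simp: u_def)
    have "(9/10 * X)\<^sup>2 \<le> x\<^sup>2" using False X0 by (intro power_mono) auto
    then have "real b * (real b - 1) * (81/100 * X\<^sup>2) \<le> real b * (real b - 1) * x\<^sup>2"
      using rb by (intro mult_left_mono) (auto simp: power_mult_distrib power2_eq_square)
    then have "81/100 * (real b * (real b - 1) * X\<^sup>2) \<le> real b * (real b - 1) * x\<^sup>2" by (simp only: mult_ac)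
    then have "1 + u \<le> ?S" using S0_lower[OF f] unfolding beta_X unfolding x_def u_def by linarith
    then have "1 / ?S \<le> 1 / (1 + u)" using u by (intro divide_left_mono) auto
    also have "\<dots> \<le> 1 - 9/10 * u" using u by (simp add: field_simps) (use u mult_left_mono[of u "1/1000" u] in simp)
    finally have i: "1 / ?S \<le> 1 - 9/10 * u" .
    have "?t * x * (real b - 1 + 1 / ?S) \<le> ?t * x * (real b - 9/10 * u)" using i x0 by (intro mult_left_mono) auto
    \<comment> \<open>729/500 is 9/10 * 81/50. It exceeds 101/100 + 1/5, which is the reason for the
      rate \<delta> / 5.\<close>
    also have "\<dots> = (?t * real b) * (1 - 729/500 * \<delta>) * x" using rb by (simp add: u_def algebra_simps)
    also have "\<dots> \<le> (1 + 101/100 * \<delta>) * (1 - 729/500 * \<delta>) * x"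
      using W(2) x0 b\<delta> by (intro mult_right_mono) auto
    also have "\<dots> \<le> (1 - \<delta> / 5) * x"
      using \<delta>0 by (intro mult_right_mono x0) (simp add: algebra_simps)
    finally show ?thesis using le by (simp add: x_def le_max_iff_disj)
  qed
qed

text \<open>Either f 1 \<le> 3/4 M, and one crude step already lands below 9/10 M, or f 1 dominates
  all ratios and \<open>renorm_one_upper\<close> applies.\<close>

lemma renorm_upper_bd:
  assumes f: "unit_seq f" and u: "upper_bd f M" and w: "window \<kappa>"
  shows "upper_bd (renorm b \<kappa> f) (max X ((1 - \<delta> / 5) * M))"
proof -
  define c where "c = max (f 1) (3/4 * M)"
  have M0: "0 \<le> M" using u unit_seqD(3)[OF f, of 1] by (auto simp: upper_bd_def)
  have c0: "0 \<le> c" "c \<le> M" using M0 u by (auto simp: c_def upper_bd_def)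
  have r: "ratio_le f c" unfolding c_def by (rule upper_bd_ratio[OF f u])
  note W = window_bounds[OF w]
  have \<delta>M: "9/10 * M \<le> (1 - \<delta> / 5) * M" using b\<delta> M0 by (intro mult_right_mono) auto
  have rn: "0 \<le> renorm b \<kappa> f q" for q by (rule unit_seqD(3)[OF renorm_unit[OF f W(5)]])
  have "renorm b \<kappa> f 1 \<le> max X ((1 - \<delta> / 5) * M)"
  proof (cases "f 1 \<le> 3/4 * M")
    case True
    have "renorm b \<kappa> f (0 + 1) \<le> exp (- \<kappa>) * real b * c * renorm b \<kappa> f 0"
      by (rule renorm_ratio(1)[OF f r c0(1) W(5)]) simp
    also have "renorm b \<kappa> f 0 = 1" by (rule unit_seqD(2)[OF renorm_unit[OF f W(5)]])
    also have "exp (- \<kappa>) * real b * c * 1 \<le> 101/100 * c" using mult_right_mono[OF W(3) c0(1)] by simp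
    also have "\<dots> = 101/100 * (3/4 * M)" using True by (simp add: c_def)
    also have "\<dots> \<le> 9/10 * M" using M0 by simp
    finally show ?thesis using \<delta>M by simp
  next
    case False
    then have r': "ratio_le f (f 1)" using r by (simp add: c_def max_def)
    have "(1 - \<delta> / 5) * f 1 \<le> (1 - \<delta> / 5) * M" using u b\<delta> by (intro mult_left_mono) (auto simp: upper_bd_def)
    then show ?thesis using renorm_one_upper[OF f r' w] by (auto simp: max_def split: if_splits)
  qed
  moreover have "renorm b \<kappa> f (q + 1) \<le> 3/4 * max X ((1 - \<delta> / 5) * M) * renorm b \<kappa> f q" if q: "1 \<le> q" for q
  proof -
    have "renorm b \<kappa> f (q + 1) \<le> exp (- \<kappa>) ^ 3 * real b * c * renorm b \<kappa> f q"
      by (rule renorm_ratio(2)[OF f r c0(1) W(5)]) (use q in auto)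
    also have "\<dots> \<le> (26/100 * M) * renorm b \<kappa> f q" using W(4) c0 rn by (intro mult_right_mono mult_mono) auto
    also have "\<dots> \<le> 3/4 * max X ((1 - \<delta> / 5) * M) * renorm b \<kappa> f q"
      using \<delta>M M0 rn by (intro mult_right_mono) (auto simp: max_def)
    finally show ?thesis .
  qed
  ultimately show ?thesis by (simp add: upper_bd_def)
qed

lemma upper_bd_X_ratio: assumes f: "unit_seq f" and u: "upper_bd f X" shows "ratio_le f X"
proof -
  have "max (f 1) (3/4 * X) \<le> X" using u X0 by (simp add: upper_bd_def)
  moreover have "c * f q \<le> X * f q" if "c \<le> X" for c q using that unit_seqD(3)[OF f, of q] by (rule mult_right_mono)
  ultimately show ?thesis using upper_bd_ratio[OF f u] unfolding ratio_le_def by (meson order_trans)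
qed

text \<open>Converts bounds in terms of the old first coefficient into bounds in terms of the new
  one, at the price of a factor close to one.\<close>

lemma renorm_one_ge_X:
  assumes f: "unit_seq f" "ratio_le f c" "0 \<le> c" "c \<le> X" and w: "window \<kappa>"
  shows "f 1 \<le> 1001/1000 * renorm b \<kappa> f 1"
proof -
  have S: "1 \<le> cpow f b 0" "cpow f b 0 \<le> 1001/1000" using S0_ge1 S0_upper_X f by auto
  have x: "0 \<le> f 1" by (rule unit_seqD(3)[OF f(1)])
  have "1 * f 1 \<le> exp (- \<kappa>) * real b * f 1" using window_bounds(1)[OF w] \<delta>0 x by (intro mult_right_mono) auto
  also have "\<dots> = cpow f b 0 * (exp (- \<kappa>) * real b * f 1 / cpow f b 0)" using S by simp
  also have "\<dots> \<le> cpow f b 0 * renorm b \<kappa> f 1" using S renorm_one_ge[OF f(1)] by (intro mult_left_mono) auto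
  also have "\<dots> \<le> 1001/1000 * renorm b \<kappa> f 1"
    using S unit_seqD(3)[OF renorm_unit[OF f(1) window_bounds(5)[OF w]]] by (intro mult_right_mono) auto
  finally show ?thesis by simp
qed

text \<open>The higher ratios gain a factor 26/100 while the first coefficient hardly decreases, so
  the excess G of the ratios over f 1 is halved until it reaches 1.\<close>

lemma renorm_ratio_self:
  assumes f: "unit_seq f" "ratio_le f X" and r: "ratio_le f (G * f 1)" and G: "1 \<le> G" and w: "window \<kappa>"
  shows "ratio_le (renorm b \<kappa> f) (max 1 (G / 2) * renorm b \<kappa> f 1)"
  unfolding ratio_le_def
proof (intro allI impI)
  let ?g = "renorm b \<kappa> f"
  note W = window_bounds[OF w]
  have g: "unit_seq ?g" by (rule renorm_unit[OF f(1) W(5)])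
  have x: "0 \<le> f 1" by (rule unit_seqD(3)[OF f(1)])
  fix q :: int assume q: "0 \<le> q"
  show "?g (q + 1) \<le> max 1 (G / 2) * ?g 1 * ?g q"
  proof (cases "q = 0")
    case True
    have "1 * ?g 1 \<le> max 1 (G / 2) * ?g 1" using unit_seqD(3)[OF g] by (intro mult_right_mono) auto
    then show ?thesis using True unit_seqD(2)[OF g] by simp
  next
    case False
    have "?g (q + 1) \<le> exp (- \<kappa>) ^ 3 * real b * (G * f 1) * ?g q"
      by (rule renorm_ratio(2)[OF f(1) r _ W(5) q]) (use G x False q in auto)
    also have "\<dots> \<le> (26/100 * (G * (1001/1000 * ?g 1))) * ?g q"
      using W(4) G x renorm_one_ge_X[OF f _ order_refl w] X0 unit_seqD(3)[OF g] by (intro mult_right_mono mult_mono) auto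
    also have "\<dots> \<le> max 1 (G / 2) * ?g 1 * ?g q"
    proof (intro mult_right_mono unit_seqD(3)[OF g])
      have "26/100 * (G * 1001/1000) * ?g 1 \<le> max 1 (G / 2) * ?g 1"
        using G unit_seqD(3)[OF g] by (intro mult_right_mono) (auto simp: max_def)
      then show "26/100 * (G * (1001/1000 * ?g 1)) \<le> max 1 (G / 2) * ?g 1" by (simp add: mult_ac)
    qed
    finally show ?thesis .
  qed
qed

lemma xlo0: "0 < xlo" and xlo_sq: "real b * (real b - 1) * xlo\<^sup>2 = 9/10 * \<delta>" and xlo_X: "xlo \<le> X"
proof -
  show "0 < xlo" using X0 rb by (simp add: xlo_def)
  have "xlo\<^sup>2 = X\<^sup>2 * (9 / (20 * real b))" using rb by (simp add: xlo_def power_mult_distrib)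
  then show "real b * (real b - 1) * xlo\<^sup>2 = 9/10 * \<delta>" using rb by (simp add: \<delta>_def field_simps)
  have "sqrt (9 / (20 * real b)) \<le> 1" using rb by simp
  then show "xlo \<le> X" using X0 by (simp add: xlo_def)
qed

text \<open>Above 101/100 xlo a single step loses too little to fall below xlo. Below it S_0 is at
  most 1 + 93/100 \<delta>, while b exp (- \<kappa>) is at least 1 + 99/100 \<delta>; the difference
  pays for the growth rate \<delta> / 50.\<close>

lemma renorm_one_lower:
  assumes f: "unit_seq f" and r: "ratio_le f (f 1)" and x: "f 1 \<le> X" and w: "window \<kappa>"
  shows "min xlo ((1 + \<delta> / 50) * f 1) \<le> renorm b \<kappa> f 1"
proof -
  have x0: "0 \<le> f 1" by (rule unit_seqD(3)[OF f])
  show ?thesis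
  proof (cases "f 1 \<le> 101/100 * xlo")
    case False
    have "f 1 \<le> 1001/1000 * renorm b \<kappa> f 1" by (rule renorm_one_ge_X[OF f r x0 x w])
    then have "xlo \<le> renorm b \<kappa> f 1" using False xlo0 by simp
    then show ?thesis by simp
  next
    case True
    let ?S = "cpow f b 0"
    have sq: "(f 1)\<^sup>2 \<le> (101/100)\<^sup>2 * xlo\<^sup>2" unfolding power_mult_distrib[symmetric] using True x0 by (intro power_mono) auto
    have "real b * (real b - 1) * (f 1)\<^sup>2 \<le> real b * (real b - 1) * ((101/100)\<^sup>2 * xlo\<^sup>2)"
      using sq rb by (intro mult_left_mono) auto
    also have "\<dots> = (101/100)\<^sup>2 * (real b * (real b - 1) * xlo\<^sup>2)" by (simp only: mult_ac)
    also have "\<dots> \<le> 92/100 * \<delta>" unfolding xlo_sq using \<delta>0 by (simp add: power2_eq_square)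
    finally have 1: "real b * (real b - 1) * (f 1)\<^sup>2 \<le> 92/100 * \<delta>" .
    have "K * (f 1) ^ 3 \<le> K * X ^ 3" using K0 x x0 by (intro mult_left_mono power_mono) auto
    also have "\<dots> \<le> 1/64000 * X\<^sup>2" using mult_right_mono[OF KX, of "X\<^sup>2"] by (simp add: power2_eq_square power3_eq_cube mult.assoc)
    also have "\<dots> \<le> 1/100 * \<delta>" using X2\<delta> \<delta>0 by simp
    finally have S: "?S \<le> 1 + 93/100 * \<delta>"
      using 1 S0_upper[OF f r x0] x NX(3) by simp
    have S1: "1 \<le> ?S" by (rule S0_ge1[OF f])
    have "(1 + \<delta> / 50) * ?S \<le> (1 + \<delta> / 50) * (1 + 93/100 * \<delta>)" using S \<delta>0 by (intro mult_left_mono) auto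
    also have "\<dots> \<le> 1 + 99/100 * \<delta>"
      using mult_left_mono[OF b\<delta>(2), of \<delta>] \<delta>0 by (simp add: algebra_simps)
    also have "\<dots> \<le> exp (- \<kappa>) * real b" by (rule window_bounds[OF w])
    finally have "(1 + \<delta> / 50) * ?S * f 1 \<le> exp (- \<kappa>) * real b * f 1" using x0 by (rule mult_right_mono)
    then have "(1 + \<delta> / 50) * f 1 \<le> exp (- \<kappa>) * real b * f 1 / ?S" using S1 by (simp add: field_simps)
    also have "\<dots> \<le> renorm b \<kappa> f 1" by (rule renorm_one_ge[OF f])
    finally show ?thesis by simp
  qed
qed

text \<open>The invariant region. Its lower bound \<open>xlo\<close> is essential: the trivial fixed point \<open>delta_seq\<close> is repelling,
  and the map contracts only where \<open>f 1\<close> is comparable to \<open>X\<close>.\<close>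

definition Om :: "(int \<Rightarrow> real) \<Rightarrow> bool" where
  "Om f \<longleftrightarrow> unit_seq f \<and> ratio_le f (f 1) \<and> f 2 \<le> 11/10 / (real b)\<^sup>2 * (f 1)\<^sup>2 \<and> xlo \<le> f 1 \<and> f 1 \<le> X"

text \<open>The factor b exp (- \<kappa>)^3 is about 1 / b^2. It is retained because
  \<open>region_gain\<close> needs lambda(2) to be small against lambda(1)^2, also for b =
  2.\<close>

lemma renorm_two_le:
  assumes f: "unit_seq f" and r: "ratio_le f (f 1)" and x: "f 1 \<le> X" and w: "window \<kappa>"
  shows "renorm b \<kappa> f 2 \<le> 11/10 / (real b)\<^sup>2 * (renorm b \<kappa> f 1)\<^sup>2"
proof -
  let ?g = "renorm b \<kappa> f"
  note W = window_bounds[OF w]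
  have x0: "0 \<le> f 1" by (rule unit_seqD(3)[OF f])
  have g0: "0 \<le> ?g 1" by (rule unit_seqD(3)[OF renorm_unit[OF f W(5)]])
  have "?g (1 + 1) \<le> exp (- \<kappa>) ^ 3 * real b * f 1 * ?g 1"
    by (rule renorm_ratio(2)[OF f r x0 W(5)]) auto
  also have "\<dots> \<le> (101/100 / (real b)\<^sup>2 * (1001/1000 * ?g 1)) * ?g 1"
    using W(7) renorm_one_ge_X[OF f r x0 x w] x0 g0 by (intro mult_right_mono mult_mono) auto
  also have "\<dots> = (101/100 * (1001/1000)) / (real b)\<^sup>2 * (?g 1)\<^sup>2" by (simp add: power2_eq_square)
  also have "\<dots> \<le> 11/10 / (real b)\<^sup>2 * (?g 1)\<^sup>2" by (intro mult_right_mono divide_right_mono) auto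
  finally show ?thesis by simp
qed

lemma Om_renorm: assumes O: "Om f" and w: "window \<kappa>" shows "Om (renorm b \<kappa> f)"
proof -
  have f: "unit_seq f" and r: "ratio_le f (f 1)" and x: "xlo \<le> f 1" "f 1 \<le> X" using O by (auto simp: Om_def)
  have rX: "ratio_le f X"
    using r x mult_right_mono[OF x(2) unit_seqD(3)[OF f]] unfolding ratio_le_def by (meson order_trans)
  have "ratio_le (renorm b \<kappa> f) (max 1 (1 / 2) * renorm b \<kappa> f 1)"
    by (rule renorm_ratio_self[OF f rX _ _ w]) (use r in auto)
  moreover have "xlo \<le> renorm b \<kappa> f 1"
  proof -
    have "1 * f 1 \<le> (1 + \<delta> / 50) * f 1" using \<delta>0 x xlo0 by (intro mult_right_mono) auto
    then have "min xlo ((1 + \<delta> / 50) * f 1) = xlo" using x by simp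
    then show ?thesis using renorm_one_lower[OF f r x(2) w] by simp
  qed
  moreover have "renorm b \<kappa> f 1 \<le> X"
  proof -
    have "(1 - \<delta> / 5) * f 1 \<le> 1 * f 1" using \<delta>0 x xlo0 by (intro mult_right_mono) auto
    then show ?thesis using renorm_one_upper[OF f r w] x by simp
  qed
  ultimately show ?thesis
    using renorm_unit[OF f window_bounds(5)[OF w]] renorm_two_le[OF f r x(2) w] by (simp add: Om_def)
qed

section \<open>Contraction on the invariant region\<close>

definition "tau = X / (real b)\<^sup>2"

lemma tau0: "0 < tau" and tau_le: "tau \<le> 2 * X"
proof -
  show "0 < tau" using X0 rb by (simp add: tau_def)
  have "X / (real b)\<^sup>2 \<le> X / 1" using X0 rb one_le_power[of "real b" 2] by (intro divide_left_mono) auto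
  then show "tau \<le> 2 * X" using X0 by (simp add: tau_def)
qed

text \<open>The weight \<open>tau\<close> is small enough for the effect of the tail on the first coefficient to stay below the
  gain of order \<open>\<delta>\<close>, and large enough for the first coefficient not to spoil the contraction of the tail.\<close>

definition close_seq :: "(int \<Rightarrow> real) \<Rightarrow> (int \<Rightarrow> real) \<Rightarrow> real \<Rightarrow> bool" where
  "close_seq f g M \<longleftrightarrow> \<bar>f 1 - g 1\<bar> \<le> M \<and> (\<Sum>\<^sub>\<infinity>q\<in>{2..}. \<bar>f q - g q\<bar>) \<le> tau * M"

lemma OmD: assumes "Om f"
  shows "unit_seq f" "ratio_le f (f 1)" "f 2 \<le> 11/10 / (real b)\<^sup>2 * (f 1)\<^sup>2" "xlo \<le> f 1" "f 1 \<le> X" "0 < f 1" "ratio_le f X"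
proof -
  show f: "unit_seq f" "ratio_le f (f 1)" "f 2 \<le> 11/10 / (real b)\<^sup>2 * (f 1)\<^sup>2" "xlo \<le> f 1" and x: "f 1 \<le> X"
    using assms by (auto simp: Om_def)
  show "0 < f 1" using f(4) xlo0 by linarith
  show "ratio_le f X"
    using f(2) mult_right_mono[OF x unit_seqD(3)[OF f(1)]] unfolding ratio_le_def by (meson order_trans)
qed

lemma X_eighth: "0 \<le> X" "X \<le> 1/8" using X0 NX by auto

lemma Om_le_power: "Om f \<Longrightarrow> f q \<le> X ^ nat \<bar>q\<bar>"
  by (rule ratio_le_power[OF OmD(1,7) X_eighth(1)])

lemma seq_pair_Om: assumes "Om f" "Om g" "close_seq f g M" shows "seq_pair f g X M"
proof
  have M: "0 \<le> M" using assms(3) by (auto simp: close_seq_def)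
  show "(\<Sum>\<^sub>\<infinity>q\<in>{2..}. \<bar>f q - g q\<bar>) \<le> 2 * X * M"
    using assms(3) mult_right_mono[OF tau_le M] by (auto simp: close_seq_def)
qed (use assms OmD Om_le_power X_eighth in \<open>auto simp: close_seq_def\<close>)

lemma seq_diff_summable:
  assumes "unit_seq f" "unit_seq g" shows "(\<lambda>q. \<bar>f q - g q\<bar>) summable_on A"
  using summable_on_norm_bound(1)[OF summable_on_add[OF nnsymD(2)[OF unit_seqD(1)[OF assms(1)]] nnsymD(2)[OF unit_seqD(1)[OF assms(2)]]], of A "\<lambda>q. f q - g q"]
    unit_seqD(3)[OF assms(1)] unit_seqD(3)[OF assms(2)] by (auto simp: abs_le_iff add_increasing add_increasing2)

lemma close_seq_term:
  assumes "unit_seq f" "unit_seq g" "close_seq f g M" "2 \<le> q" shows "\<bar>f q - g q\<bar> \<le> tau * M"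
  using finite_sum_le_infsum[OF seq_diff_summable[OF assms(1,2), of "{2..}"], of "{q}"] assms by (auto simp: close_seq_def)

lemma bK_le_N: "(real b)\<^sup>2 + K \<le> N" "2 * (real b)\<^sup>2 + K \<le> N" "real b ^ 3 + K \<le> N"
proof -
  have "1 \<le> real b ^ 3" using rb by simp
  then have "K \<le> K * real b ^ 3" using K0 by (simp add: mult_le_cancel_left1)
  then show 3: "real b ^ 3 + K \<le> N" by (simp add: N_def algebra_simps)
  have "2 * (real b)\<^sup>2 \<le> real b ^ 3" using mult_right_mono[OF rb, of "(real b)\<^sup>2"] by (simp add: power2_eq_square power3_eq_cube mult.assoc)
  then show "2 * (real b)\<^sup>2 + K \<le> N" "(real b)\<^sup>2 + K \<le> N" using 3 zero_le_power2[of "real b"] by linarith+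
qed

lemma binom_bounds: "0 \<le> binom2 b" "2 * binom2 b \<le> (real b)\<^sup>2" "0 \<le> binom3 b" "6 * binom3 b \<le> real b ^ 3"
  "2 * binom2 b = real b * (real b - 1)"
proof -
  show "0 \<le> binom2 b" "0 \<le> binom3 b" using rb by (auto simp: binom2_def binom3_def)
  show "2 * binom2 b \<le> (real b)\<^sup>2" using rb by (simp add: binom2_def power2_eq_square algebra_simps)
  have "(real b - 1) * (real b - 2) \<le> real b * real b" using rb by (intro mult_mono) auto
  then have "real b * ((real b - 1) * (real b - 2)) \<le> real b * (real b * real b)" by (rule mult_left_mono) simp
  then show "6 * binom3 b \<le> real b ^ 3" by (simp add: binom3_def power3_eq_cube mult.assoc)
  show "2 * binom2 b = real b * (real b - 1)" by (simp add: binom2_def)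
qed

lemma Om_cpow_bounds:
  assumes "Om g"
  shows "cpow g b 0 \<le> 1 + N * X\<^sup>2" "\<bar>cpow g b 1 - real b * g 1\<bar> \<le> N * X\<^sup>2" "2 \<le> q \<Longrightarrow> cpow g b q \<le> N * X\<^sup>2"
proof -
  note O = OmD[OF assms]
  have x: "0 \<le> g 1" "g 1 \<le> X" using O by auto
  have g2: "0 \<le> g 2" "g 2 \<le> X\<^sup>2" using unit_seqD(3)[OF O(1)] Om_le_power[OF assms, of 2] by auto
  have x2: "(g 1)\<^sup>2 \<le> X\<^sup>2" using x by (intro power_mono) auto
  note P = K[unfolded cpow_diff_const_def, THEN conjunct2, rule_format, OF seq_pair_delta[OF O(1,7) X_eighth]]
  have X1: "X \<le> 1" using X_eighth by simp
  have KX3: "K * X\<^sup>2 * X \<le> K * X\<^sup>2" "K * X ^ 3 * X \<le> K * X\<^sup>2"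
  proof -
    show "K * X\<^sup>2 * X \<le> K * X\<^sup>2" using K0 X1 by (intro mult_right_le_one_le) (use X0 in auto)
    have "X ^ 3 * X \<le> X\<^sup>2" using power_decreasing[of 2 4 X] X0 X1 by (simp add: power4_eq_xxxx power3_eq_cube)
    then show "K * X ^ 3 * X \<le> K * X\<^sup>2" using mult_left_mono[OF _ K0, of "X ^ 3 * X" "X\<^sup>2"] by (simp add: mult.assoc)
  qed
  have N2: "((real b)\<^sup>2 + K) * X\<^sup>2 \<le> N * X\<^sup>2" "(real b ^ 3 + K) * X\<^sup>2 \<le> N * X\<^sup>2"
    using bK_le_N by (intro mult_right_mono; simp)+
  have b2x: "2 * binom2 b * (g 1)\<^sup>2 \<le> (real b)\<^sup>2 * X\<^sup>2" using binom_bounds x2 by (intro mult_mono) auto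
  have "\<bar>cpow g b 0 - 1 - 2 * binom2 b * (g 1)\<^sup>2\<bar> \<le> K * X\<^sup>2 * X"
    using conjunct1[OF P] by (simp add: cpow_delta power2_eq_square mult_ac)
  then show "cpow g b 0 \<le> 1 + N * X\<^sup>2" using N2(1) KX3(1) b2x unfolding distrib_right by linarith
  show "\<bar>cpow g b 1 - real b * g 1\<bar> \<le> N * X\<^sup>2"
  proof -
    have a: "\<bar>cpow g b 1 - (real b * g 1 + binom2 b * (2 * (g 1 * g 2)) + binom3 b * (3 * g 1 ^ 3))\<bar> \<le> K * X ^ 3 * X"
      using conjunct1[OF conjunct2[OF P]] by (simp add: cpow_delta power2_eq_square power3_eq_cube mult_ac)
    have "g 1 * g 2 \<le> 1 * X\<^sup>2" using x g2 X1 by (intro mult_mono) auto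
    then have "2 * binom2 b * (g 1 * g 2) \<le> (real b)\<^sup>2 * X\<^sup>2" using binom_bounds x g2 by (intro mult_mono) auto
    moreover have "g 1 ^ 3 \<le> X\<^sup>2" 
    proof -
      have "g 1 * (g 1)\<^sup>2 \<le> 1 * X\<^sup>2" using x x2 X1 by (intro mult_mono) auto
      then show ?thesis by (simp add: power2_eq_square power3_eq_cube)
    qed
    then have "6 * binom3 b * g 1 ^ 3 \<le> real b ^ 3 * X\<^sup>2" using binom_bounds x by (intro mult_mono) auto
    moreover have "0 \<le> binom2 b * (g 1 * g 2)" "0 \<le> binom3 b * g 1 ^ 3" using binom_bounds x g2 by auto
    moreover have "2 * (real b)\<^sup>2 * X\<^sup>2 \<le> real b ^ 3 * X\<^sup>2" using mult_right_mono[OF rb, of "(real b)\<^sup>2 * X\<^sup>2"] by (simp add: power2_eq_square power3_eq_cube mult.assoc)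
    ultimately show ?thesis using a N2(2) KX3(2) unfolding distrib_right by (simp add: abs_le_iff)
  qed
  show "cpow g b q \<le> N * X\<^sup>2" if q: "2 \<le> q" for q
  proof (cases "q = 2")
    case True
    have "\<bar>cpow g b 2 - (real b * g 2 + binom2 b * (g 1)\<^sup>2)\<bar> \<le> K * X\<^sup>2 * X"
      using conjunct1[OF conjunct2[OF conjunct2[OF P]]] by (simp add: cpow_delta power2_eq_square mult_ac)
    moreover have "2 * (real b * g 2) \<le> (real b)\<^sup>2 * X\<^sup>2" using mult_mono[OF mult_right_mono[OF rb, of "real b"] g2(2)] g2 by (simp add: power2_eq_square mult_ac)
    ultimately show ?thesis using True N2(1) KX3(1) b2x unfolding distrib_right by (simp add: abs_le_iff)
  next
    case False
    have "\<bar>cpow g b q - real b * g q\<bar> \<le> K * X\<^sup>2 * X"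
      using conjunct2[OF conjunct2[OF conjunct2[OF P]], rule_format, of q] q False by (simp add: cpow_delta)
    moreover have "g q \<le> X\<^sup>2"
    proof -
      have "2 \<le> nat \<bar>q\<bar>" using q by simp
      then show ?thesis using Om_le_power[OF assms, of q] power_decreasing[of 2 "nat \<bar>q\<bar>" X] X0 X1 by linarith
    qed
    then have "real b * g q \<le> (real b)\<^sup>2 * X\<^sup>2"
      using rb unit_seqD(3)[OF O(1)] by (intro mult_mono) (auto simp: power2_eq_square)
    ultimately show ?thesis using N2(1) KX3(1) unfolding distrib_right by linarith
  qed
qed

lemma Om_S0_diff:
  assumes O: "Om f" "Om g" and c: "close_seq f g M"
  shows "\<bar>cpow f b 0 - cpow g b 0 - real b * (real b - 1) * (f 1 + g 1) * (f 1 - g 1)\<bar> \<le> K * X\<^sup>2 * M"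
    "\<bar>cpow f b 0 - cpow g b 0\<bar> \<le> N * X * M"
proof -
  note P = K[unfolded cpow_diff_const_def, THEN conjunct2, rule_format, OF seq_pair_Om[OF O c]]
  have M: "0 \<le> M" "\<bar>f 1 - g 1\<bar> \<le> M" using c by (auto simp: close_seq_def)
  have e: "4 * binom2 b * (f 1 - g 1) * (f 1 + g 1) / 2 = real b * (real b - 1) * (f 1 + g 1) * (f 1 - g 1)"
    by (simp add: binom2_def)
  show 1: "\<bar>cpow f b 0 - cpow g b 0 - real b * (real b - 1) * (f 1 + g 1) * (f 1 - g 1)\<bar> \<le> K * X\<^sup>2 * M"
    using conjunct1[OF P] unfolding e .
  have "\<bar>real b * (real b - 1) * (f 1 + g 1) * (f 1 - g 1)\<bar> \<le> ((real b)\<^sup>2 * (2 * X)) * M"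
  proof (rule abs_mult_le[OF _ M(2)])
    have "real b * (real b - 1) \<le> (real b)\<^sup>2" using rb by (simp add: power2_eq_square)
    then show "\<bar>real b * (real b - 1) * (f 1 + g 1)\<bar> \<le> (real b)\<^sup>2 * (2 * X)"
      using OmD(5,6)[OF O(1)] OmD(5,6)[OF O(2)] rb by (intro abs_mult_le) auto
  qed
  moreover have "K * X\<^sup>2 * M \<le> K * X * M"
    using K0 M X0 X_eighth by (intro mult_right_mono mult_left_mono) (auto simp: power2_eq_square intro: mult_left_le)
  moreover have "(2 * (real b)\<^sup>2 + K) * (X * M) \<le> N * (X * M)"
    using bK_le_N(2) X0 M by (intro mult_right_mono) auto
  ultimately show "\<bar>cpow f b 0 - cpow g b 0\<bar> \<le> N * X * M"
    using 1 unfolding distrib_right by (simp add: abs_le_iff algebra_simps)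
qed

text \<open>The right-hand side is the slope lost at q = 1: the first term stems from the variation
  of S_0, the other two give back what lambda(2) and the cubic term add. P is at least 3 xlo^2, and
  135/100 is 3/2 * 9/10. The part with (real b)^2 is a reserve for the influence of the
  tail.\<close>

lemma region_gain:
  assumes O: "Om f" "Om g"
  defines "P \<equiv> (f 1)\<^sup>2 + f 1 * g 1 + (g 1)\<^sup>2"
  shows "135/100 * \<delta> + 2 * \<delta> / (real b)\<^sup>2 \<le> real b * (real b - 1) * P - (real b - 1) / 2 * (f 2 + g 2) - (real b - 1) * (real b - 2) / 2 * P"
proof -
  define u where "u = 1 / real b"
  have u: "0 < u" "u \<le> 1/2" "u * real b = 1" using rb by (auto simp: u_def field_simps)
  have x: "xlo \<le> f 1" "xlo \<le> g 1" "0 \<le> f 1" "0 \<le> g 1" using OmD(4,6)[OF O(1)] OmD(4,6)[OF O(2)] by auto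
  have P3: "3 * xlo\<^sup>2 \<le> P"
    using mult_mono[OF x(1) x(1)] mult_mono[OF x(1) x(2)] mult_mono[OF x(2) x(2)] x xlo0 by (simp add: P_def power2_eq_square)
  have "f 2 + g 2 \<le> 11/10 / (real b)\<^sup>2 * ((f 1)\<^sup>2 + (g 1)\<^sup>2)"
    using OmD(3)[OF O(1)] OmD(3)[OF O(2)] by (simp add: algebra_simps add_divide_distrib)
  also have "\<dots> \<le> 11/10 / (real b)\<^sup>2 * P" using x by (intro mult_left_mono) (auto simp: P_def)
  also have "\<dots> = 11/10 * u\<^sup>2 * P" by (simp add: u_def power_divide)
  finally have "(real b - 1) / 2 * (f 2 + g 2) \<le> (real b - 1) / 2 * (11/10 * u\<^sup>2 * P)"
    using rb by (intro mult_left_mono) auto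
  \<comment> \<open>Uses b (b - 1) - (b - 1) (b - 2) / 2 = (b - 1) (b + 2) / 2.\<close>
  then have "(real b - 1) / 2 * (real b + 2 - 11/10 * u\<^sup>2) * P
      \<le> real b * (real b - 1) * P - (real b - 1) / 2 * (f 2 + g 2) - (real b - 1) * (real b - 2) / 2 * P"
    by (simp add: field_simps)
  moreover have "(real b - 1) / 2 * (real b + 2 - 11/10 * u\<^sup>2) * (3 * xlo\<^sup>2) \<le> (real b - 1) / 2 * (real b + 2 - 11/10 * u\<^sup>2) * P"
  proof (rule mult_left_mono[OF P3])
    have "u\<^sup>2 \<le> 1" using u by (simp add: power_le_one)
    then show "0 \<le> (real b - 1) / 2 * (real b + 2 - 11/10 * u\<^sup>2)" using rb by simp
  qed
  moreover have "(real b - 1) / 2 * (real b + 2 - 11/10 * u\<^sup>2) * (3 * xlo\<^sup>2) = 135/100 * \<delta> * (1 + 2 * u - 11/10 * u ^ 3)"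
  proof -
    have "(real b - 1) * xlo\<^sup>2 = 9/10 * \<delta> * u" using xlo_sq rb by (simp add: u_def field_simps)
    then have "(real b - 1) / 2 * (real b + 2 - 11/10 * u\<^sup>2) * (3 * xlo\<^sup>2) = 3/2 * (real b + 2 - 11/10 * u\<^sup>2) * (9/10 * \<delta> * u)"
    proof -
      have "(real b - 1) / 2 * (real b + 2 - 11/10 * u\<^sup>2) * (3 * xlo\<^sup>2) = 3/2 * (real b + 2 - 11/10 * u\<^sup>2) * ((real b - 1) * xlo\<^sup>2)"
        by simp
      then show ?thesis by (simp only: \<open>(real b - 1) * xlo\<^sup>2 = 9/10 * \<delta> * u\<close>)
    qed
    also have "\<dots> = 135/100 * \<delta> * (u * real b + 2 * u - 11/10 * u ^ 3)" by (simp add: algebra_simps power2_eq_square power3_eq_cube)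
    finally show ?thesis by (simp add: u)
  qed
  moreover have "135/100 * \<delta> + 2 * \<delta> / (real b)\<^sup>2 \<le> 135/100 * \<delta> * (1 + 2 * u - 11/10 * u ^ 3)"
  proof -
    have "u\<^sup>2 \<le> u / 2" "u ^ 3 \<le> u / 4"
      using u mult_left_mono[OF u(2), of u] mult_left_mono[of "u * u" "1/4" u] mult_mono[OF u(2) u(2)] by (auto simp: power2_eq_square power3_eq_cube)
    then have "2 * u\<^sup>2 \<le> 135/100 * (2 * u - 11/10 * u ^ 3)" using u by simp
    then have "\<delta> * (2 * u\<^sup>2) \<le> \<delta> * (135/100 * (2 * u - 11/10 * u ^ 3))" using \<delta>0 by (intro mult_left_mono) auto
    then show ?thesis by (simp add: u_def power_divide algebra_simps)
  qed
  ultimately show ?thesis by linarith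
qed

lemma renorm_diff:
  assumes "unit_seq f" "unit_seq g"
  shows "renorm b \<kappa> f q - renorm b \<kappa> g q = gauss_seq \<kappa> q / cpow f b 0 *
    (cpow f b q - cpow g b q - cpow g b q / cpow g b 0 * (cpow f b 0 - cpow g b 0))"
  using S0_ge1[OF assms(1)] S0_ge1[OF assms(2)] by (simp add: renorm_def field_simps)

lemma contraction_one:
  assumes O: "Om f" "Om g" and c: "close_seq f g M" and w: "window \<kappa>"
  shows "\<bar>renorm b \<kappa> f 1 - renorm b \<kappa> g 1\<bar> \<le> (1 - \<delta> / 5) * M"
proof -
  define x y A B S G where "x = f 1" and "y = g 1" and "A = cpow f b 0" and "B = cpow g b 0"
    and "S = cpow g b 1" and "G = S / B"
  define \<beta> where "\<beta> = real b * (real b - 1)"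
  define P where "P = x\<^sup>2 + x * y + y\<^sup>2"
  define R where "R = \<beta> * P - (real b - 1) / 2 * (f 2 + g 2) - (real b - 1) * (real b - 2) / 2 * P"
  note W = window_bounds[OF w]
  have f: "unit_seq f" and g: "unit_seq g" using OmD O by auto
  have M: "0 \<le> M" "\<bar>x - y\<bar> \<le> M" using c by (auto simp: close_seq_def x_def y_def)
  have xy: "0 \<le> x" "x \<le> X" "0 \<le> y" "y \<le> X" using OmD(5,6)[OF O(1)] OmD(5,6)[OF O(2)] by (auto simp: x_def y_def)
  have A: "1 + \<beta> * x\<^sup>2 \<le> A" using S0_lower[OF f] by (simp add: A_def x_def \<beta>_def)
  have \<beta>0: "0 \<le> \<beta>" "\<beta> \<le> (real b)\<^sup>2" using rb by (auto simp: \<beta>_def power2_eq_square)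
  have A1: "1 \<le> A" using A \<beta>0 by (smt (verit) mult_nonneg_nonneg zero_le_power2)
  have B: "1 \<le> B" "B \<le> 1 + N * X\<^sup>2" using S0_ge1[OF g] Om_cpow_bounds(1)[OF O(2)] by (auto simp: B_def)
  have D2: "\<bar>f 2 - g 2\<bar> \<le> tau * M" by (rule close_seq_term[OF f g c]) simp
  have N0: "0 \<le> N" using N_ge by simp
  \<comment> \<open>G is the quotient S_1 / S_0 of the second sequence; replacing it by its leading
    term b y isolates the main part of the variation of S_0.\<close>
  have G: "\<bar>G - real b * y\<bar> \<le> 2 * N * X\<^sup>2"
  proof -
    have "G - real b * y = (S - real b * y) / B - real b * y * ((B - 1) / B)" using B by (simp add: G_def field_simps)
    moreover have "\<bar>(S - real b * y) / B\<bar> \<le> N * X\<^sup>2"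
    proof -
      have "\<bar>(S - real b * y) / B\<bar> \<le> \<bar>S - real b * y\<bar> / 1" unfolding abs_divide using B by (intro divide_left_mono) auto
      then show ?thesis using Om_cpow_bounds(2)[OF O(2)] by (simp add: S_def y_def)
    qed
    moreover have "\<bar>real b * y * ((B - 1) / B)\<bar> \<le> 1 * (N * X\<^sup>2)"
    proof (rule abs_mult_le)
      have "real b * y \<le> real b * X" using xy rb by (intro mult_left_mono) auto
      then show "\<bar>real b * y\<bar> \<le> 1" using bX xy by simp
      have "(B - 1) / B \<le> (B - 1) / 1" using B by (intro divide_left_mono) auto
      then show "\<bar>(B - 1) / B\<bar> \<le> N * X\<^sup>2" using B by simp
    qed
    moreover have "\<bar>e\<bar> \<le> 2 * d" if "e = a - c" "\<bar>a\<bar> \<le> d" "\<bar>c\<bar> \<le> 1 * d" for a c d e :: real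
      using that by linarith
    ultimately show ?thesis unfolding mult.assoc[of 2] by blast
  qed
  have Gabs: "\<bar>G\<bar> \<le> 2 * N * X"
  proof -
    have "real b * y \<le> N * X" using xy N_ge by (intro mult_mono) auto
    moreover have "2 * N * X\<^sup>2 \<le> N * X"
      using mult_left_mono[of "2 * X" 1 "N * X"] N0 X0 X_eighth by (simp add: power2_eq_square mult_ac)
    moreover have "0 \<le> real b * y" using xy by simp
    ultimately show ?thesis using G by linarith
  qed
  define E0 where "E0 = A - B - \<beta> * (x + y) * (x - y)"
  define E1 where "E1 = cpow f b 1 - S - (real b * (x - y) + binom2 b * ((x - y) * (f 2 + g 2) + (x + y) * (f 2 - g 2)) + binom3 b * (3 * (x - y) * P))"
  have E0: "\<bar>E0\<bar> \<le> K * X\<^sup>2 * M" using Om_S0_diff(1)[OF O c] by (simp add: E0_def A_def B_def \<beta>_def x_def y_def)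
  have E1: "\<bar>E1\<bar> \<le> K * X ^ 3 * M"
    using K[unfolded cpow_diff_const_def, THEN conjunct2, rule_format, OF seq_pair_Om[OF O c], THEN conjunct2, THEN conjunct1]
    by (simp add: E1_def S_def x_def y_def P_def)
  \<comment> \<open>The full coefficient of x - y. The term \<beta> x^2 is split off from - \<beta>
    y (x + y) = \<beta> x^2 - \<beta> P because it cancels in the division by A, which is at least 1
    + \<beta> x^2.\<close>
  define T where "T = real b * (1 + \<beta> * x\<^sup>2 - R)"
  have b3: "binom3 b * 3 = real b * ((real b - 1) * (real b - 2) / 2)" "binom2 b = real b * ((real b - 1) / 2)"
    by (simp_all add: binom2_def binom3_def)
  have main: "cpow f b 1 - S - G * (A - B) = T * (x - y) + binom2 b * (x + y) * (f 2 - g 2)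
      + (E1 - (G - real b * y) * (\<beta> * (x + y) * (x - y)) - G * E0)"
  proof -
    have e1: "cpow f b 1 - S = E1 + (real b * (x - y) + binom2 b * ((x - y) * (f 2 + g 2) + (x + y) * (f 2 - g 2)) + (binom3 b * 3) * ((x - y) * P))"
      by (simp add: E1_def algebra_simps)
    have e2: "A - B = E0 + \<beta> * (x + y) * (x - y)" by (simp add: E0_def)
    have e3: "T * (x - y) = real b * (x - y) + binom2 b * ((x - y) * (f 2 + g 2)) + (binom3 b * 3) * ((x - y) * P) - real b * y * (\<beta> * (x + y) * (x - y))"
      unfolding T_def R_def b3 P_def by (simp add: field_simps power2_eq_square)
    show ?thesis unfolding e1 e2 e3 by (simp add: algebra_simps)
  qed
  have t1: "\<bar>(G - real b * y) * (\<beta> * (x + y) * (x - y))\<bar> \<le> 2 * N * X\<^sup>2 * (N * (2 * X) * M)"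
  proof (intro abs_mult_le[OF G] abs_mult_le M)
    show "\<bar>\<beta>\<bar> \<le> N" using \<beta>0 N_ge by linarith
    show "\<bar>x + y\<bar> \<le> 2 * X" using xy by simp
  qed
  have t2: "\<bar>G * E0\<bar> \<le> 2 * N * X * (K * X\<^sup>2 * M)" by (rule abs_mult_le[OF Gabs E0])
  have NN: "K * X ^ 3 * M \<le> N\<^sup>2 * (X ^ 3 * M)" "2 * N * X * (K * X\<^sup>2 * M) \<le> 2 * N\<^sup>2 * (X ^ 3 * M)"
  proof -
    have X3M: "0 \<le> X ^ 3 * M" using X0 M by simp
    have "K \<le> N * 1" using N_ge by simp
    also have "\<dots> \<le> N * N" using N_ge by (intro mult_left_mono) auto
    finally show "K * X ^ 3 * M \<le> N\<^sup>2 * (X ^ 3 * M)" using X3M mult_right_mono[of K "N * N" "X ^ 3 * M"] by (simp add: power2_eq_square mult.assoc)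
    have "2 * N * K \<le> 2 * N * N" using N_ge by (intro mult_left_mono) auto
    from mult_right_mono[OF this X3M] show "2 * N * X * (K * X\<^sup>2 * M) \<le> 2 * N\<^sup>2 * (X ^ 3 * M)"
      by (simp add: power2_eq_square power3_eq_cube mult_ac)
  qed
  \<comment> \<open>The three contributions amount to 1 + 4 + 2 times N^2 X^3 M; one factor X is
    spent on N^2 X \<le> 1/8000, the remaining X^2 is at most 2 \<delta>.\<close>
  have err: "\<bar>E1 - (G - real b * y) * (\<beta> * (x + y) * (x - y)) - G * E0\<bar> \<le> \<delta> / 500 * M"
  proof -
    have "2 * N * X\<^sup>2 * (N * (2 * X) * M) = 4 * N\<^sup>2 * (X ^ 3 * M)" by (simp add: power2_eq_square power3_eq_cube)
    then have "\<bar>E1 - (G - real b * y) * (\<beta> * (x + y) * (x - y)) - G * E0\<bar> \<le> 7 * N\<^sup>2 * (X ^ 3 * M)"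
      using E1 t1 t2 NN by linarith
    also have "\<dots> = 7 * (N\<^sup>2 * X) * (X\<^sup>2 * M)" by (simp add: power2_eq_square power3_eq_cube)
    also have "\<dots> \<le> 7 * (1/8000) * (2 * \<delta> * M)" using NX(1) X2\<delta> \<delta>0 M X0 by (intro mult_mono) (auto simp: mult_right_mono)
    also have "\<dots> \<le> \<delta> / 500 * M" using \<delta>0 M by simp
    finally show ?thesis .
  qed
  \<comment> \<open>The weight \<open>tau\<close> is tuned to this term: multiplied by exp (-
    \<kappa>), which is about 1 / b, it equals the reserve in \<open>region_gain\<close>.\<close>
  have quad: "\<bar>binom2 b * (x + y) * (f 2 - g 2)\<bar> \<le> 2 * \<delta> / real b * M"
  proof -
    have "\<bar>binom2 b * (x + y) * (f 2 - g 2)\<bar> \<le> binom2 b * (2 * X) * (tau * M)"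
      using xy binom_bounds by (intro abs_mult_le D2) auto
    also have "\<dots> = (real b * (real b - 1) * X\<^sup>2) / (real b)\<^sup>2 * M" by (simp add: tau_def binom2_def power2_eq_square)
    also have "\<dots> = 2 * \<delta> / real b * M" unfolding beta_X using rb by (simp add: power2_eq_square)
    finally show ?thesis .
  qed
  have Rl: "135/100 * \<delta> + 2 * \<delta> / (real b)\<^sup>2 \<le> R"
    using region_gain[OF O] by (simp add: R_def \<beta>_def P_def x_def y_def)
  define Y where "Y = 1 + \<beta> * x\<^sup>2"
  have Y: "1 \<le> Y" "Y \<le> 1001/1000"
  proof -
    show "1 \<le> Y" using \<beta>0 by (simp add: Y_def)
    have "\<beta> * x\<^sup>2 \<le> \<beta> * X\<^sup>2" using \<beta>0 xy by (intro mult_left_mono power_mono) auto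
    then show "Y \<le> 1001/1000" using beta_X b\<delta> by (simp add: Y_def \<beta>_def)
  qed
  have Ru: "R \<le> Y"
  proof -
    have "\<beta> * P \<le> \<beta> * (3 * X\<^sup>2)"
      using \<beta>0 xy mult_mono[of x X y X] power_mono[of x X 2] power_mono[of y X 2] by (intro mult_left_mono) (auto simp: P_def power2_eq_square)
    also have "\<dots> = 3 * (2 * real b * \<delta>)" unfolding beta_X[symmetric] \<beta>_def by simp
    also have "\<dots> \<le> 1/1000" using b\<delta> by simp
    finally have "\<beta> * P \<le> 1" by simp
    moreover have "0 \<le> (real b - 1) / 2 * (f 2 + g 2)" "0 \<le> (real b - 1) * (real b - 2) / 2 * P"
      using rb unit_seqD(3)[OF f] unit_seqD(3)[OF g] xy by (auto simp: P_def)
    ultimately show ?thesis using Y by (simp add: R_def)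
  qed
  have T0: "0 \<le> T" using Ru rb by (simp add: T_def Y_def)
  have "\<bar>cpow f b 1 - S - G * (A - B)\<bar> \<le> T * M + 2 * \<delta> / real b * M + \<delta> / 500 * M"
  proof -
    have "\<bar>T * (x - y)\<bar> \<le> T * M" using T0 M by (intro abs_mult_le) auto
    then show ?thesis unfolding main using quad err by linarith
  qed
  also have "\<dots> = (T + 2 * \<delta> / real b + \<delta> / 500) * M" by (simp add: algebra_simps)
  finally have s1: "\<bar>cpow f b 1 - S - G * (A - B)\<bar> \<le> (T + 2 * \<delta> / real b + \<delta> / 500) * M" .
  have s2: "exp (- \<kappa>) * (T + 2 * \<delta> / real b + \<delta> / 500) \<le> Y * (1 - \<delta> / 5)"
  proof -
    \<comment> \<open>The net gain per factor b: the loss of slope minus the tail coupling and the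
      error.\<close>
    define Z where "Z = R - 2 * \<delta> / (real b)\<^sup>2 - \<delta> / 500"
    have Z: "134/100 * \<delta> \<le> Z" using Rl \<delta>0 unfolding Z_def by linarith
    have "T + 2 * \<delta> / real b + \<delta> / 500 \<le> real b * (Y - Z)"
    proof -
      have "\<delta> / 500 \<le> real b * (\<delta> / 500)" using rb \<delta>0 by simp
      moreover have "2 * \<delta> / real b = real b * (2 * \<delta> / (real b)\<^sup>2)" using rb by (simp add: power2_eq_square)
      ultimately show ?thesis by (simp add: T_def Y_def Z_def algebra_simps)
    qed
    then have "exp (- \<kappa>) * (T + 2 * \<delta> / real b + \<delta> / 500) \<le> exp (- \<kappa>) * (real b * (Y - Z))" by (rule mult_left_mono) simp
    also have "\<dots> = (exp (- \<kappa>) * real b) * (Y - Z)" by simp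
    also have "\<dots> \<le> (1 + 101/100 * \<delta>) * (Y - Z)"
    proof (rule mult_right_mono[OF W(2)])
      have "0 \<le> 2 * \<delta> / (real b)\<^sup>2" using \<delta>0 by simp
      then show "0 \<le> Y - Z" using Ru \<delta>0 unfolding Z_def by linarith
    qed
    also have "\<dots> \<le> Y * (1 - \<delta> / 5)"
    proof -
      have "\<delta> * Y \<le> \<delta> * (1001/1000)" using Y \<delta>0 by (intro mult_left_mono) auto
      moreover have "0 \<le> \<delta> * Z" using Z \<delta>0 by simp
      \<comment> \<open>121/100 is 101/100 for the excess of b exp (- \<kappa>) plus 1/5 for the
        claimed rate; it stays below 134/100.\<close>
      ultimately have "121/100 * (\<delta> * Y) \<le> Z + 101/100 * (\<delta> * Z)" using Z \<delta>0 by linarith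
      moreover have "(1 + 101/100 * \<delta>) * (Y - Z) = Y - Z + 101/100 * (\<delta> * Y) - 101/100 * (\<delta> * Z)" by (simp add: field_simps)
      moreover have "Y * (1 - \<delta> / 5) = Y - (\<delta> * Y) / 5" by (simp add: algebra_simps)
      moreover have "p \<le> r" if "121/100 * a \<le> Z + 101/100 * c" "p = Y - Z + 101/100 * a - 101/100 * c" "r = Y - a / 5" for a c p r :: real
        using that by linarith
      ultimately show ?thesis by blast
    qed
    finally show ?thesis .
  qed
  have "\<bar>renorm b \<kappa> f 1 - renorm b \<kappa> g 1\<bar> = exp (- \<kappa>) / A * \<bar>cpow f b 1 - S - G * (A - B)\<bar>"
    unfolding renorm_diff[OF f g] gauss_seq_1 abs_mult using A1 by (simp add: A_def B_def S_def G_def)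
  also have "\<dots> \<le> exp (- \<kappa>) / A * ((T + 2 * \<delta> / real b + \<delta> / 500) * M)" using s1 A1 by (intro mult_left_mono) auto
  also have "\<dots> = (exp (- \<kappa>) * (T + 2 * \<delta> / real b + \<delta> / 500)) * (M / A)" by simp
  also have "\<dots> \<le> (Y * (1 - \<delta> / 5)) * (M / A)" using s2 M A1 by (intro mult_right_mono) auto
  also have "\<dots> = (1 - \<delta> / 5) * M * (Y / A)" by simp
  also have "\<dots> \<le> (1 - \<delta> / 5) * M * 1"
    using A A1 M b\<delta> Y by (intro mult_left_mono) (auto simp: Y_def)
  finally show ?thesis by simp
qed

lemma gauss_tail: assumes "0 < \<kappa>" "exp (- \<kappa>) \<le> 51/100" shows "(\<Sum>\<^sub>\<infinity>q\<in>{2..}. gauss_seq \<kappa> q) \<le> 1"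
proof -
  let ?t = "exp (- \<kappa>)"
  have s: "summable (\<lambda>n. ?t ^ n)" using assms by (intro summable_geometric) auto
  have gs: "gauss_seq \<kappa> summable_on A" for A using nnsymD(2)[OF nnsym_gauss_seq[OF assms(1)]] .
  have "(\<Sum>\<^sub>\<infinity>q\<in>{2..}. gauss_seq \<kappa> q) = (\<Sum>\<^sub>\<infinity>n::nat. gauss_seq \<kappa> (int n + 2))"
    by (rule infsum_reindex_bij_witness[of _ "\<lambda>n. int n + 2" "\<lambda>q. nat (q - 2)"]) auto
  also have "\<dots> \<le> (\<Sum>\<^sub>\<infinity>n::nat. ?t\<^sup>2 * ?t ^ n)"
  proof (rule infsum_mono)
    show "(\<lambda>n. gauss_seq \<kappa> (int n + 2)) summable_on UNIV"
      using gs[of "{2..}"] by (subst summable_on_reindex_bij_witness[of UNIV "\<lambda>q. nat (q - 2)" "\<lambda>n. int n + 2" "{2..}" "gauss_seq \<kappa>"]) auto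
    show "(\<lambda>n. ?t\<^sup>2 * ?t ^ n) summable_on UNIV"
      using s by (intro summable_on_cmult_right summable_nonneg_imp_summable_on) auto
    show "gauss_seq \<kappa> (int n + 2) \<le> ?t\<^sup>2 * ?t ^ n" for n :: nat
    proof -
      have "real (n + 2) * 1 \<le> real (n + 2) * real (n + 2)" by (intro mult_left_mono) auto
      then have "\<kappa> * real (n + 2) \<le> \<kappa> * (real (n + 2))\<^sup>2" using assms by (intro mult_left_mono) (auto simp: power2_eq_square)
      then have "gauss_seq \<kappa> (int n + 2) \<le> exp (real (n + 2) * (- \<kappa>))" by (simp add: gauss_seq_def mult.commute add.commute)
      also have "\<dots> = ?t\<^sup>2 * ?t ^ n" unfolding exp_of_nat_mult by (simp add: power_add power2_eq_square mult_ac)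
      finally show ?thesis .
    qed
  qed
  also have "\<dots> = ?t\<^sup>2 * (1 / (1 - ?t))"
    unfolding infsum_cmult_right' using assms by (subst infsumI[OF sums_nonneg_imp_has_sum[OF geometric_sums]]) auto
  also have "\<dots> \<le> (51/100)\<^sup>2 * (1 / (49/100))" using assms by (intro mult_mono power_mono divide_left_mono) auto
  also have "\<dots> \<le> 1" by (simp add: power2_eq_square)
  finally show ?thesis .
qed

text \<open>From q = 2 on the Gaussian factor is about b^(-4), so the linear part contracts by
  b^(-3). The only source of size X M is the quadratic term at q = 2, and the weight
  \<open>tau\<close> turns it into a factor 1 - 1/b. The margin is thus of order 1/b, much larger
  than \<delta>.\<close>

lemma contraction_tail:
  assumes O: "Om f" "Om g" and c: "close_seq f g M" and w: "window \<kappa>"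
  shows "(\<Sum>\<^sub>\<infinity>q\<in>{2..}. \<bar>renorm b \<kappa> f q - renorm b \<kappa> g q\<bar>) \<le> tau * ((1 - \<delta> / 5) * M)"
proof -
  note W = window_bounds[OF w]
  let ?t = "exp (- \<kappa>)"
  have f: "unit_seq f" and g: "unit_seq g" using OmD O by auto
  have M: "0 \<le> M" "\<bar>f 1 - g 1\<bar> \<le> M" using c by (auto simp: close_seq_def)
  have S: "1 \<le> cpow f b 0" "1 \<le> cpow g b 0" using S0_ge1 f g by auto
  note P = K[unfolded cpow_diff_const_def, THEN conjunct2, rule_format, OF seq_pair_Om[OF O c], THEN conjunct2, THEN conjunct2]
  have X2M: "0 \<le> X\<^sup>2 * M" using M by simp
  have bound: "\<bar>cpow f b q - cpow g b q - cpow g b q / cpow g b 0 * (cpow f b 0 - cpow g b 0)\<bar>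
      \<le> real b * \<bar>f q - g q\<bar> + (if q = 2 then real b * (real b - 1) * X * M else 0) + (K + 1) * X\<^sup>2 * M" if q: "2 \<le> q" for q
  proof -
    have gq: "0 \<le> cpow g b q" by (rule nnsymD(1)[OF nnsym_cpow[OF unit_seqD(1)[OF g]]])
    have "cpow g b q / cpow g b 0 \<le> cpow g b q / 1" using S gq by (intro divide_left_mono) auto
    then have "\<bar>cpow g b q / cpow g b 0\<bar> \<le> N * X\<^sup>2" using Om_cpow_bounds(3)[OF O(2) q] gq S by simp
    then have "\<bar>cpow g b q / cpow g b 0 * (cpow f b 0 - cpow g b 0)\<bar> \<le> N * X\<^sup>2 * (N * X * M)"
      by (rule abs_mult_le[OF _ Om_S0_diff(2)[OF O c]])
    also have "\<dots> = (N\<^sup>2 * X) * (X\<^sup>2 * M)" by (simp add: power2_eq_square)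
    also have "\<dots> \<le> 1 * (X\<^sup>2 * M)" using NX(1) X2M by (intro mult_right_mono) auto
    finally have 1: "\<bar>cpow g b q / cpow g b 0 * (cpow f b 0 - cpow g b 0)\<bar> \<le> X\<^sup>2 * M" by simp
    have "\<bar>cpow f b q - cpow g b q\<bar> \<le> real b * \<bar>f q - g q\<bar> + (if q = 2 then real b * (real b - 1) * X * M else 0) + K * X\<^sup>2 * M"
    proof (cases "q = 2")
      case True
      have "\<bar>binom2 b * (f 1 - g 1) * (f 1 + g 1)\<bar> \<le> binom2 b * M * (2 * X)"
        using M binom_bounds OmD(5,6)[OF O(1)] OmD(5,6)[OF O(2)] by (intro abs_mult_le) auto
      moreover have "binom2 b * M * (2 * X) = real b * (real b - 1) * X * M" by (simp add: binom2_def)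
      moreover have "\<bar>real b * (f 2 - g 2)\<bar> = real b * \<bar>f 2 - g 2\<bar>" by (simp add: abs_mult)
      ultimately have "\<bar>cpow f b 2 - cpow g b 2\<bar> \<le> real b * \<bar>f 2 - g 2\<bar> + real b * (real b - 1) * X * M + K * X\<^sup>2 * M"
        using P[THEN conjunct1] by linarith
      then show ?thesis using True by simp
    next
      case False
      have "\<bar>real b * (f q - g q)\<bar> = real b * \<bar>f q - g q\<bar>" by (simp add: abs_mult)
      then have "\<bar>cpow f b q - cpow g b q\<bar> \<le> real b * \<bar>f q - g q\<bar> + K * X\<^sup>2 * M"
        using P[THEN conjunct2, rule_format, of q] q False by linarith
      then show ?thesis using False by simp
    qed
    moreover have "\<bar>a - c\<bar> \<le> p + r" if "\<bar>a\<bar> \<le> p" "\<bar>c\<bar> \<le> r" for a c p r :: real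
      using that by linarith
    ultimately have "\<bar>cpow f b q - cpow g b q - cpow g b q / cpow g b 0 * (cpow f b 0 - cpow g b 0)\<bar>
      \<le> real b * \<bar>f q - g q\<bar> + (if q = 2 then real b * (real b - 1) * X * M else 0) + K * X\<^sup>2 * M + X\<^sup>2 * M"
      using 1 by blast
    then show ?thesis by (simp only: distrib_right mult_1 add.assoc)
  qed
  define h where "h = (\<lambda>q. ?t ^ 4 * real b * \<bar>f q - g q\<bar> + (if q = 2 then ?t ^ 4 * (real b * (real b - 1) * X * M) else 0) + gauss_seq \<kappa> q * ((K + 1) * X\<^sup>2 * M))"
  have hb: "\<bar>renorm b \<kappa> f q - renorm b \<kappa> g q\<bar> \<le> h q" if q: "2 \<le> q" for q
  proof -
    have ga: "gauss_seq \<kappa> q / cpow f b 0 \<le> gauss_seq \<kappa> q"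
      using S gauss_seq_pos[of \<kappa> q] by (simp add: divide_le_eq mult_le_cancel_left1)
    have g4: "gauss_seq \<kappa> q \<le> ?t ^ 4"
    proof -
      have "(2::real)\<^sup>2 \<le> (of_int q)\<^sup>2" using q by (intro power_mono) auto
      then have "gauss_seq \<kappa> q \<le> exp (real 4 * (- \<kappa>))" using W(5) by (simp add: gauss_seq_def)
      then show ?thesis by (simp only: exp_of_nat_mult)
    qed
    have "\<bar>renorm b \<kappa> f q - renorm b \<kappa> g q\<bar> \<le> gauss_seq \<kappa> q *
       (real b * \<bar>f q - g q\<bar> + (if q = 2 then real b * (real b - 1) * X * M else 0) + (K + 1) * X\<^sup>2 * M)"
      unfolding renorm_diff[OF f g] using S gauss_seq_pos[of \<kappa> q] ga
      by (intro abs_mult_le bound q) auto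
    also have "\<dots> = gauss_seq \<kappa> q * (real b * \<bar>f q - g q\<bar>) + gauss_seq \<kappa> q * (if q = 2 then real b * (real b - 1) * X * M else 0) + gauss_seq \<kappa> q * ((K + 1) * X\<^sup>2 * M)"
      by (simp add: algebra_simps)
    also have "\<dots> \<le> ?t ^ 4 * (real b * \<bar>f q - g q\<bar>) + ?t ^ 4 * (if q = 2 then real b * (real b - 1) * X * M else 0) + gauss_seq \<kappa> q * ((K + 1) * X\<^sup>2 * M)"
      using g4 rb X0 M K0 by (intro add_mono mult_right_mono) auto
    also have "\<dots> = h q" by (simp add: h_def)
    finally show ?thesis .
  qed
  have s1: "(\<lambda>q. \<bar>f q - g q\<bar>) summable_on {2..}" by (rule seq_diff_summable[OF f g])
  have s2: "(\<lambda>q::int. if q = 2 then ?t ^ 4 * (real b * (real b - 1) * X * M) else 0) summable_on {2..}"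
    by (rule finite_nonzero_values_imp_summable_on, rule finite_subset[of _ "{2}"]) auto
  have s3: "gauss_seq \<kappa> summable_on {2..}" by (rule nnsymD(2)[OF nnsym_gauss_seq[OF W(5)]])
  have sh: "h summable_on {2..}" unfolding h_def
    by (intro summable_on_add summable_on_cmult_right summable_on_cmult_left s1 s2 s3)
  have uf: "unit_seq (renorm b \<kappa> f)" "unit_seq (renorm b \<kappa> g)" by (rule renorm_unit[OF f W(5)], rule renorm_unit[OF g W(5)])
  have "(\<Sum>\<^sub>\<infinity>q\<in>{2..}. \<bar>renorm b \<kappa> f q - renorm b \<kappa> g q\<bar>) \<le> infsum h {2..}"
    by (rule infsum_mono[OF seq_diff_summable[OF uf] sh]) (use hb in auto)
  also have "infsum h {2..} = ?t ^ 4 * real b * (\<Sum>\<^sub>\<infinity>q\<in>{2..}. \<bar>f q - g q\<bar>) + ?t ^ 4 * (real b * (real b - 1) * X * M)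
      + (\<Sum>\<^sub>\<infinity>q\<in>{2..}. gauss_seq \<kappa> q) * ((K + 1) * X\<^sup>2 * M)"
  proof -
    have i2: "(\<Sum>\<^sub>\<infinity>q\<in>{2::int..}. if q = 2 then ?t ^ 4 * (real b * (real b - 1) * X * M) else 0) = ?t ^ 4 * (real b * (real b - 1) * X * M)"
    proof -
      have "(\<Sum>\<^sub>\<infinity>q\<in>{2::int..}. if q = 2 then ?t ^ 4 * (real b * (real b - 1) * X * M) else 0)
          = (\<Sum>\<^sub>\<infinity>q\<in>{2::int}. if q = 2 then ?t ^ 4 * (real b * (real b - 1) * X * M) else 0)"
        by (rule infsum_cong_neutral) auto
      then show ?thesis by simp
    qed
    show ?thesis unfolding h_def
      by (subst infsum_add, intro summable_on_add summable_on_cmult_right s1 s2, intro summable_on_cmult_left s3,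
          subst infsum_add, intro summable_on_cmult_right s1, rule s2)
        (simp only: i2 infsum_cmult_right' infsum_cmult_left')
  qed
  also have "\<dots> \<le> ?t ^ 4 * real b * (tau * M) + ?t ^ 4 * (real b * (real b - 1) * X * M) + 1 * ((K + 1) * X\<^sup>2 * M)"
    using c gauss_tail[OF W(5,6)] K0 M rb X0 by (intro add_mono mult_left_mono mult_right_mono) (auto simp: close_seq_def)
  also have "\<dots> \<le> tau * ((1 - \<delta> / 5) * M)"
  proof -
    define u where "u = 1 / real b"
    have u: "0 < u" "u \<le> 1/2" "u * real b = 1" using rb by (auto simp: u_def field_simps)
    have \<delta>u: "\<delta> \<le> u / 1000000" using b\<delta>(1) rb by (simp add: u_def field_simps)
    have t4: "?t ^ 4 \<le> (1 + u / 100) * u ^ 4"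
    proof -
      have "(?t * real b) ^ 4 \<le> (1 + 101/100 * \<delta>) ^ 4" using W(2) by (intro power_mono) auto
      also have "\<dots> \<le> (1 + u / 1000) ^ 4" using \<delta>u u \<delta>0 by (intro power_mono) auto
      also have "\<dots> = ((1 + u / 1000)\<^sup>2)\<^sup>2" by simp
      also have "\<dots> \<le> (1 + u / 300)\<^sup>2"
      proof (rule power_mono)
        have "(1 + u / 1000)\<^sup>2 = 1 + u / 500 + (u * u) / 1000000" by (simp add: power2_eq_square algebra_simps)
        then show "(1 + u / 1000)\<^sup>2 \<le> 1 + u / 300" using u mult_left_mono[OF u(2), of u] by linarith
      qed simp
      also have "\<dots> \<le> 1 + u / 100"
      proof -
        have "(1 + u / 300)\<^sup>2 = 1 + u / 150 + (u * u) / 90000" by (simp add: power2_eq_square algebra_simps)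
        then show ?thesis using u mult_left_mono[OF u(2), of u] by linarith
      qed
      finally have "(?t * real b) ^ 4 * u ^ 4 \<le> (1 + u / 100) * u ^ 4" using u by (intro mult_right_mono) auto
      moreover have "(?t * real b) ^ 4 * u ^ 4 = ?t ^ 4 * (u * real b) ^ 4" by (simp add: power_mult_distrib mult_ac)
      ultimately show ?thesis by (simp add: u)
    qed
    have tu: "tau = X * u\<^sup>2" by (simp add: tau_def u_def power_divide)
    have "?t ^ 4 * real b * (tau * M) + ?t ^ 4 * (real b * (real b - 1) * X * M) = ?t ^ 4 * ((real b * tau + real b * (real b - 1) * X) * M)"
      by (simp add: algebra_simps)
    also have "\<dots> \<le> (1 + u / 100) * u ^ 4 * ((real b * tau + real b * (real b - 1) * X) * M)"
      using t4 rb X0 tau0 M by (intro mult_right_mono) auto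
    \<comment> \<open>With tau = X u^2, the linear term gives u^3 and the term b (b - 1) X gives 1 -
      u, both relative to tau M.\<close>
    also have "\<dots> = (1 + u / 100) * (1 - u + u ^ 3) * (tau * M)"
      unfolding tu using rb by (simp add: u_def field_simps power2_eq_square power3_eq_cube power4_eq_xxxx)
    also have "\<dots> \<le> (1 - 74/100 * u) * (tau * M)"
    proof (rule mult_right_mono)
      have "u ^ 3 \<le> u / 4" using u mult_left_mono[of "u * u" "1/4" u] mult_mono[OF u(2) u(2)] by (auto simp: power3_eq_cube)
      then have "(1 + u / 100) * (1 - u + u ^ 3) \<le> (1 + u / 100) * (1 - 3/4 * u)" using u by (intro mult_left_mono) auto
      also have "\<dots> \<le> 1 - 74/100 * u" using u by (simp add: algebra_simps)
      finally show "(1 + u / 100) * (1 - u + u ^ 3) \<le> 1 - 74/100 * u" .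
    qed (use tau0 M in auto)
    finally have a: "?t ^ 4 * real b * (tau * M) + ?t ^ 4 * (real b * (real b - 1) * X * M) \<le> (1 - 74/100 * u) * (tau * M)" .
    \<comment> \<open>N was defined with b^3 so that this error is N X u relative to tau M.\<close>
    have "(K + 1) * X\<^sup>2 * M = (N * X * u) * (tau * M)"
      unfolding tu N_def using rb by (simp add: u_def power2_eq_square power3_eq_cube)
    also have "\<dots> \<le> (1/100 * u) * (tau * M)" using NX(2) u tau0 M by (intro mult_right_mono) auto
    finally have b: "(K + 1) * X\<^sup>2 * M \<le> (1/100 * u) * (tau * M)" .
    have "(1 - 74/100 * u + 1/100 * u) * (tau * M) \<le> (1 - \<delta> / 5) * (tau * M)"
      using \<delta>u u tau0 M by (intro mult_right_mono) auto
    moreover have "(1 - 74/100 * u) * (tau * M) + (1/100 * u) * (tau * M) = (1 - 74/100 * u + 1/100 * u) * (tau * M)"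
      by (rule distrib_right[symmetric])
    ultimately show ?thesis using a b by (simp add: mult_ac)
  qed
  finally show ?thesis .
qed

end

section \<open>Dependence of the map on the variance\<close>

lemma exp_diff_le:
  assumes "m \<le> x" "m \<le> (y::real)" shows "\<bar>exp (- x) - exp (- y)\<bar> \<le> \<bar>x - y\<bar> * exp (- m)"
proof -
  have *: "exp (- x) - exp (- y) \<le> (y - x) * exp (- m)" if "x \<le> y" "m \<le> x" for x y
  proof -
    have "exp (- x) - exp (- y) = exp (- x) * (1 - exp (- (y - x)))" by (simp add: algebra_simps flip: exp_add)
    also have "\<dots> \<le> exp (- m) * (y - x)"
    proof (intro mult_mono)
      show "1 - exp (- (y - x)) \<le> y - x" using exp_ge_add_one_self[of "- (y - x)"] by linarith
    qed (use that in auto)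
    finally show ?thesis by (simp add: mult.commute)
  qed
  show ?thesis
  proof (cases "x \<le> y")
    case True
    then have "exp (- y) \<le> exp (- x)" by simp
    then show ?thesis using *[OF True assms(1)] True by simp
  next
    case False
    then have "exp (- x) \<le> exp (- y)" by simp
    then show ?thesis using *[of y x] assms(2) False by simp
  qed
qed

context dyn
begin

text \<open>A Lipschitz constant of the map in \<kappa> on [m, infinity). The summand 1 covers the
  first coefficient; the second moment covers the tail and is divided by its weight.\<close>

definition "pert m = 1 + gmom m 2 / tau"

lemma pert_pos: "0 < pert m" using gmom_nonneg[of m 2] tau0 by (simp add: pert_def add_pos_nonneg)

lemma Om_rser: assumes "Om f" shows "1/2 \<le> rser f z" "rser f z \<le> 3/2"
proof -
  have "\<bar>rser f z - 1\<bar> \<le> 3 * X" by (rule unit_seq_tail(2)[OF OmD(1)[OF assms] Om_le_power[OF assms] X_eighth])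
  then show "1/2 \<le> rser f z" "rser f z \<le> 3/2" using NX(3) X0 by linarith+
qed

lemma close_seq_perturb:
  assumes O: "Om g" and m: "0 < m" "m \<le> \<kappa>" "m \<le> \<kappa>'"
  shows "close_seq (renorm b \<kappa> g) (renorm b \<kappa>' g) (pert m * \<bar>\<kappa> - \<kappa>'\<bar>)"
proof -
  have g: "unit_seq g" by (rule OmD[OF O])
  have pos: "0 \<le> rser g z" for z using Om_rser(1)[OF O, of z] by simp
  have S: "1 \<le> cpow g b 0" by (rule S0_ge1[OF g])
  have b: "\<bar>renorm b \<kappa> g q - renorm b \<kappa>' g q\<bar> \<le> \<bar>\<kappa> - \<kappa>'\<bar> * ((of_int q)\<^sup>2 * gauss_seq m q)" for q
  proof -
    have r: "\<bar>cpow g b q / cpow g b 0\<bar> \<le> 1"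
      using cpow_le_zero_coeff[OF unit_seqD(1)[OF g] pos, of b q] nnsymD(1)[OF nnsym_cpow[OF unit_seqD(1)[OF g]], of b q] S by (simp add: abs_le_iff field_simps)
    have "\<bar>gauss_seq \<kappa> q - gauss_seq \<kappa>' q\<bar> \<le> \<bar>\<kappa> * (of_int q)\<^sup>2 - \<kappa>' * (of_int q)\<^sup>2\<bar> * exp (- (m * (of_int q)\<^sup>2))"
      unfolding gauss_seq_def using m by (intro exp_diff_le mult_right_mono) auto
    also have "\<dots> = \<bar>\<kappa> - \<kappa>'\<bar> * ((of_int q)\<^sup>2 * gauss_seq m q)"
      by (simp add: gauss_seq_def abs_mult flip: left_diff_distrib)
    finally have "\<bar>(gauss_seq \<kappa> q - gauss_seq \<kappa>' q) * (cpow g b q / cpow g b 0)\<bar> \<le> \<bar>\<kappa> - \<kappa>'\<bar> * ((of_int q)\<^sup>2 * gauss_seq m q) * 1"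
      by (rule abs_mult_le[OF _ r])
    then show ?thesis by (simp add: renorm_def left_diff_distrib diff_divide_distrib)
  qed
  have b': "\<bar>renorm b \<kappa> g q - renorm b \<kappa>' g q\<bar> \<le> \<bar>\<kappa> - \<kappa>'\<bar> * (gauss_seq m q * \<bar>2 * pi * of_int q\<bar>\<^sup>2)" for q
  proof -
    have "1 * 1 \<le> (2 * pi) * (2 * pi)" using pi_gt3 by (intro mult_mono) auto
    then have "1 * (of_int q)\<^sup>2 \<le> (2 * pi)\<^sup>2 * (of_int q :: real)\<^sup>2" by (intro mult_right_mono) (auto simp: power2_eq_square)
    then have "(of_int q)\<^sup>2 * gauss_seq m q \<le> gauss_seq m q * \<bar>2 * pi * of_int q\<bar>\<^sup>2"
      using gauss_seq_pos[of m q] by (simp add: power_mult_distrib mult.commute mult_right_mono)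
    then show ?thesis using b[of q] mult_left_mono[of _ _ "\<bar>\<kappa> - \<kappa>'\<bar>"] order_trans by fastforce
  qed
  have gs: "(\<lambda>q. gauss_seq m q * \<bar>2 * pi * of_int q\<bar>\<^sup>2) summable_on A" for A
    using gmom_summable[OF m(1), of 2] summable_on_subset_banach by blast
  have u: "unit_seq (renorm b \<kappa> g)" "unit_seq (renorm b \<kappa>' g)" using m by (auto intro!: renorm_unit g)
  have "(\<Sum>\<^sub>\<infinity>q\<in>{2..}. \<bar>renorm b \<kappa> g q - renorm b \<kappa>' g q\<bar>) \<le> (\<Sum>\<^sub>\<infinity>q\<in>{2..}. \<bar>\<kappa> - \<kappa>'\<bar> * (gauss_seq m q * \<bar>2 * pi * of_int q\<bar>\<^sup>2))"
    by (rule infsum_mono[OF seq_diff_summable[OF u] summable_on_cmult_right[OF gs] b'])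
  also have "\<dots> = \<bar>\<kappa> - \<kappa>'\<bar> * (\<Sum>\<^sub>\<infinity>q\<in>{2..}. gauss_seq m q * \<bar>2 * pi * of_int q\<bar>\<^sup>2)" by (rule infsum_cmult_right')
  also have "\<dots> \<le> \<bar>\<kappa> - \<kappa>'\<bar> * gmom m 2"
    unfolding gmom_def using gauss_seq_pos[of m]
    by (intro mult_left_mono infsum_mono_neutral gs) (auto simp: less_imp_le)
  also have "\<dots> \<le> tau * (pert m * \<bar>\<kappa> - \<kappa>'\<bar>)" using tau0 by (simp add: pert_def field_simps)
  finally have t: "(\<Sum>\<^sub>\<infinity>q\<in>{2..}. \<bar>renorm b \<kappa> g q - renorm b \<kappa>' g q\<bar>) \<le> tau * (pert m * \<bar>\<kappa> - \<kappa>'\<bar>)" .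
  have "gauss_seq m 1 \<le> 1" using m by (simp add: gauss_seq_def)
  then have "\<bar>renorm b \<kappa> g 1 - renorm b \<kappa>' g 1\<bar> \<le> \<bar>\<kappa> - \<kappa>'\<bar> * 1"
    using b[of 1] mult_left_mono[of "gauss_seq m 1" 1 "\<bar>\<kappa> - \<kappa>'\<bar>"] by simp
  also have "\<dots> \<le> pert m * \<bar>\<kappa> - \<kappa>'\<bar>"
    using gmom_nonneg[of m 2] tau0 by (simp add: pert_def mult_le_cancel_right1)
  finally show ?thesis using t by (simp add: close_seq_def)
qed

lemma close_seq_trans:
  assumes u: "unit_seq f" "unit_seq g" "unit_seq h" and c: "close_seq f g M" "close_seq g h M'"
  shows "close_seq f h (M + M')"
proof -
  have "(\<Sum>\<^sub>\<infinity>q\<in>{2..}. \<bar>f q - h q\<bar>) \<le> (\<Sum>\<^sub>\<infinity>q\<in>{2..}. \<bar>f q - g q\<bar> + \<bar>g q - h q\<bar>)"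
    by (intro infsum_mono summable_on_add seq_diff_summable u) auto
  also have "\<dots> = (\<Sum>\<^sub>\<infinity>q\<in>{2..}. \<bar>f q - g q\<bar>) + (\<Sum>\<^sub>\<infinity>q\<in>{2..}. \<bar>g q - h q\<bar>)"
    by (intro infsum_add seq_diff_summable u)
  finally show ?thesis using c by (auto simp: close_seq_def algebra_simps)
qed

lemma close_seq_mono: "close_seq f g M \<Longrightarrow> M \<le> M' \<Longrightarrow> close_seq f g M'"
  unfolding close_seq_def using mult_left_mono[of M M' tau] tau0 by linarith

lemma close_seq_coeff:
  assumes u: "unit_seq f" "unit_seq g" and c: "close_seq f g M" shows "\<bar>f q - g q\<bar> \<le> M"
proof -
  have M: "0 \<le> M" using c by (auto simp: close_seq_def)
  have "tau \<le> 1" using tau_le NX(3) by linarith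
  then have t: "tau * M \<le> M" using M tau0 by (simp add: mult_left_le_one_le)
  have *: "\<bar>f q - g q\<bar> \<le> M" if "0 \<le> q" for q
  proof -
    have "q = 0 \<or> q = 1 \<or> 2 \<le> q" using that by linarith
    then show ?thesis
      using unit_seqD(2)[OF u(1)] unit_seqD(2)[OF u(2)] M c close_seq_term[OF u c, of q] t
      by (elim disjE) (auto simp: close_seq_def)
  qed
  show ?thesis using *[of q] *[of "- q"] unit_seqD(4)[OF u(1)] unit_seqD(4)[OF u(2)] by (cases "0 \<le> q") auto
qed

lemma contraction:
  assumes "Om f" "Om g" "close_seq f g M" "window \<kappa>"
  shows "close_seq (renorm b \<kappa> f) (renorm b \<kappa> g) ((1 - \<delta> / 5) * M)"
  using contraction_one[OF assms] contraction_tail[OF assms] by (simp add: close_seq_def)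

lemma contraction_perturbed:
  assumes O: "Om f" "Om g" and c: "close_seq f g M" and w: "window \<kappa>" "window \<kappa>'" and m: "0 < m" "m \<le> \<kappa>" "m \<le> \<kappa>'"
  shows "close_seq (renorm b \<kappa> f) (renorm b \<kappa>' g) ((1 - \<delta> / 5) * M + pert m * \<bar>\<kappa> - \<kappa>'\<bar>)"
  by (rule close_seq_trans[OF _ _ _ contraction[OF O c w(1)] close_seq_perturb[OF O(2) m]])
    (use O OmD renorm_unit window_bounds(5) w in auto)

lemma Om_close: assumes "Om f" "Om g" shows "close_seq f g (X + 3 * X\<^sup>2 / tau)"
proof -
  have u: "unit_seq f" "unit_seq g" using OmD assms by auto
  have x: "0 \<le> f 1" "f 1 \<le> X" "0 \<le> g 1" "g 1 \<le> X" using OmD(5,6)[OF assms(1)] OmD(5,6)[OF assms(2)] by auto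
  have t: "0 \<le> 3 * X\<^sup>2 / tau" using tau0 by simp
  have a: "\<bar>f q - g q\<bar> \<le> X ^ nat \<bar>q\<bar>" for q
    using Om_le_power[OF assms(1), of q] Om_le_power[OF assms(2), of q] unit_seqD(3)[OF u(1), of q] unit_seqD(3)[OF u(2), of q]
    by (simp add: abs_le_iff)
  have "(\<Sum>\<^sub>\<infinity>q\<in>{2..}. \<bar>f q - g q\<bar>) \<le> (\<Sum>\<^sub>\<infinity>q\<in>{2::int..}. X ^ nat \<bar>q\<bar>)"
    by (intro infsum_mono seq_diff_summable u geometric_tail X_eighth a)
  also have "\<dots> \<le> 3/2 * X\<^sup>2" by (rule geometric_tail(2)[OF X_eighth])
  also have "\<dots> \<le> 3 * X\<^sup>2" by simp
  also have "\<dots> = tau * (3 * X\<^sup>2 / tau)" using tau0 by simp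
  also have "\<dots> \<le> tau * (X + 3 * X\<^sup>2 / tau)" using tau0 X0 by (intro mult_left_mono) auto
  finally show ?thesis using x t by (auto simp: close_seq_def abs_le_iff)
qed

subsection \<open>The fixed point\<close>

text \<open>The region is nonempty: it contains the Gaussian sequence whose first coefficient is
  exactly xlo. It starts the iteration towards the fixed point.\<close>

lemma Om_start: "Om (gauss_seq (- ln xlo))"
proof -
  define c where "c = - ln xlo"
  have xl1: "xlo < 1" using xlo_X NX(3) by linarith
  have c: "0 < c" using xl1 xlo0 by (simp add: c_def)
  have e: "exp (- c) = xlo" using xlo0 by (simp add: c_def)
  have one: "gauss_seq c 1 = xlo" by (simp add: gauss_seq_1 e)
  have "gauss_seq c 2 = xlo ^ 4"
    by (simp add: gauss_seq_def flip: e exp_of_nat_mult)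
  also have "\<dots> \<le> 11/10 / (real b)\<^sup>2 * xlo\<^sup>2"
  proof -
    have "real b * xlo \<le> real b * X" using xlo_X by (intro mult_left_mono) auto
    then have "(real b * xlo)\<^sup>2 \<le> 1" using bX xlo0 by (intro power_le_one) auto
    then have "xlo\<^sup>2 \<le> 11/10 / (real b)\<^sup>2" using rb by (simp add: power_mult_distrib field_simps)
    then have "xlo\<^sup>2 * xlo\<^sup>2 \<le> 11/10 / (real b)\<^sup>2 * xlo\<^sup>2" by (rule mult_right_mono) simp
    then show ?thesis by simp
  qed
  finally have two: "gauss_seq c 2 \<le> 11/10 / (real b)\<^sup>2 * xlo\<^sup>2" .
  have "unit_seq (gauss_seq c)" by (simp add: unit_seq_def nnsym_gauss_seq c)
  moreover have "ratio_le (gauss_seq c) xlo"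
    using gauss_seq_step(1)[OF c] by (simp add: ratio_le_def e mult.commute)
  ultimately show ?thesis using two xlo_X by (simp add: Om_def one flip: c_def)
qed

text \<open>All defining conditions are closed under pointwise limits; summability survives because
  the whole region has a common geometric majorant.\<close>

lemma Om_limit:
  assumes O: "\<And>n. Om (F n)" and lim: "\<And>q. (\<lambda>n. F n q) \<longlonglongrightarrow> L q"
  shows "Om L"
proof -
  note u = OmD(1)[OF O]
  have nn: "0 \<le> L q" for q by (rule LIMSEQ_le_const[OF lim]) (use unit_seqD(3)[OF u] in auto)
  have le: "L q \<le> X ^ nat \<bar>q\<bar>" for q by (rule LIMSEQ_le_const2[OF lim]) (use Om_le_power[OF O] in auto)
  have sym: "L (- q) = L q" for q
    using LIMSEQ_unique[OF lim[of "- q"]] lim[of q] unit_seqD(4)[OF u] by simp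
  have z: "L 0 = 1" using LIMSEQ_unique[OF lim[of 0]] unit_seqD(2)[OF u] by simp
  have "L summable_on UNIV"
    by (rule summable_on_norm_bound(2)[OF geometric_tail(1)[OF X_eighth]]) (use nn le in auto)
  then have unit: "unit_seq L" using nn sym z by (simp add: unit_seq_def nnsym_def)
  have "ratio_le L (L 1)" unfolding ratio_le_def
  proof (intro allI impI)
    fix q :: int assume "0 \<le> q"
    then show "L (q + 1) \<le> L 1 * L q"
      by (intro LIMSEQ_le[OF lim tendsto_mult[OF lim lim]]) (use OmD(2)[OF O] in \<open>auto simp: ratio_le_def\<close>)
  qed
  moreover have "L 2 \<le> 11/10 / (real b)\<^sup>2 * (L 1)\<^sup>2"
    by (intro LIMSEQ_le[OF lim tendsto_mult[OF tendsto_const tendsto_power[OF lim]]]) (use OmD(3)[OF O] in auto)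
  moreover have "xlo \<le> L 1" by (rule LIMSEQ_le_const[OF lim]) (use OmD(4)[OF O] in auto)
  moreover have "L 1 \<le> X" by (rule LIMSEQ_le_const2[OF lim]) (use OmD(5)[OF O] in auto)
  ultimately show ?thesis using unit by (simp add: Om_def)
qed

text \<open>Finite partial sums of the tail pass to the limit, hence so does the bound on the full
  tail.\<close>

lemma close_seq_limit:
  assumes u: "unit_seq f" "\<And>n. unit_seq (F n)" "unit_seq L" and lim: "\<And>q. (\<lambda>n. F n q) \<longlonglongrightarrow> L q"
    and c: "\<And>n. n \<ge> n0 \<Longrightarrow> close_seq f (F n) M"
  shows "close_seq f L M"
  unfolding close_seq_def
proof
  have l: "(\<lambda>n. \<bar>f q - F n q\<bar>) \<longlonglongrightarrow> \<bar>f q - L q\<bar>" for q by (intro tendsto_intros lim)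
  show "\<bar>f 1 - L 1\<bar> \<le> M" by (rule LIMSEQ_le_const2[OF l]) (use c in \<open>auto simp: close_seq_def\<close>)
  show "(\<Sum>\<^sub>\<infinity>q\<in>{2..}. \<bar>f q - L q\<bar>) \<le> tau * M"
  proof (rule infsum_le_finite_sums[OF seq_diff_summable[OF u(1,3)]])
    fix A :: "int set" assume A: "finite A" "A \<subseteq> {2..}"
    have "(\<Sum>q\<in>A. \<bar>f q - F n q\<bar>) \<le> tau * M" if "n0 \<le> n" for n
      using finite_sum_le_infsum[OF seq_diff_summable[OF u(1) u(2)[of n]] A] c[OF that] by (auto simp: close_seq_def)
    then show "(\<Sum>q\<in>A. \<bar>f q - L q\<bar>) \<le> tau * M"
      by (intro LIMSEQ_le_const2[OF tendsto_sum[OF l]]) auto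
  qed
qed

text \<open>Banach's argument coefficient by coefficient: closeness in the weighted distance makes
  every coefficient a Cauchy sequence, and the limit stays in the region, where the contraction
  applies once more and identifies it as fixed.\<close>

lemma fixed_point_exists:
  assumes w: "window \<kappa>"
  shows "\<exists>L. Om L \<and> renorm b \<kappa> L = L"
proof -
  define F where "F = (\<lambda>n. (renorm b \<kappa> ^^ n) (gauss_seq (- ln xlo)))"
  define \<rho> where "\<rho> = 1 - \<delta> / 5"
  have \<rho>: "0 < \<rho>" "\<rho> < 1" using \<delta>0 b\<delta> by (auto simp: \<rho>_def)
  have FS: "F (Suc n) = renorm b \<kappa> (F n)" for n by (simp add: F_def)
  have O: "Om (F n)" for n
  proof (induction n)
    case 0 show ?case by (simp add: F_def Om_start)
  next
    case (Suc n) then show ?case unfolding FS by (rule Om_renorm[OF _ w])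
  qed
  note u = OmD(1)[OF O]
  define M where "M = X + 3 * X\<^sup>2 / tau"
  have M0: "0 \<le> M" using X0 tau0 by (simp add: M_def)
  have step: "close_seq (F n) (F (Suc n)) (\<rho> ^ n * M)" for n
  proof (induction n)
    case 0 then show ?case using Om_close[OF O O] by (simp add: M_def)
  next
    case (Suc n)
    have "close_seq (renorm b \<kappa> (F n)) (renorm b \<kappa> (F (Suc n))) ((1 - \<delta> / 5) * (\<rho> ^ n * M))"
      by (rule contraction[OF O O Suc w])
    then show ?case by (simp add: FS \<rho>_def mult.assoc)
  qed
  have far: "close_seq (F n) (F (n + k)) (\<rho> ^ n * M / (1 - \<rho>) * (1 - \<rho> ^ k))" for n k
  proof (induction k)
    case 0
    then show ?case by (simp add: close_seq_def)
  next
    case (Suc k)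
    have "\<rho> ^ n * M / (1 - \<rho>) * (1 - \<rho> ^ k) + \<rho> ^ (n + k) * M = \<rho> ^ n * M / (1 - \<rho>) * (1 - \<rho> ^ Suc k)"
      using \<rho> by (simp add: field_simps power_add)
    then show ?case using close_seq_trans[OF u u u Suc step[of "n + k"]] by simp
  qed
  have far': "close_seq (F n) (F m) (\<rho> ^ n * M / (1 - \<rho>))" if "n \<le> m" for n m
  proof -
    have "\<rho> ^ n * M / (1 - \<rho>) * (1 - \<rho> ^ (m - n)) \<le> \<rho> ^ n * M / (1 - \<rho>) * 1"
      using \<rho> M0 by (intro mult_left_mono) auto
    then show ?thesis using close_seq_mono[OF far[of n "m - n"]] that by simp
  qed
  have to0: "(\<lambda>n. \<rho> ^ n * M / (1 - \<rho>)) \<longlonglongrightarrow> 0"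
    using tendsto_mult_right_zero[OF LIMSEQ_realpow_zero, of \<rho> "M / (1 - \<rho>)"] \<rho> by (simp add: mult.commute)
  have "Cauchy (\<lambda>n. F n q)" for q
  proof (rule CauchyI')
    fix e :: real assume "0 < e"
    then obtain N where N: "\<And>n. n \<ge> N \<Longrightarrow> norm (\<rho> ^ n * M / (1 - \<rho>)) < e"
      using LIMSEQ_D[OF to0] by auto
    show "\<exists>N. \<forall>m\<ge>N. \<forall>n>m. dist (F m q) (F n q) < e"
    proof (intro exI[of _ N] allI impI)
      fix m n assume "N \<le> m" "m < n"
      then have ab: "\<bar>F m q - F n q\<bar> \<le> \<rho> ^ m * M / (1 - \<rho>)" "\<bar>\<rho> ^ m * M / (1 - \<rho>)\<bar> < e"
        using close_seq_coeff[OF u u far'[of m n], of q] N[of m] by auto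
      then show "dist (F m q) (F n q) < e"
        unfolding dist_real_def by (intro le_less_trans[OF order_trans[OF ab(1) abs_ge_self] ab(2)])
    qed
  qed
  then have "\<exists>l. (\<lambda>n. F n q) \<longlonglongrightarrow> l" for q using Cauchy_convergent convergent_def by blast
  then obtain L where lim: "\<And>q. (\<lambda>n. F n q) \<longlonglongrightarrow> L q" by metis
  have OL: "Om L" by (rule Om_limit[OF O lim])
  have cl: "close_seq (F n) L (\<rho> ^ n * M / (1 - \<rho>))" for n
    by (rule close_seq_limit[OF u u OmD(1)[OF OL] lim far'])
  have "renorm b \<kappa> L q = L q" for q
  proof -
    have "\<bar>F (Suc n) q - renorm b \<kappa> L q\<bar> \<le> \<rho> * (\<rho> ^ n * M / (1 - \<rho>))" for n
      using close_seq_coeff[OF _ _ contraction[OF O OL cl w], of n q] renorm_unit[OF u window_bounds(5)[OF w]]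
        renorm_unit[OF OmD(1)[OF OL] window_bounds(5)[OF w]] by (simp add: FS \<rho>_def)
    then have "(\<lambda>n. F (Suc n) q - renorm b \<kappa> L q) \<longlonglongrightarrow> 0"
      by (intro Lim_null_comparison[OF _ tendsto_mult_right_zero[OF to0, of \<rho>]]) auto
    then have "(\<lambda>n. F (Suc n) q) \<longlonglongrightarrow> renorm b \<kappa> L q" by (simp add: LIM_zero_iff)
    then show ?thesis using LIMSEQ_unique LIMSEQ_Suc[OF lim[of q]] by blast
  qed
  then show ?thesis using OL by (intro exI[of _ L]) auto
qed

subsection \<open>Absorption along an orbit\<close>

text \<open>The horizon L is finite because the variances are close to one only while both k and n -
  k are large. The waiting times found below do not depend on L.\<close>

definition orbit :: "nat \<Rightarrow> (nat \<Rightarrow> real) \<Rightarrow> (nat \<Rightarrow> int \<Rightarrow> real) \<Rightarrow> bool" where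
  "orbit L \<kappa> f \<longleftrightarrow> unit_seq (f 0) \<and> (\<forall>j<L. window (\<kappa> j) \<and> f (Suc j) = renorm b (\<kappa> j) (f j))"

lemma orbit_unit: "orbit L \<kappa> f \<Longrightarrow> j \<le> L \<Longrightarrow> unit_seq (f j)"
proof (induction j)
  case (Suc j)
  then show ?case using renorm_unit[OF _ window_bounds(5)] by (auto simp: orbit_def)
qed (simp add: orbit_def)

lemma orbit_shift: assumes "orbit L \<kappa> f" "n \<le> L" shows "orbit (L - n) (\<lambda>j. \<kappa> (n + j)) (\<lambda>j. f (n + j))"
  using assms orbit_unit[OF assms] by (auto simp: orbit_def)

lemma pow_eventually_small:
  fixes r C e :: real assumes "0 \<le> r" "r < 1" "0 < e" shows "\<exists>n. r ^ n * C \<le> e"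
proof -
  have "(\<lambda>n. r ^ n * C) \<longlonglongrightarrow> 0" using assms by (intro tendsto_mult_left_zero LIMSEQ_realpow_zero)
  from LIMSEQ_D[OF this assms(3)] obtain n where "norm (r ^ n * C - 0) < e" by blast
  then show ?thesis by (intro exI[of _ n]) auto
qed

lemma absorb_upper:
  assumes "0 < M0"
  shows "\<exists>n. \<forall>L \<kappa> f. orbit L \<kappa> f \<and> upper_bd (f 0) M0 \<longrightarrow> (\<forall>j. n \<le> j \<and> j \<le> L \<longrightarrow> upper_bd (f j) X)"
proof -
  define \<rho> where "\<rho> = 1 - \<delta> / 5"
  have \<rho>: "0 < \<rho>" "\<rho> < 1" using \<delta>0 b\<delta> by (auto simp: \<rho>_def)
  obtain n where n: "\<rho> ^ n * M0 \<le> X" using pow_eventually_small[of \<rho> X M0] \<rho> X0 by auto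
  have U: "upper_bd (f j) (max X (\<rho> ^ j * M0))" if "orbit L \<kappa> f" "upper_bd (f 0) M0" "j \<le> L" for L \<kappa> f j
    using that(3)
  proof (induction j)
    case 0
    then show ?case using upper_bd_mono[OF orbit_unit[OF that(1)] that(2)] by simp
  next
    case (Suc j)
    have u: "unit_seq (f j)" using orbit_unit[OF that(1)] Suc.prems by simp
    have w: "window (\<kappa> j)" "f (Suc j) = renorm b (\<kappa> j) (f j)" using that(1) Suc.prems by (auto simp: orbit_def)
    have "upper_bd (f (Suc j)) (max X (\<rho> * max X (\<rho> ^ j * M0)))"
      unfolding w(2) \<rho>_def by (rule renorm_upper_bd[OF u Suc.IH[unfolded \<rho>_def] w(1)]) (use Suc.prems in auto)
    moreover have "max X (\<rho> * max X (\<rho> ^ j * M0)) \<le> max X (\<rho> ^ Suc j * M0)"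
    proof -
      have "\<rho> * X \<le> 1 * X" using \<rho> X0 by (intro mult_right_mono) auto
      then show ?thesis by (auto simp: max_def mult.assoc)
    qed
    ultimately show ?case using upper_bd_mono[OF orbit_unit[OF that(1) Suc.prems]] by blast
  qed
  show ?thesis
  proof (intro exI[of _ n] allI impI)
    fix L \<kappa> f j assume a: "orbit L \<kappa> f \<and> upper_bd (f 0) M0" "n \<le> j \<and> j \<le> L"
    have "\<rho> ^ j \<le> \<rho> ^ n" using \<rho> a by (intro power_decreasing) auto
    then have "\<rho> ^ j * M0 \<le> X" using n assms mult_right_mono[of "\<rho> ^ j" "\<rho> ^ n" M0] by linarith
    then show "upper_bd (f j) X" using U[of L \<kappa> f j] a by (simp add: max_def)
  qed
qed

lemma orbit_lower:
  assumes o: "orbit L \<kappa> f" and Z: "\<And>j. j < L \<Longrightarrow> cpow (f j) b 0 \<le> Z" "1 \<le> Z" and j: "j \<le> L"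
  shows "f 0 1 / Z ^ j \<le> f j 1"
  using j
proof (induction j)
  case (Suc j)
  have u: "unit_seq (f j)" using orbit_unit[OF o] Suc.prems by simp
  have w: "window (\<kappa> j)" "f (Suc j) = renorm b (\<kappa> j) (f j)" using o Suc.prems by (auto simp: orbit_def)
  have S: "1 \<le> cpow (f j) b 0" "cpow (f j) b 0 \<le> Z" using S0_ge1[OF u] Z(1)[of j] Suc.prems by auto
  have x: "0 \<le> f j 1" by (rule unit_seqD(3)[OF u])
  have "f 0 1 / Z ^ Suc j = (f 0 1 / Z ^ j) / Z" by simp
  also have "\<dots> \<le> f j 1 / Z" using Suc Z(2) by (intro divide_right_mono) auto
  also have "\<dots> \<le> f j 1 / cpow (f j) b 0" using S x by (intro divide_left_mono) auto
  also have "\<dots> \<le> exp (- \<kappa> j) * real b * f j 1 / cpow (f j) b 0"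
    using window_bounds(1)[OF w(1)] \<delta>0 x S mult_right_mono[of 1 "exp (- \<kappa> j) * real b" "f j 1"] by (intro divide_right_mono) auto
  also have "\<dots> \<le> f (Suc j) 1" unfolding w(2) by (rule renorm_one_ge[OF u])
  finally show ?case .
qed simp

lemma absorb_ratio:
  assumes "0 < m"
  shows "\<exists>n. \<forall>L \<kappa> f. orbit L \<kappa> f \<and> (\<forall>j\<le>L. upper_bd (f j) X) \<and> m \<le> f 0 1 \<longrightarrow> (\<forall>j. n \<le> j \<and> j \<le> L \<longrightarrow> ratio_le (f j) (f j 1))"
proof -
  \<comment> \<open>The initial excess of the ratios, which are at most X, over the first
    coefficient, which is at least m.\<close>
  define G where "G = max 1 (X / m)"
  obtain n where n: "(1/2) ^ n * G \<le> 1" using pow_eventually_small[of "1/2" 1 G] by auto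
  have U: "ratio_le (f j) (max 1 ((1/2) ^ j * G) * f j 1)"
    if o: "orbit L \<kappa> f" and ub: "\<And>j. j \<le> L \<Longrightarrow> upper_bd (f j) X" and m: "m \<le> f 0 1" and j: "j \<le> L" for L \<kappa> f j
    using j
  proof (induction j)
    case 0
    have u: "unit_seq (f 0)" using o by (simp add: orbit_def)
    have "X = X / m * m" using assms by simp
    also have "\<dots> \<le> max 1 ((1/2) ^ 0 * G) * f 0 1" using m X0 assms by (intro mult_mono) (auto simp: G_def)
    finally have "X * f 0 q \<le> max 1 ((1/2) ^ 0 * G) * f 0 1 * f 0 q" for q using unit_seqD(3)[OF u] by (rule mult_right_mono)
    then show ?case using upper_bd_X_ratio[OF u ub[of 0]] unfolding ratio_le_def by (meson le0 order_trans)
  next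
    case (Suc j)
    have u: "unit_seq (f j)" using orbit_unit[OF o] Suc.prems by simp
    have w: "window (\<kappa> j)" "f (Suc j) = renorm b (\<kappa> j) (f j)" using o Suc.prems by (auto simp: orbit_def)
    let ?G = "max 1 ((1/2) ^ j * G)"
    have "ratio_le (f (Suc j)) (max 1 (?G / 2) * f (Suc j) 1)"
      unfolding w(2) by (rule renorm_ratio_self[OF u upper_bd_X_ratio[OF u ub] Suc.IH _ w(1)]) (use Suc.prems in auto)
    moreover have "max 1 (?G / 2) = max 1 ((1/2) ^ Suc j * G)" by (auto simp: max_def)
    ultimately show ?case by simp
  qed
  show ?thesis
  proof (intro exI[of _ n] allI impI)
    fix L \<kappa> f j assume a: "orbit L \<kappa> f \<and> (\<forall>j\<le>L. upper_bd (f j) X) \<and> m \<le> f 0 1" "n \<le> j \<and> j \<le> L"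
    have "(1/2::real) ^ j \<le> (1/2) ^ n" using a by (intro power_decreasing) auto
    moreover have "0 \<le> G" by (simp add: G_def)
    ultimately have "(1/2) ^ j * G \<le> (1/2) ^ n * G" by (rule mult_right_mono)
    then have "max 1 ((1/2) ^ j * G) = 1" using n by (intro max_absorb1) linarith
    then show "ratio_le (f j) (f j 1)" using U[of L \<kappa> f j] a by simp
  qed
qed

lemma absorb_lower:
  assumes "0 < m"
  shows "\<exists>n. \<forall>L \<kappa> f. orbit L \<kappa> f \<and> (\<forall>j\<le>L. upper_bd (f j) X \<and> ratio_le (f j) (f j 1)) \<and> m \<le> f 0 1 \<longrightarrow> (\<forall>j. n \<le> j \<and> j \<le> L \<longrightarrow> xlo \<le> f j 1)"
proof -
  obtain n where n: "xlo / m \<le> (1 + \<delta> / 50) ^ n" using real_arch_pow[of "1 + \<delta> / 50" "xlo / m"] \<delta>0 by (auto intro: less_imp_le)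
  have U: "min xlo ((1 + \<delta> / 50) ^ j * m) \<le> f j 1"
    if o: "orbit L \<kappa> f" and ub: "\<And>j. j \<le> L \<Longrightarrow> upper_bd (f j) X \<and> ratio_le (f j) (f j 1)" and m: "m \<le> f 0 1" and j: "j \<le> L" for L \<kappa> f j
    using j
  proof (induction j)
    case (Suc j)
    have u: "unit_seq (f j)" using orbit_unit[OF o] Suc.prems by simp
    have w: "window (\<kappa> j)" "f (Suc j) = renorm b (\<kappa> j) (f j)" using o Suc.prems by (auto simp: orbit_def)
    have "min xlo ((1 + \<delta> / 50) * f j 1) \<le> f (Suc j) 1"
      unfolding w(2) by (rule renorm_one_lower[OF u _ _ w(1)]) (use ub[of j] Suc.prems in \<open>auto simp: upper_bd_def\<close>)
    moreover have "min xlo ((1 + \<delta> / 50) ^ Suc j * m) \<le> min xlo ((1 + \<delta> / 50) * f j 1)"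
    proof -
      have "(1 + \<delta> / 50) * min xlo ((1 + \<delta> / 50) ^ j * m) \<le> (1 + \<delta> / 50) * f j 1" using Suc \<delta>0 by (intro mult_left_mono) auto
      moreover have "1 * xlo \<le> (1 + \<delta> / 50) * xlo" using \<delta>0 xlo0 by (intro mult_right_mono) auto
      ultimately show ?thesis by (auto simp: min_def mult.assoc split: if_splits)
    qed
    ultimately show ?case by simp
  qed (use m in simp)
  show ?thesis
  proof (intro exI[of _ n] allI impI)
    fix L \<kappa> f j assume a: "orbit L \<kappa> f \<and> (\<forall>j\<le>L. upper_bd (f j) X \<and> ratio_le (f j) (f j 1)) \<and> m \<le> f 0 1" "n \<le> j \<and> j \<le> L"
    have "(1 + \<delta> / 50) ^ n \<le> (1 + \<delta> / 50) ^ j" using a \<delta>0 by (intro power_increasing) auto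
    then have "xlo / m \<le> (1 + \<delta> / 50) ^ j" using n by (rule order_trans[rotated])
    then have "xlo \<le> (1 + \<delta> / 50) ^ j * m" using assms by (simp only: pos_divide_le_eq)
    then show "xlo \<le> f j 1" using U[of L \<kappa> f j] a by (simp add: min_def)
  qed
qed

text \<open>The stages must succeed each other: the ratios approach f 1 only after the upper bound X
  is reached, and the growth of f 1 uses that f 1 bounds all ratios. The waiting time depends only
  on M0, m and Z, not on the orbit.\<close>

lemma absorb:
  assumes "0 < M0" "0 < m" "1 \<le> Z"
  shows "\<exists>n. \<forall>L \<kappa> f. orbit L \<kappa> f \<and> upper_bd (f 0) M0 \<and> m \<le> f 0 1 \<and> (\<forall>j\<le>L. cpow (f j) b 0 \<le> Z) \<longrightarrow>
    (\<forall>j. n \<le> j \<and> j \<le> L \<longrightarrow> Om (f j))"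
proof -
  obtain n1 where n1: "\<And>L \<kappa> f j. orbit L \<kappa> f \<Longrightarrow> upper_bd (f 0) M0 \<Longrightarrow> n1 \<le> j \<Longrightarrow> j \<le> L \<Longrightarrow> upper_bd (f j) X"
    using absorb_upper[OF assms(1)] by blast
  \<comment> \<open>During each earlier stage the first coefficient can shrink by up to a factor Z
    per step (\<open>orbit_lower\<close>); \<open>m1\<close> and \<open>m2\<close> record what
    surely remains.\<close>
  define m1 where "m1 = m / Z ^ n1"
  have m1: "0 < m1" using assms by (simp add: m1_def)
  obtain n2 where n2: "\<And>L \<kappa> f j. orbit L \<kappa> f \<Longrightarrow> (\<And>j. j \<le> L \<Longrightarrow> upper_bd (f j) X) \<Longrightarrow> m1 \<le> f 0 1 \<Longrightarrow> n2 \<le> j \<Longrightarrow> j \<le> L \<Longrightarrow> ratio_le (f j) (f j 1)"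
    using absorb_ratio[OF m1] by blast
  define m2 where "m2 = m1 / Z ^ n2"
  have m2: "0 < m2" using assms m1 by (simp add: m2_def)
  obtain n3 where n3: "\<And>L \<kappa> f j. orbit L \<kappa> f \<Longrightarrow> (\<And>j. j \<le> L \<Longrightarrow> upper_bd (f j) X \<and> ratio_le (f j) (f j 1)) \<Longrightarrow> m2 \<le> f 0 1 \<Longrightarrow> n3 \<le> j \<Longrightarrow> j \<le> L \<Longrightarrow> xlo \<le> f j 1"
    using absorb_lower[OF m2] by blast
  show ?thesis
  proof (intro exI[of _ "n1 + n2 + n3 + 1"] allI impI)
    fix L \<kappa> f j assume a: "orbit L \<kappa> f \<and> upper_bd (f 0) M0 \<and> m \<le> f 0 1 \<and> (\<forall>j\<le>L. cpow (f j) b 0 \<le> Z)"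
      and j: "n1 + n2 + n3 + 1 \<le> j \<and> j \<le> L"
    then have o: "orbit L \<kappa> f" and ub0: "upper_bd (f 0) M0" and Z: "\<And>j. j < L \<Longrightarrow> cpow (f j) b 0 \<le> Z" by auto
    have ub: "upper_bd (f i) X" if "n1 \<le> i" "i \<le> L" for i using n1[OF o ub0 that] .
    have low: "m / Z ^ i \<le> f i 1" if "i \<le> L" for i
    proof -
      have "m / Z ^ i \<le> f 0 1 / Z ^ i" using a assms by (intro divide_right_mono) auto
      then show ?thesis using orbit_lower[OF o Z assms(3) that] by simp
    qed
    have o1: "orbit (L - n1) (\<lambda>j. \<kappa> (n1 + j)) (\<lambda>j. f (n1 + j))" by (rule orbit_shift[OF o]) (use j in auto)
    have r: "ratio_le (f i) (f i 1)" if "n1 + n2 \<le> i" "i \<le> L" for i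
      using n2[OF o1, of "i - n1"] ub low[of n1] that by (auto simp: m1_def)
    have o2: "orbit (L - (n1 + n2)) (\<lambda>j. \<kappa> (n1 + n2 + j)) (\<lambda>j. f (n1 + n2 + j))" by (rule orbit_shift[OF o]) (use j in auto)
    have x: "xlo \<le> f i 1" if "n1 + n2 + n3 \<le> i" "i \<le> L" for i
      using n3[OF o2, of "i - (n1 + n2)"] ub r low[of "n1 + n2"] that by (auto simp: m1_def m2_def power_add)
    \<comment> \<open>The bound on f 2 is a property of the image of a sequence with the other
      properties. It takes one more step, hence the final + 1 in the waiting time.\<close>
    define i where "i = j - 1"
    have i: "j = Suc i" "n1 + n2 + n3 \<le> i" "i < L" using j by (auto simp: i_def)
    have w: "window (\<kappa> i)" "f j = renorm b (\<kappa> i) (f i)" using o i by (auto simp: orbit_def)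
    have "f j 2 \<le> 11/10 / (real b)\<^sup>2 * (f j 1)\<^sup>2"
      unfolding w(2) by (rule renorm_two_le[OF orbit_unit[OF o] r _ w(1)]) (use i ub[of i] in \<open>auto simp: upper_bd_def\<close>)
    then show "Om (f j)"
      using orbit_unit[OF o, of j] r[of j] x[of j] ub[of j] j by (simp add: Om_def upper_bd_def)
  qed
qed

end

lemma cpow_scale: "cpow (\<lambda>q. c * f q) j = (\<lambda>q. c ^ j * cpow f j q)"
proof (induction j)
  case (Suc j)
  have "conv (\<lambda>q. c * f q) (\<lambda>q. c ^ j * cpow f j q) q = c ^ Suc j * conv f (cpow f j) q" for q
    unfolding conv_def infsum_cmult_right'[symmetric] by (simp add: mult_ac)
  then show ?case using Suc by auto
qed auto

lemma dser_scale: "dser m (\<lambda>q. c * f q) z = c * dser m f z"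
  unfolding dser_def infsum_cmult_right'[symmetric] by (simp add: mult_ac)

subsection \<open>Sums over tuples\<close>

definition sum_tuples :: "nat \<Rightarrow> int \<Rightarrow> (nat \<Rightarrow> int) set" where
  "sum_tuples j q = {t \<in> {1..j} \<rightarrow>\<^sub>E UNIV. (\<Sum>i=1..j. t i) = q}"

lemma sum_tuples_Suc_bij:
  "bij_betw (\<lambda>(i, t). t(Suc j := i)) (Sigma UNIV (\<lambda>i. sum_tuples j (q - i))) (sum_tuples (Suc j) q)"
proof (rule bij_betwI[where g = "\<lambda>t. (t (Suc j), t(Suc j := undefined))"])
  have s: "(\<Sum>k=1..j. (t(Suc j := i)) k) = (\<Sum>k=1..j. t k)" for t :: "nat \<Rightarrow> int" and i
    by (intro sum.cong) auto
  have I: "{1..Suc j} = insert (Suc j) {1..j}" by auto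
  show "(\<lambda>(i, t). t(Suc j := i)) \<in> (Sigma UNIV (\<lambda>i. sum_tuples j (q - i))) \<rightarrow> sum_tuples (Suc j) q"
    by (auto simp: sum_tuples_def s PiE_iff extensional_def I simp del: One_nat_def)
  show "(\<lambda>t. (t (Suc j), t(Suc j := undefined))) \<in> sum_tuples (Suc j) q \<rightarrow> Sigma UNIV (\<lambda>i. sum_tuples j (q - i))"
    by (auto simp: sum_tuples_def s PiE_iff extensional_def I simp del: One_nat_def)
  show "(\<lambda>t. (t (Suc j), t(Suc j := undefined))) ((\<lambda>(i, t). t(Suc j := i)) x) = x" if "x \<in> Sigma UNIV (\<lambda>i. sum_tuples j (q - i))" for x
    using that by (auto simp: sum_tuples_def PiE_iff extensional_def fun_eq_iff)
  show "(\<lambda>(i, t). t(Suc j := i)) ((\<lambda>t. (t (Suc j), t(Suc j := undefined))) t) = t" for t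
    by auto
qed

text \<open>Identifies the iterated convolution with the sum over tuples, and so the normalizing
  constant of the limit potential with the convolution power at 0.\<close>

lemma cpow_has_sum:
  assumes f: "nnsym f"
  shows "((\<lambda>t. \<Prod>i=1..j. f (t i)) has_sum cpow f j q) (sum_tuples j q)"
proof (induction j arbitrary: q)
  case 0
  have "sum_tuples 0 q = (if q = 0 then {\<lambda>_. undefined} else {})" by (auto simp: sum_tuples_def)
  then show ?case by (auto intro!: has_sum_finiteI)
next
  case (Suc j)
  have p: "(\<Prod>k=1..Suc j. f ((t(Suc j := i)) k)) = f i * (\<Prod>k=1..j. f (t k))" for t i
  proof -
    have "(\<Prod>k=1..j. f ((t(Suc j := i)) k)) = (\<Prod>k=1..j. f (t k))" by (intro prod.cong) auto
    then show ?thesis by (simp add: mult.commute)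
  qed
  let ?F = "\<lambda>(i, t). f i * (\<Prod>k=1..j. f (t k))"
  have inner: "((\<lambda>t. ?F (i, t)) has_sum f i * cpow f j (q - i)) (sum_tuples j (q - i))" for i
    using has_sum_cmult_right[OF Suc.IH[of "q - i"], of "f i"] by simp
  have outer: "((\<lambda>i. f i * cpow f j (q - i)) has_sum cpow f (Suc j) q) UNIV"
    unfolding cpow.simps conv_def by (intro has_sum_infsum conv_summand_summable f nnsym_cpow)
  have "?F summable_on (Sigma UNIV (\<lambda>i. sum_tuples j (q - i)))"
    by (rule summable_on_SigmaI[OF inner has_sum_imp_summable[OF outer]])
      (use nnsymD(1)[OF f] in \<open>auto intro!: mult_nonneg_nonneg prod_nonneg\<close>)
  then have "(?F has_sum cpow f (Suc j) q) (Sigma UNIV (\<lambda>i. sum_tuples j (q - i)))"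
    using inner outer by (intro has_sum_SigmaI) auto
  also have "?this \<longleftrightarrow> ((\<lambda>x. \<Prod>k=1..Suc j. f ((case x of (i, t) \<Rightarrow> t(Suc j := i)) k)) has_sum cpow f (Suc j) q) (Sigma UNIV (\<lambda>i. sum_tuples j (q - i)))"
  proof (rule has_sum_cong)
    show "?F x = (\<Prod>k=1..Suc j. f ((case x of (i, t) \<Rightarrow> t(Suc j := i)) k))" for x
      by (cases x) (simp only: p case_prod_conv)
  qed
  also have "\<dots> \<longleftrightarrow> ((\<lambda>t. \<Prod>k=1..Suc j. f (t k)) has_sum cpow f (Suc j) q) (sum_tuples (Suc j) q)"
    by (rule has_sum_reindex_bij_betw[OF sum_tuples_Suc_bij])
  finally show ?case .
qed

lemma zero_sum_tuples_infsum:
  "nnsym f \<Longrightarrow> (\<Sum>\<^sub>\<infinity>t\<in>zero_sum_tuples b. \<Prod>i=1..b. f (t i)) = cpow f b 0"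
  using infsumI[OF cpow_has_sum[of f b 0]] by (simp add: zero_sum_tuples_def sum_tuples_def)

subsection \<open>Comparison of generating functions\<close>

text \<open>The difference is bounded both by M and by the Gaussian, hence by the geometric mean of
  the two. Half of the Gaussian decay pays for the sum and its derivatives, and the price is the
  square root of M, which only halves exponential rates.\<close>

lemma dser_diff_le:
  assumes m: "0 < m" and f: "\<And>q. 0 \<le> f q" "\<And>q. f q \<le> gauss_seq m q" and g: "\<And>q. 0 \<le> g q" "\<And>q. g q \<le> gauss_seq m q"
    and M: "\<And>q. \<bar>f q - g q\<bar> \<le> M"
  shows "\<bar>dser i f z - dser i g z\<bar> \<le> sqrt M * gmom (m / 2) i"
proof -
  have M0: "0 \<le> M" using M[of 0] by linarith
  have b: "\<bar>f q - g q\<bar> \<le> sqrt M * gauss_seq (m / 2) q" for q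
  proof -
    have "\<bar>f q - g q\<bar> \<le> gauss_seq m q" using f[of q] g[of q] by (simp add: abs_le_iff)
    then have "\<bar>f q - g q\<bar> * \<bar>f q - g q\<bar> \<le> M * gauss_seq m q" using M[of q] by (intro mult_mono) (auto simp: M0)
    then have "\<bar>f q - g q\<bar> \<le> sqrt (M * gauss_seq m q)" by (intro real_le_rsqrt) (simp add: power2_eq_square)
    also have "gauss_seq m q = (gauss_seq (m / 2) q)\<^sup>2" by (simp add: gauss_seq_def power2_eq_square flip: exp_add)
    finally show ?thesis using gauss_seq_pos[of "m / 2" q] by (simp add: real_sqrt_mult)
  qed
  have a: "\<bar>f q\<bar> \<le> 1 * gauss_seq m q" "\<bar>g q\<bar> \<le> 1 * gauss_seq m q" for q using f g by auto
  have "dser i f z + - dser i g z = (\<Sum>\<^sub>\<infinity>q. f q * (2 * pi * of_int q) ^ i * cos (2 * pi * of_int q * z + real i * (pi / 2))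
      + - (g q * (2 * pi * of_int q) ^ i * cos (2 * pi * of_int q * z + real i * (pi / 2))))"
    unfolding dser_def infsum_uminus[symmetric]
    by (rule infsum_add[symmetric, OF dser_bound(2)[where f = f, OF m a(1)]])
      (simp only: summable_on_uminus dser_bound(2)[where f = g, OF m a(2)])
  also have "\<dots> = dser i (\<lambda>q. f q - g q) z"
    unfolding dser_def by (intro infsum_cong) (simp add: algebra_simps)
  finally have "dser i f z + - dser i g z = dser i (\<lambda>q. f q - g q) z" .
  moreover have "\<bar>dser i (\<lambda>q. f q - g q) z\<bar> \<le> sqrt M * gmom (m / 2) i"
    by (rule dser_bound(1)[OF _ b]) (use m in auto)
  ultimately show ?thesis by simp
qed

lemma power_diff_le:
  fixes x y G :: real
  assumes "\<bar>x\<bar> \<le> G" "\<bar>y\<bar> \<le> G" "1 \<le> G" shows "\<bar>x ^ n - y ^ n\<bar> \<le> real n * G ^ n * \<bar>x - y\<bar>"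
proof (induction n)
  case (Suc n)
  have "x ^ Suc n - y ^ Suc n = x * (x ^ n - y ^ n) + y ^ n * (x - y)" by (simp add: algebra_simps)
  moreover have "\<bar>x * (x ^ n - y ^ n)\<bar> \<le> G * (real n * G ^ n * \<bar>x - y\<bar>)" by (rule abs_mult_le[OF assms(1) Suc])
  moreover have "\<bar>y ^ n * (x - y)\<bar> \<le> G ^ n * \<bar>x - y\<bar>"
    by (rule abs_mult_le) (use assms in \<open>auto simp: power_abs intro: power_mono\<close>)
  moreover have "G ^ n * \<bar>x - y\<bar> \<le> G ^ Suc n * \<bar>x - y\<bar>"
    using assms power_increasing[of n "Suc n" G] by (intro mult_right_mono) auto
  ultimately show ?case by (simp add: algebra_simps)
qed simp

lemma cpow_zero_diff_le:
  assumes f: "nnsym f" and g: "nnsym g" and G: "\<And>z. \<bar>rser f z\<bar> \<le> G" "\<And>z. \<bar>rser g z\<bar> \<le> G" "1 \<le> G"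
    and h: "\<And>z. \<bar>rser f z - rser g z\<bar> \<le> h"
  shows "\<bar>cpow f b 0 - cpow g b 0\<bar> \<le> real b * G ^ b * h"
proof -
  have i: "(\<lambda>z. rser k z ^ b) integrable_on {0..1}" if "nnsym k" for k
    by (intro integrable_continuous_interval continuous_intros rser_continuous that)
  have "cpow f b 0 - cpow g b 0 = integral {0..1} (\<lambda>z. rser f z ^ b) - integral {0..1} (\<lambda>z. rser g z ^ b)"
    using cpow_coeff[OF f, of b 0] cpow_coeff[OF g, of b 0] by simp
  also have "\<dots> = integral {0..1} (\<lambda>z. rser f z ^ b - rser g z ^ b)"
    by (rule Henstock_Kurzweil_Integration.integral_diff[symmetric, OF i[OF f] i[OF g]])
  also have "norm \<dots> \<le> real b * G ^ b * h * (1 - 0)"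
  proof (rule integral_bound)
    show "continuous_on {0..1} (\<lambda>z. rser f z ^ b - rser g z ^ b)" by (intro continuous_intros rser_continuous f g)
    show "norm (rser f z ^ b - rser g z ^ b) \<le> real b * G ^ b * h" for z
      unfolding real_norm_def using G by (intro order_trans[OF power_diff_le[OF G(1,2,3)]] mult_left_mono h) auto
  qed simp
  finally show ?thesis by simp
qed

lemma cpow_zero_le:
  assumes f: "nnsym f" and G: "\<And>z. \<bar>rser f z\<bar> \<le> G"
  shows "cpow f b 0 \<le> G ^ b"
proof -
  have "norm (integral {0..1} (\<lambda>z. rser f z ^ b)) \<le> G ^ b * (1 - 0)"
    by (rule integral_bound) (use G in \<open>auto intro!: continuous_intros rser_continuous f power_mono simp: power_abs\<close>)
  then show ?thesis using cpow_coeff[OF f, of b 0] by simp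
qed

lemma ln_diff_le: assumes "c \<le> x" "c \<le> y" "0 < (c::real)" shows "\<bar>ln x - ln y\<bar> \<le> \<bar>x - y\<bar> / c"
proof -
  have *: "ln x - ln y \<le> \<bar>x - y\<bar> / c" if "c \<le> x" "c \<le> y" for x y
  proof -
    have "ln x - ln y = ln (x / y)" using that assms by (simp add: ln_div)
    also have "\<dots> \<le> x / y - 1" using that assms by (intro ln_le_minus_one) auto
    also have "\<dots> = (x - y) / y" using that assms by (simp add: field_simps)
    also have "\<dots> \<le> \<bar>x - y\<bar> / c" using that assms by (intro frac_le) auto
    finally show ?thesis .
  qed
  show ?thesis using *[of x y] *[of y x] assms by (simp add: abs_le_iff abs_minus_commute)
qed

lemma quotient_diff_le:
  fixes a a' r r' :: real
  assumes "c \<le> r" "c \<le> r'" "0 < c" "\<bar>a - a'\<bar> \<le> h" "\<bar>r - r'\<bar> \<le> h'" "\<bar>a'\<bar> \<le> A"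
  shows "\<bar>a / r - a' / r'\<bar> \<le> h / c + A * h' / c\<^sup>2"
proof -
  have "a / r - a' / r' = (a - a') / r + (a' * (r' - r)) / (r * r')" using assms by (simp add: field_simps)
  moreover have "\<bar>(a - a') / r\<bar> \<le> h / c" unfolding abs_divide using assms by (intro frac_le) auto
  moreover have "\<bar>(a' * (r' - r)) / (r * r')\<bar> \<le> (A * h') / (c * c)"
    unfolding abs_divide using assms by (intro frac_le abs_mult_le) (auto simp: abs_mult intro!: mult_mono)
  moreover have "\<bar>x\<bar> \<le> p + p'" if "x = y + y'" "\<bar>y\<bar> \<le> p" "\<bar>y'\<bar> \<le> p'" for x y y' p p' :: real
    using that by linarith
  ultimately show ?thesis unfolding power2_eq_square by blast
qed

subsection \<open>The error weights\<close>

definition err_weight :: "real \<Rightarrow> (nat \<Rightarrow> real) \<Rightarrow> nat \<Rightarrow> nat \<Rightarrow> real" where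
  "err_weight \<eta> d n k = exp (- (\<eta> * real k)) + (\<Sum>j=0..k. exp (- (\<eta> * (real k - real j))) * d (min j (n - j)))"

lemma exp_sum_le:
  assumes "0 < \<eta>" shows "(\<Sum>j=0..k. exp (- (\<eta> * (real k - real j)))) \<le> 1 / (1 - exp (- \<eta>))"
proof -
  have "(\<Sum>j=0..k. exp (- (\<eta> * (real k - real j)))) = (\<Sum>i=0..k. exp (- \<eta>) ^ i)"
  proof (rule sum.reindex_bij_witness[of _ "\<lambda>i. k - i" "\<lambda>j. k - j"])
    fix j assume "j \<in> {0..k}"
    then show "exp (- \<eta>) ^ (k - j) = exp (- (\<eta> * (real k - real j)))"
      by (simp add: of_nat_diff mult.commute flip: exp_of_nat_mult)
  qed auto
  also have "\<dots> \<le> (\<Sum>i. exp (- \<eta>) ^ i)" using assms by (intro sum_le_suminf summable_geometric) auto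
  also have "\<dots> = 1 / (1 - exp (- \<eta>))" using assms by (intro suminf_geometric) auto
  finally show ?thesis .
qed

text \<open>Split the sum at an index J: the finitely many terms below J carry a factor exp (-
  \<eta> k), and beyond J the values of d are small while the exponential weights have a bounded
  sum.\<close>

lemma err_weight_tendsto:
  assumes \<eta>: "0 < \<eta>" and d: "d \<longlonglongrightarrow> 0" "\<And>j. 0 \<le> d j" and e: "0 < e"
  shows "\<exists>K. \<forall>n k. k \<le> n \<and> K \<le> min k (n - k) \<longrightarrow> err_weight \<eta> d n k < e"
proof -
  define S where "S = 1 / (1 - exp (- \<eta>))"
  have S: "0 < S" using \<eta> by (simp add: S_def)
  obtain J where J: "\<And>j. j \<ge> J \<Longrightarrow> norm (d j) < e / (3 * S)"
    using LIMSEQ_D[OF d(1), of "e / (3 * S)"] e S by auto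
  have "Bseq d" using d(1) convergent_imp_Bseq convergentI by blast
  then obtain D where D: "\<And>j. norm (d j) \<le> D" "0 < D" using Bseq_def by blast
  have t1: "(\<lambda>k. exp (- \<eta>) ^ k) \<longlonglongrightarrow> 0" using \<eta> by (intro LIMSEQ_realpow_zero) auto
  obtain K1 where K1: "\<And>k. k \<ge> K1 \<Longrightarrow> exp (- \<eta>) ^ k < e / 3"
    using LIMSEQ_D[OF t1, of "e / 3"] e by auto
  define B where "B = (real J + 1) * exp (\<eta> * real J) * D"
  have B: "0 < B" using D by (simp add: B_def)
  obtain K2 where K2: "\<And>k. k \<ge> K2 \<Longrightarrow> exp (- \<eta>) ^ k < e / (3 * B)"
    using LIMSEQ_D[OF t1, of "e / (3 * B)"] e B by auto
  have pw: "exp (- \<eta>) ^ k = exp (- (\<eta> * real k))" for k by (simp add: mult.commute flip: exp_of_nat_mult)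
  show ?thesis
  proof (intro exI[of _ "max J (max K1 K2)"] allI impI)
    fix n k assume a: "k \<le> n \<and> max J (max K1 K2) \<le> min k (n - k)"
    let ?w = "\<lambda>j. exp (- (\<eta> * (real k - real j)))"
    have "(\<Sum>j=0..k. ?w j * d (min j (n - j))) \<le> (\<Sum>j=0..k. ?w j * (e / (3 * S)) + (if j < J then exp (- \<eta>) ^ k * exp (\<eta> * real J) * D else 0))"
    proof (rule sum_mono)
      fix j assume j: "j \<in> {0..k}"
      show "?w j * d (min j (n - j)) \<le> ?w j * (e / (3 * S)) + (if j < J then exp (- \<eta>) ^ k * exp (\<eta> * real J) * D else 0)"
      proof (cases "j < J")
        case True
        have "\<eta> * real j \<le> \<eta> * real J" using True \<eta> by (intro mult_left_mono) auto
        then have "?w j \<le> exp (- \<eta>) ^ k * exp (\<eta> * real J)" unfolding pw by (simp add: algebra_simps flip: exp_add)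
        then have "?w j * d (min j (n - j)) \<le> exp (- \<eta>) ^ k * exp (\<eta> * real J) * D"
          using D(1)[of "min j (n - j)"] d(2) by (intro mult_mono) auto
        moreover have "0 \<le> ?w j * (e / (3 * S))" using e S by simp
        ultimately show ?thesis using True by simp
      next
        case False
        \<comment> \<open>Both entries of the minimum are at least J, because n - j \<ge> n -
          k.\<close>
        then have "d (min j (n - j)) \<le> e / (3 * S)" using J[of "min j (n - j)"] abs_ge_self[of "d (min j (n - j))"] j a by fastforce
        then have "?w j * d (min j (n - j)) \<le> ?w j * (e / (3 * S))" by (rule mult_left_mono) simp
        then show ?thesis using False by simp
      qed
    qed
    also have "\<dots> = (\<Sum>j=0..k. ?w j) * (e / (3 * S)) + (\<Sum>j=0..k. if j < J then exp (- \<eta>) ^ k * exp (\<eta> * real J) * D else 0)"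
      by (simp only: sum.distrib sum_distrib_right)
    also have "\<dots> \<le> S * (e / (3 * S)) + (real J + 1) * (exp (- \<eta>) ^ k * exp (\<eta> * real J) * D)"
    proof (intro add_mono mult_right_mono)
      show "(\<Sum>j=0..k. ?w j) \<le> S" unfolding S_def by (rule exp_sum_le[OF \<eta>])
      have "(\<Sum>j=0..k. if j < J then exp (- \<eta>) ^ k * exp (\<eta> * real J) * D else 0)
          = (\<Sum>j\<in>{0..k} \<inter> {..<J}. exp (- \<eta>) ^ k * exp (\<eta> * real J) * D)"
        by (subst sum.inter_restrict) (auto intro!: sum.cong)
      also have "\<dots> = real (card ({0..k} \<inter> {..<J})) * (exp (- \<eta>) ^ k * exp (\<eta> * real J) * D)" by simp
      also have "\<dots> \<le> (real J + 1) * (exp (- \<eta>) ^ k * exp (\<eta> * real J) * D)"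
      proof (rule mult_right_mono)
        have "card ({0..k} \<inter> {..<J}) \<le> card {..<J}" by (intro card_mono) auto
        then show "real (card ({0..k} \<inter> {..<J})) \<le> real J + 1" by simp
      qed (use D in auto)
      finally show "(\<Sum>j=0..k. if j < J then exp (- \<eta>) ^ k * exp (\<eta> * real J) * D else 0) \<le> (real J + 1) * (exp (- \<eta>) ^ k * exp (\<eta> * real J) * D)" .
    qed (use e S in auto)
    also have "\<dots> = e / 3 + exp (- \<eta>) ^ k * B" using S by (simp add: B_def mult_ac)
    also have "exp (- \<eta>) ^ k * B < e / (3 * B) * B" using K2[of k] a B by (intro mult_strict_right_mono) auto
    finally have "(\<Sum>j=0..k. ?w j * d (min j (n - j))) < 2 * e / 3" using B by simp
    moreover have "exp (- (\<eta> * real k)) < e / 3" using K1[of k] a unfolding pw by simp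
    ultimately show "err_weight \<eta> d n k < e" unfolding err_weight_def by linarith
  qed
qed

lemma err_weight_exponential:
  assumes \<eta>: "0 < \<eta>" and dec: "decays_exponentially d"
  shows "\<exists>\<eta>'>0. \<exists>C>0. \<forall>n k. k \<le> n \<longrightarrow> err_weight \<eta> d n k \<le> C * exp (- (\<eta>' * real (min k (n - k))))"
proof -
  obtain c K where c: "0 < c" and K: "\<And>j. \<bar>d j\<bar> \<le> K * exp (- (c * real j))"
    using dec unfolding decays_exponentially_def by blast
  have K0: "0 \<le> K" using K[of 0] by simp
  \<comment> \<open>Half of the smaller rate: one half keeps the sum over j bounded, the other half
    yields the decay in m.\<close>
  define a where "a = min \<eta> c / 2"
  have a: "0 < a" "2 * a \<le> \<eta>" "2 * a \<le> c" using \<eta> c by (auto simp: a_def)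
  define S where "S = 1 / (1 - exp (- a))"
  have S: "0 < S" using a by (simp add: S_def)
  show ?thesis
  proof (rule exI[of _ a], intro exI[of _ "1 + 2 * K * S"] conjI allI impI)
    show "0 < a" "0 < 1 + 2 * K * S" using a K0 S by (auto intro: add_pos_nonneg)
    fix n k :: nat assume k: "k \<le> n"
    define m where "m = real (min k (n - k))"
    have m: "m \<le> real k" "m \<le> real (n - k)" "0 \<le> m" by (auto simp: m_def)
    have t: "exp (- (\<eta> * (real k - real j))) * d (min j (n - j)) \<le> 2 * K * exp (- (a * m)) * exp (- (a * (real k - real j)))" if j: "j \<le> k" for j
    proof -
      have j': "real (n - k) \<le> real (n - j)" "real j \<le> real k" using j k by auto
      have "exp (- (c * real (min j (n - j)))) \<le> exp (- (2 * a * real (min j (n - j))))"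
        using a by (simp add: mult_right_mono)
      \<comment> \<open>If the minimum is not j, it is n - j, which is at least n - k and hence at
        least m.\<close>
      also have "\<dots> \<le> exp (- (2 * a * real j)) + exp (- (2 * a * m))"
      proof (cases "j \<le> n - j")
        case True then show ?thesis by simp
      next
        case False
        then have "m \<le> real (min j (n - j))" using m j' by simp
        then have "2 * a * m \<le> 2 * a * real (min j (n - j))" using a by (intro mult_left_mono) auto
        then show ?thesis by (simp add: add_increasing)
      qed
      finally have e1: "exp (- (c * real (min j (n - j)))) \<le> exp (- (2 * a * real j)) + exp (- (2 * a * m))" .
      have e2: "exp (- (\<eta> * (real k - real j))) \<le> exp (- (2 * a * (real k - real j)))"
        using a j' by (simp add: mult_right_mono)
      have "exp (- (\<eta> * (real k - real j))) * d (min j (n - j)) \<le> exp (- (2 * a * (real k - real j))) * (K * (exp (- (2 * a * real j)) + exp (- (2 * a * m))))"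
      proof -
        have "d (min j (n - j)) \<le> K * (exp (- (2 * a * real j)) + exp (- (2 * a * m)))"
          using K[of "min j (n - j)"] mult_left_mono[OF e1 K0] by linarith
        then have "exp (- (\<eta> * (real k - real j))) * d (min j (n - j)) \<le> exp (- (\<eta> * (real k - real j))) * (K * (exp (- (2 * a * real j)) + exp (- (2 * a * m))))"
          by (rule mult_left_mono) simp
        also have "\<dots> \<le> exp (- (2 * a * (real k - real j))) * (K * (exp (- (2 * a * real j)) + exp (- (2 * a * m))))"
          using K0 by (intro mult_right_mono[OF e2] mult_nonneg_nonneg add_nonneg_nonneg) auto
        finally show ?thesis .
      qed
      also have "\<dots> = K * (exp (- (2 * a * real k)) + exp (- (2 * a * (real k - real j)) - 2 * a * m))"
        by (simp add: algebra_simps flip: exp_add)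
      also have "\<dots> \<le> K * (exp (- (a * m)) * exp (- (a * (real k - real j))) + exp (- (a * m)) * exp (- (a * (real k - real j))))"
      proof (intro mult_left_mono add_mono K0)
        have "a * m \<le> a * real k" "0 \<le> a * real j" using a m by (auto intro: mult_left_mono)
        then show "exp (- (2 * a * real k)) \<le> exp (- (a * m)) * exp (- (a * (real k - real j)))"
          by (simp add: algebra_simps flip: exp_add)
        have "0 \<le> a * m" "0 \<le> a * (real k - real j)" using a m j' by auto
        then show "exp (- (2 * a * (real k - real j)) - 2 * a * m) \<le> exp (- (a * m)) * exp (- (a * (real k - real j)))"
          by (simp add: algebra_simps flip: exp_add)
      qed
      finally show ?thesis by (simp add: algebra_simps)
    qed
    have "(\<Sum>j=0..k. exp (- (\<eta> * (real k - real j))) * d (min j (n - j))) \<le> (\<Sum>j=0..k. 2 * K * exp (- (a * m)) * exp (- (a * (real k - real j))))"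
      by (intro sum_mono t) auto
    also have "\<dots> = 2 * K * exp (- (a * m)) * (\<Sum>j=0..k. exp (- (a * (real k - real j))))" by (rule sum_distrib_left[symmetric])
    also have "\<dots> \<le> 2 * K * exp (- (a * m)) * S" unfolding S_def using K0 by (intro mult_left_mono exp_sum_le a) auto
    finally have "(\<Sum>j=0..k. exp (- (\<eta> * (real k - real j))) * d (min j (n - j))) \<le> 2 * K * S * exp (- (a * m))" by (simp add: mult_ac)
    moreover have "exp (- (\<eta> * real k)) \<le> exp (- (a * m))"
    proof -
      have "a * m \<le> \<eta> * real k" using a m by (intro mult_mono) auto
      then show ?thesis by simp
    qed
    ultimately show "err_weight \<eta> d n k \<le> (1 + 2 * K * S) * exp (- (a * real (min k (n - k))))"
      unfolding err_weight_def m_def distrib_right mult_1 by (rule add_mono[rotated])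
  qed
qed

section \<open>The hierarchy with fluctuating variances\<close>

locale hierarchy = dyn b K X for b :: nat and K X :: real +
  fixes d :: "nat \<Rightarrow> real" and sigma2 :: "nat \<Rightarrow> nat \<Rightarrow> real" and \<beta> :: real
  assumes A: "assumption_A d sigma2" and \<beta>: "0 < \<beta>" and theta: "real b * theta \<beta> = 1 + \<delta>"
begin

lemma d_pos: "0 < d j" and d_summable: "summable d" and d_lim: "d \<longlonglongrightarrow> 0"
  using A summable_LIMSEQ_zero by (auto simp: assumption_A_def)

definition "sig_min = (INF (n, k) \<in> {(n, k). 1 \<le> n \<and> k \<le> n}. sigma2 n k)"
definition "sig_max = 1 + suminf d"

lemma sigma_bounds:
  assumes "1 \<le> n" "k \<le> n"
  shows "0 < sig_min" "sig_min \<le> sigma2 n k" "sigma2 n k \<le> sig_max" "\<bar>sigma2 n k - 1\<bar> \<le> d (min k (n - k))"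
proof -
  show "0 < sig_min" using A by (simp add: assumption_A_def sig_min_def)
  have "bdd_below ((\<lambda>(n, k). sigma2 n k) ` {(n, k). 1 \<le> n \<and> k \<le> n})"
    by (rule bdd_belowI2[of _ 0]) (use A in \<open>auto simp: assumption_A_def intro: less_imp_le\<close>)
  then show "sig_min \<le> sigma2 n k"
    unfolding sig_min_def using assms by (intro cINF_lower2[of _ _ "(n, k)"]) auto
  show 1: "\<bar>sigma2 n k - 1\<bar> \<le> d (min k (n - k))" using A assms by (auto simp: assumption_A_def)
  have "d (min k (n - k)) \<le> suminf d"
    using sum_le_suminf[OF d_summable, of "{min k (n - k)}"] d_pos by (simp add: less_imp_le)
  then show "sigma2 n k \<le> sig_max" using 1 unfolding sig_max_def by linarith
qed

definition "ks = kap \<beta> 1"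
abbreviation "kk n k \<equiv> kap \<beta> (sigma2 n k)"
text \<open>Taken below ks as well, so that the limit and all trajectories share one Gaussian
  majorant.\<close>

definition "km = min (kap \<beta> sig_min) ks"
definition "kM = kap \<beta> sig_max"

lemma theta_eq: "theta \<beta> = exp (- ks)" by (simp add: theta_def ks_def kap_def)

lemma ks0: "0 < ks" using \<beta> by (simp add: ks_def kap_def)

lemma window_ks: "window ks"
  using theta \<delta>0 by (simp add: window_def theta_eq)

lemma kap_mono: "s \<le> s' \<Longrightarrow> kap \<beta> s \<le> kap \<beta> s'"
  using \<beta> by (auto simp: kap_def intro!: mult_left_mono divide_right_mono)

lemma kap_eq: "kap \<beta> s = ks * s" by (simp add: ks_def kap_def)

lemma km0: "0 < km"
  using sigma_bounds(1)[of 1 0] \<beta> ks0 by (simp add: km_def kap_def)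

lemma kk_bounds:
  assumes "1 \<le> n" "k \<le> n"
  shows "km \<le> kk n k" "kk n k \<le> kM" "\<bar>kk n k - ks\<bar> \<le> ks * d (min k (n - k))" "0 < kk n k"
proof -
  note s = sigma_bounds[OF assms]
  show 1: "km \<le> kk n k" using kap_mono[OF s(2)] by (simp add: km_def)
  show "kk n k \<le> kM" using kap_mono[OF s(3)] by (simp add: kM_def)
  have "\<bar>kk n k - ks\<bar> = ks * \<bar>sigma2 n k - 1\<bar>"
    using ks0 by (simp add: kap_eq abs_mult flip: right_diff_distrib')
      (metis abs_mult abs_of_pos mult.right_neutral right_diff_distrib)
  then show "\<bar>kk n k - ks\<bar> \<le> ks * d (min k (n - k))" using s(4) ks0 by simp
  show "0 < kk n k" using 1 km0 by linarith
qed

text \<open>Here b exp (- \<kappa>_k) = (1 + \<delta>) exp (- (\<kappa>_k - ks)), and the exponent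
  is at most ks times an entry of d, which tends to zero; the window leaves one percent of
  \<delta>.\<close>

lemma window_eventually:
  "\<exists>k1. \<forall>n k. 1 \<le> n \<and> k \<le> n \<and> k1 \<le> min k (n - k) \<longrightarrow> window (kk n k)"
proof -
  have "(\<lambda>j. (1 + \<delta>) * exp (ks * d j)) \<longlonglongrightarrow> (1 + \<delta>) * exp (ks * 0)"
    "(\<lambda>j. (1 + \<delta>) * exp (- (ks * d j))) \<longlonglongrightarrow> (1 + \<delta>) * exp (- (ks * 0))"
    by (intro tendsto_intros d_lim)+
  then have "\<forall>\<^sub>F j in sequentially. (1 + \<delta>) * exp (ks * d j) < 1 + 101/100 * \<delta>"
    "\<forall>\<^sub>F j in sequentially. 1 + 99/100 * \<delta> < (1 + \<delta>) * exp (- (ks * d j))"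
    using \<delta>0 by (auto elim: order_tendstoD)
  then have "\<forall>\<^sub>F j in sequentially. (1 + \<delta>) * exp (ks * d j) < 1 + 101/100 * \<delta> \<and> 1 + 99/100 * \<delta> < (1 + \<delta>) * exp (- (ks * d j))"
    by (rule eventually_conj)
  then obtain k1 where k1: "\<And>j. j \<ge> k1 \<Longrightarrow> (1 + \<delta>) * exp (ks * d j) < 1 + 101/100 * \<delta> \<and> 1 + 99/100 * \<delta> < (1 + \<delta>) * exp (- (ks * d j))"
    by (auto simp: eventually_sequentially)
  show ?thesis
  proof (intro exI[of _ k1] allI impI)
    fix n k assume a: "1 \<le> n \<and> k \<le> n \<and> k1 \<le> min k (n - k)"
    define j where "j = min k (n - k)"
    have y: "\<bar>kk n k - ks\<bar> \<le> ks * d j" using kk_bounds(3)[of n k] a by (simp add: j_def)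
    have e: "real b * exp (- kk n k) = (1 + \<delta>) * exp (- (kk n k - ks))"
      unfolding theta[symmetric] theta_eq by (simp flip: exp_add)
    have "exp (- (kk n k - ks)) \<le> exp (ks * d j)" "exp (- (ks * d j)) \<le> exp (- (kk n k - ks))" using y by auto
    then have "(1 + \<delta>) * exp (- (kk n k - ks)) \<le> (1 + \<delta>) * exp (ks * d j)" "(1 + \<delta>) * exp (- (ks * d j)) \<le> (1 + \<delta>) * exp (- (kk n k - ks))"
      using \<delta>0 by (auto intro: mult_left_mono)
    then show "window (kk n k)" using k1[of j] a unfolding window_def e by (simp add: j_def)
  qed
qed

subsection \<open>The limit\<close>

text \<open>Chosen from the unperturbed map alone, before any \<nu> is given, so one limit serves
  all initial measures.\<close>

definition "lam = (SOME L. Om L \<and> renorm b ks L = L)"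

lemma lam: "Om lam" "renorm b ks lam = lam"
  using someI_ex[OF fixed_point_exists[OF window_ks]] by (auto simp: lam_def)

lemma lam_unit: "unit_seq lam" by (rule OmD(1)[OF lam(1)])

lemma lam_rser: "1/2 \<le> rser lam z" "rser lam z \<le> 3/2" using Om_rser[OF lam(1)] by auto

lemma lam_le_gauss: "lam q \<le> gauss_seq ks q"
  using renorm_le_gauss[OF lam_unit, of b ks q] lam_rser(1) lam(2) by (metis (no_types, lifting) half_gt_zero less_imp_le order_trans zero_less_one)

lemma lam_pos: "0 < lam q"
proof -
  have n: "0 < lam (int n)" for n
  proof (induction n)
    case 0 show ?case using unit_seqD(2)[OF lam_unit] by simp
  next
    case (Suc n)
    have "0 < lam 1 * lam (int (Suc n) - 1)" using Suc OmD(6)[OF lam(1)] by simp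
    also have "\<dots> \<le> cpow lam b (int (Suc n))" by (rule cpow_two_ge[OF unit_seqD(1,2)[OF lam_unit] b2])
    finally have "0 < renorm b ks lam (int (Suc n))"
      using S0_ge1[OF lam_unit] gauss_seq_pos by (auto simp: renorm_def intro!: mult_pos_pos divide_pos_pos)
    then show ?case by (simp only: lam(2))
  qed
  show ?thesis using n[of "nat \<bar>q\<bar>"] unit_seqD(4)[OF lam_unit, of q] by (cases "0 \<le> q") auto
qed

definition "vlim z = - ln (cpow lam b 0 powr (- (1 / (real b - 1))) * rser lam z)"

lemma vlim_eq: "vlim z = ln (cpow lam b 0) / (real b - 1) - ln (rser lam z)"
  using S0_ge1[OF lam_unit] lam_rser(1)[of z] by (simp add: vlim_def ln_mult ln_powr)

lemma vlim_limit_potential: "is_limit_potential b lam vlim"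
  unfolding is_limit_potential_def
proof
  fix z
  have "0 < cpow lam b 0 powr (- (1 / (real b - 1))) * rser lam z"
    using S0_ge1[OF lam_unit] lam_rser(1)[of z] by (intro mult_pos_pos) auto
  then have "exp (- vlim z) = cpow lam b 0 powr (- (1 / (real b - 1))) * rser lam z" by (simp add: vlim_def)
  moreover have "(\<Sum>\<^sub>\<infinity>q. complex_of_real (lam q) * exp (2 * of_real pi * \<i> * of_int q * of_real z)) = of_real (rser lam z)"
    unfolding cser_eq_rser[OF unit_seqD(1)[OF lam_unit], symmetric] cser_def
    by (intro infsum_cong) (simp add: cexpo_def cis_conv_exp algebra_simps)
  ultimately show "complex_of_real (exp (- vlim z)) =
        complex_of_real ((\<Sum>\<^sub>\<infinity>q\<in>zero_sum_tuples b. \<Prod>i=1..b. lam (q i)) powr (- (1 / (real b - 1)))) *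
        (\<Sum>\<^sub>\<infinity>q. complex_of_real (lam q) * exp (2 * of_real pi * \<i> * of_int q * of_real z))"
    unfolding zero_sum_tuples_infsum[OF unit_seqD(1)[OF lam_unit]] by simp
qed

lemma lam_gauss_km: "\<bar>lam q\<bar> \<le> 1 * gauss_seq km q" "0 \<le> lam q" "lam q \<le> gauss_seq km q"
proof -
  have "gauss_seq ks q \<le> gauss_seq km q" using km0 by (intro gauss_seq_mono) (auto simp: km_def)
  then show "lam q \<le> gauss_seq km q" using lam_le_gauss[of q] by linarith
  then show "\<bar>lam q\<bar> \<le> 1 * gauss_seq km q" "0 \<le> lam q" using lam_pos[of q] by auto
qed

lemma vlim_deriv: "deriv vlim z = - (dser 1 lam z / rser lam z)" "vlim differentiable (at z)"
proof -
  have D: "(dser m lam has_real_derivative dser (Suc m) lam z) (at z)" for m z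
    by (rule dser_deriv[OF km0 lam_gauss_km(1)])
  have pos: "0 < dser 0 lam z" for z using lam_rser(1)[of z] by (simp add: rser_eq_dser)
  have "((\<lambda>z. ln (cpow lam b 0) / (real b - 1) + - ln (dser 0 lam z)) has_real_derivative 0 + - (dser 1 lam z / dser 0 lam z)) (at z)"
    by (intro derivative_intros smooth_neg_ln(4)[where D = "\<lambda>m. dser m lam"] D pos)
  moreover have "vlim = (\<lambda>z. ln (cpow lam b 0) / (real b - 1) + - ln (dser 0 lam z))"
    by (simp add: vlim_eq rser_eq_dser fun_eq_iff)
  ultimately have d: "(vlim has_real_derivative - (dser 1 lam z / rser lam z)) (at z)" by (simp add: rser_eq_dser)
  then show "deriv vlim z = - (dser 1 lam z / rser lam z)" by (rule DERIV_imp_deriv)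
  show "vlim differentiable (at z)" using d real_differentiable_def by blast
qed

subsection \<open>Trajectories\<close>

definition "ratio_seq \<nu> n k q = act b \<beta> \<nu> (sigma2 n) k q / act b \<beta> \<nu> (sigma2 n) k 0"

definition "low = sqrt (pi / kM) * exp (- (pi\<^sup>2 / km))"

lemma kM0: "0 < kM" using kk_bounds(2,4)[of 1 0] by linarith

lemma low0: "0 < low" using kM0 by (simp add: low_def)

lemma low_le: assumes "km \<le> \<kappa>" "\<kappa> \<le> kM" shows "low \<le> gauss_min \<kappa>"
  unfolding low_def gauss_min_def
  using assms km0 by (intro mult_mono real_sqrt_le_mono divide_left_mono) (auto intro!: divide_left_mono mult_pos_pos)

definition "upp = max 1 (gmom km 0)"

lemma traj:
  assumes B: "assumption_B \<nu>" and n: "1 \<le> n" "k \<le> n"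
  defines "a \<equiv> act b \<beta> \<nu> (sigma2 n) k"
  shows "nnsym a" "0 < a q" "exp (- potential b \<beta> \<nu> (sigma2 n) k z) = rser a z" "low * a 0 \<le> rser a z"
    "a q \<le> a 0 * gauss_seq (kk n k) q" "a q \<le> a 0 * gauss_seq km q"
proof -
  have s: "0 < sigma2 n j" if "j \<le> k" for j using A n that by (auto simp: assumption_A_def)
  note P = act_properties[OF B \<beta> b2, of k "sigma2 n", OF s, folded a_def]
  show "nnsym a" "0 < a q" "exp (- potential b \<beta> \<nu> (sigma2 n) k z) = rser a z" using P by auto
  have a0: "0 < a 0" using P by auto
  note kb = kk_bounds[OF n]
  have "low * a 0 \<le> gauss_min (kk n k) * a 0" using low_le[OF kb(1,2)] a0 by (intro mult_right_mono) auto
  then show "low * a 0 \<le> rser a z" using P order_trans by blast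
  show 1: "a q \<le> a 0 * gauss_seq (kk n k) q" using P by (simp add: mult.commute)
  have "gauss_seq (kk n k) q \<le> gauss_seq km q" using km0 kb(1) by (intro gauss_seq_mono) auto
  then have "a 0 * gauss_seq (kk n k) q \<le> a 0 * gauss_seq km q" using a0 by (intro mult_left_mono) auto
  then show "a q \<le> a 0 * gauss_seq km q" using 1 by linarith
qed

lemma ratio_seq_facts:
  assumes B: "assumption_B \<nu>" and n: "1 \<le> n" "k \<le> n"
  shows "unit_seq (ratio_seq \<nu> n k)" "0 < ratio_seq \<nu> n k q" "ratio_seq \<nu> n k q \<le> gauss_seq (kk n k) q"
    "ratio_seq \<nu> n k q \<le> gauss_seq km q" "low \<le> rser (ratio_seq \<nu> n k) z" "rser (ratio_seq \<nu> n k) z \<le> upp"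
    "rser (act b \<beta> \<nu> (sigma2 n) k) z = act b \<beta> \<nu> (sigma2 n) k 0 * rser (ratio_seq \<nu> n k) z"
    "dser i (act b \<beta> \<nu> (sigma2 n) k) z = act b \<beta> \<nu> (sigma2 n) k 0 * dser i (ratio_seq \<nu> n k) z"
    "cpow (ratio_seq \<nu> n k) b 0 \<le> upp ^ b" "1 \<le> cpow (ratio_seq \<nu> n k) b 0"
proof -
  let ?a = "act b \<beta> \<nu> (sigma2 n) k" and ?f = "ratio_seq \<nu> n k"
  note T = traj[OF B n]
  have a0: "0 < ?a 0" by (rule T(2))
  have f: "?f = (\<lambda>q. (1 / ?a 0) * ?a q)" by (simp add: ratio_seq_def fun_eq_iff)
  have a: "?a = (\<lambda>q. ?a 0 * ?f q)" using a0 by (simp add: ratio_seq_def)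
  show u: "unit_seq ?f"
    using nnsym_scale[OF T(1), of "1 / ?a 0"] a0 unfolding unit_seq_def f by simp
  show p: "0 < ?f q" for q using T(2)[of q] a0 by (simp add: ratio_seq_def)
  show "?f q \<le> gauss_seq (kk n k) q" using T(5)[of q] a0 by (simp add: ratio_seq_def field_simps)
  show g: "?f q \<le> gauss_seq km q" for q using T(6)[of q] a0 by (simp add: ratio_seq_def field_simps)
  show r: "rser ?a z = ?a 0 * rser ?f z" for z by (subst a) (rule rser_scale)
  show "dser i ?a z = ?a 0 * dser i ?f z" by (subst a) (rule dser_scale)
  have "?a 0 * low \<le> ?a 0 * rser ?f z" for z using T(4)[of z] unfolding r by (simp add: mult.commute)
  then show l: "low \<le> rser ?f z" for z using a0 mult_le_cancel_left_pos by blast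
  have "\<bar>rser ?f z\<bar> \<le> 1 * gmom km 0" for z
    unfolding rser_eq_dser using g p by (intro dser_bound(1)[OF km0]) (simp add: less_imp_le abs_of_pos)
  then have uz: "\<bar>rser ?f z\<bar> \<le> upp" for z by (simp add: upp_def le_max_iff_disj)
  then show "rser ?f z \<le> upp" using abs_le_iff by blast
  show "cpow ?f b 0 \<le> upp ^ b" by (rule cpow_zero_le[OF unit_seqD(1)[OF u] uz])
  show "1 \<le> cpow ?f b 0" by (rule S0_ge1[OF u])
qed

lemma act_Suc_zero:
  assumes B: "assumption_B \<nu>" and n: "1 \<le> n" "Suc k \<le> n"
  shows "act b \<beta> \<nu> (sigma2 n) (Suc k) q = act b \<beta> \<nu> (sigma2 n) k 0 ^ b * (gauss_seq (kk n (Suc k)) q * cpow (ratio_seq \<nu> n k) b q)"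
    "ratio_seq \<nu> n (Suc k) = renorm b (kk n (Suc k)) (ratio_seq \<nu> n k)"
proof -
  let ?a = "act b \<beta> \<nu> (sigma2 n) k" and ?f = "ratio_seq \<nu> n k"
  have kn: "k \<le> n" using n by simp
  have a0: "0 < ?a 0" by (rule traj(2)[OF B n(1) kn])
  have a: "?a = (\<lambda>q. ?a 0 * ?f q)" using a0 by (simp add: ratio_seq_def)
  have "cpow ?a b = (\<lambda>q. ?a 0 ^ b * cpow ?f b q)" by (subst a) (rule cpow_scale)
  then show e: "act b \<beta> \<nu> (sigma2 n) (Suc k) q = ?a 0 ^ b * (gauss_seq (kk n (Suc k)) q * cpow ?f b q)" for q by simp
  show "ratio_seq \<nu> n (Suc k) = renorm b (kk n (Suc k)) ?f"
    unfolding ratio_seq_def[of \<nu> n "Suc k", abs_def] renorm_def[abs_def] e using a0 by (simp add: fun_eq_iff)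
qed

text \<open>During the first k1 steps the variances may lie outside the window. There only crude
  bounds hold: the ratios grow by at most b per step and the first coefficient shrinks by at most a
  fixed factor. They give the data from which \<open>absorb\<close> takes over at k1; the ratio
  bound for the Fourier coefficients of \<nu> starts the first of them.\<close>

lemma Om_eventually:
  assumes B: "assumption_B \<nu>"
  shows "\<exists>kA. \<forall>n k. 1 \<le> n \<and> k \<le> n \<and> kA \<le> min k (n - k) \<longrightarrow> window (kk n k) \<and> Om (ratio_seq \<nu> n k)"
proof -
  obtain k1 where k1: "\<And>n k. 1 \<le> n \<Longrightarrow> k \<le> n \<Longrightarrow> k1 \<le> min k (n - k) \<Longrightarrow> window (kk n k)"
    using window_eventually by blast
  define c where "c = max 1 (SUP q\<in>{0..}. mcoeff \<nu> (q + 1) / mcoeff \<nu> q)"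
  have c: "1 \<le> c" by (simp add: c_def)
  have mc: "mcoeff \<nu> (q + 1) \<le> c * mcoeff \<nu> q" if "0 \<le> q" for q
  proof -
    have "bdd_above ((\<lambda>q. mcoeff \<nu> (q + 1) / mcoeff \<nu> q) ` {0..})" using B by (simp add: assumption_B_def mcoeff_def)
    then have "mcoeff \<nu> (q + 1) / mcoeff \<nu> q \<le> (SUP q\<in>{0..}. mcoeff \<nu> (q + 1) / mcoeff \<nu> q)" using that by (intro cSUP_upper) auto
    then have "mcoeff \<nu> (q + 1) / mcoeff \<nu> q \<le> c" by (simp add: c_def)
    then show ?thesis using assumption_B_coeff(2)[OF B, of q] by (simp add: field_simps)
  qed
  have r0: "ratio_le (ratio_seq \<nu> n 0) c" if n: "1 \<le> n" for n
    unfolding ratio_le_def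
  proof (intro allI impI)
    fix q :: int assume q: "0 \<le> q"
    have k0: "0 < kk n 0" using kk_bounds(4)[OF n, of 0] by simp
    have s: "0 < sigma2 n 0" using A n by (auto simp: assumption_A_def)
    have f: "ratio_seq \<nu> n 0 q = gauss_seq (kk n 0) q * mcoeff \<nu> q / mcoeff \<nu> 0" for q
      using s \<beta> by (simp add: ratio_seq_def)
    have "gauss_seq (kk n 0) (q + 1) \<le> gauss_seq (kk n 0) q * exp (- kk n 0)" by (rule gauss_seq_step(1)[OF k0 q])
    also have "\<dots> \<le> gauss_seq (kk n 0) q" using k0 gauss_seq_pos[of "kk n 0" q] by (simp add: mult_left_le less_imp_le)
    finally have "gauss_seq (kk n 0) (q + 1) * mcoeff \<nu> (q + 1) \<le> gauss_seq (kk n 0) q * (c * mcoeff \<nu> q)"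
      using mc[OF q] gauss_seq_pos assumption_B_coeff(2)[OF B] by (intro mult_mono) (auto intro: less_imp_le)
    then show "ratio_seq \<nu> n 0 (q + 1) \<le> c * ratio_seq \<nu> n 0 q"
      unfolding f using divide_right_mono[of _ _ "mcoeff \<nu> 0"] assumption_B_coeff(2)[OF B, of 0] by (simp add: mult_ac less_imp_le)
  qed
  have rk: "ratio_le (ratio_seq \<nu> n k) (real b ^ k * c)" if n: "1 \<le> n" "k \<le> n" for n k
    using n(2)
  proof (induction k)
    case (Suc k)
    have k: "k \<le> n" using Suc.prems by simp
    have u: "unit_seq (ratio_seq \<nu> n k)" by (rule ratio_seq_facts(1)[OF B n(1) k])
    have \<kappa>: "0 < kk n (Suc k)" by (rule kk_bounds(4)[OF n(1) Suc.prems])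
    have c0: "0 \<le> real b ^ k * c" using c by simp
    show ?case unfolding ratio_le_def
    proof (intro allI impI)
      fix q :: int assume q: "0 \<le> q"
      have "ratio_seq \<nu> n (Suc k) (q + 1) \<le> exp (- kk n (Suc k)) * real b * (real b ^ k * c) * ratio_seq \<nu> n (Suc k) q"
        unfolding act_Suc_zero(2)[OF B n(1) Suc.prems] by (rule renorm_ratio(1)[OF u Suc.IH[OF k] c0 \<kappa> q])
      also have "\<dots> \<le> 1 * real b * (real b ^ k * c) * ratio_seq \<nu> n (Suc k) q"
        using \<kappa> c0 ratio_seq_facts(2)[OF B n(1) Suc.prems, of q] by (intro mult_right_mono) (auto intro: less_imp_le)
      finally show "ratio_seq \<nu> n (Suc k) (q + 1) \<le> real b ^ Suc k * c * ratio_seq \<nu> n (Suc k) q" by (simp add: mult_ac)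
    qed
  qed (use r0[OF n(1)] in simp)
  \<comment> \<open>The factor 4/3 compensates for the 3/4 in \<open>upper_bd\<close>.\<close>
  define M0 where "M0 = 4/3 * (real b ^ k1 * c)"
  have M0: "0 < M0" using rb c by (simp add: M0_def)
  have ub: "upper_bd (ratio_seq \<nu> n k1) M0" if n: "1 \<le> n" "k1 \<le> n" for n
  proof -
    note r = rk[OF n, unfolded ratio_le_def, rule_format]
    have "ratio_seq \<nu> n k1 1 \<le> real b ^ k1 * c"
      using r[of 0] unit_seqD(2)[OF ratio_seq_facts(1)[OF B n]] by simp
    also have "\<dots> \<le> M0" using c rb by (simp add: M0_def)
    finally have "ratio_seq \<nu> n k1 1 \<le> M0" .
    moreover have "3/4 * M0 = real b ^ k1 * c" by (simp add: M0_def)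
    ultimately show ?thesis unfolding upper_bd_def using r by auto
  qed
  \<comment> \<open>A lower bound for b exp (- \<kappa>) / S_0, the smallest factor by which one
    step can change the first coefficient, whatever the variance.\<close>
  define z where "z = exp (- kM) / upp ^ b"
  have upp1: "1 \<le> upp" by (simp add: upp_def)
  have z0: "0 < z" using upp1 by (simp add: z_def)
  define m where "m = z ^ k1 * (exp (- kM) * (mcoeff \<nu> 1 / mcoeff \<nu> 0))"
  have m: "0 < m" using z0 assumption_B_coeff(2)[OF B] by (simp add: m_def)
  have lowk: "z ^ k * (exp (- kM) * (mcoeff \<nu> 1 / mcoeff \<nu> 0)) \<le> ratio_seq \<nu> n k 1" if n: "1 \<le> n" "k \<le> n" for n k
    using n(2)
  proof (induction k)
    case 0
    have s: "0 < sigma2 n 0" using A n by (auto simp: assumption_A_def)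
    have f: "ratio_seq \<nu> n 0 1 = exp (- kk n 0) * (mcoeff \<nu> 1 / mcoeff \<nu> 0)"
      using s \<beta> by (simp add: ratio_seq_def gauss_seq_1)
    have "exp (- kM) * (mcoeff \<nu> 1 / mcoeff \<nu> 0) \<le> exp (- kk n 0) * (mcoeff \<nu> 1 / mcoeff \<nu> 0)"
      using kk_bounds(2)[OF n(1), of 0] less_imp_le[OF divide_pos_pos[OF assumption_B_coeff(2)[OF B, of 1] assumption_B_coeff(2)[OF B, of 0]]]
      by (intro mult_right_mono) auto
    then show ?case unfolding f by simp
  next
    case (Suc k)
    have k: "k \<le> n" using Suc.prems by simp
    note F = ratio_seq_facts[OF B n(1) k]
    have f1: "0 \<le> ratio_seq \<nu> n k 1" using F(2)[of 1] by simp
    have "z * ratio_seq \<nu> n k 1 \<le> exp (- kk n (Suc k)) * real b * ratio_seq \<nu> n k 1 / cpow (ratio_seq \<nu> n k) b 0"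
    proof -
      have "exp (- kM) * 1 \<le> exp (- kk n (Suc k)) * real b"
        using kk_bounds(2)[OF n(1) Suc.prems] rb by (intro mult_mono) auto
      then have "exp (- kM) / upp ^ b \<le> exp (- kk n (Suc k)) * real b / cpow (ratio_seq \<nu> n k) b 0"
        using F(9,10) by (intro frac_le) auto
      from mult_right_mono[OF this f1] show ?thesis by (simp add: z_def)
    qed
    also have "\<dots> \<le> ratio_seq \<nu> n (Suc k) 1"
      unfolding act_Suc_zero(2)[OF B n(1) Suc.prems] by (rule renorm_one_ge[OF F(1)])
    finally have "z * ratio_seq \<nu> n k 1 \<le> ratio_seq \<nu> n (Suc k) 1" .
    moreover have "z * (z ^ k * (exp (- kM) * (mcoeff \<nu> 1 / mcoeff \<nu> 0))) \<le> z * ratio_seq \<nu> n k 1"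
      using Suc.IH[OF k] z0 by (intro mult_left_mono) auto
    ultimately show ?case by (simp add: mult.assoc)
  qed
  have Z: "1 \<le> upp ^ b" using upp1 by (rule one_le_power)
  obtain na where na: "\<And>L \<kappa> f j. orbit L \<kappa> f \<Longrightarrow> upper_bd (f 0) M0 \<Longrightarrow> m \<le> f 0 1 \<Longrightarrow> (\<And>j. j \<le> L \<Longrightarrow> cpow (f j) b 0 \<le> upp ^ b) \<Longrightarrow>
      na \<le> j \<Longrightarrow> j \<le> L \<Longrightarrow> Om (f j)"
    using absorb[OF M0 m Z] by blast
  show ?thesis
  proof (intro exI[of _ "k1 + na"] allI impI conjI)
    fix n k assume a: "1 \<le> n \<and> k \<le> n \<and> k1 + na \<le> min k (n - k)"
    show "window (kk n k)" using k1[of n k] a by simp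
    have n: "1 \<le> n" "k1 \<le> n" using a by auto
    have o: "orbit (k - k1) (\<lambda>j. kk n (Suc (k1 + j))) (\<lambda>j. ratio_seq \<nu> n (k1 + j))"
      unfolding orbit_def
    proof (intro conjI allI impI)
      show "unit_seq (ratio_seq \<nu> n (k1 + 0))" using ratio_seq_facts(1)[OF B n] by simp
      fix j assume j: "j < k - k1"
      show "window (kk n (Suc (k1 + j)))" by (rule k1) (use j a in auto)
      show "ratio_seq \<nu> n (k1 + Suc j) = renorm b (kk n (Suc (k1 + j))) (ratio_seq \<nu> n (k1 + j))"
      proof -
        have "Suc (k1 + j) \<le> n" using j a by linarith
        from act_Suc_zero(2)[OF B n(1) this] show ?thesis by simp
      qed
    qed
    have "Om (ratio_seq \<nu> n (k1 + (k - k1)))"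
      by (rule na[OF o]) (use ub[OF n] lowk[OF n] ratio_seq_facts(9)[OF B n(1)] a in \<open>auto simp: m_def\<close>)
    then show "Om (ratio_seq \<nu> n k)" using a by simp
  qed
qed

section \<open>Quantitative convergence of the trajectories\<close>

text \<open>Only half of the true exponent of 1 - \<delta> / 5. Absorption takes a number of steps
  that depends on \<nu>, whereas the constants of the estimate must not; the other half of the
  exponent compensates for those steps.\<close>

definition "rate = - ln (1 - \<delta> / 5) / 2"
definition "Cst = max 1 (max (X + 3 * X\<^sup>2 / tau) (pert km * ks))"

lemma rate0: "0 < rate" using \<delta>0 b\<delta> by (simp add: rate_def)

lemma rho_power: "(1 - \<delta> / 5) ^ j \<le> exp (- (rate * real j))" "(1 - \<delta> / 5) ^ j = exp (- (2 * rate * real j))"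
proof -
  have "exp (- (2 * rate)) = 1 - \<delta> / 5" using \<delta>0 b\<delta> by (simp add: rate_def)
  then show e: "(1 - \<delta> / 5) ^ j = exp (- (2 * rate * real j))" by (metis exp_of_nat_mult mult.commute mult_minus_right)
  show "(1 - \<delta> / 5) ^ j \<le> exp (- (rate * real j))" unfolding e using rate0 by simp
qed

lemma err_weight_nonneg: "0 \<le> err_weight r d n k"
  unfolding err_weight_def using d_pos by (intro add_nonneg_nonneg sum_nonneg mult_nonneg_nonneg) (auto intro: less_imp_le)

text \<open>Each step contracts the distance to the fixed point and adds an error proportional to
  the deviation of the current variance; unrolling gives the convolution sum in the error
  weight.\<close>

lemma close_eventually:
  assumes B: "assumption_B \<nu>"
  shows "\<exists>k0. \<forall>n k. 1 \<le> n \<and> k \<le> n \<and> k0 \<le> min k (n - k) \<longrightarrow>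
    Om (ratio_seq \<nu> n k) \<and> close_seq (ratio_seq \<nu> n k) lam (Cst * err_weight rate d n k)"
proof -
  obtain kA where kA: "\<And>n k. 1 \<le> n \<Longrightarrow> k \<le> n \<Longrightarrow> kA \<le> min k (n - k) \<Longrightarrow> window (kk n k) \<and> Om (ratio_seq \<nu> n k)"
    using Om_eventually[OF B] by blast
  define \<rho> where "\<rho> = 1 - \<delta> / 5"
  define P where "P = pert km * ks"
  define Mc where "Mc = X + 3 * X\<^sup>2 / tau"
  have \<rho>: "0 < \<rho>" using b\<delta> by (simp add: \<rho>_def)
  have P0: "0 \<le> P" using pert_pos[of km] ks0 by (simp add: P_def)
  have rec: "close_seq (ratio_seq \<nu> n k) lam (\<rho> ^ (k - kA) * Mc + P * (\<Sum>j=0..k. \<rho> ^ (k - j) * d (min j (n - j))))"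
    if "1 \<le> n" "k \<le> n" "kA \<le> k" "kA \<le> n - k" for n k
    using that(3,2,4)
  proof (induction k rule: dec_induct)
    case base
    have "close_seq (ratio_seq \<nu> n kA) lam Mc" unfolding Mc_def by (rule Om_close) (use kA[of n kA] that(1) base lam in auto)
    moreover have "0 \<le> P * (\<Sum>j=0..kA. \<rho> ^ (kA - j) * d (min j (n - j)))"
      using P0 \<rho> d_pos by (intro mult_nonneg_nonneg sum_nonneg) (auto intro: less_imp_le)
    ultimately show ?case by (elim close_seq_mono) simp
  next
    case (step k)
    let ?s = "\<lambda>k. \<Sum>j=0..k. \<rho> ^ (k - j) * d (min j (n - j))"
    have k: "k \<le> n" "kA \<le> n - k" using step.prems by auto
    have w: "window (kk n (Suc k))" using kA[of n "Suc k"] that(1) step by auto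
    have O: "Om (ratio_seq \<nu> n k)" using kA[of n k] that(1) step k by auto
    have "close_seq (ratio_seq \<nu> n (Suc k)) lam ((1 - \<delta> / 5) * (\<rho> ^ (k - kA) * Mc + P * ?s k) + pert km * \<bar>kk n (Suc k) - ks\<bar>)"
      using contraction_perturbed[OF O lam(1) step.IH[OF k] w window_ks km0 kk_bounds(1)[OF that(1) step.prems(1)]]
      by (simp add: act_Suc_zero(2)[OF B that(1) step.prems(1)] lam(2) km_def)
    moreover have "(1 - \<delta> / 5) * (\<rho> ^ (k - kA) * Mc + P * ?s k) + pert km * \<bar>kk n (Suc k) - ks\<bar> \<le> \<rho> ^ (Suc k - kA) * Mc + P * ?s (Suc k)"
    proof -
      have "pert km * \<bar>kk n (Suc k) - ks\<bar> \<le> P * d (min (Suc k) (n - Suc k))"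
        unfolding P_def mult.assoc using pert_pos[of km] by (intro mult_left_mono kk_bounds(3)[OF that(1) step.prems(1)]) simp
      moreover have "?s (Suc k) = \<rho> * ?s k + d (min (Suc k) (n - Suc k))"
        by (simp add: sum_distrib_left Suc_diff_le mult.assoc)
      moreover have "\<rho> ^ (Suc k - kA) = \<rho> * \<rho> ^ (k - kA)" using step.hyps by (simp add: Suc_diff_le)
      ultimately show ?thesis unfolding \<rho>_def[symmetric] by (simp add: algebra_simps)
    qed
    ultimately show ?case by (rule close_seq_mono)
  qed
  show ?thesis
  \<comment> \<open>Twice the absorption time, so that k - kA is at least k / 2 and the halved rate
    suffices.\<close>
  proof (intro exI[of _ "2 * kA"] allI impI conjI)
    fix n k assume a: "1 \<le> n \<and> k \<le> n \<and> 2 * kA \<le> min k (n - k)"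
    show "Om (ratio_seq \<nu> n k)" using kA[of n k] a by simp
    have "close_seq (ratio_seq \<nu> n k) lam (\<rho> ^ (k - kA) * Mc + P * (\<Sum>j=0..k. \<rho> ^ (k - j) * d (min j (n - j))))"
      by (rule rec) (use a in auto)
    moreover have "\<rho> ^ (k - kA) * Mc + P * (\<Sum>j=0..k. \<rho> ^ (k - j) * d (min j (n - j))) \<le> Cst * err_weight rate d n k"
    proof -
      have C: "Mc \<le> Cst" "P \<le> Cst" "0 \<le> Cst" by (auto simp: Cst_def Mc_def P_def)
      have "real k \<le> 2 * real (k - kA)" using a by auto
      then have "rate * real k \<le> 2 * rate * real (k - kA)" using rate0 mult_left_mono[of "real k" "2 * real (k - kA)" rate] by simp
      then have 1: "\<rho> ^ (k - kA) \<le> exp (- (rate * real k))" unfolding \<rho>_def rho_power(2) by simp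
      have 2: "(\<Sum>j=0..k. \<rho> ^ (k - j) * d (min j (n - j))) \<le> (\<Sum>j=0..k. exp (- (rate * (real k - real j))) * d (min j (n - j)))"
      proof (intro sum_mono mult_right_mono)
        fix j assume "j \<in> {0..k}"
        then show "\<rho> ^ (k - j) \<le> exp (- (rate * (real k - real j)))" using rho_power(1)[of "k - j"] by (simp add: \<rho>_def of_nat_diff)
      qed (use d_pos in \<open>auto intro: less_imp_le\<close>)
      have s0: "0 \<le> (\<Sum>j=0..k. exp (- (rate * (real k - real j))) * d (min j (n - j)))"
        using d_pos by (intro sum_nonneg mult_nonneg_nonneg) (auto intro: less_imp_le)
      have "\<rho> ^ (k - kA) * Mc \<le> exp (- (rate * real k)) * Cst"
        using 1 C \<rho> X0 tau0 by (intro mult_mono) (auto simp: Mc_def)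
      moreover have "P * (\<Sum>j=0..k. \<rho> ^ (k - j) * d (min j (n - j))) \<le> Cst * (\<Sum>j=0..k. exp (- (rate * (real k - real j))) * d (min j (n - j)))"
        using mult_left_mono[OF 2 P0] mult_right_mono[OF C(2) s0] by linarith
      ultimately show ?thesis by (simp add: err_weight_def algebra_simps)
    qed
    ultimately show "close_seq (ratio_seq \<nu> n k) lam (Cst * err_weight rate d n k)" by (rule close_seq_mono)
  qed
qed

definition "clow = min low (1/2)"
definition "cupp = max upp 2"
definition "der_const = gmom (km / 2) 1 / clow + gmom km 1 * gmom (km / 2) 0 / clow\<^sup>2"
definition "pot_const = gmom (km / 2) 0 / clow + real b * cupp ^ b * gmom (km / 2) 0 + real b * (gmom (km / 2) 0 / clow)"

lemma clow0: "0 < clow" using low0 by (simp add: clow_def)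

lemma cupp1: "1 \<le> cupp" by (simp add: cupp_def)

lemma der_const0: "0 \<le> der_const" and pot_const0: "0 \<le> pot_const"
  using gmom_nonneg clow0 cupp1 by (auto simp: der_const_def pot_const_def intro!: add_nonneg_nonneg mult_nonneg_nonneg divide_nonneg_nonneg)

lemma rser_ranges:
  assumes B: "assumption_B \<nu>" and n: "1 \<le> n" "k \<le> n"
  shows "clow \<le> rser (ratio_seq \<nu> n k) z" "clow \<le> rser lam z" "\<bar>rser (ratio_seq \<nu> n k) z\<bar> \<le> cupp" "\<bar>rser lam z\<bar> \<le> cupp"
  using ratio_seq_facts(5,6)[OF B n, of z] lam_rser[of z] low0 by (auto simp: clow_def cupp_def)

lemma dser_ratio_diff:
  assumes B: "assumption_B \<nu>" and n: "1 \<le> n" "k \<le> n" and M: "\<And>q. \<bar>ratio_seq \<nu> n k q - lam q\<bar> \<le> M"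
  shows "\<bar>dser i (ratio_seq \<nu> n k) z - dser i lam z\<bar> \<le> sqrt M * gmom (km / 2) i"
  by (rule dser_diff_le[OF km0 _ ratio_seq_facts(4)[OF B n] lam_gauss_km(2,3) M])
    (use ratio_seq_facts(2)[OF B n] in \<open>auto intro: less_imp_le\<close>)

lemma potential_facts:
  assumes B: "assumption_B \<nu>" and n: "1 \<le> n" "k \<le> n"
  defines "v \<equiv> potential b \<beta> \<nu> (sigma2 n) k"
  shows "smooth_real v" "deriv v z = - (dser 1 (ratio_seq \<nu> n k) z / rser (ratio_seq \<nu> n k) z)"
    "\<bar>deriv v z\<bar> \<le> gmom km 1 / low" "\<bar>deriv (deriv v) z\<bar> \<le> (gmom km 1 / low)\<^sup>2 + gmom km 2 / low"
    "v z = - ln (act b \<beta> \<nu> (sigma2 n) k 0) - ln (rser (ratio_seq \<nu> n k) z)"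
proof -
  let ?a = "act b \<beta> \<nu> (sigma2 n) k"
  note T = traj[OF B n, folded v_def]
  note F = ratio_seq_facts[OF B n]
  have ab: "\<bar>?a q\<bar> \<le> ?a 0 * gauss_seq km q" for q using T(2)[of q] T(6)[of q] by simp
  note D = potential_derivatives[OF km0 ab T(2) low0 T(4,3)]
  show "smooth_real v" "\<bar>deriv v z\<bar> \<le> gmom km 1 / low" "\<bar>deriv (deriv v) z\<bar> \<le> (gmom km 1 / low)\<^sup>2 + gmom km 2 / low"
    by (rule D)+
  show "deriv v z = - (dser 1 (ratio_seq \<nu> n k) z / rser (ratio_seq \<nu> n k) z)"
    unfolding D(2) F(7,8) using T(2)[of 0] by simp
  have "- v z = ln (rser ?a z)" using T(3)[of z] by (metis ln_exp)
  then show "v z = - ln (?a 0) - ln (rser (ratio_seq \<nu> n k) z)"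
    unfolding F(7) using T(2)[of 0] F(5)[of z] low0 by (simp add: ln_mult)
qed

lemma deriv_diff:
  assumes B: "assumption_B \<nu>" and n: "1 \<le> n" "k \<le> n" and M: "\<And>q. \<bar>ratio_seq \<nu> n k q - lam q\<bar> \<le> M"
  shows "\<bar>deriv (potential b \<beta> \<nu> (sigma2 n) k) z - deriv vlim z\<bar> \<le> sqrt M * der_const"
proof -
  have "\<bar>dser 1 (ratio_seq \<nu> n k) z / rser (ratio_seq \<nu> n k) z - dser 1 lam z / rser lam z\<bar>
      \<le> (sqrt M * gmom (km / 2) 1) / clow + gmom km 1 * (sqrt M * gmom (km / 2) 0) / clow\<^sup>2"
  proof (rule quotient_diff_le[OF rser_ranges(1,2)[OF B n] clow0 dser_ratio_diff[OF B n M]])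
    show "\<bar>rser (ratio_seq \<nu> n k) z - rser lam z\<bar> \<le> sqrt M * gmom (km / 2) 0"
      unfolding rser_eq_dser by (rule dser_ratio_diff[OF B n M])
    show "\<bar>dser 1 lam z\<bar> \<le> gmom km 1" using dser_bound(1)[OF km0 lam_gauss_km(1), of 1 z] by simp
  qed
  also have "\<dots> = sqrt M * der_const" by (simp add: der_const_def field_simps)
  finally show ?thesis unfolding potential_facts(2)[OF B n] vlim_deriv(1) by (simp add: abs_minus_commute)
qed

text \<open>The coefficients a_k(0) cancel in this combination: ln a_(k+1)(0) is b times ln a_k(0)
  plus the logarithm of S_0. What remains depends on normalized coefficients only and is continuous
  in them.\<close>

lemma potential_diff:
  assumes B: "assumption_B \<nu>" and n: "1 \<le> n" "Suc k \<le> n"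
    and M: "\<And>q. \<bar>ratio_seq \<nu> n k q - lam q\<bar> \<le> M" "\<And>q. \<bar>ratio_seq \<nu> n (Suc k) q - lam q\<bar> \<le> M"
  shows "\<bar>potential b \<beta> \<nu> (sigma2 n) (Suc k) z - real b * potential b \<beta> \<nu> (sigma2 n) k z' - (vlim z - real b * vlim z')\<bar> \<le> sqrt M * pot_const"
proof -
  have kn: "k \<le> n" using n by simp
  let ?f = "ratio_seq \<nu> n k" and ?g = "ratio_seq \<nu> n (Suc k)" and ?S = "\<lambda>f. ln (cpow f b 0)"
  define h where "h = sqrt M * gmom (km / 2) 0"
  note F = ratio_seq_facts[OF B n(1) kn]
  have a0: "0 < act b \<beta> \<nu> (sigma2 n) k 0" by (rule traj(2)[OF B n(1) kn])
  have "act b \<beta> \<nu> (sigma2 n) (Suc k) 0 = act b \<beta> \<nu> (sigma2 n) k 0 ^ b * cpow ?f b 0"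
    using act_Suc_zero(1)[OF B n, of 0] by simp
  then have "ln (act b \<beta> \<nu> (sigma2 n) (Suc k) 0) = real b * ln (act b \<beta> \<nu> (sigma2 n) k 0) + ?S ?f"
    using a0 F(10) by (simp add: ln_mult ln_realpow del: act.simps)
  then have v: "potential b \<beta> \<nu> (sigma2 n) (Suc k) z - real b * potential b \<beta> \<nu> (sigma2 n) k z'
      = - ?S ?f - ln (rser ?g z) + real b * ln (rser ?f z')"
    unfolding potential_facts(5)[OF B n] potential_facts(5)[OF B n(1) kn] by (simp add: algebra_simps del: act.simps)
  \<comment> \<open>The exponent - 1 / (b - 1) in the normalization of the limit potential is what
    makes the same logarithm of S_0 appear there.\<close>
  have "real b * (?S lam / (real b - 1)) - ?S lam / (real b - 1) = (real b - 1) * (?S lam / (real b - 1))"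
    by (simp add: left_diff_distrib diff_divide_distrib)
  also have "\<dots> = ?S lam" using rb by simp
  finally have "real b * (?S lam / (real b - 1)) - ?S lam / (real b - 1) = ?S lam" .
  then have vl: "vlim z - real b * vlim z' = - ?S lam - ln (rser lam z) + real b * ln (rser lam z')"
    unfolding vlim_eq by (simp add: algebra_simps)
  have hf: "\<bar>rser ?f z - rser lam z\<bar> \<le> h" for z
    unfolding h_def rser_eq_dser by (rule dser_ratio_diff[OF B n(1) kn M(1)])
  have hg: "\<bar>rser ?g z - rser lam z\<bar> \<le> h" for z
    unfolding h_def rser_eq_dser by (rule dser_ratio_diff[OF B n M(2)])
  have "\<bar>?S ?f - ?S lam\<bar> \<le> \<bar>cpow ?f b 0 - cpow lam b 0\<bar> / 1"
    using F(10) S0_ge1[OF lam_unit] by (intro ln_diff_le) auto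
  also have "\<dots> \<le> real b * cupp ^ b * h"
    using cpow_zero_diff_le[OF unit_seqD(1)[OF F(1)] unit_seqD(1)[OF lam_unit] rser_ranges(3,4)[OF B n(1) kn] cupp1 hf] by simp
  finally have 1: "\<bar>?S ?f - ?S lam\<bar> \<le> real b * cupp ^ b * h" .
  have "\<bar>ln (rser ?g z) - ln (rser lam z)\<bar> \<le> \<bar>rser ?g z - rser lam z\<bar> / clow"
    by (rule ln_diff_le[OF rser_ranges(1,2)[OF B n] clow0])
  also have "\<dots> \<le> h / clow" using hg clow0 by (intro divide_right_mono) auto
  finally have 2: "\<bar>ln (rser ?g z) - ln (rser lam z)\<bar> \<le> h / clow" .
  have "\<bar>ln (rser ?f z') - ln (rser lam z')\<bar> \<le> \<bar>rser ?f z' - rser lam z'\<bar> / clow"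
    by (rule ln_diff_le[OF rser_ranges(1,2)[OF B n(1) kn] clow0])
  also have "\<dots> \<le> h / clow" using hf clow0 by (intro divide_right_mono) auto
  finally have "\<bar>real b * (ln (rser ?f z') - ln (rser lam z'))\<bar> \<le> real b * (h / clow)" by (intro abs_mult_le) auto
  then have "\<bar>(- ?S ?f - ln (rser ?g z) + real b * ln (rser ?f z')) - (- ?S lam - ln (rser lam z) + real b * ln (rser lam z'))\<bar>
      \<le> real b * cupp ^ b * h + h / clow + real b * (h / clow)"
    using 1 2 unfolding right_diff_distrib by linarith
  also have "\<dots> = sqrt M * pot_const" by (simp add: h_def pot_const_def field_simps)
  finally show ?thesis unfolding v vl .
qed

text \<open>Outside the range of the quantitative comparison the trivial bound \<open>2\<close> is used.\<close>

definition "err k0 n k = (if k0 \<le> min k (n - k) then Cst * err_weight rate d n k else 2)"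

lemma Cst1: "1 \<le> Cst" by (simp add: Cst_def)

lemma err_nonneg: "0 \<le> err k0 n k"
  using err_weight_nonneg[of rate n k] Cst1 by (simp add: err_def)

lemma err_bound:
  assumes B: "assumption_B \<nu>" and n: "1 \<le> n" "k \<le> n"
    and k0: "\<And>n k. 1 \<le> n \<Longrightarrow> k \<le> n \<Longrightarrow> k0 \<le> min k (n - k) \<Longrightarrow>
      close_seq (ratio_seq \<nu> n k) lam (Cst * err_weight rate d n k)"
  shows "\<bar>ratio_seq \<nu> n k q - lam q\<bar> \<le> err k0 n k"
proof (cases "k0 \<le> min k (n - k)")
  case True
  then show ?thesis
    using close_seq_coeff[OF ratio_seq_facts(1)[OF B n] lam_unit k0[OF n True], of q] by (simp add: err_def)
next
  case False
  then have "err k0 n k = 2" unfolding err_def by (rule if_not_P)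
  moreover have "gauss_seq km q \<le> 1" using km0 by (simp add: gauss_seq_def)
  ultimately show ?thesis
    using ratio_seq_facts(2,4)[OF B n, of q] lam_gauss_km(2,3)[of q] by linarith
qed

lemma err_small:
  assumes "0 < e" "0 \<le> Q"
  shows "\<exists>K. \<forall>n k. k \<le> n \<and> K \<le> min k (n - k) \<longrightarrow> sqrt (err k0 n k) * Q < e"
proof -
  define e' where "e' = (e / (Q + 1))\<^sup>2 / Cst"
  have e': "0 < e'" using assms Cst1 by (simp add: e'_def)
  obtain K where K: "\<And>n k. k \<le> n \<Longrightarrow> K \<le> min k (n - k) \<Longrightarrow> err_weight rate d n k < e'"
    using err_weight_tendsto[OF rate0 d_lim _ e'] d_pos less_imp_le by metis
  show ?thesis
  proof (intro exI[of _ "max K k0"] allI impI)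
    fix n k assume a: "k \<le> n \<and> max K k0 \<le> min k (n - k)"
    have "Cst * err_weight rate d n k < Cst * e'" using K[of k n] a Cst1 by (intro mult_strict_left_mono) auto
    then have "err k0 n k < (e / (Q + 1))\<^sup>2" using a Cst1 by (simp add: err_def e'_def)
    then have "sqrt (err k0 n k) < e / (Q + 1)" using assms real_sqrt_less_mono[of _ "(e / (Q + 1))\<^sup>2"] by simp
    then have "sqrt (err k0 n k) * (Q + 1) < e" using assms by (simp add: pos_less_divide_eq)
    moreover have "sqrt (err k0 n k) * Q \<le> sqrt (err k0 n k) * (Q + 1)" using err_nonneg by (intro mult_left_mono) auto
    ultimately show "sqrt (err k0 n k) * Q < e" by linarith
  qed
qed

lemma err_exponential:
  assumes "decays_exponentially d"
  shows "\<exists>\<eta>'>0. \<exists>C>0. \<forall>n k. k \<le> n \<longrightarrow> sqrt (err k0 n k) \<le> C * exp (- (\<eta>' * real (min k (n - k))))"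
proof -
  obtain r C where r: "0 < r" "0 < C" and E: "\<And>n k. k \<le> n \<Longrightarrow> err_weight rate d n k \<le> C * exp (- (r * real (min k (n - k))))"
    using err_weight_exponential[OF rate0 assms] by blast
  \<comment> \<open>The second summand covers the indices below k0, where \<open>err\<close> has the
    value 2 and the exponential is at least exp (- r k0).\<close>
  define C' where "C' = Cst * C + 2 * exp (r * real k0)"
  have C': "0 < C'" using r Cst1 by (simp add: C'_def add_nonneg_pos)
  have "sqrt (err k0 n k) \<le> sqrt C' * exp (- (r / 2 * real (min k (n - k))))" if k: "k \<le> n" for n k
  proof -
    define m where "m = real (min k (n - k))"
    have "err k0 n k \<le> C' * exp (- (r * m))"
    proof (cases "k0 \<le> min k (n - k)")
      case True
      have "Cst * err_weight rate d n k \<le> Cst * (C * exp (- (r * m)))" using E[OF k] Cst1 by (intro mult_left_mono) (auto simp: m_def)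
      also have "\<dots> \<le> C' * exp (- (r * m))" by (simp add: C'_def distrib_right)
      finally show ?thesis using True by (simp add: err_def)
    next
      case False
      then have "r * m \<le> r * real k0" using r by (intro mult_left_mono) (auto simp: m_def)
      then have "2 * 1 \<le> 2 * (exp (r * real k0) * exp (- (r * m)))" by (intro mult_left_mono) (auto simp flip: exp_add)
      also have "\<dots> \<le> C' * exp (- (r * m))" using Cst1 r by (simp add: C'_def distrib_right)
      finally show ?thesis unfolding err_def if_not_P[OF False] by simp
    qed
    then have "sqrt (err k0 n k) \<le> sqrt (C' * exp (- (r * m)))" by (rule real_sqrt_le_mono)
    also have "exp (- (r * m)) = (exp (- (r / 2 * m)))\<^sup>2" by (simp add: power2_eq_square flip: exp_add)
    finally show ?thesis by (simp add: real_sqrt_mult m_def)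
  qed
  then show ?thesis using r C' by (intro exI[of _ "r / 2"] conjI exI[of _ "sqrt C'"]) auto
qed

lemma activity_ratio:
  assumes B: "assumption_B \<nu>" and n: "1 \<le> n" "k \<le> n"
  defines "a \<equiv> activity (potential b \<beta> \<nu> (sigma2 n) k)"
  shows "a q \<in> \<real>" "Re (a q) = act b \<beta> \<nu> (sigma2 n) k q" "a q / a 0 = of_real (ratio_seq \<nu> n k q)"
    "Re (a q) = Re (a 0) * ratio_seq \<nu> n k q"
proof -
  note T = traj[OF B n]
  have a: "a q = of_real (act b \<beta> \<nu> (sigma2 n) k q)" for q
    unfolding a_def by (rule activity_eq[OF T(1,3)])
  show "a q \<in> \<real>" "Re (a q) = act b \<beta> \<nu> (sigma2 n) k q" "a q / a 0 = of_real (ratio_seq \<nu> n k q)"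
    by (simp_all add: a ratio_seq_def)
  show "Re (a q) = Re (a 0) * ratio_seq \<nu> n k q" using T(2)[of 0] by (simp add: a ratio_seq_def)
qed

lemma X_le: "X \<le> 2 * sqrt (real b) * sqrt (real b * theta \<beta> - 1)"
proof (rule power2_le_imp_le)
  have "X\<^sup>2 \<le> 2 * \<delta>" by (rule X2\<delta>)
  also have "\<dots> \<le> 2 * (real b * \<delta>)" using rb \<delta>0 by simp
  also have "\<dots> \<le> 4 * (real b * \<delta>)" using rb \<delta>0 by simp
  also have "\<dots> = (2 * sqrt (real b) * sqrt (real b * theta \<beta> - 1))\<^sup>2"
    using theta \<delta>0 by (simp add: power_mult_distrib)
  finally show "X\<^sup>2 \<le> (2 * sqrt (real b) * sqrt (real b * theta \<beta> - 1))\<^sup>2" .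
  show "0 \<le> 2 * sqrt (real b) * sqrt (real b * theta \<beta> - 1)" using theta \<delta>0 by simp
qed

lemma Om_le_powi: assumes "Om f" shows "f q \<le> (2 * sqrt (real b) * sqrt (real b * theta \<beta> - 1)) powi \<bar>q\<bar>"
proof -
  have "f q \<le> X ^ nat \<bar>q\<bar>" by (rule Om_le_power[OF assms])
  also have "\<dots> \<le> (2 * sqrt (real b) * sqrt (real b * theta \<beta> - 1)) ^ nat \<bar>q\<bar>" using X_le X0 by (intro power_mono) auto
  finally show ?thesis by (simp add: power_int_def)
qed

lemma lam_le_theta: "lam q \<le> theta \<beta> powi (q\<^sup>2)"
proof -
  have "theta \<beta> powi (q\<^sup>2) = exp (- ks) ^ nat (q\<^sup>2)" by (simp add: theta_eq power_int_def)
  also have "\<dots> = exp (real (nat (q\<^sup>2)) * (- ks))" by (rule exp_of_nat_mult[symmetric])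
  also have "\<dots> = gauss_seq ks q" by (simp add: gauss_seq_def mult.commute)
  finally show ?thesis using lam_le_gauss by simp
qed

lemma activity_convergence:
  assumes B: "assumption_B \<nu>"
  defines "a \<equiv> \<lambda>n k. activity (potential b \<beta> \<nu> (sigma2 n) k)"
  shows "\<exists>k0. \<forall>n\<ge>1. \<forall>k\<le>n. k0 \<le> min k (n - k) \<longrightarrow> (\<forall>q.
             a n k q \<in> \<real> \<and>
             Re (a n k q) \<le> Re (a n k 0) * (2 * sqrt (real b) * sqrt (real b * theta \<beta> - 1)) powi \<bar>q\<bar> \<and>
             cmod (a n k q / a n k 0 - complex_of_real (lam q)) \<le>
               Cst powi \<bar>q\<bar> * (exp (- (rate * real k)) +
                 (\<Sum>j=0..k. exp (- (rate * (real k - real j))) * d (min j (n - j)))))"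
proof -
  obtain k0 where k0: "\<And>n k. 1 \<le> n \<Longrightarrow> k \<le> n \<Longrightarrow> k0 \<le> min k (n - k) \<Longrightarrow>
      Om (ratio_seq \<nu> n k) \<and> close_seq (ratio_seq \<nu> n k) lam (Cst * err_weight rate d n k)"
    using close_eventually[OF B] by blast
  show ?thesis
  proof (intro exI[of _ k0] allI impI conjI)
    fix n k :: nat and q assume n: "1 \<le> n" "k \<le> n" and k: "k0 \<le> min k (n - k)"
    have ar: "a n k q \<in> \<real>" "Re (a n k q) = act b \<beta> \<nu> (sigma2 n) k q"
      "a n k q / a n k 0 = of_real (ratio_seq \<nu> n k q)" "Re (a n k q) = Re (a n k 0) * ratio_seq \<nu> n k q" for q
      unfolding a_def by (rule activity_ratio[OF B n])+
    note F = ratio_seq_facts[OF B n]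
    have O: "Om (ratio_seq \<nu> n k)" and c: "close_seq (ratio_seq \<nu> n k) lam (Cst * err_weight rate d n k)"
      using k0[OF n k] by auto
    show "a n k q \<in> \<real>" by (rule ar)
    have "0 \<le> Re (a n k 0)" using ar(2)[of 0] traj(2)[OF B n, of 0] by simp
    then show "Re (a n k q) \<le> Re (a n k 0) * (2 * sqrt (real b) * sqrt (real b * theta \<beta> - 1)) powi \<bar>q\<bar>"
      unfolding ar(4)[of q] by (intro mult_left_mono Om_le_powi O)
    have "\<bar>ratio_seq \<nu> n k q - lam q\<bar> \<le> Cst powi \<bar>q\<bar> * err_weight rate d n k"
    proof (cases "q = 0")
      case True
      then show ?thesis using unit_seqD(2)[OF F(1)] unit_seqD(2)[OF lam_unit] err_weight_nonneg[of rate n k] by simp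
    next
      case False
      \<comment> \<open>The distance bounds all coefficients uniformly; for q nonzero a power of the
        constant only enlarges the bound, and at q = 0 both coefficients are 1.\<close>
      then have "Cst \<le> Cst ^ nat \<bar>q\<bar>" using Cst1 by (intro self_le_power) auto
      then have "Cst * err_weight rate d n k \<le> Cst ^ nat \<bar>q\<bar> * err_weight rate d n k"
        using err_weight_nonneg by (rule mult_right_mono)
      then show ?thesis using close_seq_coeff[OF F(1) lam_unit c, of q] by (simp add: power_int_def)
    qed
    then show "cmod (a n k q / a n k 0 - complex_of_real (lam q)) \<le>
               Cst powi \<bar>q\<bar> * (exp (- (rate * real k)) + (\<Sum>j=0..k. exp (- (rate * (real k - real j))) * d (min j (n - j))))"
      unfolding ar(3) of_real_diff[symmetric] norm_of_real err_weight_def .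
  qed
qed

lemma potential_convergence:
  assumes B: "assumption_B \<nu>"
  defines "v \<equiv> \<lambda>n. potential b \<beta> \<nu> (sigma2 n)"
  shows "\<forall>e>0. \<exists>K. \<forall>n\<ge>1. \<forall>k. 1 \<le> k \<and> k \<le> n \<and> K \<le> min k (n - k) \<longrightarrow>
             (\<forall>z z'. \<bar>(v n k z - real b * v n (k - 1) z') - (vlim z - real b * vlim z')\<bar> < e)"
    and "\<forall>e>0. \<exists>K. \<forall>n\<ge>1. \<forall>k\<le>n. K \<le> min k (n - k) \<longrightarrow> (\<forall>z. \<bar>deriv (v n k) z - deriv vlim z\<bar> < e)"
    and "decays_exponentially d \<Longrightarrow>
             (\<exists>\<eta>'>0. \<exists>C'>0.
                (\<forall>n\<ge>1. \<forall>k<n. \<forall>z z'.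
                   \<bar>v n (k + 1) z - real b * v n k z' - (vlim z - real b * vlim z')\<bar>
                     \<le> C' * exp (- (\<eta>' * real (min k (n - k))))) \<and>
                (\<forall>n\<ge>1. \<forall>k\<le>n. \<forall>z.
                   \<bar>deriv (v n k) z - deriv vlim z\<bar> \<le> C' * exp (- (\<eta>' * real (min k (n - k))))))"
proof -
  obtain k0 where k0: "\<And>n k. 1 \<le> n \<Longrightarrow> k \<le> n \<Longrightarrow> k0 \<le> min k (n - k) \<Longrightarrow>
      close_seq (ratio_seq \<nu> n k) lam (Cst * err_weight rate d n k)"
    using close_eventually[OF B] by blast
  have E: "\<bar>ratio_seq \<nu> n k q - lam q\<bar> \<le> err k0 n k" if "1 \<le> n" "k \<le> n" for n k q
    by (rule err_bound[OF B that k0])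
  have D: "\<bar>deriv (v n k) z - deriv vlim z\<bar> \<le> sqrt (err k0 n k) * der_const" if "1 \<le> n" "k \<le> n" for n k z
    unfolding v_def by (rule deriv_diff[OF B that E[OF that]])
  have P: "\<bar>v n (Suc k) z - real b * v n k z' - (vlim z - real b * vlim z')\<bar>
      \<le> max (sqrt (err k0 n k)) (sqrt (err k0 n (Suc k))) * pot_const" if n: "1 \<le> n" "Suc k \<le> n" for n k z z'
  proof -
    have M: "\<bar>ratio_seq \<nu> n k q - lam q\<bar> \<le> max (err k0 n k) (err k0 n (Suc k))" for q
      using E[OF n(1) Suc_leD[OF n(2)], of q] by (simp add: le_max_iff_disj)
    have M': "\<bar>ratio_seq \<nu> n (Suc k) q - lam q\<bar> \<le> max (err k0 n k) (err k0 n (Suc k))" for q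
      using E[OF n, of q] by (simp add: le_max_iff_disj)
    have "sqrt (max (err k0 n k) (err k0 n (Suc k))) = max (sqrt (err k0 n k)) (sqrt (err k0 n (Suc k)))"
      by (auto simp: max_def)
    then show ?thesis unfolding v_def using potential_diff[OF B n M M', of z z'] by simp
  qed
  show "\<forall>e>0. \<exists>K. \<forall>n\<ge>1. \<forall>k. 1 \<le> k \<and> k \<le> n \<and> K \<le> min k (n - k) \<longrightarrow>
             (\<forall>z z'. \<bar>(v n k z - real b * v n (k - 1) z') - (vlim z - real b * vlim z')\<bar> < e)"
  proof (intro allI impI)
    fix e :: real assume e: "0 < e"
    obtain K where K: "\<And>n k. k \<le> n \<Longrightarrow> K \<le> min k (n - k) \<Longrightarrow> sqrt (err k0 n k) * pot_const < e"
      using err_small[OF e pot_const0, of k0] by blast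
    show "\<exists>K. \<forall>n\<ge>1. \<forall>k. 1 \<le> k \<and> k \<le> n \<and> K \<le> min k (n - k) \<longrightarrow>
             (\<forall>z z'. \<bar>(v n k z - real b * v n (k - 1) z') - (vlim z - real b * vlim z')\<bar> < e)"
    \<comment> \<open>Raised by one so that k - 1 also lies within the range of K.\<close>
    proof (intro exI[of _ "Suc K"] allI impI)
      fix n k :: nat and z z' assume n: "1 \<le> n" and k: "1 \<le> k \<and> k \<le> n \<and> Suc K \<le> min k (n - k)"
      define j where "j = k - 1"
      have j: "k = Suc j" using k by (simp add: j_def)
      have "sqrt (err k0 n j) * pot_const < e" "sqrt (err k0 n k) * pot_const < e"
        using K[of j n] K[of k n] k j by auto
      then have "max (sqrt (err k0 n j)) (sqrt (err k0 n k)) * pot_const < e" by (auto simp: max_def)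
      then show "\<bar>(v n k z - real b * v n (k - 1) z') - (vlim z - real b * vlim z')\<bar> < e"
        using P[OF n, of j z z'] k j by simp
    qed
  qed
  show "\<forall>e>0. \<exists>K. \<forall>n\<ge>1. \<forall>k\<le>n. K \<le> min k (n - k) \<longrightarrow> (\<forall>z. \<bar>deriv (v n k) z - deriv vlim z\<bar> < e)"
  proof (intro allI impI)
    fix e :: real assume e: "0 < e"
    obtain K where "\<And>n k. k \<le> n \<Longrightarrow> K \<le> min k (n - k) \<Longrightarrow> sqrt (err k0 n k) * der_const < e"
      using err_small[OF e der_const0, of k0] by blast
    then show "\<exists>K. \<forall>n\<ge>1. \<forall>k\<le>n. K \<le> min k (n - k) \<longrightarrow> (\<forall>z. \<bar>deriv (v n k) z - deriv vlim z\<bar> < e)"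
      using D by (meson le_less_trans)
  qed
  assume "decays_exponentially d"
  then obtain r C where r: "0 < r" "0 < C" and S: "\<And>n k. k \<le> n \<Longrightarrow> sqrt (err k0 n k) \<le> C * exp (- (r * real (min k (n - k))))"
    using err_exponential[of k0] by blast
  \<comment> \<open>The factor exp r allows for comparing the weight at k + 1 with the one at k; the
    bracket dominates both constants.\<close>
  define C' where "C' = C * exp r * (pot_const + der_const + 1)"
  have C': "0 < C'" using r pot_const0 der_const0 by (simp add: C'_def)
  have S': "sqrt (err k0 n k) * q \<le> C' * exp (- (r * real m))"
    if k: "k \<le> n" and m: "real m \<le> real (min k (n - k)) + 1" and q: "0 \<le> q" "q \<le> pot_const + der_const + 1" for n k m :: nat and q :: real
  proof -
    have "r * real m \<le> r * (real (min k (n - k)) + 1)" using r m by (intro mult_left_mono) auto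
    then have "exp (- (r * real (min k (n - k)))) \<le> exp r * exp (- (r * real m))" by (simp add: algebra_simps flip: exp_add)
    then have "C * exp (- (r * real (min k (n - k)))) \<le> C * (exp r * exp (- (r * real m)))" using r by (intro mult_left_mono) auto
    then have "sqrt (err k0 n k) \<le> C * (exp r * exp (- (r * real m)))" using S[OF k] by linarith
    then have "sqrt (err k0 n k) * q \<le> C * (exp r * exp (- (r * real m))) * (pot_const + der_const + 1)"
      using q r by (intro mult_mono) auto
    then show ?thesis by (simp add: C'_def mult_ac)
  qed
  show "\<exists>\<eta>'>0. \<exists>C'>0.
                (\<forall>n\<ge>1. \<forall>k<n. \<forall>z z'.
                   \<bar>v n (k + 1) z - real b * v n k z' - (vlim z - real b * vlim z')\<bar>
                     \<le> C' * exp (- (\<eta>' * real (min k (n - k))))) \<and>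
                (\<forall>n\<ge>1. \<forall>k\<le>n. \<forall>z.
                   \<bar>deriv (v n k) z - deriv vlim z\<bar> \<le> C' * exp (- (\<eta>' * real (min k (n - k)))))"
  proof (rule exI[of _ r], intro conjI r exI[of _ C'] C' allI impI)
    fix n k :: nat and z z' assume n: "1 \<le> n" "k < n"
    have "sqrt (err k0 n k) * pot_const \<le> C' * exp (- (r * real (min k (n - k))))"
      "sqrt (err k0 n (Suc k)) * pot_const \<le> C' * exp (- (r * real (min k (n - k))))"
      by (rule S'; use n pot_const0 der_const0 in auto)+
    then have "max (sqrt (err k0 n k)) (sqrt (err k0 n (Suc k))) * pot_const \<le> C' * exp (- (r * real (min k (n - k))))"
      by (auto simp: max_def)
    then show "\<bar>v n (k + 1) z - real b * v n k z' - (vlim z - real b * vlim z')\<bar> \<le> C' * exp (- (r * real (min k (n - k))))"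
      using P[of n k z z'] n by simp
  next
    fix n k :: nat and z assume n: "1 \<le> n" "k \<le> n"
    have "sqrt (err k0 n k) * der_const \<le> C' * exp (- (r * real (min k (n - k))))"
      by (rule S') (use n pot_const0 der_const0 in auto)
    then show "\<bar>deriv (v n k) z - deriv vlim z\<bar> \<le> C' * exp (- (r * real (min k (n - k))))"
      using D[OF n, of z] by linarith
  qed
qed

end

theorem theorem3p6:
  fixes d :: "nat \<Rightarrow> real" and sigma2 :: "nat \<Rightarrow> nat \<Rightarrow> real" and b :: nat
  assumes A: "assumption_A d sigma2"
    and b: "2 \<le> b"
  shows "\<exists>\<epsilon>>0. \<forall>\<beta>>0. 1 < real b * theta \<beta> \<and> real b * theta \<beta> < 1 + \<epsilon> \<longrightarrow>
    (\<exists>\<eta>>0. \<exists>C>0. \<exists>lam :: int \<Rightarrow> real. \<exists>vs :: real \<Rightarrow> real.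
      lam 0 = 1 \<and>
      (\<forall>q. lam q \<le> theta \<beta> powi (q\<^sup>2)) \<and>
      (\<forall>q. 0 < lam q \<and> lam q = lam (- q) \<and>
           lam q \<le> (2 * sqrt (real b) * sqrt (real b * theta \<beta> - 1)) powi \<bar>q\<bar>) \<and>
      is_limit_potential b lam vs \<and> (\<forall>z. vs differentiable (at z)) \<and>
      (\<forall>\<nu>. assumption_B \<nu> \<longrightarrow>
        (let v = (\<lambda>n. potential b \<beta> \<nu> (sigma2 n)); a = (\<lambda>n k. activity (v n k)) in
          (\<exists>k0. \<forall>n\<ge>1. \<forall>k\<le>n. k0 \<le> min k (n - k) \<longrightarrow> (\<forall>q.
             a n k q \<in> \<real> \<and>
             Re (a n k q) \<le> Re (a n k 0) * (2 * sqrt (real b) * sqrt (real b * theta \<beta> - 1)) powi \<bar>q\<bar> \<and>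
             cmod (a n k q / a n k 0 - complex_of_real (lam q)) \<le>
               C powi \<bar>q\<bar> * (exp (- (\<eta> * real k)) +
                 (\<Sum>j=0..k. exp (- (\<eta> * (real k - real j))) * d (min j (n - j)))))) \<and>
          (\<forall>n\<ge>1. \<forall>k\<le>n. smooth_real (v n k)) \<and>
          (\<exists>M. \<forall>n\<ge>1. \<forall>k\<le>n. \<forall>z. \<bar>deriv (v n k) z\<bar> \<le> M) \<and>
          (\<exists>M. \<forall>n\<ge>1. \<forall>k\<le>n. \<forall>z. \<bar>deriv (deriv (v n k)) z\<bar> \<le> M) \<and>
          (\<forall>e>0. \<exists>K. \<forall>n\<ge>1. \<forall>k. 1 \<le> k \<and> k \<le> n \<and> K \<le> min k (n - k) \<longrightarrow>
             (\<forall>z z'. \<bar>(v n k z - real b * v n (k - 1) z') - (vs z - real b * vs z')\<bar> < e)) \<and>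
          (\<forall>e>0. \<exists>K. \<forall>n\<ge>1. \<forall>k\<le>n. K \<le> min k (n - k) \<longrightarrow>
             (\<forall>z. \<bar>deriv (v n k) z - deriv vs z\<bar> < e)) \<and>
          (decays_exponentially d \<longrightarrow>
             (\<exists>\<eta>'>0. \<exists>C'>0.
                (\<forall>n\<ge>1. \<forall>k<n. \<forall>z z'.
                   \<bar>v n (k + 1) z - real b * v n k z' - (vs z - real b * vs z')\<bar>
                     \<le> C' * exp (- (\<eta>' * real (min k (n - k))))) \<and>
                (\<forall>n\<ge>1. \<forall>k\<le>n. \<forall>z.
                   \<bar>deriv (v n k) z - deriv vs z\<bar> \<le> C' * exp (- (\<eta>' * real (min k (n - k))))))))))"
proof -
  obtain K where K: "cpow_diff_const b K" using cpow_diff_const_exists by blast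
  have K0: "0 \<le> K" using K by (simp add: cpow_diff_const_def)
  have rb: "2 \<le> real b" using b by simp
  define N where "N = (K + 1) * real b ^ 3"
  have N: "0 < N" using K0 rb by (simp add: N_def)
  \<comment> \<open>The value of (b - 1) X^2 / 2 at X = 1 / (1000 N^3), so that b \<theta> - 1 <
    \<epsilon> forces the smallness demanded by \<open>dyn\<close>.\<close>
  define \<epsilon> where "\<epsilon> = (real b - 1) / 2 * (1 / (1000 * N ^ 3))\<^sup>2"
  have "0 < \<epsilon>" using N rb by (simp add: \<epsilon>_def)
  show ?thesis
  proof (rule exI[of _ \<epsilon>], intro conjI allI impI, goal_cases)
    case 1
    show ?case by fact
  next
    case (2 \<beta>)
    then have \<beta>: "0 < \<beta>" and t: "1 < real b * theta \<beta>" "real b * theta \<beta> < 1 + \<epsilon>" by auto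
    \<comment> \<open>Solves (b - 1) X^2 / 2 = b \<theta> - 1 for X.\<close>
    define X where "X = sqrt (2 * (real b * theta \<beta> - 1) / (real b - 1))"
    have X2: "X\<^sup>2 = 2 * (real b * theta \<beta> - 1) / (real b - 1)" using t rb by (simp add: X_def)
    have X0: "0 < X" using t rb by (simp add: X_def)
    have "X\<^sup>2 \<le> (1 / (1000 * N ^ 3))\<^sup>2" unfolding X2 using t rb by (simp add: \<epsilon>_def field_simps)
    then have "X \<le> 1 / (1000 * N ^ 3)" by (rule power2_le_imp_le) (use N in simp)
    then have "N ^ 3 * X \<le> 1 / 1000" using N by (simp add: field_simps)
    then interpret dyn b K X by unfold_locales (use b K X0 in \<open>auto simp: N_def\<close>)
    have "\<delta> = real b * theta \<beta> - 1" unfolding \<delta>_def X2 using rb by (simp add: field_simps)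
    then interpret hierarchy b K X d sigma2 \<beta> by unfold_locales (use A \<beta> in auto)
    have Cst0: "0 < Cst" using Cst1 by simp
    show ?case
    proof (rule exI[of _ rate], rule conjI[OF rate0], rule exI[of _ Cst], rule conjI[OF Cst0],
        rule exI[of _ lam], rule exI[of _ vlim], intro conjI allI impI, goal_cases)
      case 1 show ?case by (rule unit_seqD(2)[OF lam_unit])
    next
      case (2 q) show ?case by (rule lam_le_theta)
    next
      case (3 q) show ?case by (rule lam_pos)
    next
      case (4 q) show ?case by (rule unit_seqD(4)[OF lam_unit, symmetric])
    next
      case (5 q) show ?case by (rule Om_le_powi[OF lam(1)])
    next
      case 6 show ?case by (rule vlim_limit_potential)
    next
      case (7 z) show ?case by (rule vlim_deriv(2))
    next
      case (8 \<nu>)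
      note P = potential_facts(1,3,4)[OF 8]
      show ?case unfolding Let_def
        by (intro conjI activity_convergence[OF 8] potential_convergence[OF 8] impI)
          (use P in \<open>blast+\<close>)
    qed
  qed
qed

end
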